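(* For every $1\le M<\infty$ there exists a positive, finite number $\Gamma$, depending only on $M$, with the following property. Suppose $m\le n$ are positive integers, $n\le M$, $1\le Q\le M$, $U$ is an open subset of $\mathbb R^n$, $V$ is an $m$-dimensional varifold in $U$, $\|\delta V\|$ is a Radon measure, $\Theta^m(\|V\|,z)\ge1$ for $\|V\|$ almost all $z$, $E$ is $\|V\|+\|\delta V\|$ measurable, $B$ is a closed subset of the topological boundary of $U$, and $$\|V\|(E\cap K)+\|\delta V\|(E\cap K)+\|V\,\partial E\|(U\cap K)<\infty,$$ $$\int_{E\times\mathbf G(n,m)}S_\natural\bullet D\theta(z)\,dV(z,S)=((\delta V)\llcorner E)(\theta|U)-(V\,\partial E)(\theta|U)$$ whenever $K$ is a compact subset of $\mathbb R^n\setminus B$ and $\theta\in C_c^\infty(\mathbb R^n\setminus B,\mathbb R^n)$. Suppose also $0<r<\infty$ and $$\|V\|(E)\le(Q-M^{-1})\alpha(m)r^m,\qquad \|V\|(E\cap\{z:\Theta^m(\|V\|,z)<Q\})\le\Gamma^{-1}r^m .$$ Then $$\|V\|\big(E\cap\{z:U(z,r)\subset\mathbb R^n\setminus B\}\big)^{1-1/m}\le\Gamma\big(\|V\,\partial E\|(U)+\|\delta V\|(E)\big),$$ where $0^0=0$.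
   Context: $\mathbf G(n,m)$ is the set of $m$-dimensional linear subspaces of $\mathbb R^n$; $S_\natural$ is the orthogonal projection onto $S$; $\sigma\bullet\tau=\operatorname{trace}(\sigma^*\circ\tau)$. $U(z,r)$ and $B(z,r)$ are the open and closed balls; $\alpha(m)$ is the Lebesgue measure of the unit ball of $\mathbb R^m$; $\Theta^m(\phi,z)=\lim_{r\to0+}\phi(B(z,r))/(\alpha(m)r^m)$. An $m$-dimensional varifold $V$ in $U$ is a Radon measure over $U\times\mathbf G(n,m)$, with weight $\|V\|(A)=V(A\times\mathbf G(n,m))$; first variation $\delta V(g)=\int Dg(z)\bullet S_\natural\,dV(z,S)$ for $g\in C_c^\infty(U,\mathbb R^n)$. For $S\in\mathscr D'(U,\mathbb R^n)$, $\|S\|$ is the largest Borel regular measure on $U$ with $\|S\|(C)=\sup\{S(\theta):\theta\in C_c^\infty(U,\mathbb R^n),\operatorname{spt}\theta\subset C,|\theta|\le1\}$ for open $C\subset U$. If $\|S\|$ is a Radon measure, $S(\theta)$ for $\theta\in\mathbf L_1(\|S\|,\mathbb R^n)$ denotes the value of the unique $\mathbf L_1(\|S\|)$-continuous extension of $S$. For $\|\delta V\|$ Radon and $E$ $\|V\|+\|\delta V\|$ measurable, $((\delta V)\llcorner E)(\theta)=\delta V(\chi_E\theta)$ (extension), and the distributional $V$ boundary of $E$ is $V\,\partial E=(\delta V)\llcorner E-\delta(V\llcorner(E\times\mathbf G(n,m)))\in\mathscr D'(U,\mathbb R^n)$. *)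

theory Defs
  imports "HOL-Analysis.Analysis"
begin

section \<open>Euclidean spaces of varying dimension\<close>

text \<open>
  The number \<open>\<Gamma>\<close> of the theorem depends only on \<open>M\<close>, not on the dimension \<open>n \<le> M\<close>, so the
  dimension has to be quantified inside the formula.  All spaces \<open>R^n\<close> are therefore
  realised as the coordinate subspaces \<open>Rn n\<close> of one real inner product space, the finitely
  supported real sequences with the Euclidean inner product.  (The library
  norm on the type \<open>poly_mapping\<close> is the sum norm, hence the new type.)
\<close>

typedef fseq = "{f :: nat \<Rightarrow> real. finite {i. f i \<noteq> 0}}"
  morphisms coord Abs_fseq
  by (rule exI[of _ "\<lambda>_. 0"]) simp

setup_lifting type_definition_fseq

lemma finite_coord [simp]: "finite {i. coord x i \<noteq> 0}"
  using coord by auto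

lemma fseq_eq_iff: "x = y \<longleftrightarrow> (\<forall>i. coord x i = coord y i)"
  by (metis coord_inject ext)

instantiation fseq :: real_vector
begin

lift_definition zero_fseq :: fseq is "\<lambda>_. 0" by simp

lift_definition plus_fseq :: "fseq \<Rightarrow> fseq \<Rightarrow> fseq" is "\<lambda>f g i. f i + g i"
  subgoal for f g
    by (rule finite_subset[of _ "{i. f i \<noteq> 0} \<union> {i. g i \<noteq> 0}"]) auto
  done

lift_definition uminus_fseq :: "fseq \<Rightarrow> fseq" is "\<lambda>f i. - f i" by simp

lift_definition minus_fseq :: "fseq \<Rightarrow> fseq \<Rightarrow> fseq" is "\<lambda>f g i. f i - g i"
  subgoal for f g
    by (rule finite_subset[of _ "{i. f i \<noteq> 0} \<union> {i. g i \<noteq> 0}"]) auto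
  done

lift_definition scaleR_fseq :: "real \<Rightarrow> fseq \<Rightarrow> fseq" is "\<lambda>c f i. c * f i"
  subgoal for c f
    by (rule finite_subset[of _ "{i. f i \<noteq> 0}"]) auto
  done

instance
  by standard
    (simp_all add: fseq_eq_iff zero_fseq.rep_eq plus_fseq.rep_eq uminus_fseq.rep_eq
      minus_fseq.rep_eq scaleR_fseq.rep_eq algebra_simps)

end

instantiation fseq :: real_inner
begin

definition inner_fseq :: "fseq \<Rightarrow> fseq \<Rightarrow> real" where
  "inner_fseq x y = (\<Sum>i | coord x i \<noteq> 0. coord x i * coord y i)"

definition norm_fseq :: "fseq \<Rightarrow> real" where
  "norm_fseq x = sqrt (inner x x)"

definition sgn_fseq :: "fseq \<Rightarrow> fseq" where
  "sgn_fseq x = x /\<^sub>R norm x"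

definition dist_fseq :: "fseq \<Rightarrow> fseq \<Rightarrow> real" where
  "dist_fseq x y = norm (x - y)"

definition uniformity_fseq :: "(fseq \<times> fseq) filter" where
  "uniformity_fseq = (INF e\<in>{0<..}. principal {(x, y). dist x y < e})"

definition open_fseq :: "fseq set \<Rightarrow> bool" where
  "open_fseq U \<longleftrightarrow> (\<forall>x\<in>U. eventually (\<lambda>(x', y). x' = x \<longrightarrow> y \<in> U) uniformity)"

lemma inner_fseq_superset:
  assumes "finite I" "{i. coord x i \<noteq> 0} \<subseteq> I"
  shows "inner x y = (\<Sum>i\<in>I. coord x i * coord y i)"
  unfolding inner_fseq_def by (rule sum.mono_neutral_left) (use assms in auto)

instance
proof
  fix x y z :: fseq and c :: real
  let ?I = "{i. coord x i \<noteq> 0} \<union> {i. coord y i \<noteq> 0} \<union> {i. coord z i \<noteq> 0}"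
  have I: "finite ?I" by simp
  show "dist x y = norm (x - y)" by (rule dist_fseq_def)
  show "sgn x = x /\<^sub>R norm x" by (rule sgn_fseq_def)
  show "(uniformity :: (fseq \<times> fseq) filter) = (INF e\<in>{0<..}. principal {(x, y). dist x y < e})"
    by (rule uniformity_fseq_def)
  show "open U \<longleftrightarrow> (\<forall>x\<in>U. eventually (\<lambda>(x', y). x' = x \<longrightarrow> y \<in> U) uniformity)" for U :: "fseq set"
    by (rule open_fseq_def)
  have "inner x y = (\<Sum>i\<in>?I. coord x i * coord y i)"
    by (rule inner_fseq_superset[OF I]) auto
  also have "\<dots> = (\<Sum>i\<in>?I. coord y i * coord x i)"
    by (simp add: mult.commute)
  also have "\<dots> = inner y x"
    by (rule inner_fseq_superset[OF I, symmetric]) auto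
  finally show "inner x y = inner y x" .
  have "inner (x + y) z = (\<Sum>i\<in>?I. coord (x + y) i * coord z i)"
    by (rule inner_fseq_superset[OF I]) (auto simp: plus_fseq.rep_eq)
  also have "\<dots> = (\<Sum>i\<in>?I. coord x i * coord z i) + (\<Sum>i\<in>?I. coord y i * coord z i)"
    by (simp add: plus_fseq.rep_eq algebra_simps sum.distrib)
  also have "\<dots> = inner x z + inner y z"
    by (intro arg_cong2[of _ _ _ _ "(+)"] inner_fseq_superset[OF I, symmetric]) auto
  finally show "inner (x + y) z = inner x z + inner y z" .
  have "inner (c *\<^sub>R x) y = (\<Sum>i\<in>?I. coord (c *\<^sub>R x) i * coord y i)"
    by (rule inner_fseq_superset[OF I]) (auto simp: scaleR_fseq.rep_eq)
  also have "\<dots> = c * (\<Sum>i\<in>?I. coord x i * coord y i)"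
    by (simp add: scaleR_fseq.rep_eq sum_distrib_left mult.assoc)
  also have "\<dots> = c * inner x y"
    by (intro arg_cong[of _ _ "(*) c"] inner_fseq_superset[OF I, symmetric]) auto
  finally show "inner (c *\<^sub>R x) y = c * inner x y" .
  show "0 \<le> inner x x"
    unfolding inner_fseq_def by (rule sum_nonneg) simp
  have "inner x x = 0 \<longleftrightarrow> (\<forall>i\<in>{i. coord x i \<noteq> 0}. coord x i * coord x i = 0)"
    unfolding inner_fseq_def by (rule sum_nonneg_eq_0_iff) auto
  also have "\<dots> \<longleftrightarrow> x = 0"
    by (auto simp: fseq_eq_iff zero_fseq.rep_eq)
  finally show "inner x x = 0 \<longleftrightarrow> x = 0" .
  show "norm x = sqrt (inner x x)" by (rule norm_fseq_def)
qed

end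

definition Rn :: "nat \<Rightarrow> fseq set" where
  "Rn n = {x. \<forall>i\<ge>n. coord x i = 0}"

definition unit_vec :: "nat \<Rightarrow> fseq" where
  "unit_vec i = Abs_fseq (\<lambda>j. if j = i then 1 else 0)"

lemma inner_Rn: "x \<in> Rn n \<Longrightarrow> inner x y = (\<Sum>i<n. coord x i * coord y i)"
  by (rule inner_fseq_superset) (auto simp: Rn_def not_le[symmetric])

lemma coord_unit_vec: "coord (unit_vec i) j = (if j = i then 1 else 0)"
  unfolding unit_vec_def by (subst Abs_fseq_inverse) simp_all

abbreviation Rn_top :: "nat \<Rightarrow> fseq topology" where
  "Rn_top n \<equiv> top_of_set (Rn n)"


section \<open>The Grassmannian\<close>

definition orth_proj :: "fseq set \<Rightarrow> fseq \<Rightarrow> fseq" where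
  "orth_proj S x = (THE y. y \<in> S \<and> (\<forall>v\<in>S. inner (x - y) v = 0))"

definition Gr :: "nat \<Rightarrow> nat \<Rightarrow> fseq set set" where
  "Gr n m = {S. subspace S \<and> S \<subseteq> Rn n \<and> dim S = m}"

text \<open>As usual, \<open>S\<close> is identified with its orthogonal projection, and the topology is that of
  the normed space of linear maps.\<close>

definition Gr_top :: "nat \<Rightarrow> nat \<Rightarrow> fseq set topology" where
  "Gr_top n m = pullback_topology (Gr n m) (\<lambda>S. Blinfun (orth_proj S)) euclidean"

text \<open>The inner product \<open>trace (\<sigma>\<^sup>* \<circ> \<tau>)\<close> of linear maps of \<open>R^n\<close>, the trace being taken in the
  standard basis: the \<open>i\<close>-th diagonal entry is
  \<open>e\<^sub>i \<bullet> \<sigma>\<^sup>* (\<tau> e\<^sub>i) = \<sigma> e\<^sub>i \<bullet> \<tau> e\<^sub>i\<close>.\<close>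

definition trace_inner :: "nat \<Rightarrow> (fseq \<Rightarrow> fseq) \<Rightarrow> (fseq \<Rightarrow> fseq) \<Rightarrow> real" where
  "trace_inner n \<sigma> \<tau> = (\<Sum>i<n. inner (\<sigma> (unit_vec i)) (\<tau> (unit_vec i)))"


section \<open>Test functions\<close>

text \<open>Only the restriction of a derivative within \<^term>\<open>Rn n\<close> to \<^term>\<open>Rn n\<close> is determined, and
  only this restriction is used.\<close>

fun Ck_on :: "nat \<Rightarrow> nat \<Rightarrow> fseq set \<Rightarrow> (fseq \<Rightarrow> fseq) \<Rightarrow> bool" where
  "Ck_on n 0 W f \<longleftrightarrow> continuous_on W f"
| "Ck_on n (Suc k) W f \<longleftrightarrow>
     (\<exists>D. (\<forall>x\<in>W. (f has_derivative D x) (at x within Rn n)) \<and>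
          (\<forall>v\<in>Rn n. Ck_on n k W (\<lambda>x. D x v)))"

definition Deriv :: "nat \<Rightarrow> (fseq \<Rightarrow> fseq) \<Rightarrow> fseq \<Rightarrow> fseq \<Rightarrow> fseq" where
  "Deriv n g z = frechet_derivative g (at z within Rn n)"

definition spt :: "(fseq \<Rightarrow> fseq) \<Rightarrow> fseq set" where
  "spt \<theta> = closure {x. \<theta> x \<noteq> 0}"

text \<open>\<open>C\<^sub>c\<^sup>\<infinity>(W, R^n)\<close> for \<open>W\<close> open in \<open>R^n\<close>; its members are represented by their extension by
  zero.\<close>

definition Cc_infty :: "nat \<Rightarrow> fseq set \<Rightarrow> (fseq \<Rightarrow> fseq) set" where
  "Cc_infty n W = {\<theta>. (\<forall>k. Ck_on n k W \<theta>) \<and> range \<theta> \<subseteq> Rn n \<and> compact (spt \<theta>) \<and> spt \<theta> \<subseteq> W}"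

text \<open>The product \<open>\<chi>\<^sub>A \<theta>\<close>; with \<open>A = U\<close> this represents the restriction \<open>\<theta>|U\<close>.\<close>

definition cutoff :: "fseq set \<Rightarrow> (fseq \<Rightarrow> fseq) \<Rightarrow> fseq \<Rightarrow> fseq" where
  "cutoff A \<theta> = (\<lambda>z. indicat_real A z *\<^sub>R \<theta> z)"


section \<open>Measures\<close>

text \<open>
  A Borel regular (outer) measure is represented by its restriction to the Borel sets; its value
  on an arbitrary set is given by \<^const>\<open>outer_measure_of\<close>, and its measurable sets are, for Radon
  measures on the spaces considered here, those of the \<^const>\<open>completion\<close>.
\<close>

definition borel_of :: "'a topology \<Rightarrow> 'a measure" where
  "borel_of X = sigma (topspace X) {C. openin X C}"

definition radon_measure :: "'a topology \<Rightarrow> 'a measure \<Rightarrow> bool" where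
  "radon_measure X M \<longleftrightarrow>
     sets M = sets (borel_of X) \<and>
     (\<forall>K. compactin X K \<longrightarrow> emeasure M K < \<infinity>) \<and>
     (\<forall>C. openin X C \<longrightarrow> emeasure M C = (SUP K\<in>{K. compactin X K \<and> K \<subseteq> C}. emeasure M K)) \<and>
     (\<forall>A\<in>sets M. emeasure M A = (INF C\<in>{C. openin X C \<and> A \<subseteq> C}. emeasure M C))"

definition restrict_measure :: "'a measure \<Rightarrow> 'a set \<Rightarrow> 'a measure" where
  "restrict_measure M A = measure_of (space M) (sets M) (\<lambda>B. outer_measure_of M (A \<inter> B))"

definition add_measure :: "'a measure \<Rightarrow> 'a measure \<Rightarrow> 'a measure" where
  "add_measure M N = measure_of (space M) (sets M) (\<lambda>B. emeasure M B + emeasure N B)"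

text \<open>\<open>\<Theta>\<^sup>m(\<phi>, z)\<close> exists and equals \<open>d\<close>, for \<open>\<phi>\<close> a measure over an open subset of some \<open>R^n\<close>.\<close>

definition has_density :: "nat \<Rightarrow> fseq measure \<Rightarrow> fseq \<Rightarrow> ennreal \<Rightarrow> bool" where
  "has_density m \<phi> z d \<longleftrightarrow>
     ((\<lambda>r. emeasure \<phi> (cball z r \<inter> space \<phi>) / ennreal (unit_ball_vol (real m) * r ^ m)) \<longlongrightarrow> d)
       (at_right 0)"


section \<open>Vector distributions represented by integration\<close>

text \<open>In the following, a distribution \<open>S\<close> of type \<open>R^n\<close> in \<open>U\<close> is a functional of which only the
  values on \<^term>\<open>Cc_infty n U\<close> matter.\<close>

type_synonym distrib = "(fseq \<Rightarrow> fseq) \<Rightarrow> real"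

text \<open>\<open>\<parallel>S\<parallel>\<close>: the order on measures with the same measurable sets is the pointwise one.\<close>

definition variation :: "nat \<Rightarrow> fseq set \<Rightarrow> distrib \<Rightarrow> fseq measure" where
  "variation n U S = (GREATEST M.
     sets M = sets (borel_of (top_of_set U)) \<and>
     (\<forall>C. openin (top_of_set U) C \<longrightarrow>
        emeasure M C =
          (SUP \<theta>\<in>{\<theta> \<in> Cc_infty n U. spt \<theta> \<subseteq> C \<and> (\<forall>x. norm (\<theta> x) \<le> 1)}. ennreal (S \<theta>))))"

definition L1 :: "nat \<Rightarrow> fseq measure \<Rightarrow> (fseq \<Rightarrow> fseq) set" where
  "L1 n M = {\<theta> \<in> borel_measurable (completion M).
     \<theta> ` space M \<subseteq> Rn n \<and> (\<integral>\<^sup>+z. ennreal (norm (\<theta> z)) \<partial>completion M) < \<infinity>}"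

text \<open>The unique continuous extension of \<open>S\<close> to \<open>L\<^sub>1(\<parallel>S\<parallel>, R^n)\<close> (set to zero elsewhere).\<close>

definition L1_extension :: "nat \<Rightarrow> fseq set \<Rightarrow> distrib \<Rightarrow> distrib" where
  "L1_extension n U S = (THE T.
     (\<forall>\<theta>\<in>Cc_infty n U. T \<theta> = S \<theta>) \<and>
     (\<forall>\<theta>. \<theta> \<notin> L1 n (variation n U S) \<longrightarrow> T \<theta> = 0) \<and>
     (\<forall>f \<theta>. (\<forall>k::nat. f k \<in> L1 n (variation n U S)) \<and> \<theta> \<in> L1 n (variation n U S) \<and>
        (\<lambda>k. \<integral>\<^sup>+z. ennreal (norm (f k z - \<theta> z)) \<partial>completion (variation n U S)) \<longlonglongrightarrow> 0
        \<longrightarrow> (\<lambda>k. T (f k)) \<longlonglongrightarrow> T \<theta>))"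

definition restrict_distrib :: "nat \<Rightarrow> fseq set \<Rightarrow> distrib \<Rightarrow> fseq set \<Rightarrow> distrib" where
  "restrict_distrib n U S E = (\<lambda>\<theta>. L1_extension n U S (cutoff E \<theta>))"


section \<open>Varifolds\<close>

definition varifold :: "nat \<Rightarrow> nat \<Rightarrow> fseq set \<Rightarrow> (fseq \<times> fseq set) measure \<Rightarrow> bool" where
  "varifold n m U V \<longleftrightarrow> radon_measure (prod_topology (top_of_set U) (Gr_top n m)) V"

definition weight :: "fseq set \<Rightarrow> (fseq \<times> fseq set) measure \<Rightarrow> fseq measure" where
  "weight U V = distr V (borel_of (top_of_set U)) fst"

definition first_variation :: "nat \<Rightarrow> (fseq \<times> fseq set) measure \<Rightarrow> distrib" where
  "first_variation n V = (\<lambda>g. \<integral>(z, S). trace_inner n (Deriv n g z) (orth_proj S) \<partial>V)"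

definition variation_fv :: "nat \<Rightarrow> fseq set \<Rightarrow> (fseq \<times> fseq set) measure \<Rightarrow> fseq measure" where
  "variation_fv n U V = variation n U (first_variation n V)"

definition distrib_boundary ::
  "nat \<Rightarrow> nat \<Rightarrow> fseq set \<Rightarrow> (fseq \<times> fseq set) measure \<Rightarrow> fseq set \<Rightarrow> distrib" where
  "distrib_boundary n m U V E = (\<lambda>\<theta>.
     restrict_distrib n U (first_variation n V) E \<theta>
     - first_variation n (restrict_measure V (E \<times> Gr n m)) \<theta>)"

definition variation_boundary ::
  "nat \<Rightarrow> nat \<Rightarrow> fseq set \<Rightarrow> (fseq \<times> fseq set) measure \<Rightarrow> fseq set \<Rightarrow> fseq measure" where
  "variation_boundary n m U V E = variation n U (distrib_boundary n m U V E)"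

end

theory Submission
  imports Defs "HOL-Analysis.Analysis"
begin

text \<open>
  Put \<open>\<mu> = \<parallel>V\<parallel> \<llcorner> E\<close> and \<open>\<nu> = \<parallel>\<delta>V\<parallel> \<llcorner> E + \<parallel>V \<partial>E\<parallel>\<close>. Testing the integral identity with radial vector
  fields around \<open>z\<close>, which is admissible as long as the balls stay away from \<open>B\<close>, gives a
  monotonicity formula: \<open>s\<^sup>-\<^sup>m \<mu>(B(z, s))\<close> can only decrease with \<open>s\<close> at the expense of \<open>\<nu>\<close>. It is
  all that is needed from the varifold. Let \<open>X\<^sub>t\<close> be the set of points with distance at least
  \<open>t\<close> from \<open>B\<close>. If \<open>A \<mu>(X\<^sub>r\<^sub>-\<^sub>t)\<^sup>1\<^sup>/\<^sup>m\<close> plus \<open>t\<close> is at most \<open>\<delta>r\<close> for a suitable \<open>t\<close>, then at that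
  radius the density ratios are small, whereas they are at least about \<open>1\<close> at small scales; hence \<open>\<nu>\<close>
  is large on some ball around almost every point, and Vitali's covering theorem yields the
  isoperimetric inequality. Otherwise \<open>X\<^bsub>(1-\<delta>)r\<^esub>\<close> has mass comparable with \<open>r\<^sup>m\<close>. Apart from a set whose
  mass is again controlled by \<open>\<nu>\<close> through a covering, the ratios at points of density at least \<open>Q\<close>
  would persist up to scale \<open>r\<close>, contradicting \<open>\<mu>(U) \<le> (Q - M\<^sup>-\<^sup>1) \<alpha>(m) r\<^sup>m\<close>; the points of lower
  density are negligible by hypothesis.
\<close>

section \<open>An abstract isoperimetric inequality\<close>

text \<open>The inequality \<open>step\<close> compares two radii at the price of \<nu> on a still
  larger open ball, so every argument is a chain of doublings. A chain towards radius 0 has no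
  bounded length, and its errors must be summable. In the small mass case they are, because a
  failing cover makes the error at scale s at most proportional to s. At points of density Q this is
  enforced: a good point is one where \<nu> of the ball of radius c is at most \<eta> c^(m-1)
  sqrt(c/r) for all c in the range, and the square root turns the errors into a geometric series.

  The constants depend on m and M alone, because the coverings live in a separable metric space and
  only enlarge radii by 5; the ambient dimension does no more than bound m.

  On the analytic side, the variation and the extension to integrable fields are given by
  \<open>GREATEST\<close> and \<open>THE\<close>. Both have to be constructed before the hypotheses
  can be exploited, and twice in a row for (\<delta>V) restricted to E, whose own extension occurs
  in the integral identity. Most of the later sections serve this purpose.\<close>

lemma Vitali_covering_5r:
  fixes a :: "'i \<Rightarrow> 'a::{metric_space,second_countable_topology}"
  assumes r: "\<And>i. i \<in> K \<Longrightarrow> 0 < r i \<and> r i \<le> b"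
  obtains C where "countable C" "C \<subseteq> K"
    "disjoint_family_on (\<lambda>i. ball (a i) (r i)) C"
    "(\<Union>i\<in>K. ball (a i) (r i)) \<subseteq> (\<Union>i\<in>C. ball (a i) (5 * r i))"
proof -
  define meets where "meets i j \<longleftrightarrow> ball (a i) (r i) \<inter> ball (a j) (r j) \<noteq> {}" for i j
  \<comment> \<open>The last clause says that a ball meeting the family meets a member of at least
    half its radius. It passes to unions of chains, and it gives the factor 5: every point of ball
    \<open>i\<close> is within \<open>r j + 2 * r i\<close>, hence within \<open>5 * r j\<close>, of
    \<open>a j\<close>.\<close>
  define \<F> where "\<F> = {F. F \<subseteq> K \<and> disjoint_family_on (\<lambda>i. ball (a i) (r i)) F \<and>
    (\<forall>i\<in>K. (\<exists>j\<in>F. meets i j) \<longrightarrow> (\<exists>j\<in>F. meets i j \<and> r i \<le> 2 * r j))}"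
  have "\<exists>F\<in>\<F>. \<forall>G\<in>\<F>. F \<subseteq> G \<longrightarrow> G = F"
  proof (rule subset_Zorn')
    fix c assume c: "subset.chain \<F> c"
    have sub: "c \<subseteq> \<F>" and tot: "\<And>x y. x \<in> c \<Longrightarrow> y \<in> c \<Longrightarrow> x \<subseteq> y \<or> y \<subseteq> x"
      using c by (auto simp: subset_chain_def)
    show "\<Union>c \<in> \<F>"
      unfolding \<F>_def
    proof (intro CollectI conjI ballI impI)
      show "\<Union>c \<subseteq> K" using sub by (auto simp: \<F>_def)
      show "disjoint_family_on (\<lambda>i. ball (a i) (r i)) (\<Union>c)"
        unfolding disjoint_family_on_def
      proof (intro ballI impI)
        fix i j assume "i \<in> \<Union>c" "j \<in> \<Union>c" "i \<noteq> j"
        then obtain x y where xy: "x \<in> c" "y \<in> c" "i \<in> x" "j \<in> y" by auto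
        then obtain w where "w \<in> c" "i \<in> w" "j \<in> w" using tot[OF xy(1,2)] by auto
        with \<open>i \<noteq> j\<close> sub show "ball (a i) (r i) \<inter> ball (a j) (r j) = {}"
          by (auto simp: \<F>_def disjoint_family_on_def)
      qed
      fix i assume "i \<in> K" "\<exists>j\<in>\<Union>c. meets i j"
      then obtain x j where "x \<in> c" "j \<in> x" "meets i j" by auto
      then obtain j' where "j' \<in> x" "meets i j'" "r i \<le> 2 * r j'"
        using sub \<open>i \<in> K\<close> unfolding \<F>_def by blast
      then show "\<exists>j\<in>\<Union>c. meets i j \<and> r i \<le> 2 * r j" using \<open>x \<in> c\<close> by auto
    qed
  qed
  then obtain F where F: "F \<in> \<F>" and max: "\<And>G. G \<in> \<F> \<Longrightarrow> F \<subseteq> G \<Longrightarrow> G = F" by blast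
  have FK: "F \<subseteq> K" and disj: "disjoint_family_on (\<lambda>i. ball (a i) (r i)) F"
    and FF: "\<And>i. i \<in> K \<Longrightarrow> \<exists>j\<in>F. meets i j \<Longrightarrow> \<exists>j\<in>F. meets i j \<and> r i \<le> 2 * r j"
    using F by (auto simp: \<F>_def)
  \<comment> \<open>By maximality: among the balls that miss \<open>F\<close>, one whose radius
    exceeds half of the supremum could be added without breaking the last clause.\<close>
  have meets_F: "\<exists>j\<in>F. meets i j" if "i \<in> K" for i
  proof (rule ccontr)
    assume neg: "\<not> (\<exists>j\<in>F. meets i j)"
    define J where "J = {i \<in> K. \<not> (\<exists>j\<in>F. meets i j)}"
    have J: "i \<in> J" using that neg by (auto simp: J_def)
    have bdd: "bdd_above (r ` J)" using r by (auto simp: J_def intro!: bdd_aboveI2[of _ _ b])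
    have "r i \<le> Sup (r ` J)" using J bdd by (auto intro: cSup_upper)
    moreover have "0 < r i" using r that by auto
    ultimately have "Sup (r ` J) / 2 < Sup (r ` J)" by linarith
    then obtain k where k: "k \<in> J" "Sup (r ` J) / 2 < r k"
      using less_cSup_iff[of "r ` J" "Sup (r ` J) / 2"] J bdd by auto
    have kK: "k \<in> K" and kF: "\<And>j. j \<in> F \<Longrightarrow> \<not> meets k j" using k by (auto simp: J_def)
    have "insert k F \<in> \<F>"
      unfolding \<F>_def
    proof (intro CollectI conjI ballI impI)
      show "insert k F \<subseteq> K" using FK kK by auto
      show "disjoint_family_on (\<lambda>i. ball (a i) (r i)) (insert k F)"
        using disj kF by (auto simp: disjoint_family_on_def meets_def)
      fix l assume l: "l \<in> K" "\<exists>j\<in>insert k F. meets l j"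
      show "\<exists>j\<in>insert k F. meets l j \<and> r l \<le> 2 * r j"
      proof (cases "\<exists>j\<in>F. meets l j")
        case True then show ?thesis using FF[OF l(1)] by auto
      next
        case False
        then have "l \<in> J" "meets l k" using l by (auto simp: J_def)
        then have "r l \<le> Sup (r ` J)" using bdd by (auto intro: cSup_upper)
        then show ?thesis using k \<open>meets l k\<close> by (auto intro!: bexI[of _ k])
      qed
    qed
    then have "k \<in> F" using max[of "insert k F"] by auto
    then have "\<not> meets k k" using kF by auto
    then show False using r[OF kK] by (auto simp: meets_def)
  qed
  have "countable F"
  proof -
    have "countable ((\<lambda>i. ball (a i) (r i)) ` F)"
    proof (rule countable_disjoint_open_subsets)
      show "disjoint ((\<lambda>i. ball (a i) (r i)) ` F)"
        using disj by (metis disjoint_family_on_disjoint_image)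
    qed auto
    moreover have "inj_on (\<lambda>i. ball (a i) (r i)) F"
    proof (rule inj_onI)
      fix i j assume *: "i \<in> F" "j \<in> F" "ball (a i) (r i) = ball (a j) (r j)"
      have "a i \<in> ball (a i) (r i)" using r FK *(1) by auto
      with *(3) have "a i \<in> ball (a i) (r i) \<inter> ball (a j) (r j)" by blast
      then show "i = j" using disj *(1,2) unfolding disjoint_family_on_def by blast
    qed
    ultimately show ?thesis by (rule countable_image_inj_on)
  qed
  moreover have "(\<Union>i\<in>K. ball (a i) (r i)) \<subseteq> (\<Union>i\<in>F. ball (a i) (5 * r i))"
  proof
    fix x assume "x \<in> (\<Union>i\<in>K. ball (a i) (r i))"
    then obtain i where i: "i \<in> K" "dist (a i) x < r i" by auto
    then obtain j where j: "j \<in> F" "meets i j" "r i \<le> 2 * r j" using FF meets_F by blast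
    then obtain y where y: "dist (a i) y < r i" "dist (a j) y < r j" by (auto simp: meets_def)
    have "dist (a j) x \<le> dist (a j) y + dist (a i) y + dist (a i) x"
      using dist_triangle[of "a j" x y] dist_triangle[of y x "a i"] by (simp add: dist_commute)
    then have "dist (a j) x < 5 * r j" using y i j by linarith
    then show "x \<in> (\<Union>i\<in>F. ball (a i) (5 * r i))" using j by auto
  qed
  ultimately show thesis using that FK disj by blast
qed

lemma emeasure_UN_le_nn_integral:
  assumes D: "countable D" and A: "\<And>z. z \<in> D \<Longrightarrow> A z \<in> sets M"
  shows "emeasure M (\<Union>z\<in>D. A z) \<le> (\<integral>\<^sup>+z. emeasure M (A z) \<partial>count_space D)"
proof -
  have "(\<Union>z\<in>D. A z) \<in> sets M" using assms by (intro sets.countable_UN') auto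
  then have "emeasure M (\<Union>z\<in>D. A z) = (\<integral>\<^sup>+x. indicator (\<Union>z\<in>D. A z) x \<partial>M)" by simp
  also have "\<dots> \<le> (\<integral>\<^sup>+x. (\<integral>\<^sup>+z. indicator (A z) x \<partial>count_space D) \<partial>M)"
  proof (rule nn_integral_mono)
    fix x
    show "indicator (\<Union>z\<in>D. A z) x \<le> (\<integral>\<^sup>+z. indicator (A z) x \<partial>count_space D)"
    proof (cases "x \<in> (\<Union>z\<in>D. A z)")
      case True
      then obtain z where "z \<in> D" "x \<in> A z" by auto
      then show ?thesis using True nn_integral_ge_point[of z D "\<lambda>z. indicator (A z) x"] by simp
    qed simp
  qed
  also have "\<dots> = (\<integral>\<^sup>+z. (\<integral>\<^sup>+x. indicator (A z) x \<partial>M) \<partial>count_space D)"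
    by (rule nn_integral_count_space_nn_integral) (use assms in auto)
  also have "\<dots> = (\<integral>\<^sup>+z. emeasure M (A z) \<partial>count_space D)"
    by (rule nn_integral_cong) (use A in auto)
  finally show ?thesis .
qed

text \<open>The selected balls of radius \<open>s\<close> are disjoint, so their \<nu> masses add
  up, while the enlarged balls still cover. The result is a Borel cover because \<open>S\<close>
  itself need not be measurable.\<close>

lemma emeasure_cover_le:
  fixes \<mu> \<nu> :: "'a::{metric_space,second_countable_topology} measure"
  assumes [simp]: "sets \<mu> = sets borel" "sets \<nu> = sets borel"
    and s: "\<And>z. z \<in> S \<Longrightarrow> \<exists>s. 0 < s \<and> s \<le> b \<and> s \<le> h z \<and>
      emeasure \<mu> (ball z (5 * s)) \<le> K * emeasure \<nu> (ball z s)"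
  obtains C where "C \<in> sets borel" "S \<subseteq> C" 
    "emeasure \<mu> C \<le> K * emeasure \<nu> (\<Union>z\<in>S. ball z (h z))"
proof -
  obtain f where f: "\<And>z. z \<in> S \<Longrightarrow> 0 < f z \<and> f z \<le> b \<and> f z \<le> h z \<and>
      emeasure \<mu> (ball z (5 * f z)) \<le> K * emeasure \<nu> (ball z (f z))"
    using s by metis
  obtain D where D: "countable D" "D \<subseteq> S" "disjoint_family_on (\<lambda>z. ball z (f z)) D"
    "(\<Union>z\<in>S. ball z (f z)) \<subseteq> (\<Union>z\<in>D. ball z (5 * f z))"
    using Vitali_covering_5r[of S f b "\<lambda>z. z"] f by metis
  show thesis
  proof (rule that)
    show "(\<Union>z\<in>D. ball z (5 * f z)) \<in> sets borel"
      by (intro borel_open open_UN ballI open_ball)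
    show "S \<subseteq> (\<Union>z\<in>D. ball z (5 * f z))"
    proof
      fix z assume "z \<in> S"
      then have "z \<in> (\<Union>z\<in>S. ball z (f z))" using f by (auto intro!: bexI[of _ z])
      then show "z \<in> (\<Union>z\<in>D. ball z (5 * f z))" using D(4) by blast
    qed
    have "emeasure \<mu> (\<Union>z\<in>D. ball z (5 * f z)) \<le> (\<integral>\<^sup>+z. emeasure \<mu> (ball z (5 * f z)) \<partial>count_space D)"
      by (rule emeasure_UN_le_nn_integral) (use D in auto)
    also have "\<dots> \<le> (\<integral>\<^sup>+z. K * emeasure \<nu> (ball z (f z)) \<partial>count_space D)"
      by (rule nn_integral_mono) (use f D in auto)
    also have "\<dots> = K * (\<integral>\<^sup>+z. emeasure \<nu> (ball z (f z)) \<partial>count_space D)"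
      by (rule nn_integral_cmult) auto
    also have "(\<integral>\<^sup>+z. emeasure \<nu> (ball z (f z)) \<partial>count_space D) = emeasure \<nu> (\<Union>z\<in>D. ball z (f z))"
      by (rule emeasure_UN_countable[symmetric]) (use D in auto)
    also have "\<dots> \<le> emeasure \<nu> (\<Union>z\<in>S. ball z (h z))"
    proof (rule emeasure_mono)
      show "(\<Union>z\<in>D. ball z (f z)) \<subseteq> (\<Union>z\<in>S. ball z (h z))"
        using D(2) f by (intro UN_mono subset_ball) auto
    qed (simp, intro borel_open open_UN ballI open_ball)
    finally show "emeasure \<mu> (\<Union>z\<in>D. ball z (5 * f z)) \<le> K * emeasure \<nu> (\<Union>z\<in>S. ball z (h z))"
      by (simp add: mult_left_mono)
  qed
qed

text \<open>The assumption \<open>step\<close> is the monotonicity formula with the integral of \<open>\<nu>\<close> replaced by the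
  mass of the largest ball.\<close>

locale isoperimetric_pair =
  fixes \<mu> \<nu> :: "'a::{metric_space,second_countable_topology} measure"
    and R B :: "'a set" and m :: nat and \<alpha> :: real
  assumes sets_mu [simp, measurable_cong]: "sets \<mu> = sets borel"
    and sets_nu [simp, measurable_cong]: "sets \<nu> = sets borel"
    and fin_mu: "finite_measure \<mu>" and fin_nu: "finite_measure \<nu>"
    and m_pos: "1 \<le> m" and alpha_pos: "0 < \<alpha>"
    and closed_R: "closed R" and null_R: "emeasure \<mu> (- R) = 0"
    and step: "\<And>z a b c. z \<in> R \<Longrightarrow> (\<And>y. y \<in> B \<Longrightarrow> c \<le> dist z y) \<Longrightarrow> 0 < a \<Longrightarrow> a < b \<Longrightarrow> b < c \<Longrightarrow>
      measure \<mu> (ball z a) / a ^ m \<le> measure \<mu> (ball z b) / b ^ m + b / a ^ m * measure \<nu> (ball z c)"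
begin

sublocale mu: finite_measure \<mu> by (rule fin_mu)
sublocale nu: finite_measure \<nu> by (rule fin_nu)

definition X :: "real \<Rightarrow> 'a set" where
  "X t = {z \<in> R. \<forall>y\<in>B. t \<le> dist z y}"

lemma X_mono: "s \<le> t \<Longrightarrow> X t \<subseteq> X s"
  unfolding X_def using order_trans by blast

lemma X_borel [measurable]: "X t \<in> sets borel"
proof -
  have "X t = R \<inter> (\<Inter>y\<in>B. {z. t \<le> dist z y})" by (auto simp: X_def)
  moreover have "closed (\<Inter>y\<in>B. {z. t \<le> dist z y})"
    by (intro closed_INT ballI closed_Collect_le continuous_on_const continuous_on_dist continuous_on_id)
  ultimately show ?thesis using closed_R by (simp add: borel_closed closed_Int)
qed

lemma step_X:
  "z \<in> X c \<Longrightarrow> 0 < a \<Longrightarrow> a < b \<Longrightarrow> b < c \<Longrightarrow>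
    measure \<mu> (ball z a) / a ^ m \<le> measure \<mu> (ball z b) / b ^ m + b / a ^ m * measure \<nu> (ball z c)"
  by (rule step) (auto simp: X_def)

lemma ball_mono: "s \<le> t \<Longrightarrow> measure \<mu> (ball z s) \<le> measure \<mu> (ball z t)"
  by (rule mu.finite_measure_mono) auto

lemma measure_cover_le:
  assumes s: "\<And>z. z \<in> S \<Longrightarrow> \<exists>s. 0 < s \<and> s \<le> b \<and> measure \<mu> (ball z (5 * s)) \<le> K * measure \<nu> (ball z s)"
    and "0 \<le> K"
  obtains C where "C \<in> sets borel" "S \<subseteq> C" "measure \<mu> C \<le> K * measure \<nu> UNIV"
proof -
  have e: "\<exists>s. 0 < s \<and> s \<le> b \<and> s \<le> b \<and>
      emeasure \<mu> (ball z (5 * s)) \<le> ennreal K * emeasure \<nu> (ball z s)" if z: "z \<in> S" for z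
  proof -
    obtain s where s: "0 < s" "s \<le> b" "measure \<mu> (ball z (5 * s)) \<le> K * measure \<nu> (ball z s)"
      using assms(1)[OF z] by auto
    then have "ennreal (measure \<mu> (ball z (5 * s))) \<le> ennreal (K * measure \<nu> (ball z s))"
      by (intro ennreal_leI)
    then show ?thesis using s \<open>0 \<le> K\<close>
      by (auto simp: mu.emeasure_eq_measure nu.emeasure_eq_measure ennreal_mult intro!: exI[of _ s])
  qed
  then obtain C where C: "C \<in> sets borel" "S \<subseteq> C"
    and le: "emeasure \<mu> C \<le> ennreal K * emeasure \<nu> (\<Union>z\<in>S. ball z b)"
    using emeasure_cover_le[of \<mu> \<nu> S b "\<lambda>_. b" "ennreal K"] by auto
  have "ennreal (measure \<mu> C) \<le> ennreal K * emeasure \<nu> UNIV"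
  proof -
    have "emeasure \<nu> (\<Union>z\<in>S. ball z b) \<le> emeasure \<nu> UNIV" by (rule emeasure_mono) auto
    then have "ennreal K * emeasure \<nu> (\<Union>z\<in>S. ball z b) \<le> ennreal K * emeasure \<nu> UNIV"
      by (rule mult_left_mono) simp
    then show ?thesis using le by (simp add: mu.emeasure_eq_measure)
  qed
  then have "measure \<mu> C \<le> K * measure \<nu> UNIV"
    using \<open>0 \<le> K\<close> by (simp add: nu.emeasure_eq_measure flip: ennreal_mult)
  then show thesis using that C by auto
qed

text \<open>Suppose that no such radius exists, and let g be the density ratio. The failure bounds
  \<nu> by the mass of a ball 5 times larger, so by \<open>step\<close> the ratio grows from
  \<open>2 * s\<close> to \<open>s\<close> by at most \<open>2 * s * L / r\<close>, where L bounds
  g. These increments sum to a fraction of L, whence L is at most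
  \<open>\<alpha> / 4 + L / 5\<close>; but \<open>dens\<close> makes L at least
  \<open>\<alpha> / 2\<close>.\<close>

lemma small_mass_covering_ball:
  assumes R: "0 < r" and z: "z \<in> X r"
    and small: "measure \<mu> (ball z r) \<le> \<alpha> / (4 * 20 ^ m) * r ^ m"
    and dens: "\<And>s. 0 < s \<Longrightarrow> \<exists>a. 0 < a \<and> a < s \<and> \<alpha> / 2 * a ^ m \<le> measure \<mu> (ball z a)"
  shows "\<exists>s. 0 < s \<and> s \<le> r / 5 \<and> measure \<mu> (ball z (5 * s)) \<le> 20 ^ m * r * measure \<nu> (ball z s)"
proof (rule ccontr)
  assume "\<not> ?thesis"
  then have neg: "20 ^ m * r * measure \<nu> (ball z s) < measure \<mu> (ball z (5 * s))" if "0 < s" "s \<le> r / 5" for s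
    using that by force
  define g where "g s = measure \<mu> (ball z s) / s ^ m" for s
  obtain a where a: "0 < a" "a < r / 20" "\<alpha> / 2 * a ^ m \<le> measure \<mu> (ball z a)"
    using dens[of "r / 20"] R by auto
  \<comment> \<open>The supremum only goes down to the radius \<open>a\<close>. This makes it
    finite, and at \<open>a\<close> the ratio is known to be at least
    \<open>\<alpha> / 2\<close>.\<close>
  define L where "L = Sup (g ` {a..r})"
  have bdd: "bdd_above (g ` {a..r})"
  proof (rule bdd_aboveI2)
    fix s assume "s \<in> {a..r}"
    then show "g s \<le> measure \<mu> UNIV / a ^ m"
      unfolding g_def using a
      by (intro frac_le power_mono) (auto intro!: mu.finite_measure_mono)
  qed
  have gL: "g s \<le> L" if "a \<le> s" "s \<le> r" for s
    unfolding L_def using bdd that by (intro cSup_upper) auto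
  have "\<alpha> / 2 \<le> g a" using a by (simp add: g_def field_simps)
  also have "g a \<le> L" using gL a by auto
  finally have La: "\<alpha> / 2 \<le> L" .
  \<comment> \<open>From \<open>r / 20\<close> on, the mass hypothesis alone suffices; its
    denominator \<open>20 ^ m\<close> is chosen for this.\<close>
  have large: "g s \<le> \<alpha> / 4" if s: "r / 20 \<le> s" "s \<le> r" for s
  proof -
    have "measure \<mu> (ball z s) \<le> \<alpha> / (4 * 20 ^ m) * r ^ m"
      using small ball_mono[OF s(2), of z] by linarith
    also have "\<dots> = \<alpha> / 4 * (r / 20) ^ m" by (simp add: power_divide)
    also have "\<dots> \<le> \<alpha> / 4 * s ^ m"
      using R s alpha_pos by (intro mult_left_mono power_mono) auto
    finally show ?thesis using R s by (simp add: g_def field_simps)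
  qed
  \<comment> \<open>The correction is linear in \<open>s\<close> so that doubling telescopes:
    \<open>r / 5 - 4 * s\<close> plus \<open>2 * s\<close> is \<open>r / 5 - 2 * s\<close>. The
    number \<open>k\<close> counts the doublings that lead up to \<open>r / 20\<close>.\<close>
  have key: "g s \<le> \<alpha> / 4 + L / r * (r / 5 - 2 * s)" if "a \<le> s" "s < r / 10" "r / 20 \<le> s * 2 ^ k" for s k
    using that
  proof (induction k arbitrary: s)
    case 0
    have "0 \<le> L / r * (r / 5 - 2 * s)" using La alpha_pos R 0 by (intro mult_nonneg_nonneg) auto
    moreover have "g s \<le> \<alpha> / 4" using large[of s] 0 R by auto
    ultimately show ?case by linarith
  next
    case (Suc k)
    show ?case
    proof (cases "r / 20 \<le> s")
      case True
      have "0 \<le> L / r * (r / 5 - 2 * s)" using La alpha_pos R Suc by (intro mult_nonneg_nonneg) auto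
      moreover have "g s \<le> \<alpha> / 4" using large[of s] Suc True R by auto
      ultimately show ?thesis by linarith
    next
      case False
      have s0: "0 < s" using a Suc by auto
      have IH: "g (2 * s) \<le> \<alpha> / 4 + L / r * (r / 5 - 2 * (2 * s))"
        using Suc False s0 by (intro Suc.IH) (auto simp: mult_ac)
      have zX: "z \<in> X (4 * s)" using X_mono[of "4 * s" r] z False s0 by auto
      have "g s \<le> g (2 * s) + (2 * s) / s ^ m * measure \<nu> (ball z (4 * s))"
        unfolding g_def using step_X[OF zX, of s "2 * s"] s0 by auto
      also have "(2 * s) / s ^ m * measure \<nu> (ball z (4 * s)) \<le> (2 * s) / s ^ m * (L * s ^ m / r)"
      proof (rule mult_left_mono)
        \<comment> \<open>The step from \<open>s\<close> to \<open>2 * s\<close> is charged to the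
          ball of radius \<open>4 * s\<close>, where the failing cover brings in the radius
          \<open>20 * s\<close>; the two factors \<open>20 ^ m\<close> cancel.\<close>
        have "20 ^ m * r * measure \<nu> (ball z (4 * s)) \<le> measure \<mu> (ball z (20 * s))"
          using neg[of "4 * s"] s0 False by auto
        also have "\<dots> \<le> L * (20 * s) ^ m"
          using gL[of "20 * s"] False s0 Suc by (auto simp: g_def field_simps)
        finally show "measure \<nu> (ball z (4 * s)) \<le> L * s ^ m / r"
          using R by (simp add: field_simps power_mult_distrib)
      qed (use s0 in auto)
      also have "(2 * s) / s ^ m * (L * s ^ m / r) = L / r * (2 * s)" using s0 by (simp add: field_simps)
      finally show ?thesis using IH by (simp add: algebra_simps)
    qed
  qed
  have "g s \<le> \<alpha> / 4 + L / 5" if s: "s \<in> {a..r}" for s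
  proof (cases "s < r / 10")
    case True
    obtain k :: nat where "r / 20 / s < 2 ^ k" using real_arch_pow[of 2 "r / 20 / s"] by auto
    then have "r / 20 \<le> s * 2 ^ k" using s a by (simp add: field_simps)
    then have "g s \<le> \<alpha> / 4 + L / r * (r / 5 - 2 * s)" using key s True by auto
    also have "\<dots> \<le> \<alpha> / 4 + L / r * (r / 5)"
      using La alpha_pos R s a by (intro add_left_mono mult_left_mono) auto
    finally show ?thesis using R by simp
  next
    case False
    then show ?thesis using large[of s] s La alpha_pos R by auto
  qed
  then have "L \<le> \<alpha> / 4 + L / 5" unfolding L_def using a R by (intro cSup_least) auto
  then show False using La alpha_pos by linarith
qed

text \<open>Each doubling costs at most \<open>4 ^ m * \<eta> * sqrt (s / r)\<close>. The square
  root grows by the factor sqrt 2 per doubling, so the total cost does not depend on the number of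
  steps. The growth bound is assumed above \<open>s0\<close> only, because the lemma is also applied
  at points where it fails at a smaller radius.\<close>

lemma density_ratio_bound:
  assumes w: "w \<in> X \<rho>" and r: "0 < \<rho>" "\<rho> \<le> r" and \<beta>: "\<beta> < \<rho>" "\<rho> \<le> 2 * \<beta>" and "0 \<le> \<eta>"
    and s0: "0 < s0" "\<And>c. s0 < c \<Longrightarrow> c \<le> \<rho> \<Longrightarrow> measure \<nu> (ball w c) \<le> \<eta> * c ^ (m - 1) * sqrt (c / r)"
    and s: "s0 \<le> s" "s < \<beta>"
  shows "measure \<mu> (ball w s) / s ^ m \<le> measure \<mu> (ball w \<beta>) / \<beta> ^ m + 4 * 4 ^ m * \<eta>"
proof -
  define g where "g s = measure \<mu> (ball w s) / s ^ m" for s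
  define q where "q s = sqrt (s / r)" for s
  have r0: "0 < r" and b0: "0 < \<beta>" using assms by auto
  have q1: "q s \<le> 1" if "s \<le> r" for s using that r0 by (simp add: q_def)
  have powm: "x ^ m = x * x ^ (m - 1)" for x :: real using m_pos by (cases m) auto
  have inc: "b / s ^ m * measure \<nu> (ball w c) \<le> 4 ^ m * \<eta> * q s"
    if "s0 \<le> s" "s < c" "c \<le> \<rho>" "c \<le> 4 * s" "0 < b" "b \<le> 2 * s" for s b c
  proof -
    have "measure \<nu> (ball w c) \<le> \<eta> * c ^ (m - 1) * sqrt (c / r)" using s0 that by auto
    also have "\<dots> \<le> \<eta> * (4 * s) ^ (m - 1) * sqrt (4 * s / r)"
      using that s0 r0 \<open>0 \<le> \<eta>\<close>
      by (intro mult_mono power_mono real_sqrt_le_mono divide_right_mono) auto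
    also have "sqrt (4 * s / r) = 2 * q s" by (simp add: q_def real_sqrt_mult real_sqrt_divide)
    finally have "b / s ^ m * measure \<nu> (ball w c) \<le> (2 * s) / s ^ m * (\<eta> * (4 * s) ^ (m - 1) * (2 * q s))"
      using that s0 by (intro mult_mono divide_right_mono) auto
    also have "\<dots> = 4 ^ m * \<eta> * q s" using that s0 by (simp add: powm power_mult_distrib)
    finally show ?thesis .
  qed
  \<comment> \<open>The term \<open>1 - q s\<close> makes the induction telescope: as sqrt 2 is at
    least 4/3, \<open>q s\<close> is at most \<open>3 * (q (2 * s) - q s)\<close>. The separate
    \<open>4 ^ m * \<eta>\<close> pays for the last step, which ends exactly at
    \<open>\<beta>\<close>.\<close>
  have key: "g s \<le> g \<beta> + 4 ^ m * \<eta> + 3 * (4 ^ m * \<eta>) * (1 - q s)"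
    if "s0 \<le> s" "s < \<beta>" "\<beta> \<le> s * 2 ^ Suc k" for s k
    using that
  proof (induction k arbitrary: s)
    case (0 s)
    have X: "w \<in> X \<rho>" by (rule w)
    have "g s \<le> g \<beta> + \<beta> / s ^ m * measure \<nu> (ball w \<rho>)"
      unfolding g_def using step_X[OF X, of s \<beta>] \<beta> 0 s0 by auto
    also have "\<beta> / s ^ m * measure \<nu> (ball w \<rho>) \<le> 4 ^ m * \<eta> * q s"
      using inc[of s \<rho> \<beta>] 0 \<beta> b0 by auto
    also have "4 ^ m * \<eta> * q s \<le> 4 ^ m * \<eta> * 1"
      using q1[of s] 0 \<beta> r \<open>0 \<le> \<eta>\<close> by (intro mult_left_mono) auto
    moreover have "0 \<le> 3 * (4 ^ m * \<eta>) * (1 - q s)"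
      using q1[of s] 0 \<beta> r \<open>0 \<le> \<eta>\<close> by (intro mult_nonneg_nonneg) auto
    ultimately show ?case by linarith
  next
    case (Suc k s)
    show ?case
    proof (cases "\<beta> \<le> s * 2")
      case True
      have X: "w \<in> X \<rho>" by (rule w)
      have "g s \<le> g \<beta> + \<beta> / s ^ m * measure \<nu> (ball w \<rho>)"
        unfolding g_def using step_X[OF X, of s \<beta>] \<beta> Suc s0 by auto
      also have "\<beta> / s ^ m * measure \<nu> (ball w \<rho>) \<le> 4 ^ m * \<eta> * q s"
        using inc[of s \<rho> \<beta>] Suc True \<beta> b0 by auto
      also have "4 ^ m * \<eta> * q s \<le> 4 ^ m * \<eta> * 1"
        using q1[of s] Suc \<beta> r \<open>0 \<le> \<eta>\<close> by (intro mult_left_mono) auto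
      moreover have "0 \<le> 3 * (4 ^ m * \<eta>) * (1 - q s)"
        using q1[of s] Suc \<beta> r \<open>0 \<le> \<eta>\<close> by (intro mult_nonneg_nonneg) auto
      ultimately show ?thesis by linarith
    next
      case False
      have sp: "0 < s" using s0 Suc by auto
      \<comment> \<open>The charged ball must be larger than \<open>2 * s\<close>, but may not
        exceed \<open>\<rho>\<close>, up to which the growth bound and the distance from
        \<open>B\<close> are known.\<close>
      define c where "c = min (4 * s) \<rho>"
      have c: "2 * s < c" "c \<le> \<rho>" "c \<le> 4 * s" using sp False \<beta> by (auto simp: c_def)
      have X: "w \<in> X c" using X_mono[OF c(2)] w by auto
      have IH: "g (2 * s) \<le> g \<beta> + 4 ^ m * \<eta> + 3 * (4 ^ m * \<eta>) * (1 - q (2 * s))"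
        using Suc False sp by (intro Suc.IH) (auto simp: mult_ac)
      have "g s \<le> g (2 * s) + (2 * s) / s ^ m * measure \<nu> (ball w c)"
        unfolding g_def using step_X[OF X, of s "2 * s"] sp c by auto
      also have "(2 * s) / s ^ m * measure \<nu> (ball w c) \<le> 4 ^ m * \<eta> * q s"
        using inc[of s c "2 * s"] c Suc sp by auto
      finally have 1: "g s \<le> g \<beta> + 4 ^ m * \<eta> + 3 * (4 ^ m * \<eta>) * (1 - q (2 * s)) + 4 ^ m * \<eta> * q s"
        using IH by linarith
      have q2: "q (2 * s) = sqrt 2 * q s" by (simp add: q_def real_sqrt_mult real_sqrt_divide)
      have "4 / 3 \<le> sqrt (2::real)" by (rule real_le_rsqrt) (simp add: power2_eq_square)
      then have "4 / 3 * q s \<le> q (2 * s)" unfolding q2 using r0 sp by (intro mult_right_mono) (auto simp: q_def)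
      then have "4 ^ m * \<eta> * (3 * (1 - q (2 * s)) + q s) \<le> 4 ^ m * \<eta> * (3 * (1 - q s))"
        using \<open>0 \<le> \<eta>\<close> by (intro mult_left_mono) auto
      then show ?thesis using 1 by (simp add: algebra_simps)
    qed
  qed
  have sp: "0 < s" using s s0 by auto
  obtain k :: nat where "\<beta> / s < 2 ^ k" using real_arch_pow[of 2 "\<beta> / s"] by auto
  then have "\<beta> < s * 2 ^ k" using sp by (simp add: field_simps)
  moreover have "0 < s * 2 ^ k" using sp by simp
  ultimately have "\<beta> \<le> s * 2 ^ Suc k" by simp
  then have "g s \<le> g \<beta> + 4 ^ m * \<eta> + 3 * (4 ^ m * \<eta>) * (1 - q s)" using key s by auto
  also have "\<dots> \<le> g \<beta> + 4 ^ m * \<eta> + 3 * (4 ^ m * \<eta>) * 1"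
    using \<open>0 \<le> \<eta>\<close> r0 sp by (intro add_left_mono mult_left_mono) (auto simp: q_def)
  finally show ?thesis by (simp add: g_def mult_ac)
qed

text \<open>At an exceptional point take a violating radius s above half of the supremum of all
  violating radii. The growth bound then holds above \<open>2 * s\<close>, so
  \<open>density_ratio_bound\<close> limits the mass of the ball of radius \<open>5 * s\<close> to
  the order of \<open>s ^ m\<close>. The violation in turn bounds \<open>s ^ m\<close> by
  \<open>r / \<eta>\<close> times \<nu> of the ball of radius s, and a covering finishes the
  proof.\<close>

lemma growth_exceptional_set:
  assumes r: "0 < r" "r \<le> 2 * \<rho>" "\<rho> \<le> r" and \<beta>: "\<beta> < \<rho>" "\<rho> \<le> 2 * \<beta>" and \<eta>: "0 < \<eta>" "\<eta> \<le> 1"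
    and mass: "measure \<mu> UNIV \<le> C0 * r ^ m"
  obtains C where "C \<in> sets borel" "measure \<mu> C \<le> (C0 * 4 ^ m + 4 * 4 ^ m) * 20 ^ m * r / \<eta> * measure \<nu> UNIV"
    "\<And>w c. w \<in> X \<rho> - C \<Longrightarrow> 0 < c \<Longrightarrow> c \<le> \<rho> \<Longrightarrow> measure \<nu> (ball w c) \<le> \<eta> * c ^ (m - 1) * sqrt (c / r)"
proof -
  define C1 where "C1 = (C0 * 4 ^ m + 4 * 4 ^ m) * 20 ^ m"
  define V where "V w = {s. 0 < s \<and> s \<le> \<rho> \<and> \<eta> * s ^ (m - 1) * sqrt (s / r) < measure \<nu> (ball w s)}" for w
  have powm: "x ^ m = x * x ^ (m - 1)" for x :: real using m_pos by (cases m) auto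
  have rm: "0 < r ^ m" using r by simp
  have "0 \<le> C0 * r ^ m" using mass measure_nonneg[of \<mu> UNIV] by linarith
  then have C0: "0 \<le> C0" using rm by (metis not_less mult_neg_pos)
  have C1: "0 \<le> C1" using C0 by (simp add: C1_def)
  have cover: "\<exists>s. 0 < s \<and> s \<le> \<rho> \<and> measure \<mu> (ball w (5 * s)) \<le> C1 * r / \<eta> * measure \<nu> (ball w s)"
    if w: "w \<in> {w \<in> X \<rho>. V w \<noteq> {}}" for w
  proof -
    have wX: "w \<in> X \<rho>" and ne: "V w \<noteq> {}" using w by auto
    have bdd: "bdd_above (V w)" by (auto simp: V_def intro!: bdd_aboveI[of _ \<rho>])
    obtain s1 where s1: "s1 \<in> V w" using ne by auto
    then have "0 < Sup (V w)" using cSup_upper[OF s1 bdd] by (auto simp: V_def)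
    then obtain s where s: "s \<in> V w" "Sup (V w) / 2 < s"
      using less_cSup_iff[OF ne bdd, of "Sup (V w) / 2"] by auto
    have sp: "0 < s" "s \<le> \<rho>" and viol: "\<eta> * s ^ (m - 1) * sqrt (s / r) < measure \<nu> (ball w s)"
      using s by (auto simp: V_def)
    have good: "measure \<nu> (ball w c) \<le> \<eta> * c ^ (m - 1) * sqrt (c / r)" if "2 * s < c" "c \<le> \<rho>" for c
    proof (rule ccontr)
      assume "\<not> ?thesis"
      then have "c \<in> V w" using that sp by (auto simp: V_def)
      then have "c \<le> Sup (V w)" using bdd by (rule cSup_upper)
      then show False using s that by linarith
    qed
    have r4: "r / 4 \<le> \<beta>" using r \<beta> by auto
    have m1: "measure \<mu> (ball w (5 * s)) \<le> C1 * s ^ m"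
    proof (cases "5 * s < \<beta>")
      case True
      have "measure \<mu> (ball w (5 * s)) / (5 * s) ^ m \<le> measure \<mu> (ball w \<beta>) / \<beta> ^ m + 4 * 4 ^ m * \<eta>"
        by (rule density_ratio_bound[OF wX _ _ \<beta> _ _ _ _ True, of r \<eta> "2 * s"]) (use r \<eta> sp good in auto)
      also have "\<dots> \<le> C0 * r ^ m / (r / 4) ^ m + 4 * 4 ^ m * 1"
      proof (intro add_mono frac_le mult_left_mono power_mono)
        have "measure \<mu> (ball w \<beta>) \<le> measure \<mu> UNIV" by (rule mu.finite_measure_mono) auto
        then show "measure \<mu> (ball w \<beta>) \<le> C0 * r ^ m" using mass by linarith
      qed (use r r4 \<eta> C0 in auto)
      also have "\<dots> = C0 * 4 ^ m + 4 * 4 ^ m" using r by (simp add: power_divide)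
      finally have "measure \<mu> (ball w (5 * s)) \<le> (C0 * 4 ^ m + 4 * 4 ^ m) * (5 * s) ^ m"
        using sp by (simp add: divide_le_eq)
      also have "\<dots> \<le> (C0 * 4 ^ m + 4 * 4 ^ m) * (20 * s) ^ m"
        using sp C0 by (intro mult_left_mono power_mono) auto
      finally show ?thesis by (simp add: C1_def power_mult_distrib mult_ac)
    next
      case False
      \<comment> \<open>Here \<open>s\<close> is at least \<open>r / 20\<close>, and the total mass
        is already of the order of \<open>s ^ m\<close>.\<close>
      have "measure \<mu> (ball w (5 * s)) \<le> measure \<mu> UNIV" by (rule mu.finite_measure_mono) auto
      also have "\<dots> \<le> C0 * (20 * s) ^ m"
        using mass mult_left_mono[OF power_mono[of r "20 * s" m] C0] False r4 r by auto
      also have "\<dots> \<le> (C0 * 4 ^ m + 4 * 4 ^ m) * (20 * s) ^ m"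
      proof (rule mult_right_mono)
        have "C0 * 1 \<le> C0 * 4 ^ m" using C0 by (intro mult_left_mono) auto
        moreover have "(0::real) \<le> 4 * 4 ^ m" by simp
        ultimately show "C0 \<le> C0 * 4 ^ m + 4 * 4 ^ m" by linarith
      qed (use sp in auto)
      finally show ?thesis by (simp add: C1_def power_mult_distrib mult_ac)
    qed
    have "s ^ m = s ^ (m - 1) * s" by (simp add: powm)
    also have "\<dots> = s ^ (m - 1) * (sqrt (s / r) * sqrt (s / r)) * r" using sp r by simp
    \<comment> \<open>One of the two square roots is given away; the other one matches the growth
      bound.\<close>
    also have "\<dots> \<le> s ^ (m - 1) * (sqrt (s / r) * 1) * r"
      using sp r by (intro mult_left_mono mult_right_mono) auto
    also have "\<dots> \<le> r / \<eta> * measure \<nu> (ball w s)"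
      using viol \<eta> r by (simp add: field_simps)
    finally have "C1 * s ^ m \<le> C1 * (r / \<eta> * measure \<nu> (ball w s))" using C1 by (rule mult_left_mono)
    then show ?thesis using m1 sp by (intro exI[of _ s]) auto
  qed
  have "0 \<le> C1 * r / \<eta>" using C1 r \<eta> by simp
  then obtain C where C: "C \<in> sets borel" "{w \<in> X \<rho>. V w \<noteq> {}} \<subseteq> C"
    "measure \<mu> C \<le> C1 * r / \<eta> * measure \<nu> UNIV"
    using measure_cover_le[OF cover \<open>0 \<le> C1 * r / \<eta>\<close>] by blast
  show thesis
  proof (rule that[OF C(1)])
    show "measure \<mu> C \<le> (C0 * 4 ^ m + 4 * 4 ^ m) * 20 ^ m * r / \<eta> * measure \<nu> UNIV"
      using C(3) by (simp add: C1_def)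
    fix w c assume "w \<in> X \<rho> - C" "0 < c" "c \<le> \<rho>"
    then have "c \<notin> V w" using C(2) by auto
    then show "measure \<nu> (ball w c) \<le> \<eta> * c ^ (m - 1) * sqrt (c / r)"
      using \<open>0 < c\<close> \<open>c \<le> \<rho>\<close> by (auto simp: V_def)
  qed
qed

text \<open>A point outside \<open>L\<close> and outside the exceptional set would carry the ratio
  \<open>Q - 1 / (4 * M)\<close>, in units of \<open>\<alpha>\<close>, from a small radius up to
  \<open>(1 - 2 * \<delta>) * r\<close>. There the mass bound leaves \<open>Q - 1 / M\<close>; the
  smaller radius adds at most \<open>1 / (4 * M)\<close> by the choice of \<open>\<delta>\<close>,
  and the doubling chain adds at most another \<open>1 / (4 * M)\<close> by the choice of
  \<open>\<eta>\<close>. The gap \<open>3 / (4 * M)\<close> is larger than both together.\<close>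

lemma multilayer_estimate:
  assumes M: "1 \<le> M" "1 \<le> Q" "Q \<le> M" and r: "0 < r"
    and \<delta>: "0 < \<delta>" "\<delta> \<le> 1 / 8" "(1 / (1 - 2 * \<delta>)) ^ m \<le> 1 + 1 / (4 * M\<^sup>2)"
    and \<eta>: "0 < \<eta>" "\<eta> \<le> 1" "4 * 4 ^ m * \<eta> \<le> \<alpha> / (4 * M)"
    and mass: "measure \<mu> UNIV \<le> (Q - 1 / M) * \<alpha> * r ^ m"
    and L: "L \<in> sets borel"
      "\<And>z s. z \<in> R - L \<Longrightarrow> 0 < s \<Longrightarrow> \<exists>a. 0 < a \<and> a < s \<and> (Q - 1 / (4 * M)) * \<alpha> * a ^ m \<le> measure \<mu> (ball z a)"
  shows "measure \<mu> (X ((1 - \<delta>) * r))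
    \<le> measure \<mu> L + (M * \<alpha> * 4 ^ m + 4 * 4 ^ m) * 20 ^ m * r / \<eta> * measure \<nu> UNIV"
proof -
  define \<rho> \<beta> where "\<rho> = (1 - \<delta>) * r" and "\<beta> = (1 - 2 * \<delta>) * r"
  have rm: "0 < r ^ m" using r by simp
  have "8 * (\<delta> * r) \<le> r" "0 < \<delta> * r" using r \<delta> by (auto simp: field_simps)
  then have \<beta>: "\<beta> < \<rho>" "\<rho> \<le> 2 * \<beta>" "r \<le> 2 * \<rho>" "\<rho> \<le> r" "0 < \<beta>"
    using r by (auto simp: \<rho>_def \<beta>_def algebra_simps)
  have "(Q - 1 / M) * \<alpha> * r ^ m \<le> M * \<alpha> * r ^ m"
  proof (intro mult_right_mono)
    have "0 \<le> 1 / M" using M by auto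
    then show "Q - 1 / M \<le> M" using M by linarith
  qed (use alpha_pos r in auto)
  then have mass': "measure \<mu> UNIV \<le> (M * \<alpha>) * r ^ m" using mass by linarith
  obtain C where C: "C \<in> sets borel" 
    "measure \<mu> C \<le> (M * \<alpha> * 4 ^ m + 4 * 4 ^ m) * 20 ^ m * r / \<eta> * measure \<nu> UNIV"
    "\<And>w c. w \<in> X \<rho> - C \<Longrightarrow> 0 < c \<Longrightarrow> c \<le> \<rho> \<Longrightarrow> measure \<nu> (ball w c) \<le> \<eta> * c ^ (m - 1) * sqrt (c / r)"
    using growth_exceptional_set[OF r \<beta>(3,4,1,2) \<eta>(1,2) mass'] by metis
  have "X \<rho> \<subseteq> L \<union> C"
  proof (rule ccontr)
    assume "\<not> ?thesis"
    then obtain w where w: "w \<in> X \<rho>" "w \<notin> L" "w \<notin> C" by auto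
    then have "w \<in> R - L" by (auto simp: X_def)
    from L(2)[OF this \<beta>(5)] obtain a
      where a: "0 < a" "a < \<beta>" "(Q - 1 / (4 * M)) * \<alpha> * a ^ m \<le> measure \<mu> (ball w a)" by auto
    have "1 / M \<le> 1" using M by simp
    then have Q0: "0 \<le> Q - 1 / M" using M by linarith
    have "(Q - 1 / (4 * M)) * \<alpha> \<le> measure \<mu> (ball w a) / a ^ m"
      using a by (simp add: field_simps)
    also have "\<dots> \<le> measure \<mu> (ball w \<beta>) / \<beta> ^ m + 4 * 4 ^ m * \<eta>"
      by (rule density_ratio_bound[OF w(1) _ _ \<beta>(1,2) _ _ _ _ a(2), of r \<eta> a])
        (use \<beta> r \<eta> a C(3) w in auto)
    also have "\<dots> \<le> (Q - 1 / M) * \<alpha> * r ^ m / \<beta> ^ m + \<alpha> / (4 * M)"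
    proof (intro add_mono divide_right_mono \<eta>)
      have "measure \<mu> (ball w \<beta>) \<le> measure \<mu> UNIV" by (rule mu.finite_measure_mono) auto
      then show "measure \<mu> (ball w \<beta>) \<le> (Q - 1 / M) * \<alpha> * r ^ m" using mass by linarith
    qed (use \<beta> in auto)
    also have "(Q - 1 / M) * \<alpha> * r ^ m / \<beta> ^ m = (Q - 1 / M) * \<alpha> * (1 / (1 - 2 * \<delta>)) ^ m"
      using r by (simp add: \<beta>_def power_mult_distrib power_divide)
    also have "\<dots> \<le> (Q - 1 / M) * \<alpha> * (1 + 1 / (4 * M\<^sup>2))"
      using Q0 alpha_pos \<delta> by (intro mult_left_mono) auto
    finally have "\<alpha> * (Q - 1 / (4 * M)) \<le> \<alpha> * ((Q - 1 / M) * (1 + 1 / (4 * M\<^sup>2)) + 1 / (4 * M))"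
      by (simp add: algebra_simps)
    then have "Q - 1 / (4 * M) \<le> (Q - 1 / M) * (1 + 1 / (4 * M\<^sup>2)) + 1 / (4 * M)"
      using alpha_pos by simp
    also have "\<dots> = Q - 1 / M + (Q - 1 / M) / (4 * M\<^sup>2) + 1 / (4 * M)"
      by (simp add: algebra_simps)
    also have "(Q - 1 / M) / (4 * M\<^sup>2) \<le> M / (4 * M\<^sup>2)"
    proof (intro divide_right_mono)
      have "0 \<le> 1 / M" using M by auto
      then show "Q - 1 / M \<le> M" using M by linarith
    qed auto
    also have "M / (4 * M\<^sup>2) = 1 / (4 * M)" using M by (simp add: power2_eq_square)
    finally have "1 / M \<le> 3 * (1 / (4 * M))" by linarith
    moreover have "1 / (4 * M) = (1 / M) / 4" "0 < 1 / M" using M by auto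
    ultimately show False by linarith
  qed
  then have "measure \<mu> (X \<rho>) \<le> measure \<mu> (L \<union> C)"
    using L C by (intro mu.finite_measure_mono) auto
  also have "\<dots> \<le> measure \<mu> L + measure \<mu> C" using L C by (intro measure_Un_le) auto
  finally show ?thesis using C(2) by (simp add: \<rho>_def)
qed

text \<open>To be applied to \<open>G t = \<mu>(X\<^sub>r\<^sub>-\<^sub>t)\<^sup>1\<^sup>/\<^sup>m\<close>, where balls of radius \<open>A * G t\<close> have small density
  ratio.\<close>

lemma doubling_dichotomy:
  fixes G :: "real \<Rightarrow> real"
  assumes G0: "0 < G 0" and mono: "\<And>s t. s \<le> t \<Longrightarrow> G s \<le> G t" and bdd: "\<And>t. G t \<le> b" and A: "0 < A" and "0 \<le> d"
  obtains (small) t where "0 \<le> t" "t + A * G t \<le> d" "G (t + A * G t) < 2 * G t" "0 < G t"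
    | (large) "d \<le> 2 * A * G d"
proof -
  \<comment> \<open>\<open>T\<close> holds the depths \<open>t\<close> that are at most
    \<open>A * G t\<close>. Take \<open>t\<close> in \<open>T\<close> where \<open>G\<close> exceeds
    half of its supremum over \<open>T\<close>. If \<open>G\<close> doubled up to
    \<open>t + A * G t\<close>, that depth would belong to \<open>T\<close> again, against the
    choice of \<open>t\<close>. If that depth exceeds \<open>d\<close>, then \<open>d\<close> is
    below \<open>2 * A * G t\<close>.\<close>
  define T where "T = {t. 0 \<le> t \<and> t \<le> d \<and> t \<le> A * G t}"
  have T0: "0 \<in> T" using G0 A \<open>0 \<le> d\<close> by (auto simp: T_def)
  have bddT: "bdd_above (G ` T)" using bdd by (auto intro!: bdd_aboveI2)
  have "G 0 \<le> Sup (G ` T)" using T0 bddT by (auto intro: cSup_upper)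
  then have "Sup (G ` T) / 2 < Sup (G ` T)" using G0 by auto
  then obtain t where t: "t \<in> T" "Sup (G ` T) / 2 < G t"
    using less_cSup_iff[of "G ` T" "Sup (G ` T) / 2"] T0 bddT by auto
  have t0: "0 \<le> t" "t \<le> d" "t \<le> A * G t" using t by (auto simp: T_def)
  have Gt: "0 < G t" using G0 mono[OF t0(1)] by linarith
  define t' where "t' = t + A * G t"
  show thesis
  proof (cases "t' \<le> d")
    case True
    have "G t' < 2 * G t"
    proof (rule ccontr)
      assume *: "\<not> G t' < 2 * G t"
      then have "A * (2 * G t) \<le> A * G t'" using A by (intro mult_left_mono) auto
      then have "t' \<le> A * G t'" using t0 unfolding t'_def by linarith
      then have "t' \<in> T" using True t0 A Gt by (auto simp: T_def t'_def)
      then have "G t' \<le> Sup (G ` T)" using bddT by (intro cSup_upper) auto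
      then show False using * t by linarith
    qed
    then show thesis using small[of t] True t0 Gt by (simp add: t'_def)
  next
    case False
    have "A * G t \<le> A * G d" using A mono[OF t0(2)] by (intro mult_left_mono) auto
    then have "d \<le> 2 * A * G d" using False t0 by (auto simp: t'_def)
    then show thesis by (rule large)
  qed
qed

text \<open>\<open>A\<close> makes \<open>(2 / A) ^ m\<close> the mass ratio tolerated by
  \<open>small_mass_covering_ball\<close>. In the case \<open>large\<close>,
  \<open>c1 * r ^ m\<close> is a lower bound for the mass of the layer, and
  \<open>\<epsilon>\<close> is such that the exceptional set has at most a quarter of this mass if
  \<nu> is at most \<open>\<epsilon> * r ^ (m - 1)\<close>. The lower bounds for
  \<open>\<Gamma>\<close> belong to the case \<open>small\<close>, to the mass of \<open>L\<close>,
  and to the final estimate in the case \<open>large\<close>.\<close>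

theorem isoperimetric_inequality:
  assumes M: "1 \<le> M" "1 \<le> Q" "Q \<le> M" and r: "0 < r"
    and \<delta>: "0 < \<delta>" "\<delta> \<le> 1 / 8" "(1 / (1 - 2 * \<delta>)) ^ m \<le> 1 + 1 / (4 * M\<^sup>2)"
    and \<eta>: "0 < \<eta>" "\<eta> \<le> 1" "4 * 4 ^ m * \<eta> \<le> \<alpha> / (4 * M)"
    and mass: "measure \<mu> UNIV \<le> (Q - 1 / M) * \<alpha> * r ^ m"
    and N: "N \<in> null_sets \<mu>"
      "\<And>z s. z \<in> R - N \<Longrightarrow> 0 < s \<Longrightarrow> \<exists>a. 0 < a \<and> a < s \<and> \<alpha> / 2 * a ^ m \<le> measure \<mu> (ball z a)"
    and L: "L \<in> sets borel" "measure \<mu> L \<le> r ^ m / \<Gamma>"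
      "\<And>z s. z \<in> R - L \<Longrightarrow> 0 < s \<Longrightarrow> \<exists>a. 0 < a \<and> a < s \<and> (Q - 1 / (4 * M)) * \<alpha> * a ^ m \<le> measure \<mu> (ball z a)"
    and A: "A = 2 / root m (\<alpha> / (4 * 20 ^ m))"
    and c1: "c1 = (\<delta> / (2 * A)) ^ m"
    and \<epsilon>: "\<epsilon> = c1 * \<eta> / (4 * ((M * \<alpha> * 4 ^ m + 4 * 4 ^ m) * 20 ^ m))"
    and \<Gamma>: "20 ^ m * A \<le> \<Gamma>" "4 / c1 \<le> \<Gamma>" "(M * \<alpha>) powr (1 - 1 / real m) / \<epsilon> \<le> \<Gamma>"
  shows "measure \<mu> (X r) powr (1 - 1 / real m) \<le> \<Gamma> * measure \<nu> UNIV"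
proof (cases "measure \<mu> (X r) = 0")
  case True
  have "0 < A" using A alpha_pos m_pos by simp
  then have "0 \<le> \<Gamma>" using \<Gamma>(1) by (meson dual_order.trans less_imp_le mult_nonneg_nonneg zero_le_numeral zero_le_power)
  \<comment> \<open>\<open>0 powr x\<close> is 0 for every \<open>x\<close>; for
    \<open>m = 1\<close> this is the convention on the zeroth power of 0.\<close>
  then show ?thesis using True by simp
next
  case False
  have A0: "0 < A" using A alpha_pos m_pos by simp
  have G0: "0 < \<Gamma>" using \<Gamma>(1) A0 by (smt (verit) mult_pos_pos zero_less_power)
  have powm: "x ^ m = x * x ^ (m - 1)" for x :: real using m_pos by (cases m) auto
  define G where "G t = root m (measure \<mu> (X (r - t)))" for t
  have Gm: "G t ^ m = measure \<mu> (X (r - t))" for t using m_pos by (simp add: G_def)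
  have Gpowr: "measure \<mu> (X (r - t)) powr (1 - 1 / real m) = G t ^ (m - 1)" if "0 < G t" for t
  proof -
    have "measure \<mu> (X (r - t)) = G t powr real m" using that by (simp add: Gm powr_realpow)
    then have "measure \<mu> (X (r - t)) powr (1 - 1 / real m) = G t powr (real m * (1 - 1 / real m))"
      by (simp add: powr_powr)
    also have "real m * (1 - 1 / real m) = real (m - 1)" using m_pos by (simp add: field_simps of_nat_diff)
    finally show ?thesis using that by (simp only: powr_realpow)
  qed
  have powr_mono: "measure \<mu> (X r) powr (1 - 1 / real m) \<le> y powr (1 - 1 / real m)" if "measure \<mu> (X r) \<le> y" for y
    using that m_pos by (intro powr_mono2) auto
  have monoG: "G s \<le> G t" if "s \<le> t" for s t
    unfolding G_def using m_pos that
    by (intro real_root_le_mono mu.finite_measure_mono X_mono) auto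
  have bddG: "G t \<le> root m (measure \<mu> UNIV)" for t
    unfolding G_def using m_pos by (intro real_root_le_mono mu.finite_measure_mono) auto
  have "0 < measure \<mu> (X r)" using False measure_nonneg[of \<mu> "X r"] by linarith
  then have G00: "0 < G 0" using m_pos by (simp add: G_def)
  have d0: "0 \<le> \<delta> * r" using \<delta> r by simp
  consider (small) t where "0 \<le> t" "t + A * G t \<le> \<delta> * r" "G (t + A * G t) < 2 * G t" "0 < G t"
    | (large) "\<delta> * r \<le> 2 * A * G (\<delta> * r)"
    by (rule doubling_dichotomy[of G, OF G00 _ bddG A0 d0]) (rule monoG that; assumption)+
  then show ?thesis
  proof cases
    case t: small
    define s where "s = A * G t"
    have s0: "0 < s" using A0 t by (simp add: s_def)
    have "8 * (\<delta> * r) \<le> r" using r \<delta> by (auto simp: field_simps)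
    then have st: "s \<le> r - t" using t(1,2) s0 r unfolding s_def by linarith
    have cover: "\<exists>u. 0 < u \<and> u \<le> s / 5 \<and> measure \<mu> (ball z (5 * u)) \<le> 20 ^ m * s * measure \<nu> (ball z u)"
      if z: "z \<in> X (r - t) - N" for z
    proof (rule small_mass_covering_ball[OF s0])
      show "z \<in> X s" using X_mono[OF st] z by auto
      \<comment> \<open>Moving by less than \<open>s\<close> costs less than \<open>s\<close> of the
        distance from \<open>B\<close>, so the ball stays in the next layer, where \<open>G\<close>
        has not yet doubled.\<close>
      have sub: "ball z s \<inter> R \<subseteq> X (r - t - s)"
      proof
        fix y assume y: "y \<in> ball z s \<inter> R"
        have "r - t - s \<le> dist y x" if "x \<in> B" for x
        proof -
          have "r - t \<le> dist z x" using z that by (auto simp: X_def)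
          also have "\<dots> \<le> dist z y + dist y x" by (rule dist_triangle)
          finally show ?thesis using y by auto
        qed
        then show "y \<in> X (r - t - s)" using y by (auto simp: X_def)
      qed
      have "measure \<mu> (ball z s) \<le> measure \<mu> (X (r - t - s) \<union> - R)"
        by (rule mu.finite_measure_mono) (use sub closed_R in auto)
      also have "\<dots> \<le> measure \<mu> (X (r - t - s)) + measure \<mu> (- R)"
        using closed_R by (intro measure_Un_le) auto
      also have "measure \<mu> (- R) = 0" using null_R by (simp add: measure_def)
      also have "measure \<mu> (X (r - t - s)) + 0 = G (t + s) ^ m" by (simp add: Gm algebra_simps)
      also have "\<dots> \<le> (2 * G t) ^ m"
        using t monoG[of 0 "t + s"] G00 s0 by (intro power_mono) (auto simp: s_def)
      also have "\<dots> = (2 / A) ^ m * s ^ m" using A0 by (simp add: s_def power_mult_distrib power_divide)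
      also have "(2 / A) ^ m = \<alpha> / (4 * 20 ^ m)" using A alpha_pos m_pos by simp
      finally show "measure \<mu> (ball z s) \<le> \<alpha> / (4 * 20 ^ m) * s ^ m" .
      show "\<exists>a. 0 < a \<and> a < s \<and> \<alpha> / 2 * a ^ m \<le> measure \<mu> (ball z a)" if "0 < s" for s
        using N(2)[of z s] z that by (auto simp: X_def)
    qed
    have K0: "0 \<le> 20 ^ m * s" using s0 by simp
    obtain C where C: "C \<in> sets borel" "X (r - t) - N \<subseteq> C" "measure \<mu> C \<le> 20 ^ m * s * measure \<nu> UNIV"
      using measure_cover_le[OF cover K0] by blast
    \<comment> \<open>The covering bound carries the factor \<open>s = A * G t\<close>. Cancelling
      \<open>G t\<close> lowers the power from \<open>m\<close> to \<open>m - 1\<close>, the power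
      in the claim.\<close>
    have "G t * G t ^ (m - 1) = measure \<mu> (X (r - t))" by (simp add: powm flip: Gm)
    also have "\<dots> \<le> measure \<mu> (C \<union> N)"
      using C N(1) by (intro mu.finite_measure_mono) auto
    also have "\<dots> \<le> measure \<mu> C + measure \<mu> N" using C N(1) by (intro measure_Un_le) auto
    also have "measure \<mu> N = 0" using N(1) by (simp add: null_setsD1 measure_def)
    finally have "G t * G t ^ (m - 1) \<le> G t * (20 ^ m * A * measure \<nu> UNIV)"
      using C by (simp add: s_def mult_ac)
    then have "G t ^ (m - 1) \<le> 20 ^ m * A * measure \<nu> UNIV" using t by simp
    also have "\<dots> \<le> \<Gamma> * measure \<nu> UNIV" using \<Gamma>(1) by (intro mult_right_mono) auto
    finally have "measure \<mu> (X (r - t)) powr (1 - 1 / real m) \<le> \<Gamma> * measure \<nu> UNIV" using t Gpowr by simp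
    moreover have "measure \<mu> (X r) \<le> measure \<mu> (X (r - t))"
      using t by (intro mu.finite_measure_mono X_mono) auto
    ultimately show ?thesis using powr_mono by (meson order_trans)
  next
    case large: large
    define C1 where "C1 = (M * \<alpha> * 4 ^ m + 4 * 4 ^ m) * 20 ^ m"
    have C1: "0 < C1" using M alpha_pos by (auto simp: C1_def intro!: mult_pos_pos add_pos_pos)
    have c1p: "0 < c1" using c1 \<delta> A0 by simp
    have \<epsilon>0: "0 < \<epsilon>" using \<epsilon> c1p \<eta> C1 by (simp add: C1_def)
    have rm: "0 < r ^ m" using r by simp
    \<comment> \<open>If \<nu> were smaller, \<open>L\<close> and the exceptional set would account
      for at most half of the mass \<open>c1 * r ^ m\<close> that the layer is known to
      have.\<close>
    have "\<epsilon> * r ^ (m - 1) \<le> measure \<nu> UNIV"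
    proof (rule ccontr)
      assume "\<not> ?thesis"
      then have lt: "measure \<nu> UNIV \<le> \<epsilon> * r ^ (m - 1)" by simp
      have "c1 * r ^ m = (\<delta> * r / (2 * A)) ^ m" using c1 by (simp add: power_mult_distrib power_divide)
      also have "\<dots> \<le> G (\<delta> * r) ^ m"
        using large A0 d0 by (intro power_mono) (auto simp: divide_le_eq mult_ac)
      also have "\<dots> = measure \<mu> (X ((1 - \<delta>) * r))" by (simp add: Gm algebra_simps)
      also have "\<dots> \<le> measure \<mu> L + C1 * r / \<eta> * measure \<nu> UNIV"
        unfolding C1_def by (rule multilayer_estimate[OF M r \<delta> \<eta> mass L(1) L(3)])
      also have "\<dots> \<le> r ^ m / (4 / c1) + C1 * r / \<eta> * (\<epsilon> * r ^ (m - 1))"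
      proof (intro add_mono mult_left_mono lt)
        have "measure \<mu> L \<le> r ^ m / \<Gamma>" by (rule L(2))
        also have "\<dots> \<le> r ^ m / (4 / c1)" using \<Gamma>(2) c1p rm G0 by (intro divide_left_mono) auto
        finally show "measure \<mu> L \<le> r ^ m / (4 / c1)" .
      qed (use C1 r \<eta> in auto)
      also have "C1 * r / \<eta> * (\<epsilon> * r ^ (m - 1)) = c1 / 4 * r ^ m"
      proof -
        have "\<epsilon> = c1 * \<eta> / (4 * C1)" using \<epsilon> by (simp add: C1_def)
        then show ?thesis using C1 \<eta> by (simp add: powm[of r])
      qed
      finally show False using c1p rm by (simp add: field_simps)
    qed
    have "(Q - 1 / M) * \<alpha> * r ^ m \<le> M * \<alpha> * r ^ m"
    proof (intro mult_right_mono)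
      have "0 \<le> 1 / M" using M by auto
      then show "Q - 1 / M \<le> M" using M by linarith
    qed (use alpha_pos r in auto)
    moreover have "measure \<mu> (X r) \<le> measure \<mu> UNIV" by (rule mu.finite_measure_mono) auto
    ultimately have "measure \<mu> (X r) \<le> M * \<alpha> * r ^ m" using mass by linarith
    then have "measure \<mu> (X r) powr (1 - 1 / real m) \<le> (M * \<alpha> * r ^ m) powr (1 - 1 / real m)"
      by (rule powr_mono)
    also have "\<dots> = (M * \<alpha>) powr (1 - 1 / real m) * (r ^ m) powr (1 - 1 / real m)"
      using M alpha_pos r by (simp add: powr_mult)
    also have "(r ^ m) powr (1 - 1 / real m) = r ^ (m - 1)"
    proof -
      have "(r ^ m) powr (1 - 1 / real m) = r powr (real m * (1 - 1 / real m))"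
        using r by (simp add: powr_powr flip: powr_realpow)
      also have "real m * (1 - 1 / real m) = real (m - 1)" using m_pos by (simp add: field_simps of_nat_diff)
      finally show ?thesis using r by (simp only: powr_realpow)
    qed
    also have "(M * \<alpha>) powr (1 - 1 / real m) * r ^ (m - 1)
      \<le> (M * \<alpha>) powr (1 - 1 / real m) * (measure \<nu> UNIV / \<epsilon>)"
      using \<open>\<epsilon> * r ^ (m - 1) \<le> measure \<nu> UNIV\<close> \<epsilon>0 by (intro mult_left_mono) (auto simp: field_simps)
    also have "\<dots> = (M * \<alpha>) powr (1 - 1 / real m) / \<epsilon> * measure \<nu> UNIV" by simp
    also have "\<dots> \<le> \<Gamma> * measure \<nu> UNIV" using \<Gamma>(3) by (intro mult_right_mono) auto
    finally show ?thesis .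
  qed
qed

end

theorem isoperimetric_pair_constant:
  fixes M \<alpha> :: real and m :: nat
  assumes M: "1 \<le> M" and "1 \<le> m" and "0 < \<alpha>"
  obtains \<Gamma>0 :: real where "0 < \<Gamma>0"
    "\<And>(\<mu> :: 'a::{metric_space,second_countable_topology} measure) \<nu> R B \<Gamma> Q r N L.
      isoperimetric_pair \<mu> \<nu> R B m \<alpha> \<Longrightarrow> \<Gamma>0 \<le> \<Gamma> \<Longrightarrow> 1 \<le> Q \<Longrightarrow> Q \<le> M \<Longrightarrow> 0 < r \<Longrightarrow>
      measure \<mu> UNIV \<le> (Q - 1 / M) * \<alpha> * r ^ m \<Longrightarrow>
      N \<in> null_sets \<mu> \<Longrightarrow>
      (\<And>z s. z \<in> R - N \<Longrightarrow> 0 < s \<Longrightarrow> \<exists>a. 0 < a \<and> a < s \<and> \<alpha> / 2 * a ^ m \<le> measure \<mu> (ball z a)) \<Longrightarrow>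
      L \<in> sets borel \<Longrightarrow> measure \<mu> L \<le> r ^ m / \<Gamma> \<Longrightarrow>
      (\<And>z s. z \<in> R - L \<Longrightarrow> 0 < s \<Longrightarrow>
        \<exists>a. 0 < a \<and> a < s \<and> (Q - 1 / (4 * M)) * \<alpha> * a ^ m \<le> measure \<mu> (ball z a)) \<Longrightarrow>
      measure \<mu> {z \<in> R. \<forall>y\<in>B. r \<le> dist z y} powr (1 - 1 / real m) \<le> \<Gamma> * measure \<nu> UNIV"
proof -
  \<comment> \<open>A suitable \<open>\<delta>\<close> exists by continuity, since the power is 1 at
    0.\<close>
  have "((\<lambda>\<delta>. (1 / (1 - 2 * \<delta>)) ^ m) \<longlongrightarrow> (1 / (1 - 2 * 0)) ^ m) (at_right (0::real))"
    by (intro tendsto_intros) auto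
  moreover have "(1 / (1 - 2 * 0)) ^ m < 1 + 1 / (4 * M\<^sup>2)" using M by simp
  ultimately have "\<forall>\<^sub>F \<delta> in at_right (0::real). (1 / (1 - 2 * \<delta>)) ^ m < 1 + 1 / (4 * M\<^sup>2)"
    by (rule order_tendstoD)
  moreover have "\<forall>\<^sub>F \<delta> in at_right (0::real). \<delta> < 1 / 8" by (rule eventually_at_rightI[of 0 "1 / 8"]) auto
  ultimately have "\<forall>\<^sub>F \<delta> in at_right (0::real). 0 < \<delta> \<and> \<delta> \<le> 1 / 8 \<and> (1 / (1 - 2 * \<delta>)) ^ m \<le> 1 + 1 / (4 * M\<^sup>2)"
    using eventually_at_right_less[of "0::real"] by eventually_elim auto
  then obtain \<delta> where \<delta>: "0 < \<delta>" "\<delta> \<le> 1 / 8" "(1 / (1 - 2 * \<delta>)) ^ m \<le> 1 + 1 / (4 * M\<^sup>2)"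
    using eventually_happens'[OF trivial_limit_at_right_real] by blast
  define \<eta> where "\<eta> = min 1 (\<alpha> / (4 * M) / (4 * 4 ^ m))"
  have "\<eta> \<le> \<alpha> / (4 * M) / (4 * 4 ^ m)" by (simp add: \<eta>_def)
  then have "4 * 4 ^ m * \<eta> \<le> 4 * 4 ^ m * (\<alpha> / (4 * M) / (4 * 4 ^ m))" by (intro mult_left_mono) auto
  then have \<eta>: "0 < \<eta>" "\<eta> \<le> 1" "4 * 4 ^ m * \<eta> \<le> \<alpha> / (4 * M)"
    using assms by (auto simp: \<eta>_def)
  define A where "A = 2 / root m (\<alpha> / (4 * 20 ^ m))"
  define c1 where "c1 = (\<delta> / (2 * A)) ^ m"
  define \<epsilon> where "\<epsilon> = c1 * \<eta> / (4 * ((M * \<alpha> * 4 ^ m + 4 * 4 ^ m) * 20 ^ m))"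
  define \<Gamma>0 where "\<Gamma>0 = max (20 ^ m * A) (max (4 / c1) ((M * \<alpha>) powr (1 - 1 / real m) / \<epsilon>))"
  have "0 < A" using assms by (simp add: A_def)
  then have "0 < \<Gamma>0" by (simp add: \<Gamma>0_def less_max_iff_disj)
  then show thesis
  proof (rule that)
    fix \<mu> \<nu> :: "'a measure" and R B \<Gamma> Q r N L
    assume "isoperimetric_pair \<mu> \<nu> R B m \<alpha>" "\<Gamma>0 \<le> \<Gamma>" and Q: "1 \<le> Q" "Q \<le> M" and r: "0 < r"
      and mass: "measure \<mu> UNIV \<le> (Q - 1 / M) * \<alpha> * r ^ m"
      and N: "N \<in> null_sets \<mu>"
        "\<And>z s. z \<in> R - N \<Longrightarrow> 0 < s \<Longrightarrow> \<exists>a. 0 < a \<and> a < s \<and> \<alpha> / 2 * a ^ m \<le> measure \<mu> (ball z a)"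
      and L: "L \<in> sets borel" "measure \<mu> L \<le> r ^ m / \<Gamma>"
        "\<And>z s. z \<in> R - L \<Longrightarrow> 0 < s \<Longrightarrow>
          \<exists>a. 0 < a \<and> a < s \<and> (Q - 1 / (4 * M)) * \<alpha> * a ^ m \<le> measure \<mu> (ball z a)"
    interpret isoperimetric_pair \<mu> \<nu> R B m \<alpha> by fact
    have "measure \<mu> (X r) powr (1 - 1 / real m) \<le> \<Gamma> * measure \<nu> UNIV"
      by (rule isoperimetric_inequality[OF M Q r \<delta> \<eta> mass N L A_def c1_def \<epsilon>_def])
        (use \<open>\<Gamma>0 \<le> \<Gamma>\<close> in \<open>auto simp: \<Gamma>0_def\<close>)
    then show "measure \<mu> {z \<in> R. \<forall>y\<in>B. r \<le> dist z y} powr (1 - 1 / real m) \<le> \<Gamma> * measure \<nu> UNIV"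
      by (simp add: X_def)
  qed
qed

section \<open>Differentiability classes\<close>

text \<open>\<open>Ck_on\<close> for arbitrary normed spaces: test fields are assembled from real
  valued cutoff functions and from profiles on the line, which need the same calculus.\<close>

primrec Ck :: "'a::real_normed_vector set \<Rightarrow> 'a set \<Rightarrow> nat \<Rightarrow> ('a \<Rightarrow> 'b::real_normed_vector) \<Rightarrow> bool" where
  "Ck A W 0 f \<longleftrightarrow> continuous_on W f"
| "Ck A W (Suc k) f \<longleftrightarrow>
     (\<exists>D. (\<forall>x\<in>W. (f has_derivative D x) (at x within A)) \<and> (\<forall>v\<in>A. Ck A W k (\<lambda>x. D x v)))"

declare Ck.simps(2) [simp del]

lemma Ck_SucI:
  assumes "\<And>x. x \<in> W \<Longrightarrow> (f has_derivative D x) (at x within A)"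
    "\<And>v. v \<in> A \<Longrightarrow> Ck A W k (\<lambda>x. D x v)"
  shows "Ck A W (Suc k) f"
  using assms by (auto simp: Ck.simps(2))

lemma Ck_SucE:
  assumes "Ck A W (Suc k) f"
  obtains D where "\<And>x. x \<in> W \<Longrightarrow> (f has_derivative D x) (at x within A)"
    "\<And>v. v \<in> A \<Longrightarrow> Ck A W k (\<lambda>x. D x v)"
  using assms unfolding Ck.simps by (auto intro: that)

lemma Ck_SucD: "W \<subseteq> A \<Longrightarrow> Ck A W (Suc k) f \<Longrightarrow> Ck A W k f"
proof (induction k arbitrary: f)
  case 0
  from 0(2) obtain D where "\<And>x. x \<in> W \<Longrightarrow> (f has_derivative D x) (at x within A)" by (rule Ck_SucE) blast
  then have "continuous (at x within W) f" if "x \<in> W" for x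
    using has_derivative_continuous has_derivative_subset[OF _ 0(1)] that by blast
  then show ?case by (simp add: continuous_on_eq_continuous_within)
next
  case (Suc k)
  from Suc.prems(2) obtain D where "\<And>x. x \<in> W \<Longrightarrow> (f has_derivative D x) (at x within A)"
    "\<And>v. v \<in> A \<Longrightarrow> Ck A W (Suc k) (\<lambda>x. D x v)" by (rule Ck_SucE) blast
  then show ?case by (auto intro!: Ck_SucI[of W f D] Suc.IH[OF Suc.prems(1)])
qed

lemma Ck_subset: "W' \<subseteq> W \<Longrightarrow> Ck A W k f \<Longrightarrow> Ck A W' k f"
proof (induction k arbitrary: f)
  case 0 then show ?case by (auto intro: continuous_on_subset)
next
  case (Suc k)
  from Suc.prems(2) obtain D where "\<And>x. x \<in> W \<Longrightarrow> (f has_derivative D x) (at x within A)"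
    "\<And>v. v \<in> A \<Longrightarrow> Ck A W k (\<lambda>x. D x v)" by (rule Ck_SucE) blast
  then show ?case using Suc.prems(1) by (auto intro!: Ck_SucI[of W' f D] Suc.IH[OF Suc.prems(1)])
qed

lemma Ck_cong:
  assumes "W \<subseteq> A" "\<And>x. x \<in> A \<Longrightarrow> f x = g x" "Ck A W k f"
  shows "Ck A W k g"
proof (cases k)
  case 0
  have "continuous_on W f \<longleftrightarrow> continuous_on W g"
    by (rule continuous_on_cong) (use assms in auto)
  then show ?thesis using 0 assms by simp
next
  case (Suc j)
  have "Ck A W (Suc j) f" using assms(3) Suc by simp
  then obtain D where D: "\<And>x. x \<in> W \<Longrightarrow> (f has_derivative D x) (at x within A)"
    "\<And>v. v \<in> A \<Longrightarrow> Ck A W j (\<lambda>x. D x v)" by (rule Ck_SucE) blast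
  have "(g has_derivative D x) (at x within A)" if "x \<in> W" for x
    by (rule has_derivative_transform[OF _ _ D(1)[OF that]]) (use assms that in auto)
  then show ?thesis using D Suc by (auto intro: Ck_SucI[of W g D])
qed

lemma Ck_const [simp]: "Ck A W k (\<lambda>_. c)"
  by (induction k arbitrary: c) (auto intro!: Ck_SucI[of W _ "\<lambda>_ _. 0"])

lemma Ck_bounded_linear:
  assumes "bounded_linear f" shows "Ck A W k f"
proof (cases k)
  case 0
  then show ?thesis using linear_continuous_on[OF assms] by simp
next
  case (Suc j)
  then show ?thesis using bounded_linear_imp_has_derivative[OF assms] by (auto intro!: Ck_SucI[of W _ "\<lambda>_. f"])
qed

lemma Ck_add: "Ck A W k f \<Longrightarrow> Ck A W k g \<Longrightarrow> Ck A W k (\<lambda>x. f x + g x)"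
proof (induction k arbitrary: f g)
  case 0 then show ?case by (auto intro: continuous_intros)
next
  case (Suc k)
  from Suc.prems(1) obtain D where D:
    "\<And>x. x \<in> W \<Longrightarrow> (f has_derivative D x) (at x within A)" "\<And>v. v \<in> A \<Longrightarrow> Ck A W k (\<lambda>x. D x v)"
    by (rule Ck_SucE) blast
  from Suc.prems(2) obtain E where E:
    "\<And>x. x \<in> W \<Longrightarrow> (g has_derivative E x) (at x within A)" "\<And>v. v \<in> A \<Longrightarrow> Ck A W k (\<lambda>x. E x v)"
    by (rule Ck_SucE) blast
  note * = D E
  then show ?case using Suc.IH
    by (intro Ck_SucI[of W _ "\<lambda>x v. D x v + E x v"] has_derivative_add) auto
qed

lemma Ck_bilinear:
  assumes "bounded_bilinear p" and WA: "W \<subseteq> A"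
  shows "Ck A W k f \<Longrightarrow> Ck A W k g \<Longrightarrow> Ck A W k (\<lambda>x. p (f x) (g x))"
proof (induction k arbitrary: f g)
  case 0 then show ?case by (auto intro: bounded_bilinear.continuous_on[OF assms(1)])
next
  case (Suc k)
  from Suc.prems(1) obtain D where D:
    "\<And>x. x \<in> W \<Longrightarrow> (f has_derivative D x) (at x within A)" "\<And>v. v \<in> A \<Longrightarrow> Ck A W k (\<lambda>x. D x v)"
    by (rule Ck_SucE) blast
  from Suc.prems(2) obtain E where E:
    "\<And>x. x \<in> W \<Longrightarrow> (g has_derivative E x) (at x within A)" "\<And>v. v \<in> A \<Longrightarrow> Ck A W k (\<lambda>x. E x v)"
    by (rule Ck_SucE) blast
  note * = D E
  have k: "Ck A W k f" "Ck A W k g" using Suc.prems Ck_SucD[OF WA] by blast+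
  show ?case using * k Suc.IH
    by (intro Ck_SucI[of W _ "\<lambda>x v. p (f x) (E x v) + p (D x v) (g x)"]
        bounded_bilinear.FDERIV[OF assms(1)] Ck_add) auto
qed

lemmas Ck_scaleR = Ck_bilinear[OF bounded_bilinear_scaleR]
lemmas Ck_mult = Ck_bilinear[OF bounded_bilinear_mult]
lemmas Ck_inner = Ck_bilinear[OF bounded_bilinear_inner]

lemma Ck_cmult: "Ck A W k f \<Longrightarrow> W \<subseteq> A \<Longrightarrow> Ck A W k (\<lambda>x. c *\<^sub>R f x)"
  by (rule Ck_scaleR) auto

lemma Ck_minus: "Ck A W k f \<Longrightarrow> W \<subseteq> A \<Longrightarrow> Ck A W k (\<lambda>x. - f x)"
  using Ck_cmult[of A W k f "-1"] by simp

lemma Ck_diff: "Ck A W k f \<Longrightarrow> Ck A W k g \<Longrightarrow> W \<subseteq> A \<Longrightarrow> Ck A W k (\<lambda>x. f x - g x)"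
  using Ck_add[of A W k f "\<lambda>x. - g x"] Ck_minus[of A W k g] by simp

lemma Ck_id [simp]: "Ck A W k (\<lambda>x. x)"
  by (rule Ck_bounded_linear) (rule bounded_linear_ident)

lemma Ck_prod:
  fixes f :: "'i \<Rightarrow> 'a::real_normed_vector \<Rightarrow> real"
  shows "W \<subseteq> A \<Longrightarrow> (\<And>i. i \<in> I \<Longrightarrow> Ck A W k (f i)) \<Longrightarrow> Ck A W k (\<lambda>x. \<Prod>i\<in>I. f i x)"
  by (induction I rule: infinite_finite_induct) (auto intro: Ck_mult)

lemma Ck_real_SucI:
  fixes h :: "real \<Rightarrow> real"
  assumes "\<And>x. x \<in> X \<Longrightarrow> (h has_real_derivative h' x) (at x)" "Ck UNIV X k h'"
  shows "Ck UNIV X (Suc k) h"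
proof -
  have "Ck UNIV X k (\<lambda>x. h' x * v)" for v by (rule Ck_mult) (use assms in auto)
  then show ?thesis using assms(1)
    by (auto simp: has_field_derivative_def intro!: Ck_SucI[of X _ "\<lambda>x v. h' x * v"])
qed

lemma Ck_compose_real:
  fixes h :: "real \<Rightarrow> real" and f :: "'a::real_normed_vector \<Rightarrow> real"
  assumes WA: "W \<subseteq> A"
  shows "Ck UNIV X k h \<Longrightarrow> f ` W \<subseteq> X \<Longrightarrow> Ck A W k f \<Longrightarrow> Ck A W k (\<lambda>x. h (f x))"
proof (induction k arbitrary: h)
  case 0
  then show ?case by (auto intro: continuous_on_compose2)
next
  case (Suc k)
  from Suc.prems(3) obtain D where D:
    "\<And>x. x \<in> W \<Longrightarrow> (f has_derivative D x) (at x within A)" "\<And>v. v \<in> A \<Longrightarrow> Ck A W k (\<lambda>x. D x v)"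
    by (rule Ck_SucE) blast
  from Suc.prems(1) obtain E where E:
    "\<And>y. y \<in> X \<Longrightarrow> (h has_derivative E y) (at y)" "\<And>v. Ck UNIV X k (\<lambda>x. E x v)"
    by (rule Ck_SucE) blast
  note * = D E
  have fk: "Ck A W k f" using Suc.prems Ck_SucD[OF WA] by blast
  have "((\<lambda>x. h (f x)) has_derivative (\<lambda>v. D x v * E (f x) 1)) (at x within A)" if "x \<in> W" for x
  proof -
    have fx: "f x \<in> X" using that Suc.prems by auto
    interpret bounded_linear "E (f x)" using *(3)[OF fx] by (rule has_derivative_bounded_linear)
    have "((\<lambda>x. h (f x)) has_derivative (\<lambda>v. E (f x) (D x v))) (at x within A)"
      by (rule has_derivative_compose[OF *(1)[OF that] *(3)[OF fx]])
    \<comment> \<open>A linear map of the line is multiplication by its value at 1. This gives the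
      chain rule the form of a product, to which the induction hypothesis and \<open>Ck_mult\<close>
      apply.\<close>
    moreover have "E (f x) (D x v) = D x v * E (f x) 1" for v
      using scaleR[of "D x v" 1] by (simp only: real_scaleR_def mult_1_right)
    ultimately show ?thesis by (simp only:)
  qed
  moreover have "Ck A W k (\<lambda>x. D x v * E (f x) 1)" if "v \<in> A" for v
    by (rule Ck_mult[OF WA *(2)[OF that] Suc.IH[OF *(4) Suc.prems(2) fk]])
  ultimately show ?case by (rule Ck_SucI)
qed

section \<open>The functions t^(-j) exp(-1/t) and smooth steps\<close>

definition bump_deriv :: "nat \<Rightarrow> real \<Rightarrow> real" where
  "bump_deriv j t = (if 0 < t then inverse t ^ j * exp (- inverse t) else 0)"

lemma bump_deriv_tendsto_0: "(bump_deriv j \<longlongrightarrow> 0) (at 0)"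
proof -
  have "((\<lambda>x::real. x ^ j * exp (- x)) \<longlongrightarrow> 0) at_top"
    using tendsto_power_div_exp_0[of j] by (simp only: exp_minus divide_inverse)
  then have "((\<lambda>t. inverse t ^ j * exp (- inverse t)) \<longlongrightarrow> 0) (at_right (0::real))"
    by (rule filterlim_compose[OF _ filterlim_inverse_at_top_right])
  then have "(bump_deriv j \<longlongrightarrow> 0) (at_right 0)"
    by (rule Lim_transform_eventually)
       (auto simp: bump_deriv_def eventually_at_right_less intro: eventually_mono[OF eventually_at_right_less])
  moreover have "(bump_deriv j \<longlongrightarrow> 0) (at_left 0)"
    by (rule Lim_transform_eventually[OF tendsto_const])
       (auto simp: bump_deriv_def eventually_at_filter)
  ultimately show ?thesis by (simp add: filterlim_split_at)
qed

text \<open>The derivative stays in the span of the family, so that one induction proves all members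
  smooth. At 0 the difference quotient of the member \<open>j\<close> is the member
  \<open>j + 1\<close>, which tends to 0.\<close>

lemma bump_deriv_has_derivative:
  "(bump_deriv j has_real_derivative (bump_deriv (j + 2) t - real j * bump_deriv (j + 1) t)) (at t)"
proof (cases t "0::real" rule: linorder_cases)
  case less
  have "((\<lambda>_. 0) has_real_derivative 0) (at t)" by simp
  then have "(bump_deriv j has_real_derivative 0) (at t)"
    by (rule DERIV_cong_ev[THEN iffD1, rotated -1, OF _ refl _ refl])
       (use less in \<open>auto simp: bump_deriv_def intro!: eventually_mono[OF eventually_nhds_in_open[of "{..<0}" t]]\<close>)
  then show ?thesis using less by (simp add: bump_deriv_def)
next
  case equal
  have "((\<lambda>h. (bump_deriv j (0 + h) - bump_deriv j 0) / h) \<longlongrightarrow> 0) (at 0)"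
    by (rule Lim_transform_eventually[OF bump_deriv_tendsto_0[of "Suc j"]])
       (auto simp: bump_deriv_def eventually_at_filter field_simps)
  then show ?thesis using equal by (simp add: DERIV_def bump_deriv_def)
next
  case greater
  have "((\<lambda>t. inverse t ^ j * exp (- inverse t)) has_real_derivative
      (inverse t ^ j * (exp (- inverse t) * (inverse t * inverse t)) -
       real j * (inverse t * inverse t) * inverse t ^ (j - 1) * exp (- inverse t))) (at t)"
    using greater by (auto intro!: derivative_eq_intros simp: mult_ac)
  also have "(inverse t ^ j * (exp (- inverse t) * (inverse t * inverse t)) -
       real j * (inverse t * inverse t) * inverse t ^ (j - 1) * exp (- inverse t)) =
      bump_deriv (j + 2) t - real j * bump_deriv (j + 1) t"
    using greater by (cases j) (auto simp: bump_deriv_def algebra_simps)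
  finally show ?thesis
    by (rule DERIV_cong_ev[THEN iffD1, rotated -1, OF _ refl _ refl])
       (use greater in \<open>auto simp: bump_deriv_def intro!: eventually_mono[OF eventually_nhds_in_open[of "{0<..}" t]]\<close>)
qed

lemma Ck_bump_deriv: "Ck UNIV UNIV k (bump_deriv j)"
proof (induction k arbitrary: j)
  case 0
  show ?case using DERIV_isCont[OF bump_deriv_has_derivative]
    by (auto simp: continuous_on_eq_continuous_at)
next
  case (Suc k)
  show ?case
    by (rule Ck_real_SucI[OF bump_deriv_has_derivative]) (auto intro!: Ck_diff Ck_mult Suc)
qed

lemma Ck_inverse: "Ck UNIV {0<..} k (inverse :: real \<Rightarrow> real)"
proof (induction k)
  case 0 show ?case by (auto intro!: continuous_intros)
next
  case (Suc k)
  have "Ck UNIV {0<..} k (\<lambda>t. - (inverse t * inverse t) :: real)"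
    by (intro Ck_minus Ck_mult Suc) auto
  then show ?case
    by (rule Ck_real_SucI[rotated]) (auto intro!: derivative_eq_intros)
qed

lemma Ck_powr: "Ck UNIV {0<..} k (\<lambda>t::real. t powr p)"
proof (induction k arbitrary: p)
  case 0 show ?case by (auto intro!: continuous_intros)
next
  case (Suc k)
  have "Ck UNIV {0<..} k (\<lambda>t. p * t powr (p - 1))" by (intro Ck_mult Suc) auto
  then show ?case
    by (rule Ck_real_SucI[rotated]) (auto intro!: has_real_derivative_powr)
qed

text \<open>The quotient e(t) / (e(t) + e(1 - t)), where e(t) is exp(-1/t) for positive t and 0
  otherwise. The denominator is positive because t or 1 - t is.\<close>

lemma smooth_step_exists:
  obtains s s' :: "real \<Rightarrow> real" where "\<And>k. Ck UNIV UNIV k s"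
    "\<And>t. (s has_real_derivative s' t) (at t)" "\<And>t. 0 \<le> s' t"
    "\<And>t. 0 \<le> s t" "\<And>t. s t \<le> 1" "\<And>t. t \<le> 0 \<Longrightarrow> s t = 0" "\<And>t. 1 \<le> t \<Longrightarrow> s t = 1"
    "\<And>t. t < 0 \<Longrightarrow> s' t = 0" "\<And>t. 1 < t \<Longrightarrow> s' t = 0"
proof -
  define e where "e = bump_deriv 0"
  define E where "E t = e t + e (1 - t)" for t
  define s where "s t = e t * inverse (E t)" for t
  have e0: "0 \<le> e t" for t by (simp add: e_def bump_deriv_def)
  have epos: "0 < e t \<longleftrightarrow> 0 < t" for t by (simp add: e_def bump_deriv_def)
  have Epos: "0 < E t" for t
    unfolding E_def using e0[of t] e0[of "1 - t"] epos[of t] epos[of "1 - t"] by linarith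
  have de: "(e has_real_derivative bump_deriv 2 t) (at t)" for t
    using bump_deriv_has_derivative[of 0 t] by (simp add: e_def numeral_2_eq_2)
  have de1: "((\<lambda>t. e (1 - t)) has_real_derivative - bump_deriv 2 (1 - t)) (at t)" for t
      proof -
    have "((\<lambda>t. 1 - t) has_real_derivative - 1) (at t)" by (auto intro!: derivative_eq_intros)
    from DERIV_chain2[where f = e and g = "\<lambda>t. 1 - t", OF de this] show ?thesis by simp
  qed
  define s' where "s' t = (bump_deriv 2 t * e (1 - t) + e t * bump_deriv 2 (1 - t)) / (E t)\<^sup>2" for t
  have ds: "(s has_real_derivative s' t) (at t)" for t
  proof -
    have "E t \<noteq> 0" using Epos[of t] by simp
    moreover have "(E has_real_derivative bump_deriv 2 t - bump_deriv 2 (1 - t)) (at t)"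
      using DERIV_add[OF de[of t] de1[of t]] by (simp add: E_def[abs_def])
    ultimately have "((\<lambda>t. e t / E t) has_real_derivative
       (bump_deriv 2 t * E t - e t * (bump_deriv 2 t - bump_deriv 2 (1 - t))) / (E t * E t)) (at t)"
      by (intro DERIV_divide de)
    moreover have "(bump_deriv 2 t * E t - e t * (bump_deriv 2 t - bump_deriv 2 (1 - t))) / (E t * E t) = s' t"
      by (simp add: s'_def E_def power2_eq_square algebra_simps)
    ultimately show ?thesis by (simp add: s_def[abs_def] field_simps)
  qed
  have b2: "0 \<le> bump_deriv 2 t" for t by (simp add: bump_deriv_def)
  have Cke: "Ck UNIV UNIV k e" for k unfolding e_def by (rule Ck_bump_deriv)
  have Cke1: "Ck UNIV UNIV k (\<lambda>t. e (1 - t))" for k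
    by (rule Ck_compose_real[OF _ Cke]) (auto intro!: Ck_diff)
  have "Ck UNIV UNIV k (\<lambda>t. inverse (E t))" for k
    by (rule Ck_compose_real[OF _ Ck_inverse]) (use Epos in \<open>auto simp: E_def[abs_def] intro!: Ck_add Cke Cke1\<close>)
  then have Cks: "Ck UNIV UNIV k s" for k unfolding s_def[abs_def] by (intro Ck_mult Cke) auto
  show thesis
  proof (rule that[OF Cks ds])
    fix t
    show "0 \<le> s' t" unfolding s'_def using e0 b2 by simp
    show "0 \<le> s t" using e0[of t] Epos[of t] by (simp add: s_def)
    show "s t \<le> 1" using e0[of "1 - t"] Epos[of t] by (simp add: s_def E_def field_simps)
    show "s t = 0" if "t \<le> 0" using that epos[of t] e0[of t] by (simp add: s_def)
    show "s t = 1" if "1 \<le> t"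
    proof -
      have "e (1 - t) = 0" using that epos[of "1 - t"] e0[of "1 - t"] by linarith
      then show ?thesis using Epos[of t] by (simp add: s_def E_def)
    qed
    show "s' t = 0" if "t < 0" using that by (simp add: s'_def e_def bump_deriv_def)
    show "s' t = 0" if "1 < t" using that by (simp add: s'_def e_def bump_deriv_def)
  qed
qed

lemma smooth_step_between:
  fixes a b :: real
  assumes "a < b"
  obtains s s' :: "real \<Rightarrow> real" where "\<And>k. Ck UNIV UNIV k s"
    "\<And>t. (s has_real_derivative s' t) (at t)" "\<And>t. 0 \<le> s' t"
    "\<And>t. 0 \<le> s t" "\<And>t. s t \<le> 1" "\<And>t. t \<le> a \<Longrightarrow> s t = 0" "\<And>t. b \<le> t \<Longrightarrow> s t = 1"
    "\<And>t. t < a \<Longrightarrow> s' t = 0" "\<And>t. b < t \<Longrightarrow> s' t = 0"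
proof -
  obtain s s' :: "real \<Rightarrow> real" where s: "\<And>k. Ck UNIV UNIV k s"
    "\<And>t. (s has_real_derivative s' t) (at t)" "\<And>t. 0 \<le> s' t"
    "\<And>t. 0 \<le> s t" "\<And>t. s t \<le> 1" "\<And>t. t \<le> 0 \<Longrightarrow> s t = 0" "\<And>t. 1 \<le> t \<Longrightarrow> s t = 1"
    "\<And>t. t < 0 \<Longrightarrow> s' t = 0" "\<And>t. 1 < t \<Longrightarrow> s' t = 0"
    using smooth_step_exists by metis
  show thesis
  proof (rule that[of "\<lambda>t. s ((t - a) / (b - a))" "\<lambda>t. s' ((t - a) / (b - a)) / (b - a)"])
    show "Ck UNIV UNIV k (\<lambda>t. s ((t - a) / (b - a)))" for k
    proof (rule Ck_compose_real[OF _ s(1)])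
      have "Ck UNIV UNIV k (\<lambda>t. (1 / (b - a)) * (t - a))" by (intro Ck_mult Ck_diff) auto
      then show "Ck UNIV UNIV k (\<lambda>t. (t - a) / (b - a))" by simp
    qed auto
    show "((\<lambda>t. s ((t - a) / (b - a))) has_real_derivative s' ((t - a) / (b - a)) / (b - a)) (at t)" for t
    proof -
      have "((\<lambda>t. (t - a) / (b - a)) has_real_derivative 1 / (b - a)) (at t)"
        using assms by (auto intro!: derivative_eq_intros)
      from DERIV_chain2[OF s(2) this] show ?thesis by simp
    qed
  qed (use s assms in \<open>auto simp: field_simps\<close>)
qed

lemma continuous_antiderivative:
  fixes w :: "real \<Rightarrow> real"
  assumes "continuous_on UNIV w"
  obtains F where "\<And>x. (F has_real_derivative w x) (at x)"
proof -
  have "\<exists>F. \<forall>x::real. -\<infinity> < ereal x \<longrightarrow> ereal x < \<infinity> \<longrightarrow> (F has_vector_derivative w x) (at x)"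
    by (rule einterval_antiderivative) (use assms in \<open>auto simp: continuous_on_eq_continuous_at\<close>)
  then show thesis using that by (auto simp: has_real_derivative_iff_has_vector_derivative)
qed

text \<open>The vector field \<open>\<Psi>(|x - z|\<^sup>2) (x - z)\<close> is a smooth version of the one whose radial profile is
  \<open>(max(|x - z|, a)\<^sup>-\<^sup>m - b\<^sup>-\<^sup>m)\<^sup>+\<close>; testing the first variation with it gives the monotonicity formula.\<close>

lemma radial_profile:
  fixes a a1 b1 b :: real and m :: nat
  assumes ord: "0 < a" "a < a1" "a1 < b1" "b1 < b" and m: "1 \<le> m"
  obtains \<Psi> w :: "real \<Rightarrow> real" where "\<And>k. Ck UNIV UNIV k \<Psi>"
    "\<And>t. (\<Psi> has_real_derivative - w t) (at t)" "\<And>t. 0 \<le> w t" "\<And>t. b\<^sup>2 \<le> t \<Longrightarrow> \<Psi> t = 0"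
    "\<And>t. 0 \<le> \<Psi> t" "\<And>t. \<Psi> t \<le> 2 / a ^ m"
    "\<And>t. 0 \<le> t \<Longrightarrow> 2 / a1 ^ m * (if t < a\<^sup>2 then 1 else 0) - 2 / b1 ^ m * (if t < b\<^sup>2 then 1 else 0)
      \<le> real m * \<Psi> t - 2 * t * w t"
proof -
  define p where "p = real m / 2"
  have p0: "0 < p" using m by (simp add: p_def)
  have sq: "0 < a\<^sup>2" "a\<^sup>2 < a1\<^sup>2" "a1\<^sup>2 < b1\<^sup>2" "b1\<^sup>2 < b\<^sup>2"
    using ord by (auto intro!: power_strict_mono)
  have pw: "(x\<^sup>2) powr (- p) = 1 / x ^ m" if "0 < x" for x :: real
  proof -
    have "x\<^sup>2 = x powr 2" using that by simp
    then have "(x\<^sup>2) powr (- p) = x powr (- real m)" by (simp only: powr_powr) (simp add: p_def)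
    then show ?thesis using that by (simp add: powr_minus powr_realpow inverse_eq_divide)
  qed
  obtain s1 s1' :: "real \<Rightarrow> real" where s1: "\<And>k. Ck UNIV UNIV k s1"
    "\<And>t. (s1 has_real_derivative s1' t) (at t)" "\<And>t. 0 \<le> s1' t"
    "\<And>t. 0 \<le> s1 t" "\<And>t. s1 t \<le> 1" "\<And>t. t \<le> a\<^sup>2 \<Longrightarrow> s1 t = 0" "\<And>t. a1\<^sup>2 \<le> t \<Longrightarrow> s1 t = 1"
    "\<And>t. t < a\<^sup>2 \<Longrightarrow> s1' t = 0" "\<And>t. a1\<^sup>2 < t \<Longrightarrow> s1' t = 0"
    using smooth_step_between[OF sq(2)] by metis
  obtain s2 s2' :: "real \<Rightarrow> real" where s2: "\<And>k. Ck UNIV UNIV k s2"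
    "\<And>t. (s2 has_real_derivative s2' t) (at t)" "\<And>t. 0 \<le> s2' t"
    "\<And>t. 0 \<le> s2 t" "\<And>t. s2 t \<le> 1" "\<And>t. t \<le> b1\<^sup>2 \<Longrightarrow> s2 t = 0" "\<And>t. b\<^sup>2 \<le> t \<Longrightarrow> s2 t = 1"
    "\<And>t. t < b1\<^sup>2 \<Longrightarrow> s2' t = 0" "\<And>t. b\<^sup>2 < t \<Longrightarrow> s2' t = 0"
    using smooth_step_between[OF sq(4)] by metis
  obtain s3 s3' :: "real \<Rightarrow> real" where s3: "\<And>k. Ck UNIV UNIV k s3"
    "\<And>t. (s3 has_real_derivative s3' t) (at t)" "\<And>t. 0 \<le> s3' t"
    "\<And>t. 0 \<le> s3 t" "\<And>t. s3 t \<le> 1" "\<And>t. t \<le> 0 \<Longrightarrow> s3 t = 0" "\<And>t. a\<^sup>2 \<le> t \<Longrightarrow> s3 t = 1"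
    "\<And>t. t < 0 \<Longrightarrow> s3' t = 0" "\<And>t. a\<^sup>2 < t \<Longrightarrow> s3' t = 0"
    using smooth_step_between[OF sq(1)] by metis
  \<comment> \<open>\<open>\<kappa>\<close> is a smooth cutoff, 1 between \<open>a1\<^sup>2\<close>
    and \<open>b1\<^sup>2\<close> and 0 outside the interval from \<open>a\<^sup>2\<close> to
    \<open>b\<^sup>2\<close>. The function \<open>\<sigma>\<close> equals \<open>t\<close> from
    \<open>a\<^sup>2\<close> on but is positive everywhere, which makes the power in
    \<open>w\<close> smooth on the whole line.\<close>
  define \<kappa> where "\<kappa> t = s1 t - s2 t" for t
  define \<sigma> where "\<sigma> t = 1 + s3 t * (t - 1)" for t
  define w where "w t = \<kappa> t * \<sigma> t powr (- p - 1)" for t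
  have \<kappa>: "0 \<le> \<kappa> t" "\<kappa> t \<le> 1" for t
    proof -
    have "s1 t = 1 \<or> s2 t = 0" using s1(7)[of t] s2(6)[of t] sq by linarith
    then show "0 \<le> \<kappa> t" "\<kappa> t \<le> 1" using s1(4,5)[of t] s2(4,5)[of t] by (auto simp: \<kappa>_def)
  qed
  have \<sigma>pos: "0 < \<sigma> t" for t
  proof (cases "0 < t")
    case True
    have "\<sigma> t = (1 - s3 t) + s3 t * t" by (simp add: \<sigma>_def algebra_simps)
    moreover have "0 \<le> s3 t * t" "0 < s3 t \<Longrightarrow> 0 < s3 t * t" using True s3(4)[of t] by auto
    ultimately show ?thesis using s3(4,5)[of t] by (cases "0 < s3 t") auto
  next
    case False
    then show ?thesis using s3(6)[of t] by (simp add: \<sigma>_def)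
  qed
  have \<sigma>t: "\<sigma> t = t" if "a\<^sup>2 \<le> t" for t using s3(7)[OF that] by (simp add: \<sigma>_def)
  have wt: "w t = \<kappa> t * t powr (- p - 1)" for t
  proof (cases "a\<^sup>2 \<le> t")
    case True then show ?thesis by (simp add: w_def \<sigma>t)
  next
    case False
    then have "\<kappa> t = 0" using s1(6)[of t] s2(6)[of t] sq by (simp add: \<kappa>_def)
    then show ?thesis by (simp add: w_def)
  qed
  have w0: "w t = 0" if "t \<le> a\<^sup>2 \<or> b\<^sup>2 \<le> t" for t
    using that s1(6,7)[of t] s2(6,7)[of t] sq by (auto simp: w_def \<kappa>_def)
  have wpos: "0 \<le> w t" for t using \<kappa> by (simp add: w_def)
  have Ck\<sigma>: "Ck UNIV UNIV k \<sigma>" for k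
    unfolding \<sigma>_def[abs_def] by (intro Ck_add Ck_mult Ck_diff s3) auto
  have Ckw: "Ck UNIV UNIV k w" for k
    unfolding w_def[abs_def] \<kappa>_def
    by (intro Ck_mult Ck_diff s1 s2 Ck_compose_real[OF _ Ck_powr _ Ck\<sigma>]) (use \<sigma>pos in auto)
  have "continuous_on UNIV w" using Ckw[of 0] by simp
  then obtain F where F: "\<And>x. (F has_real_derivative w x) (at x)"
    using continuous_antiderivative by metis
  \<comment> \<open>\<open>\<Psi> t\<close> is the integral of \<open>w\<close> from
    \<open>t\<close> to \<open>b\<^sup>2\<close>. Without the cutoff \<open>\<kappa>\<close> it
    would be (2/m) (|x - z|^(-m) - b^(-m)) at t = |x - z|^2, which is where the bound
    \<open>2 / a ^ m\<close> comes from.\<close>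
  define \<Psi> where "\<Psi> t = F (b\<^sup>2) - F t" for t
  have d\<Psi>: "(\<Psi> has_real_derivative - w t) (at t)" for t
    unfolding \<Psi>_def[abs_def] by (auto intro!: derivative_eq_intros F)
  have Ck\<Psi>: "Ck UNIV UNIV k \<Psi>" for k
  proof (cases k)
    case 0
    then show ?thesis using DERIV_isCont[OF d\<Psi>] by (simp add: continuous_on_eq_continuous_at)
  next
    case (Suc j)
    have "Ck UNIV UNIV (Suc j) \<Psi>"
      by (rule Ck_real_SucI[OF d\<Psi> Ck_minus[OF Ckw]]) auto
    then show ?thesis using Suc by simp
  qed
  have anti: "\<Psi> y \<le> \<Psi> x" if "x \<le> y" for x y
    by (rule DERIV_nonpos_imp_nonincreasing[OF that]) (use d\<Psi> wpos in force)
  have const: "\<Psi> x \<le> \<Psi> y" if "x \<le> y" "y \<le> a\<^sup>2 \<or> b\<^sup>2 \<le> x" for x y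
  proof (rule DERIV_nonneg_imp_nondecreasing[OF that(1)])
    fix t assume "x \<le> t" "t \<le> y"
    then have "w t = 0" using that by (intro w0) auto
    then show "\<exists>z. (\<Psi> has_real_derivative z) (at t) \<and> 0 \<le> z" using d\<Psi>[of t] by auto
  qed
  have \<Psi>b: "\<Psi> t = 0" if "b\<^sup>2 \<le> t" for t
    using anti[of "b\<^sup>2" t] const[of "b\<^sup>2" t] that by (simp add: \<Psi>_def)
  have \<Psi>0: "0 \<le> \<Psi> t" for t
    using anti[of t "max t (b\<^sup>2)"] \<Psi>b[of "max t (b\<^sup>2)"] by simp
  have \<Psi>le1: "\<Psi> t \<le> 2 / a ^ m" if "a\<^sup>2 \<le> t" for t
  proof -
    define T where "T = max t (b\<^sup>2)"
    have T: "t \<le> T" "b\<^sup>2 \<le> T" by (auto simp: T_def)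
    have "\<Psi> t - 1 / p * t powr (- p) \<le> \<Psi> T - 1 / p * T powr (- p)"
    proof (rule DERIV_nonneg_imp_nondecreasing[OF T(1)])
      fix u assume u: "t \<le> u" "u \<le> T"
      then have u0: "0 < u" using that sq by linarith
      have "((\<lambda>t. \<Psi> t - 1 / p * t powr (- p)) has_real_derivative - w u + u powr (- p - 1)) (at u)"
        using u0 p0 by (auto intro!: derivative_eq_intros d\<Psi>)
      moreover have "w u \<le> u powr (- p - 1)"
        unfolding wt using \<kappa>[of u] by (simp add: mult_left_le_one_le)
      ultimately show "\<exists>z. ((\<lambda>t. \<Psi> t - 1 / p * t powr (- p)) has_real_derivative z) (at u) \<and> 0 \<le> z"
        by (auto intro!: exI)
    qed
    then have "\<Psi> t \<le> 1 / p * t powr (- p) - 1 / p * T powr (- p)" using \<Psi>b[OF T(2)] by simp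
    also have "\<dots> \<le> 1 / p * t powr (- p)" using p0 by simp
    also have "\<dots> \<le> 2 * (a\<^sup>2) powr (- p)"
    proof (rule mult_mono)
      show "1 / p \<le> 2" using m by (simp add: p_def field_simps)
      show "t powr (- p) \<le> (a\<^sup>2) powr (- p)" using p0 that sq by (intro powr_mono2') auto
    qed auto
    finally show ?thesis using pw ord by simp
  qed
  have \<Psi>le: "\<Psi> t \<le> 2 / a ^ m" for t
    using \<Psi>le1[of "max t (a\<^sup>2)"] const[of t "a\<^sup>2"] by (cases "a\<^sup>2 \<le> t") (auto simp: max_def)
  have main: "2 / a1 ^ m * (1 - s1 t) - 2 / b1 ^ m * (1 - s2 t) \<le> real m * \<Psi> t - 2 * t * w t"
    if t: "0 < t" for t
  proof -
    \<comment> \<open>Up to a constant, \<open>J\<close> is the right side of the claim minus the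
      left side. In its derivative the terms with \<open>\<kappa>\<close> cancel because
      \<open>real m = 2 * p\<close>, and the terms with \<open>s1'\<close> and \<open>s2'\<close>
      are nonpositive on the intervals where these live. Hence \<open>J\<close> decreases to its
      value at \<open>T\<close>, where all cutoffs are complete.\<close>
    define J where "J t = real m * \<Psi> t - 2 * (\<kappa> t * t powr (- p)) + 2 / a1 ^ m * s1 t - 2 / b1 ^ m * s2 t" for t
    define T where "T = max t (b\<^sup>2)"
    have T: "t \<le> T" "b\<^sup>2 \<le> T" by (auto simp: T_def)
    have "J T \<le> J t"
    proof (rule DERIV_nonpos_imp_nonincreasing[OF T(1)])
      fix u assume u: "t \<le> u" "u \<le> T"
      have u0: "0 < u" using u t by linarith
      define J' where "J' = real m * (- w u) - 2 * ((s1' u - s2' u) * u powr (- p) + \<kappa> u * ((- p) * u powr (- p - 1)))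
        + 2 / a1 ^ m * s1' u - 2 / b1 ^ m * s2' u"
      have d\<kappa>: "(\<kappa> has_real_derivative s1' u - s2' u) (at u)"
        unfolding \<kappa>_def[abs_def] by (intro DERIV_diff s1 s2)
      have "(J has_real_derivative J') (at u)"
        unfolding J_def[abs_def] J'_def using u0 ord
        by (auto intro!: derivative_eq_intros d\<Psi> d\<kappa> s1(2) s2(2) simp: mult_ac)
      moreover have "J' = 2 * s1' u * (1 / a1 ^ m - u powr (- p)) + 2 * s2' u * (u powr (- p) - 1 / b1 ^ m)"
      proof -
        have "real m = 2 * p" by (simp add: p_def)
        then show ?thesis by (simp add: J'_def wt algebra_simps)
      qed
      moreover have "2 * s1' u * (1 / a1 ^ m - u powr (- p)) \<le> 0"
      proof (cases "u \<le> a1\<^sup>2")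
        case True
        have "(a1\<^sup>2) powr (- p) \<le> u powr (- p)" using p0 u0 True by (intro powr_mono2') auto
        then show ?thesis using s1(3)[of u] pw[of a1] ord by (intro mult_nonneg_nonpos) auto
      next
        case False then show ?thesis using s1(9)[of u] by simp
      qed
      moreover have "2 * s2' u * (u powr (- p) - 1 / b1 ^ m) \<le> 0"
      proof (cases "b1\<^sup>2 \<le> u")
        case True
        have "u powr (- p) \<le> (b1\<^sup>2) powr (- p)" using p0 sq True by (intro powr_mono2') auto
        then show ?thesis using s2(3)[of u] pw[of b1] ord by (intro mult_nonneg_nonpos) auto
      next
        case False then show ?thesis using s2(8)[of u] by simp
      qed
      ultimately show "\<exists>z. (J has_real_derivative z) (at u) \<and> z \<le> 0"
        by (auto intro!: exI[of _ J'])
    qed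
    moreover have "J T = 2 / a1 ^ m - 2 / b1 ^ m"
      using \<Psi>b[OF T(2)] s2(7)[OF T(2)] s1(7)[of T] T sq by (simp add: J_def \<kappa>_def)
    moreover have "2 * t * w t = 2 * (\<kappa> t * t powr (- p))"
    proof -
      have "t * t powr (- p - 1) = t powr (- p)" using t by (simp add: powr_diff)
      then show ?thesis by (simp add: wt)
    qed
    ultimately show ?thesis using J_def[of t] unfolding right_diff_distrib by linarith
  qed
  have main': "2 / a1 ^ m * (if t < a\<^sup>2 then 1 else 0) - 2 / b1 ^ m * (if t < b\<^sup>2 then 1 else 0)
      \<le> real m * \<Psi> t - 2 * t * w t" if t: "0 < t" for t
  proof -
    have "2 / a1 ^ m * (if t < a\<^sup>2 then 1 else 0) \<le> 2 / a1 ^ m * (1 - s1 t)"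
      using s1(5,6)[of t] ord by (intro mult_left_mono) auto
    moreover have "2 / b1 ^ m * (1 - s2 t) \<le> 2 / b1 ^ m * (if t < b\<^sup>2 then 1 else 0)"
      using s2(4)[of t] s2(7)[of t] ord by (intro mult_left_mono) auto
    ultimately show ?thesis using main[OF t] by linarith
  qed
  show thesis
  proof (rule that[OF Ck\<Psi> d\<Psi> wpos \<Psi>b \<Psi>0 \<Psi>le])
    fix t :: real assume t: "0 \<le> t"
    show "2 / a1 ^ m * (if t < a\<^sup>2 then 1 else 0) - 2 / b1 ^ m * (if t < b\<^sup>2 then 1 else 0)
      \<le> real m * \<Psi> t - 2 * t * w t"
    proof (cases "0 < t")
      case True then show ?thesis by (rule main')
    next
      case False
      then have "t = 0" using t by simp
      \<comment> \<open>\<open>main'\<close> is restricted to positive arguments. At 0 it is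
        replaced by its instance at \<open>a\<^sup>2 / 2\<close>, where \<open>w\<close> vanishes as
        it does at 0 and \<open>\<Psi>\<close> is no larger.\<close>
      have "real m * \<Psi> (a\<^sup>2 / 2) \<le> real m * \<Psi> 0"
        using anti[of 0 "a\<^sup>2 / 2"] by (intro mult_left_mono) auto
      moreover have "a\<^sup>2 / 2 < b\<^sup>2" "0 < b\<^sup>2" using sq by linarith+
      ultimately show ?thesis using main'[of "a\<^sup>2 / 2"] w0[of "a\<^sup>2 / 2"] w0[of 0] sq \<open>t = 0\<close> by auto
    qed
  qed
qed

section \<open>Smooth fields on \<open>R^n\<close>\<close>

lemma coord_scaleR [simp]: "coord (c *\<^sub>R x) i = c * coord x i"
  by (simp add: scaleR_fseq.rep_eq)

lemma coord_add [simp]: "coord (x + y) i = coord x i + coord y i"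
  by (simp add: plus_fseq.rep_eq)

lemma coord_diff [simp]: "coord (x - y) i = coord x i - coord y i"
  by (simp add: minus_fseq.rep_eq)

lemma coord_0 [simp]: "coord 0 i = 0"
  by (simp add: zero_fseq.rep_eq)

lemma coord_sum [simp]: "coord (\<Sum>i\<in>I. f i) j = (\<Sum>i\<in>I. coord (f i) j)"
  by (induction I rule: infinite_finite_induct) auto

lemma unit_vec_Rn: "i < n \<Longrightarrow> unit_vec i \<in> Rn n"
  by (auto simp: Rn_def coord_unit_vec)

lemma inner_unit_vec [simp]: "inner x (unit_vec i) = coord x i"
proof -
  have "inner (unit_vec i) x = (\<Sum>j<Suc i. coord (unit_vec i) j * coord x j)"
    by (rule inner_Rn) (simp add: unit_vec_Rn)
  also have "\<dots> = (\<Sum>j<Suc i. if j = i then coord x j else 0)"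
    by (rule sum.cong) (auto simp: coord_unit_vec)
  finally show ?thesis by (simp add: inner_commute)
qed

lemma inner_unit_vec' [simp]: "inner (unit_vec i) x = coord x i"
  by (simp add: inner_commute)

lemma Rn_expand:
  assumes x: "x \<in> Rn n"
  shows "x = (\<Sum>i<n. coord x i *\<^sub>R unit_vec i)"
proof -
  have "(\<Sum>i<n. coord x i * coord (unit_vec i) j) = coord x j" for j
  proof -
    have "(\<Sum>i<n. coord x i * coord (unit_vec i) j) = (\<Sum>i<n. if i = j then coord x i else 0)"
      by (rule sum.cong) (auto simp: coord_unit_vec)
    also have "\<dots> = coord x j" using x by (simp add: Rn_def)
    finally show ?thesis .
  qed
  then show ?thesis unfolding fseq_eq_iff coord_sum coord_scaleR by simp
qed

lemma subspace_Rn [simp]: "subspace (Rn n)"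
  by (auto simp: subspace_def Rn_def)

lemma Rn_add: "x \<in> Rn n \<Longrightarrow> y \<in> Rn n \<Longrightarrow> x + y \<in> Rn n"
  and Rn_diff: "x \<in> Rn n \<Longrightarrow> y \<in> Rn n \<Longrightarrow> x - y \<in> Rn n"
  and Rn_scaleR: "x \<in> Rn n \<Longrightarrow> c *\<^sub>R x \<in> Rn n"
  and Rn_0 [simp]: "0 \<in> Rn n"
  by (auto simp: Rn_def)

lemma Rn_sum: "(\<And>i. i \<in> I \<Longrightarrow> f i \<in> Rn n) \<Longrightarrow> (\<Sum>i\<in>I. f i) \<in> Rn n"
  by (rule subspace_sum) auto

lemma continuous_on_coord [continuous_intros]: "continuous_on A f \<Longrightarrow> continuous_on A (\<lambda>x. coord (f x) i)"
  using continuous_on_inner[OF _ continuous_on_const[of A "unit_vec i"], of f] by simp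

lemma closed_Rn: "closed (Rn n)"
proof -
  have "Rn n = (\<Inter>i\<in>{n..}. {x. coord x i = 0})" by (auto simp: Rn_def)
  then show ?thesis
    by (auto intro!: closed_INT closed_Collect_eq continuous_intros)
qed

lemma abs_coord_le: "\<bar>coord x i\<bar> \<le> norm x"
proof -
  have "norm (unit_vec i) = 1" by (simp add: norm_eq_sqrt_inner coord_unit_vec)
  then show ?thesis using Cauchy_Schwarz_ineq2[of x "unit_vec i"] by simp
qed

lemma norm_unit_vec [simp]: "norm (unit_vec i) = 1"
  by (simp add: norm_eq_sqrt_inner coord_unit_vec)

text \<open>Bounded sets with finitely many degrees of freedom: this replaces the Heine-Borel theorem,
  which fails for \<^typ>\<open>fseq\<close>.\<close>

lemma compact_zonotope:
  fixes b :: "nat \<Rightarrow> 'a::real_normed_vector"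
  shows "compact ((\<lambda>t. \<Sum>i<k. t i *\<^sub>R b i) ` {t. \<forall>i<k. \<bar>t i\<bar> \<le> (R::real)})"
proof (induction k)
  case 0
  have "(\<lambda>t. \<Sum>i<0. t i *\<^sub>R b i) ` {t. \<forall>i<0. \<bar>t i\<bar> \<le> R} \<subseteq> {0}" by auto
  then show ?case using finite_subset finite_imp_compact by blast
next
  case (Suc k)
  let ?Z = "\<lambda>k. (\<lambda>t. \<Sum>i<k. t i *\<^sub>R b i) ` {t. \<forall>i<k. \<bar>t i\<bar> \<le> R}"
  have "?Z (Suc k) = (\<lambda>(x, s). x + s *\<^sub>R b k) ` (?Z k \<times> {-R..R})"
  proof (intro equalityI subsetI)
    fix x assume "x \<in> ?Z (Suc k)"
    then obtain t where t: "\<forall>i<Suc k. \<bar>t i\<bar> \<le> R" "x = (\<Sum>i<Suc k. t i *\<^sub>R b i)" by auto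
    then have "\<bar>t k\<bar> \<le> R" by auto
    then show "x \<in> (\<lambda>(x, s). x + s *\<^sub>R b k) ` (?Z k \<times> {-R..R})"
      using t by (intro image_eqI[of _ _ "(\<Sum>i<k. t i *\<^sub>R b i, t k)"]) auto
  next
    fix x assume "x \<in> (\<lambda>(x, s). x + s *\<^sub>R b k) ` (?Z k \<times> {-R..R})"
    then obtain q where q: "x = (case q of (x, s) \<Rightarrow> x + s *\<^sub>R b k)" "q \<in> ?Z k \<times> {-R..R}" by (rule imageE)
    define s where "s = snd q"
    have "fst q \<in> ?Z k" using q(2) unfolding mem_Times_iff by (rule conjunct1)
    then obtain t where t0: "fst q = (\<Sum>i<k. t i *\<^sub>R b i)" "t \<in> {t. \<forall>i<k. \<bar>t i\<bar> \<le> R}" by (rule imageE)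
    have "s \<in> {-R..R}" using q(2) unfolding mem_Times_iff s_def by (rule conjunct2)
    then have t: "\<forall>i<k. \<bar>t i\<bar> \<le> R" "\<bar>s\<bar> \<le> R" "x = (\<Sum>i<k. t i *\<^sub>R b i) + s *\<^sub>R b k"
      using t0 q(1) by (auto simp: s_def case_prod_beta)
    have "(\<Sum>i<k. t i *\<^sub>R b i) = (\<Sum>i<k. (t(k := s)) i *\<^sub>R b i)" by (rule sum.cong) auto
    then show "x \<in> ?Z (Suc k)"
      using t by (intro image_eqI[of _ _ "t(k := s)"]) auto
  qed
  moreover have "compact ((\<lambda>(x, s). x + s *\<^sub>R b k) ` (?Z k \<times> {-R..R}))"
  proof (rule compact_continuous_image)
    show "continuous_on (?Z k \<times> {-R..R}) (\<lambda>(x, s). x + s *\<^sub>R b k)"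
      unfolding case_prod_beta by (intro continuous_intros)
    show "compact (?Z k \<times> {-R..R})" by (rule compact_Times[OF Suc compact_Icc])
  qed
  ultimately show ?case by (simp only:)
qed

lemma compact_Rn:
  assumes "closed S" "bounded S" "S \<subseteq> Rn n"
  shows "compact S"
proof -
  obtain R where R: "\<And>x. x \<in> S \<Longrightarrow> norm x \<le> R" using assms(2) by (auto simp: bounded_iff)
  let ?Z = "(\<lambda>t. \<Sum>i<n. t i *\<^sub>R unit_vec i) ` {t. \<forall>i<n. \<bar>t i\<bar> \<le> R}"
  have "S \<subseteq> ?Z"
  proof
    fix x assume x: "x \<in> S"
    then have "\<forall>i<n. \<bar>coord x i\<bar> \<le> R" using R abs_coord_le order_trans by blast
    then show "x \<in> ?Z" using Rn_expand[of x n] x assms(3) by (intro image_eqI[of _ _ "coord x"]) auto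
  qed
  then have "S \<inter> ?Z = S" by (rule Int_absorb2)
  moreover have "compact (S \<inter> ?Z)" by (rule closed_Int_compact[OF assms(1) compact_zonotope])
  ultimately show ?thesis by (simp only:)
qed

text \<open>Rational combinations of the unit vectors are dense. The covering arguments require this
  class, since the disjoint balls have to be countably many.\<close>

instance fseq :: second_countable_topology
proof
  define D where "D = (\<Union>n. (\<lambda>l. \<Sum>i<n. of_rat (l ! i) *\<^sub>R unit_vec i) ` (UNIV :: rat list set))"
  have cD: "countable D" by (auto simp: D_def)
  have dense: "\<exists>d\<in>D. dist d x < e" if e: "0 < e" for x e
  proof -
    have "finite {i. coord x i \<noteq> 0}" by simp
    then obtain n where "\<forall>i\<in>{i. coord x i \<noteq> 0}. i < n" using finite_nat_set_iff_bounded by blast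
    then have x: "x \<in> Rn n" by (fastforce simp: Rn_def)
    have "\<exists>q. \<bar>of_rat q - coord x i\<bar> < e / (real n + 1)" for i
    proof -
      have "0 < e / (real n + 1)" using e by simp
      then have "coord x i < coord x i + e / (real n + 1)" by linarith
      from of_rat_dense[OF this] obtain q where "coord x i < of_rat q" "of_rat q < coord x i + e / (real n + 1)"
        by auto
      then show ?thesis by (intro exI[of _ q]) auto
    qed
    then obtain q where q: "\<And>i. \<bar>of_rat (q i) - coord x i\<bar> < e / (real n + 1)" by metis
    define d where "d = (\<Sum>i<n. of_rat (map q [0..<n] ! i) *\<^sub>R unit_vec i)"
    have "d \<in> D" unfolding D_def d_def by blast
    moreover have "dist d x < e"
    proof -
      have "d - x = (\<Sum>i<n. (of_rat (q i) - coord x i) *\<^sub>R unit_vec i)"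
        using Rn_expand[OF x] by (simp add: d_def scaleR_diff_left sum_subtractf)
      then have "dist d x \<le> (\<Sum>i<n. norm ((of_rat (q i) - coord x i) *\<^sub>R unit_vec i))"
        unfolding dist_norm by (metis norm_sum)
      also have "\<dots> \<le> (\<Sum>i<n. e / (real n + 1))" using q by (intro sum_mono) (auto intro: less_imp_le)
      also have "\<dots> < e" using e by (simp add: field_simps)
      finally show ?thesis .
    qed
    ultimately show ?thesis by blast
  qed
  define \<B> where "\<B> = (\<lambda>(d, k). ball d (1 / real (Suc k))) ` (D \<times> UNIV)"
  have "topological_basis \<B>"
  proof (rule topological_basisI)
    show "open B" if "B \<in> \<B>" for B using that by (auto simp: \<B>_def)
    fix O' and x :: fseq assume "open O'" "x \<in> O'"
    then obtain e where e: "0 < e" "ball x e \<subseteq> O'" by (auto simp: open_contains_ball)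
    obtain k where k: "1 / real (Suc k) < e / 2" using e nat_approx_posE[of "e / 2"] by auto
    obtain d where d: "d \<in> D" "dist d x < 1 / real (Suc k)" using dense[of "1 / real (Suc k)" x] by auto
    have "ball d (1 / real (Suc k)) \<subseteq> ball x e"
    proof
      fix y assume "y \<in> ball d (1 / real (Suc k))"
      then have "dist x y < 1 / real (Suc k) + 1 / real (Suc k)"
        using d dist_triangle[of x y d] by (simp add: dist_commute)
      then have "dist x y < e" using k by linarith
      then show "y \<in> ball x e" by simp
    qed
    then show "\<exists>B'\<in>\<B>. x \<in> B' \<and> B' \<subseteq> O'"
      using d e by (intro bexI[of _ "ball d (1 / real (Suc k))"]) (auto simp: \<B>_def)
  qed
  moreover have "countable \<B>" using cD by (auto simp: \<B>_def)
  ultimately show "\<exists>B::fseq set set. countable B \<and> open = generate_topology B"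
    using topological_basis_imp_subbasis by blast
qed

text \<open>A derivative within a proper subspace is not determined as a linear map of the whole
  space, but its values on the subspace are: restrict \<open>f\<close> to the line through
  \<open>z\<close> in the direction \<open>v\<close>.\<close>

lemma has_derivative_unique_subspace:
  fixes f :: "'a::real_normed_vector \<Rightarrow> 'b::real_normed_vector"
  assumes "subspace A" "z \<in> A" "v \<in> A"
    and D: "(f has_derivative D) (at z within A)" and E: "(f has_derivative E) (at z within A)"
  shows "D v = E v"
proof -
  have *: "((\<lambda>t::real. f (z + t *\<^sub>R v)) has_vector_derivative F v) (at 0)"
    if F: "(f has_derivative F) (at z within A)" for F
  proof -
    interpret bounded_linear F using F by (rule has_derivative_bounded_linear)
    have "((\<lambda>t::real. z + t *\<^sub>R v) has_derivative (\<lambda>t. t *\<^sub>R v)) (at 0)"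
      by (auto intro!: derivative_eq_intros)
    moreover have "(\<lambda>t::real. z + t *\<^sub>R v) ` UNIV \<subseteq> A"
      using assms by (auto simp: subspace_add subspace_scale)
    moreover have "(f has_derivative F) (at (z + 0 *\<^sub>R v) within A)" using F by simp
    ultimately have "((\<lambda>t::real. f (z + t *\<^sub>R v)) has_derivative (\<lambda>t. F (t *\<^sub>R v))) (at 0)"
      using has_derivative_in_compose[of "\<lambda>t. z + t *\<^sub>R v" "\<lambda>t. t *\<^sub>R v" 0 UNIV f F]
        has_derivative_subset[of f F "z + 0 *\<^sub>R v" A "range (\<lambda>t. z + t *\<^sub>R v)"] by blast
    then show ?thesis by (simp add: has_vector_derivative_def scaleR)
  qed
  from vector_derivative_unique_at[OF *[OF D] *[OF E]] show ?thesis .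
qed

lemma Deriv_eq:
  assumes "(f has_derivative D) (at z within Rn n)" "z \<in> Rn n" "v \<in> Rn n"
  shows "Deriv n f z v = D v"
proof -
  have "(f has_derivative frechet_derivative f (at z within Rn n)) (at z within Rn n)"
    using assms(1) frechet_derivative_works by (auto simp: differentiable_def)
  then show ?thesis unfolding Deriv_def
    using has_derivative_unique_subspace[OF subspace_Rn assms(2,3) _ assms(1)] by blast
qed

lemma Ck_on_eq_Ck: "Ck_on n k W f \<longleftrightarrow> Ck (Rn n) W k f"
proof (induction k arbitrary: f)
  case 0
  show ?case by simp
next
  case (Suc k)
  show ?case unfolding Ck_on.simps Ck.simps Suc ..
qed

section \<open>Orthogonal projections and the compactness of the Grassmannian\<close>

lemma orthonormal_basis_exists:
  fixes S :: "'a::real_inner set"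
  assumes "finite B" "independent B"
  shows "\<exists>C. finite C \<and> card C = card B \<and> span C = span B \<and> (\<forall>c\<in>C. \<forall>d\<in>C. inner c d = (if c = d then 1 else 0))"
  using assms
proof (induction B)
  case empty then show ?case by auto
next
  case (insert x B)
  have "independent B" using insert.prems insert.hyps by (simp add: independent_insert)
  from insert.IH[OF this] obtain C where C: "finite C" "card C = card B" "span C = span B"
    "\<And>c d. c \<in> C \<Longrightarrow> d \<in> C \<Longrightarrow> inner c d = (if c = d then 1 else 0)"
    by blast
  have xB: "x \<notin> span B" using insert by (simp add: independent_insert)
  define y where "y = x - (\<Sum>c\<in>C. inner x c *\<^sub>R c)"
  have sC: "(\<Sum>c\<in>C. inner x c *\<^sub>R c) \<in> span C" by (intro span_sum span_scale span_base)
  have y0: "y \<noteq> 0" using xB sC C(3) by (auto simp: y_def)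
  have yc: "inner y d = 0" if d: "d \<in> C" for d
  proof -
    have "(\<Sum>c\<in>C. inner x c * inner c d) = (\<Sum>c\<in>C. if c = d then inner x c else 0)"
      by (rule sum.cong) (auto simp: C(4) d)
    then show ?thesis using C(1) d by (simp add: y_def inner_diff_left inner_sum_left)
  qed
  define u where "u = y /\<^sub>R norm y"
  have uu: "inner u u = 1" using y0 by (simp add: u_def dot_square_norm power2_eq_square)
  have uc: "inner u c = 0" "inner c u = 0" if "c \<in> C" for c
    using yc[OF that] by (auto simp: u_def inner_commute)
  have uC: "u \<notin> C" using uc[of u] uu by auto
  have "span (insert u C) = span (insert x B)"
  proof -
    have "u \<in> span (insert x B)"
    proof -
      have "x \<in> span (insert x B)" by (rule span_base) simp
      moreover have "(\<Sum>c\<in>C. inner x c *\<^sub>R c) \<in> span (insert x B)"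
        using sC C(3) span_mono[OF subset_insertI[of B x]] by blast
      ultimately show ?thesis unfolding u_def y_def by (intro span_scale span_diff)
    qed
    moreover have "x \<in> span (insert u C)"
    proof -
      have "x = norm y *\<^sub>R u + (\<Sum>c\<in>C. inner x c *\<^sub>R c)" using y0 by (simp add: u_def y_def)
      moreover have "norm y *\<^sub>R u \<in> span (insert u C)" by (intro span_scale span_base) auto
      moreover have "(\<Sum>c\<in>C. inner x c *\<^sub>R c) \<in> span (insert u C)"
        by (intro span_sum span_scale span_base) auto
      ultimately show ?thesis by (metis span_add)
    qed
    moreover have "C \<subseteq> span (insert x B)"
      using C(3) span_superset[of C] span_mono[OF subset_insertI[of B x]] by blast
    moreover have "B \<subseteq> span (insert u C)"
      using C(3) span_superset[of B] span_mono[OF subset_insertI[of C u]] by blast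
    ultimately show ?thesis by (auto simp: span_eq)
  qed
  moreover have "card (insert u C) = card (insert x B)" using C(1,2) uC insert.hyps by simp
  moreover have "inner c d = (if c = d then 1 else 0)" if "c \<in> insert u C" "d \<in> insert u C" for c d
  proof (cases "c = u")
    case True
    then show ?thesis using uu uc that(2) by (cases "d = u") auto
  next
    case False
    then show ?thesis using C(4) uc uC that by (cases "d = u") auto
  qed
  ultimately show ?case using C(1) by (intro exI[of _ "insert u C"] conjI ballI) simp_all
qed

lemma Gr_orthonormal_basis:
  assumes "S \<in> Gr n m"
  obtains C where "finite C" "card C = m" "span C = S" "C \<subseteq> S"
    "\<And>c d. c \<in> C \<Longrightarrow> d \<in> C \<Longrightarrow> inner c d = (if c = d then 1 else 0)"
proof -
  have S: "subspace S" "S \<subseteq> Rn n" "dim S = m" using assms by (auto simp: Gr_def)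
  obtain B where B: "B \<subseteq> S" "independent B" "S \<subseteq> span B" "card B = dim S" using basis_exists by blast
  have "Rn n \<subseteq> span (unit_vec ` {..<n})"
  proof
    fix x assume "x \<in> Rn n"
    from Rn_expand[OF this] show "x \<in> span (unit_vec ` {..<n})"
      by (metis (no_types, lifting) image_eqI span_base span_scale span_sum)
  qed
  then have "finite B" using B S independent_span_bound[of "unit_vec ` {..<n}" B] by auto
  then obtain C where C: "finite C" "card C = card B" "span C = span B"
    "\<And>c d. c \<in> C \<Longrightarrow> d \<in> C \<Longrightarrow> inner c d = (if c = d then 1 else 0)"
    using orthonormal_basis_exists[OF _ B(2)] by metis
  have "span B = S" using B S span_minimal[of B S] by auto
  then show thesis using that[of C] C B S span_superset[of C] by auto
qed

lemma orth_proj_eqI: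
  assumes "subspace S" "y \<in> S" "\<And>v. v \<in> S \<Longrightarrow> inner (x - y) v = 0"
  shows "orth_proj S x = y"
  unfolding orth_proj_def
proof (rule the_equality)
  show "y \<in> S \<and> (\<forall>v\<in>S. inner (x - y) v = 0)" using assms by auto
  fix w assume w: "w \<in> S \<and> (\<forall>v\<in>S. inner (x - w) v = 0)"
  have "w - y \<in> S" using w assms by (auto intro: subspace_diff)
  then have "inner (x - y) (w - y) - inner (x - w) (w - y) = 0" using w assms by auto
  then have "inner (w - y) (w - y) = 0" by (simp add: inner_diff_left)
  then show "w = y" by simp
qed

lemma orth_proj_basis:
  assumes "finite C" "span C = S"
    "\<And>c d. c \<in> C \<Longrightarrow> d \<in> C \<Longrightarrow> inner c d = (if c = d then 1 else 0)"
  shows "orth_proj S x = (\<Sum>c\<in>C. inner x c *\<^sub>R c)"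
proof (rule orth_proj_eqI)
  show "subspace S" using assms(2) by auto
  show "(\<Sum>c\<in>C. inner x c *\<^sub>R c) \<in> S" unfolding assms(2)[symmetric] by (intro span_sum span_scale span_base)
  fix v assume "v \<in> S"
  then have "v \<in> span C" using assms(2) by simp
  then show "inner (x - (\<Sum>c\<in>C. inner x c *\<^sub>R c)) v = 0"
  proof (induction rule: span_induct_alt)
    case base then show ?case by simp
  next
    case (step t d y)
    have "(\<Sum>c\<in>C. inner x c * inner c d) = (\<Sum>c\<in>C. if c = d then inner x c else 0)"
      by (rule sum.cong) (auto simp: assms(3) step)
    also have "\<dots> = inner x d" using assms(1) step by simp
    finally have "inner (x - (\<Sum>c\<in>C. inner x c *\<^sub>R c)) d = 0"
      by (simp add: inner_diff_left inner_sum_left)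
    then show ?case using step by (simp add: inner_add_right)
  qed
qed

lemma bounded_linear_orth_proj:
  assumes "S \<in> Gr n m" shows "bounded_linear (orth_proj S)"
proof -
  obtain C where C: "finite C" "card C = m" "span C = S" "C \<subseteq> S"
    "\<And>c d. c \<in> C \<Longrightarrow> d \<in> C \<Longrightarrow> inner c d = (if c = d then 1 else 0)"
    using Gr_orthonormal_basis[OF assms] by blast
  have "orth_proj S = (\<lambda>x. \<Sum>c\<in>C. inner x c *\<^sub>R c)" using orth_proj_basis[OF C(1,3,5)] by auto
  then show ?thesis
    by (auto intro!: bounded_linear_sum bounded_linear_scaleR_const bounded_linear_inner_left)
qed

lemma orth_proj_props:
  assumes "S \<in> Gr n m"
  shows "orth_proj S x \<in> S" "orth_proj S (orth_proj S x) = orth_proj S x"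
    "inner (orth_proj S x) y = inner x (orth_proj S y)"
    "0 \<le> inner x (orth_proj S x)" "inner x (orth_proj S x) \<le> inner x x" "norm (orth_proj S x) \<le> norm x"
    "(\<Sum>i<n. coord (orth_proj S (unit_vec i)) i) = real m"
proof -
  obtain C where C: "finite C" "card C = m" "span C = S" "C \<subseteq> S"
    "\<And>c d. c \<in> C \<Longrightarrow> d \<in> C \<Longrightarrow> inner c d = (if c = d then 1 else 0)"
    using Gr_orthonormal_basis[OF assms] by blast
  have eq: "orth_proj S x = (\<Sum>c\<in>C. inner x c *\<^sub>R c)" for x using orth_proj_basis[OF C(1,3,5)] by auto
  have S: "subspace S" "S \<subseteq> Rn n" using assms by (auto simp: Gr_def)
  show in_S: "orth_proj S x \<in> S" for x
    unfolding eq using S C(4) by (intro subspace_sum subspace_scale) auto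
  show idem: "orth_proj S (orth_proj S x) = orth_proj S x" for x
    by (rule orth_proj_eqI) (use S in_S in auto)
  show sym: "inner (orth_proj S x) y = inner x (orth_proj S y)" for x y
    unfolding eq by (simp add: inner_sum_left inner_sum_right mult_ac inner_commute)
  show pos: "0 \<le> inner x (orth_proj S x)" for x
  proof -
    have "inner x (orth_proj S x) = inner (orth_proj S x) (orth_proj S x)" using sym idem by metis
    then show ?thesis by simp
  qed
  have "0 \<le> inner (x - orth_proj S x) (x - orth_proj S x)" by simp
  also have "\<dots> = inner x x - inner x (orth_proj S x)"
    using sym[of x x] sym[of x "orth_proj S x"] idem[of x] by (simp add: inner_diff_left inner_diff_right)
  finally show le: "inner x (orth_proj S x) \<le> inner x x" by simp
  have "inner (orth_proj S x) (orth_proj S x) \<le> inner x x"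
    using le sym[of x "orth_proj S x"] idem[of x] by simp
  then show "norm (orth_proj S x) \<le> norm x" by (simp add: norm_eq_sqrt_inner)
  have "(\<Sum>i<n. coord (orth_proj S (unit_vec i)) i) = (\<Sum>i<n. \<Sum>c\<in>C. coord c i * coord c i)"
    by (simp add: eq)
  also have "\<dots> = (\<Sum>c\<in>C. \<Sum>i<n. coord c i * coord c i)" by (rule sum.swap)
  also have "\<dots> = (\<Sum>c\<in>C. inner c c)"
    by (rule sum.cong) (use C(4) S inner_Rn in auto)
  also have "\<dots> = real m" using C by simp
  finally show "(\<Sum>i<n. coord (orth_proj S (unit_vec i)) i) = real m" .
qed

lemma compact_space_pullback_topology:
  assumes "compactin T (f ` A)"
  shows "compact_space (pullback_topology A f T)"
  unfolding compact_space_def compactin_def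
proof (intro conjI allI impI)
  let ?P = "pullback_topology A f T"
  have top: "topspace ?P = A"
    using compactin_subset_topspace[OF assms] by (auto simp: topspace_pullback_topology)
  fix \<U> assume \<U>: "(\<forall>U\<in>\<U>. openin ?P U) \<and> topspace ?P \<subseteq> \<Union>\<U>"
  then have "\<forall>U\<in>\<U>. \<exists>W. openin T W \<and> U = f -` W \<inter> A" by (auto simp: openin_pullback_topology)
  then obtain W where W: "\<And>U. U \<in> \<U> \<Longrightarrow> openin T (W U) \<and> U = f -` W U \<inter> A" by metis
  have "f ` A \<subseteq> \<Union>(W ` \<U>)"
  proof
    fix y assume "y \<in> f ` A"
    then obtain x where x: "x \<in> A" "y = f x" by auto
    then obtain U where "U \<in> \<U>" "x \<in> U" using \<U> top by auto
    then show "y \<in> \<Union>(W ` \<U>)" using W[of U] x by auto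
  qed
  then obtain \<F> where F: "finite \<F>" "\<F> \<subseteq> W ` \<U>" "f ` A \<subseteq> \<Union>\<F>"
    using assms W unfolding compactin_def by (metis (no_types, lifting) imageE)
  then obtain \<G> where G: "\<G> \<subseteq> \<U>" "finite \<G>" "\<F> = W ` \<G>" using finite_subset_image by metis
  have "topspace ?P \<subseteq> \<Union>\<G>"
  proof
    fix x assume x: "x \<in> topspace ?P"
    then obtain U where "U \<in> \<G>" "f x \<in> W U" using F(3) G(3) top by auto
    then show "x \<in> \<Union>\<G>" using W[of U] G(1) x top by auto
  qed
  then show "\<exists>\<F>. finite \<F> \<and> \<F> \<subseteq> \<U> \<and> topspace ?P \<subseteq> \<Union>\<F>" using G by auto
qed auto

text \<open>The matrix units. Projections of \<open>Rn n\<close> are combinations of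
  \<open>n * n\<close> of them with coefficients in a bounded interval, hence lie in a compact
  zonotope.\<close>

definition coord_map :: "nat \<Rightarrow> nat \<Rightarrow> fseq \<Rightarrow>\<^sub>L fseq" where
  "coord_map i j = Blinfun (\<lambda>x. coord x j *\<^sub>R unit_vec i)"

lemma coord_map_apply: "blinfun_apply (coord_map i j) x = coord x j *\<^sub>R unit_vec i"
proof -
  have "bounded_linear (\<lambda>x. inner x (unit_vec j) *\<^sub>R unit_vec i)"
    by (intro bounded_linear_scaleR_const bounded_linear_inner_left)
  then show ?thesis unfolding coord_map_def by (subst bounded_linear_Blinfun_apply) auto
qed

text \<open>\<open>compact_zonotope\<close> indexes its generators by an initial segment of the
  natural numbers; this unfolds such an index into row and column.\<close>

lemma sum_div_mod:
  fixes f :: "nat \<Rightarrow> nat \<Rightarrow> 'a::comm_monoid_add"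
  shows "(\<Sum>l<n*n. f (l div n) (l mod n)) = (\<Sum>i<n. \<Sum>j<n. f i j)"
  unfolding sum.cartesian_product
proof (rule sum.reindex_bij_witness[where i = "\<lambda>(i, j). i * n + j" and j = "\<lambda>l. (l div n, l mod n)"])
  fix l assume l: "l \<in> {..<n*n}"
  then have "0 < n" by (cases n) auto
  then show "(l div n, l mod n) \<in> {..<n} \<times> {..<n}" using l by (auto simp: less_mult_imp_div_less)
next
  fix p assume "p \<in> {..<n} \<times> {..<n}"
  then obtain i j where p: "p = (i, j)" "i < n" "j < n" by auto
  have "i * n + j < (i + 1) * n" using p by simp
  also have "\<dots> \<le> n * n" using p by (intro mult_right_mono) auto
  finally show "(case p of (i, j) \<Rightarrow> i * n + j) \<in> {..<n*n}" using p by simp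
  show "((case p of (i, j) \<Rightarrow> i * n + j) div n, (case p of (i, j) \<Rightarrow> i * n + j) mod n) = p" using p by simp
qed auto

text \<open>The projections are the symmetric idempotents of trace m among the matrices with entries
  between -1 and 1. These are equations between continuous functions of the map, hence closed
  conditions. The trace stands in for the dimension of the range because it is continuous.\<close>

lemma compact_projections: "compact ((\<lambda>S. Blinfun (orth_proj S)) ` Gr n m)"
proof -
  define b where "b l = coord_map (l div n) (l mod n)" for l
  define Z where "Z = (\<lambda>t. \<Sum>l<n*n. t l *\<^sub>R b l) ` {t. \<forall>l<n*n. \<bar>t l\<bar> \<le> (1::real)}"
  define P where "P = {A :: fseq \<Rightarrow>\<^sub>L fseq. (\<forall>x. A (A x) = A x) \<and> (\<forall>x y. inner (A x) y = inner x (A y)) \<and>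
      (\<Sum>i<n. coord (A (unit_vec i)) i) = real m}"
  have "compact Z" unfolding Z_def by (rule compact_zonotope)
  moreover have "closed P"
  proof -
    have P: "P = (\<Inter>x. {A. blinfun_apply A (blinfun_apply A x) = blinfun_apply A x}) \<inter>
      (\<Inter>x. \<Inter>y. {A. inner (blinfun_apply A x) y = inner x (blinfun_apply A y)}) \<inter>
      {A. (\<Sum>i<n. coord (blinfun_apply A (unit_vec i)) i) = real m}"
      by (auto simp: P_def)
    show ?thesis unfolding P
      by (intro closed_Int closed_INT ballI closed_Collect_eq continuous_intros)
  qed
  ultimately have "compact (P \<inter> Z)" by (rule closed_Int_compact[rotated])
  moreover have "(\<lambda>S. Blinfun (orth_proj S)) ` Gr n m = P \<inter> Z"
  proof (intro equalityI subsetI)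
    fix A assume "A \<in> (\<lambda>S. Blinfun (orth_proj S)) ` Gr n m"
    then obtain S where S: "S \<in> Gr n m" and A: "A = Blinfun (orth_proj S)" by auto
    have Ax: "blinfun_apply A = orth_proj S"
      unfolding A by (rule bounded_linear_Blinfun_apply[OF bounded_linear_orth_proj[OF S]])
    have "A \<in> P" using orth_proj_props[OF S] by (auto simp: P_def Ax)
    moreover have "A \<in> Z"
    proof -
      obtain C where C: "finite C" "card C = m" "span C = S" "C \<subseteq> S"
        "\<And>c d. c \<in> C \<Longrightarrow> d \<in> C \<Longrightarrow> inner c d = (if c = d then 1 else 0)"
        using Gr_orthonormal_basis[OF S] by blast
      have CR: "c \<in> Rn n" if "c \<in> C" for c using C S that by (auto simp: Gr_def)
      have eq: "orth_proj S x = (\<Sum>c\<in>C. inner x c *\<^sub>R c)" for x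
        by (rule orth_proj_basis) (use C in auto)
      define t where "t l = coord (orth_proj S (unit_vec (l mod n))) (l div n)" for l
      have t1: "\<bar>t l\<bar> \<le> 1" for l
        using abs_coord_le[of "orth_proj S (unit_vec (l mod n))" "l div n"]
          orth_proj_props(6)[OF S, of "unit_vec (l mod n)"] by (simp add: t_def)
      have "A = (\<Sum>l<n*n. t l *\<^sub>R b l)"
      proof (rule blinfun_eqI)
        fix x
        define T where "T i j = coord (orth_proj S (unit_vec j)) i * coord x j" for i j
        have T: "T i j = (\<Sum>c\<in>C. coord c i * (coord c j * coord x j))" for i j
          unfolding T_def eq by (simp add: sum_distrib_left sum_distrib_right mult_ac)
        have "blinfun_apply (\<Sum>l<n*n. t l *\<^sub>R b l) x = (\<Sum>l<n*n. T (l div n) (l mod n) *\<^sub>R unit_vec (l div n))"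
          unfolding blinfun.sum_left blinfun.scaleR_left b_def coord_map_apply t_def T_def scaleR_scaleR ..
        also have "\<dots> = (\<Sum>i<n. \<Sum>j<n. T i j *\<^sub>R unit_vec i)"
          by (rule sum_div_mod)
        also have "\<dots> = (\<Sum>i<n. \<Sum>c\<in>C. (coord c i * inner x c) *\<^sub>R unit_vec i)"
        proof (rule sum.cong[OF refl])
          fix i
          have "(\<Sum>j<n. T i j) = (\<Sum>c\<in>C. coord c i * inner x c)"
          proof -
            have "(\<Sum>j<n. T i j) = (\<Sum>c\<in>C. coord c i * (\<Sum>j<n. coord c j * coord x j))"
              unfolding T sum_distrib_left by (rule sum.swap)
            then show ?thesis using inner_Rn[OF CR] by (simp add: inner_commute)
          qed
          then show "(\<Sum>j<n. T i j *\<^sub>R unit_vec i) = (\<Sum>c\<in>C. (coord c i * inner x c) *\<^sub>R unit_vec i)"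
            by (simp only: scaleR_left.sum[symmetric])
        qed
        also have "\<dots> = (\<Sum>c\<in>C. \<Sum>i<n. (coord c i * inner x c) *\<^sub>R unit_vec i)" by (rule sum.swap)
        also have "\<dots> = (\<Sum>c\<in>C. inner x c *\<^sub>R c)"
        proof (rule sum.cong[OF refl])
          fix c assume c: "c \<in> C"
          have "inner x c *\<^sub>R c = inner x c *\<^sub>R (\<Sum>i<n. coord c i *\<^sub>R unit_vec i)" using Rn_expand[OF CR[OF c]] by simp
          then show "(\<Sum>i<n. (coord c i * inner x c) *\<^sub>R unit_vec i) = inner x c *\<^sub>R c"
            by (simp add: scaleR_sum_right mult.commute)
        qed
        finally show "blinfun_apply A x = blinfun_apply (\<Sum>l<n*n. t l *\<^sub>R b l) x"
          by (simp only: Ax eq)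
      qed
      then show ?thesis unfolding Z_def using t1 by (intro image_eqI[of _ _ t]) auto
    qed
    ultimately show "A \<in> P \<inter> Z" by auto
  next
    fix A assume A: "A \<in> P \<inter> Z"
    then have idem: "\<And>x. A (A x) = A x" and sym: "\<And>x y. inner (A x) y = inner x (A y)"
      and tr: "(\<Sum>i<n. coord (A (unit_vec i)) i) = real m" by (auto simp: P_def)
    define S where "S = range (blinfun_apply A)"
    have sub: "subspace S"
      unfolding S_def using linear_subspace_image[OF bounded_linear.linear[OF blinfun.bounded_linear_right] subspace_UNIV] by metis
    have "blinfun_apply A x \<in> Rn n" for x
    proof -
      obtain t where "A = (\<Sum>l<n*n. t l *\<^sub>R b l)" using A by (auto simp: Z_def)
      then have "blinfun_apply A x = (\<Sum>l<n*n. t l *\<^sub>R coord x (l mod n) *\<^sub>R unit_vec (l div n))"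
        by (simp add: blinfun.sum_left blinfun.scaleR_left b_def coord_map_apply)
      then show ?thesis
        by (auto intro!: Rn_sum Rn_scaleR unit_vec_Rn simp: less_mult_imp_div_less)
    qed
    then have SR: "S \<subseteq> Rn n" by (auto simp: S_def)
    have proj: "orth_proj S x = blinfun_apply A x" for x
    proof (rule orth_proj_eqI[OF sub])
      show "blinfun_apply A x \<in> S" by (auto simp: S_def)
      fix v assume "v \<in> S"
      then obtain u where "v = blinfun_apply A u" by (auto simp: S_def)
      then show "inner (x - blinfun_apply A x) v = 0"
        using sym[of "x - blinfun_apply A x" u] by (simp add: blinfun.diff_right idem)
    qed
    have Sd: "S \<in> Gr n (dim S)" using sub SR by (auto simp: Gr_def)
    have "real (dim S) = real m" using orth_proj_props(7)[OF Sd] tr by (simp add: proj)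
    then have "S \<in> Gr n m" using Sd by simp
    moreover have "A = Blinfun (orth_proj S)"
      using proj by (metis blinfun_apply_inverse ext)
    ultimately show "A \<in> (\<lambda>S. Blinfun (orth_proj S)) ` Gr n m" by auto
  qed
  ultimately show ?thesis by simp
qed

lemma topspace_Gr [simp]: "topspace (Gr_top n m) = Gr n m"
  by (simp add: Gr_top_def topspace_pullback_topology)

text \<open>Compactness of the fibres is used twice: a cylinder over a compact set is compact, hence
  of finite mass, and the projection to the base is a closed map.\<close>

lemma compact_space_Gr: "compact_space (Gr_top n m)"
  unfolding Gr_top_def by (rule compact_space_pullback_topology) (simp add: compact_projections)

lemma continuous_map_orth_proj: "continuous_map (Gr_top n m) euclidean (\<lambda>S. orth_proj S x)"
proof -
  have "continuous_map (Gr_top n m) euclidean ((\<lambda>A. blinfun_apply A x) \<circ> (\<lambda>S. Blinfun (orth_proj S)))"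
    unfolding Gr_top_def
    by (rule continuous_map_pullback)
       (simp add: linear_continuous_on[OF blinfun.bounded_linear_left])
  then show ?thesis
    by (rule continuous_map_eq) (simp add: bounded_linear_Blinfun_apply bounded_linear_orth_proj)
qed

section \<open>The variation measure of a distribution\<close>

lemma openin_Rn_borel: "openin (Rn_top n) W \<Longrightarrow> W \<in> sets borel"
  using closed_Rn by (auto simp: openin_open)

lemma sets_borel_of_top_of_set:
  assumes "U \<in> sets borel"
  shows "sets (borel_of (top_of_set U)) = {A \<in> sets borel. A \<subseteq> U}"
proof -
  have *: "{C. openin (top_of_set U) C} = (\<inter>) U ` {T. open T}" by (auto simp: openin_open)
  have "sets (borel_of (top_of_set U)) = sigma_sets U {C. openin (top_of_set U) C}"
    unfolding borel_of_def by (subst sets_measure_of) (auto dest: openin_imp_subset)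
  also have "\<dots> = (\<inter>) U ` sigma_sets UNIV {T. open T}"
    unfolding * by (rule sigma_sets_Int[symmetric]) (use assms in \<open>auto simp: borel_def\<close>)
  also have "sigma_sets UNIV {T. open T} = sets (borel :: 'a measure)" by (simp add: borel_def)
  also have "(\<inter>) U ` sets borel = {A \<in> sets borel. A \<subseteq> U}"
    using assms by (auto intro!: image_eqI[of _ "(\<inter>) U"])
  finally show ?thesis .
qed

lemma space_borel_of [simp]: "space (borel_of X) = topspace X"
  unfolding borel_of_def by (rule space_measure_of) (auto dest: openin_subset)

text \<open>Finitely many radial bumps, each equal to 1 near a point of \<open>K\<close>, are
  combined into one minus the product of their complements. That \<open>\<zeta>\<close> is 1 on an
  open set, and not on \<open>K\<close> alone, keeps the support of \<open>1 - \<zeta>\<close> times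
  a field away from \<open>K\<close>.\<close>

lemma smooth_urysohn:
  assumes C: "openin (Rn_top n) C" and K: "compact K" "K \<subseteq> C"
  obtains \<zeta> :: "fseq \<Rightarrow> real" and L N where "\<And>k. Ck (Rn n) (Rn n) k \<zeta>" "\<And>x. 0 \<le> \<zeta> x" "\<And>x. \<zeta> x \<le> 1"
    "openin (Rn_top n) N" "K \<subseteq> N" "\<And>x. x \<in> N \<Longrightarrow> \<zeta> x = 1"
    "compact L" "L \<subseteq> C" "\<And>x. x \<notin> L \<Longrightarrow> \<zeta> x = 0"
proof -
  obtain T where T: "open T" "C = Rn n \<inter> T" using C by (auto simp: openin_open)
  have "\<exists>e>0. cball x (2 * e) \<subseteq> T" if "x \<in> K" for x
  proof -
    have "x \<in> T" using that K T by auto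
    then obtain e where "0 < e" "cball x e \<subseteq> T" using T(1) open_contains_cball by blast
    then show ?thesis by (intro exI[of _ "e / 2"]) auto
  qed
  then obtain e where e: "\<And>x. x \<in> K \<Longrightarrow> 0 < e x \<and> cball x (2 * e x) \<subseteq> T" by metis
  have "\<exists>b::fseq \<Rightarrow> real. (\<forall>k. Ck (Rn n) (Rn n) k b) \<and> (\<forall>y. 0 \<le> b y \<and> b y \<le> 1) \<and>
      (\<forall>y\<in>Rn n \<inter> ball x (e x). b y = 1) \<and> (\<forall>y. y \<notin> cball x (2 * e x) \<inter> Rn n \<longrightarrow> b y = 0)"
    if x: "x \<in> K" for x
  proof -
    have ex: "0 < e x" using e[OF x] by simp
    then have "(e x)\<^sup>2 < (2 * e x)\<^sup>2" by (intro power_strict_mono) auto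
    then obtain s s' :: "real \<Rightarrow> real" where s: "\<And>k. Ck UNIV UNIV k s"
      "\<And>t. (s has_real_derivative s' t) (at t)" "\<And>t. 0 \<le> s' t"
      "\<And>t. 0 \<le> s t" "\<And>t. s t \<le> 1" "\<And>t. t \<le> (e x)\<^sup>2 \<Longrightarrow> s t = 0" "\<And>t. (2 * e x)\<^sup>2 \<le> t \<Longrightarrow> s t = 1"
      "\<And>t. t < (e x)\<^sup>2 \<Longrightarrow> s' t = 0" "\<And>t. (2 * e x)\<^sup>2 < t \<Longrightarrow> s' t = 0"
      by (rule smooth_step_between) blast
    \<comment> \<open>Cutting to 0 off \<open>Rn n\<close> makes \<open>\<zeta>\<close> vanish
      outside a compact set of the whole space; smoothness within \<open>Rn n\<close> does not see
      this.\<close>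
    define b where "b y = (if y \<in> Rn n then 1 - s (inner (y - x) (y - x)) else 0)" for y
    have "Ck (Rn n) (Rn n) k (\<lambda>y. 1 - s (inner (y - x) (y - x)))" for k
      by (intro Ck_diff Ck_const Ck_compose_real[OF _ s(1)] Ck_inner Ck_id) auto
    then have "Ck (Rn n) (Rn n) k b" for k
      by (rule Ck_cong[rotated 2]) (auto simp: b_def)
    moreover have "0 \<le> b y \<and> b y \<le> 1" for y using s(4,5) by (auto simp: b_def)
    moreover have "b y = 1" if "y \<in> Rn n \<inter> ball x (e x)" for y
    proof -
      have "norm (y - x) \<le> e x" using that by (simp add: dist_norm norm_minus_commute)
      then have "inner (y - x) (y - x) \<le> (e x)\<^sup>2" by (simp add: dot_square_norm power_mono)
      then show ?thesis using that s(6) by (simp add: b_def)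
    qed
    moreover have "b y = 0" if "y \<notin> cball x (2 * e x) \<inter> Rn n" for y
    proof (cases "y \<in> Rn n")
      case True
      then have "2 * e x \<le> norm (y - x)" using that by (simp add: dist_norm norm_minus_commute)
      then have "(2 * e x)\<^sup>2 \<le> inner (y - x) (y - x)" using ex by (simp only: dot_square_norm) (intro power_mono, auto)
      then show ?thesis using s(7) by (simp add: b_def)
    qed (simp add: b_def)
    ultimately show ?thesis by blast
  qed
  then obtain b :: "fseq \<Rightarrow> fseq \<Rightarrow> real" where b: "\<And>x k. x \<in> K \<Longrightarrow> Ck (Rn n) (Rn n) k (b x)"
    "\<And>x y. x \<in> K \<Longrightarrow> 0 \<le> b x y \<and> b x y \<le> 1"
    "\<And>x y. x \<in> K \<Longrightarrow> y \<in> Rn n \<inter> ball x (e x) \<Longrightarrow> b x y = 1"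
    "\<And>x y. x \<in> K \<Longrightarrow> y \<notin> cball x (2 * e x) \<inter> Rn n \<Longrightarrow> b x y = 0"
    by metis
  have "K \<subseteq> (\<Union>x\<in>K. ball x (e x))" using e by auto
  then obtain F where F: "F \<subseteq> K" "finite F" "K \<subseteq> (\<Union>x\<in>F. ball x (e x))"
    using compactE_image[OF K(1), of K "\<lambda>x. ball x (e x)"] by auto
  define \<zeta> where "\<zeta> y = 1 - (\<Prod>x\<in>F. 1 - b x y)" for y
  show thesis
  proof (rule that)
    show "Ck (Rn n) (Rn n) k \<zeta>" for k
    proof -
      have ck: "Ck (Rn n) (Rn n) k (\<lambda>y. 1 - b x y)" if "x \<in> F" for x
        using that F(1) by (intro Ck_diff Ck_const b(1)) auto
      show ?thesis unfolding \<zeta>_def[abs_def] by (rule Ck_diff[OF Ck_const Ck_prod]) (use ck in auto)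
    qed
    have bF: "0 \<le> 1 - b x y" "1 - b x y \<le> 1" if "x \<in> F" for x y
      using b(2)[of x y] F(1) that by auto
    have "0 \<le> (\<Prod>x\<in>F. 1 - b x y)" "(\<Prod>x\<in>F. 1 - b x y) \<le> 1" for y
      using bF by (simp_all add: prod_nonneg prod_le_1)
    then show "0 \<le> \<zeta> y" "\<zeta> y \<le> 1" for y by (simp_all add: \<zeta>_def)
    show "openin (Rn_top n) (Rn n \<inter> (\<Union>x\<in>F. ball x (e x)))" by (simp add: openin_open_Int open_UN)
    show "K \<subseteq> Rn n \<inter> (\<Union>x\<in>F. ball x (e x))" using F K T by auto
    show "\<zeta> y = 1" if y: "y \<in> Rn n \<inter> (\<Union>x\<in>F. ball x (e x))" for y
    proof -
      obtain x where "x \<in> F" "y \<in> Rn n \<inter> ball x (e x)" using y by auto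
      then have "b x y = 1" using b(3)[of x y] F by auto
      then have "(\<Prod>x\<in>F. 1 - b x y) = 0" using F \<open>x \<in> F\<close> by (auto simp: prod_zero_iff)
      then show ?thesis by (simp add: \<zeta>_def)
    qed
    show "compact (\<Union>x\<in>F. cball x (2 * e x) \<inter> Rn n)"
      using F by (intro compact_UN compact_Rn closed_Int closed_Rn) auto
    show "(\<Union>x\<in>F. cball x (2 * e x) \<inter> Rn n) \<subseteq> C" using F e T by auto
    show "\<zeta> y = 0" if "y \<notin> (\<Union>x\<in>F. cball x (2 * e x) \<inter> Rn n)" for y
      using that b(4) F by (auto simp: \<zeta>_def subset_iff)
  qed
qed

section \<open>Algebra and splitting of test fields\<close>

lemma Cc_inftyD:
  assumes "\<theta> \<in> Cc_infty n W"
  shows "Ck (Rn n) W k \<theta>" "\<theta> x \<in> Rn n" "compact (spt \<theta>)" "spt \<theta> \<subseteq> W"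
  using assms by (auto simp: Cc_infty_def Ck_on_eq_Ck)

lemma Cc_inftyI:
  assumes "\<And>k. Ck (Rn n) W k \<theta>" "\<And>x. \<theta> x \<in> Rn n" "compact L" "L \<subseteq> W" "\<And>x. x \<notin> L \<Longrightarrow> \<theta> x = 0"
  shows "\<theta> \<in> Cc_infty n W" "spt \<theta> \<subseteq> L"
proof -
  show sub: "spt \<theta> \<subseteq> L"
    unfolding spt_def using assms(3,5) by (intro closure_minimal compact_imp_closed) auto
  then have "compact (spt \<theta>)" unfolding spt_def
    using compact_Int_closed[OF assms(3) closed_closure] by (metis inf.absorb2)
  then show "\<theta> \<in> Cc_infty n W" using assms sub by (auto simp: Cc_infty_def Ck_on_eq_Ck)
qed

lemma not_in_spt: "x \<notin> spt \<theta> \<Longrightarrow> \<theta> x = 0"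
  unfolding spt_def using subsetD[OF closure_subset, of x "{x. \<theta> x \<noteq> 0}"] by auto

lemma Cc_infty_add:
  assumes "f \<in> Cc_infty n W" "g \<in> Cc_infty n W"
  shows "(\<lambda>x. f x + g x) \<in> Cc_infty n W"
proof (rule Cc_inftyI(1)[of n W _ "spt f \<union> spt g"])
  show "Ck (Rn n) W k (\<lambda>x. f x + g x)" for k using assms by (intro Ck_add Cc_inftyD(1))
  show "f x + g x \<in> Rn n" for x using assms by (intro Rn_add Cc_inftyD(2))
  show "compact (spt f \<union> spt g)" using assms by (intro compact_Un Cc_inftyD(3))
  show "spt f \<union> spt g \<subseteq> W" using assms by (intro Un_least Cc_inftyD(4))
  show "f x + g x = 0" if "x \<notin> spt f \<union> spt g" for x using that by (simp add: not_in_spt)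
qed

lemma Cc_infty_scaleR:
  assumes "f \<in> Cc_infty n W" "W \<subseteq> Rn n"
  shows "(\<lambda>x. c *\<^sub>R f x) \<in> Cc_infty n W"
proof (rule Cc_inftyI(1)[of n W _ "spt f"])
  show "Ck (Rn n) W k (\<lambda>x. c *\<^sub>R f x)" for k using assms by (intro Ck_cmult Cc_inftyD(1))
  show "c *\<^sub>R f x \<in> Rn n" for x using assms by (intro Rn_scaleR Cc_inftyD(2))
  show "compact (spt f)" "spt f \<subseteq> W" using Cc_inftyD[OF assms(1)] by auto
  show "c *\<^sub>R f x = 0" if "x \<notin> spt f" for x using that by (simp add: not_in_spt)
qed

lemma Cc_infty_0: "(\<lambda>x. 0) \<in> Cc_infty n W"
  by (rule Cc_inftyI(1)[of n W _ "{}"]) auto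

lemma Cc_infty_mult:
  assumes "f \<in> Cc_infty n W" "W \<subseteq> Rn n" "\<And>k. Ck (Rn n) (Rn n) k \<zeta>"
    and L: "closed L" "\<And>x. x \<notin> L \<Longrightarrow> \<zeta> x *\<^sub>R f x = 0"
  shows "(\<lambda>x. \<zeta> x *\<^sub>R f x) \<in> Cc_infty n W" "spt (\<lambda>x. \<zeta> x *\<^sub>R f x) \<subseteq> spt f \<inter> L"
proof -
  have c: "compact (spt f \<inter> L)" using Cc_inftyD(3)[OF assms(1)] L(1) by (rule compact_Int_closed)
  have ck: "Ck (Rn n) W k (\<lambda>x. \<zeta> x *\<^sub>R f x)" for k
    by (rule Ck_scaleR[OF assms(2) Ck_subset[OF assms(2,3)] Cc_inftyD(1)[OF assms(1)]])
  have sub: "spt f \<inter> L \<subseteq> W" using Cc_inftyD(4)[OF assms(1)] by (rule le_infI1)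
  have zero: "\<zeta> x *\<^sub>R f x = 0" if "x \<notin> spt f \<inter> L" for x
    using that L(2)[of x] not_in_spt[of x f] by (cases "x \<in> L") auto
  note I = Cc_inftyI[of n W "\<lambda>x. \<zeta> x *\<^sub>R f x" "spt f \<inter> L", OF ck Rn_scaleR[OF Cc_inftyD(2)[OF assms(1)]] c sub zero]
  show "(\<lambda>x. \<zeta> x *\<^sub>R f x) \<in> Cc_infty n W" by (rule I(1))
  show "spt (\<lambda>x. \<zeta> x *\<^sub>R f x) \<subseteq> spt f \<inter> L" by (rule I(2))
qed

text \<open>A partition of unity with two terms. It is behind the subadditivity of the variation
  and, with \<open>K\<close> a piece of a level set, behind the peeling argument; for the latter it
  matters that neither part exceeds \<open>f\<close> in norm.\<close>

lemma Cc_infty_split: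
  assumes f: "f \<in> Cc_infty n W" and W: "openin (Rn_top n) W" and C: "openin (Rn_top n) C" and K: "compact K" "K \<subseteq> C"
  obtains g h where "g \<in> Cc_infty n W" "h \<in> Cc_infty n W" "\<And>x. f x = g x + h x"
    "spt g \<subseteq> spt f \<inter> C" "spt h \<subseteq> spt f - K" "\<And>x. norm (g x) \<le> norm (f x)" "\<And>x. norm (h x) \<le> norm (f x)"
proof -
  obtain \<zeta> :: "fseq \<Rightarrow> real" and L N where z: "\<And>k. Ck (Rn n) (Rn n) k \<zeta>" "\<And>x. 0 \<le> \<zeta> x" "\<And>x. \<zeta> x \<le> 1"
    "openin (Rn_top n) N" "K \<subseteq> N" "\<And>x. x \<in> N \<Longrightarrow> \<zeta> x = 1"
    "compact L" "L \<subseteq> C" "\<And>x. x \<notin> L \<Longrightarrow> \<zeta> x = 0"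
    by (rule smooth_urysohn[OF C K]) blast
  have WR: "W \<subseteq> Rn n" using W openin_imp_subset by blast
  obtain T where T: "open T" "N = Rn n \<inter> T" using z(4) by (auto simp: openin_open)
  have g: "(\<lambda>x. \<zeta> x *\<^sub>R f x) \<in> Cc_infty n W" "spt (\<lambda>x. \<zeta> x *\<^sub>R f x) \<subseteq> spt f \<inter> L"
    using Cc_infty_mult[OF f WR z(1) compact_imp_closed[OF z(7)]] z(9) by simp_all
  have "(1 - \<zeta> x) *\<^sub>R f x = 0" if "x \<notin> - T" for x
  proof (cases "x \<in> Rn n")
    case True
    then show ?thesis using that T z(6) by auto
  next
    case False
    then have "x \<notin> spt f" using Cc_inftyD(4)[OF f] WR by auto
    then show ?thesis by (simp add: not_in_spt)
  qed
  moreover have "Ck (Rn n) (Rn n) k (\<lambda>x. 1 - \<zeta> x)" for k by (intro Ck_diff z(1) Ck_const) auto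
  ultimately have h: "(\<lambda>x. (1 - \<zeta> x) *\<^sub>R f x) \<in> Cc_infty n W" "spt (\<lambda>x. (1 - \<zeta> x) *\<^sub>R f x) \<subseteq> spt f \<inter> - T"
    using Cc_infty_mult[OF f WR, of "\<lambda>x. 1 - \<zeta> x" "- T"] T(1) by auto
  show thesis
  proof (rule that[OF g(1) h(1)])
    show "f x = \<zeta> x *\<^sub>R f x + (1 - \<zeta> x) *\<^sub>R f x" for x by (simp add: scaleR_left_diff_distrib)
    show "spt (\<lambda>x. \<zeta> x *\<^sub>R f x) \<subseteq> spt f \<inter> C" using g(2) z(8) by auto
    show "spt (\<lambda>x. (1 - \<zeta> x) *\<^sub>R f x) \<subseteq> spt f - K" using h(2) z(5) T(2) by auto
    show "norm (\<zeta> x *\<^sub>R f x) \<le> norm (f x)" for x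
      using z(2,3)[of x] by (simp add: mult_left_le_one_le)
    show "norm ((1 - \<zeta> x) *\<^sub>R f x) \<le> norm (f x)" for x
      using z(2,3)[of x] by (simp add: mult_left_le_one_le)
  qed
qed

section \<open>The variation of a distribution as a Caratheodory measure\<close>

lemma ennreal_less_add_pos: "x \<noteq> top \<Longrightarrow> 0 < e \<Longrightarrow> x < x + ennreal e"
  by (cases x) (auto simp: ennreal_less_iff simp flip: ennreal_plus)

locale vector_distribution =
  fixes n :: nat and U :: "fseq set" and S :: distrib
  assumes open_U: "openin (Rn_top n) U"
    and S_add: "\<And>f g. f \<in> Cc_infty n U \<Longrightarrow> g \<in> Cc_infty n U \<Longrightarrow> S (\<lambda>x. f x + g x) = S f + S g"
    and S_scaleR: "\<And>f c. f \<in> Cc_infty n U \<Longrightarrow> S (\<lambda>x. c *\<^sub>R f x) = c * S f"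
begin

lemma U_Rn: "U \<subseteq> Rn n"
  using open_U openin_imp_subset by blast

lemma U_borel [measurable]: "U \<in> sets borel"
  using openin_Rn_borel[OF open_U] .

lemma openin_U_iff: "openin (top_of_set U) C \<longleftrightarrow> openin (Rn_top n) C \<and> C \<subseteq> U"
  using open_U openin_trans openin_imp_subset openin_subset_trans[of "Rn n" C U] U_Rn by metis

definition tests :: "fseq set \<Rightarrow> (fseq \<Rightarrow> fseq) set" where
  "tests C = {\<theta> \<in> Cc_infty n U. spt \<theta> \<subseteq> C \<and> (\<forall>x. norm (\<theta> x) \<le> 1)}"

definition var_open :: "fseq set \<Rightarrow> ennreal" where
  "var_open C = (SUP \<theta>\<in>tests C. ennreal (S \<theta>))"

definition var_outer :: "fseq set \<Rightarrow> ennreal" where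
  "var_outer A = (INF C\<in>{C. openin (top_of_set U) C \<and> A \<subseteq> C}. var_open C)"

lemma S_0: "S (\<lambda>x. 0) = 0"
  using S_scaleR[OF Cc_infty_0, of 0] by simp

lemma spt_0: "spt (\<lambda>x. 0) = {}"
  by (simp add: spt_def)

lemma var_open_mono: "C \<subseteq> D \<Longrightarrow> var_open C \<le> var_open D"
  unfolding var_open_def by (rule SUP_subset_mono) (auto simp: tests_def)

lemma spt_scaleR_subset: "spt (\<lambda>x. c *\<^sub>R f x) \<subseteq> spt f"
  unfolding spt_def by (rule closure_mono) auto

lemma abs_S_le:
  assumes f: "f \<in> Cc_infty n U" "spt f \<subseteq> C" "\<And>x. norm (f x) \<le> c"
  shows "ennreal \<bar>S f\<bar> \<le> ennreal c * var_open C"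
proof -
  have "0 \<le> c" using assms(3)[of 0] norm_ge_zero order_trans by blast
  show ?thesis
  proof (cases "c = 0")
    case True
    then have "f = (\<lambda>x. 0)" using assms(3) by auto
    then show ?thesis using S_0 by simp
  next
    case False
    then have c: "0 < c" using \<open>0 \<le> c\<close> by simp
    define \<sigma> where "\<sigma> = sgn (S f) / c"
    have "(\<lambda>x. \<sigma> *\<^sub>R f x) \<in> tests C"
      unfolding tests_def
    proof (intro CollectI conjI allI)
      show "(\<lambda>x. \<sigma> *\<^sub>R f x) \<in> Cc_infty n U" by (rule Cc_infty_scaleR[OF f(1) U_Rn])
      show "spt (\<lambda>x. \<sigma> *\<^sub>R f x) \<subseteq> C" using spt_scaleR_subset f(2) by blast
      fix x
      have "norm (\<sigma> *\<^sub>R f x) \<le> (1 / c) * c"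
        unfolding norm_scaleR using c f(3)[of x] by (intro mult_mono) (auto simp: \<sigma>_def sgn_if)
      then show "norm (\<sigma> *\<^sub>R f x) \<le> 1" using c by simp
    qed
    then have "ennreal (S (\<lambda>x. \<sigma> *\<^sub>R f x)) \<le> var_open C" unfolding var_open_def by (rule SUP_upper)
    moreover have "S (\<lambda>x. \<sigma> *\<^sub>R f x) = \<bar>S f\<bar> / c"
      by (simp add: S_scaleR[OF f(1)] \<sigma>_def abs_sgn mult.commute)
    ultimately have "ennreal c * ennreal (\<bar>S f\<bar> / c) \<le> ennreal c * var_open C" by (simp add: mult_left_mono)
    moreover have "ennreal c * ennreal (\<bar>S f\<bar> / c) = ennreal \<bar>S f\<bar>"
      using c by (simp flip: ennreal_mult)
    ultimately show ?thesis by simp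
  qed
qed

text \<open>A test field for the union is split at the part of its support outside \<open>D\<close>,
  which is a compact subset of \<open>C\<close>.\<close>

lemma var_open_Un:
  assumes C: "openin (top_of_set U) C" and D: "openin (top_of_set U) D"
  shows "var_open (C \<union> D) \<le> var_open C + var_open D"
  unfolding var_open_def[of "C \<union> D"]
proof (rule SUP_least)
  fix f assume "f \<in> tests (C \<union> D)"
  then have f: "f \<in> Cc_infty n U" "spt f \<subseteq> C \<union> D" "\<And>x. norm (f x) \<le> 1" by (auto simp: tests_def)
  obtain T where T: "open T" "D = U \<inter> T" using D by (auto simp: openin_open)
  have "compact (spt f \<inter> - T)" using Cc_inftyD(3)[OF f(1)] T by (intro compact_Int_closed) auto
  moreover have "spt f \<inter> - T \<subseteq> C" using f(2) T Cc_inftyD(4)[OF f(1)] by auto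
  moreover have "openin (Rn_top n) C" using C openin_U_iff by simp
  ultimately obtain g h where gh: "g \<in> Cc_infty n U" "h \<in> Cc_infty n U" "\<And>x. f x = g x + h x"
    "spt g \<subseteq> spt f \<inter> C" "spt h \<subseteq> spt f - (spt f \<inter> - T)" "\<And>x. norm (g x) \<le> norm (f x)" "\<And>x. norm (h x) \<le> norm (f x)"
    using Cc_infty_split[OF f(1) open_U] by metis
  have "f = (\<lambda>x. g x + h x)" using gh(3) by auto
  then have "ennreal (S f) \<le> ennreal (\<bar>S g\<bar> + \<bar>S h\<bar>)" using S_add[OF gh(1,2)] by (intro ennreal_leI) auto
  also have "\<dots> = ennreal \<bar>S g\<bar> + ennreal \<bar>S h\<bar>" by simp
  also have "\<dots> \<le> ennreal 1 * var_open C + ennreal 1 * var_open D"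
  proof (intro add_mono abs_S_le gh)
    show "spt g \<subseteq> C" using gh by auto
    show "spt h \<subseteq> D" using gh T Cc_inftyD(4)[OF f(1)] by auto
    show "norm (g x) \<le> 1" "norm (h x) \<le> 1" for x using gh(6,7) f(3) order_trans by blast+
  qed
  finally show "ennreal (S f) \<le> var_open C + var_open D" by simp
qed

lemma var_open_empty: "var_open {} = 0"
proof -
  have "ennreal (S f) \<le> 0" if "f \<in> tests {}" for f
  proof -
    have "f = (\<lambda>x. 0)" using that not_in_spt[of _ f] by (auto simp: tests_def)
    then show ?thesis by (simp add: S_0)
  qed
  then have "var_open {} \<le> 0" unfolding var_open_def by (intro SUP_least)
  then show ?thesis by simp
qed

lemma var_open_UN:
  assumes C: "\<And>i::nat. openin (top_of_set U) (C i)"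
  shows "var_open (\<Union>i. C i) \<le> (\<Sum>i. var_open (C i))"
  unfolding var_open_def[of "\<Union>i. C i"]
proof (rule SUP_least)
  fix f assume "f \<in> tests (\<Union>i. C i)"
  then have f: "f \<in> Cc_infty n U" "spt f \<subseteq> (\<Union>i. C i)" "\<And>x. norm (f x) \<le> 1" by (auto simp: tests_def)
  have "\<forall>i. \<exists>T. open T \<and> C i = U \<inter> T" using C by (auto simp: openin_open)
  then obtain T where T: "\<And>i. open (T i)" "\<And>i. C i = U \<inter> T i" by metis
  have "spt f \<subseteq> (\<Union>i. T i)" using f(2) T by auto
  then obtain F where F: "finite F" "spt f \<subseteq> (\<Union>i\<in>F. T i)"
    using compactE_image[OF Cc_inftyD(3)[OF f(1)], of UNIV T] T(1) by auto
  have fin: "var_open (\<Union>i\<in>F. C i) \<le> (\<Sum>i\<in>F. var_open (C i))"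
    using F(1)
  proof (induction F)
    case empty then show ?case by (simp add: var_open_empty)
  next
    case (insert i F)
    have "var_open (C i \<union> (\<Union>i\<in>F. C i)) \<le> var_open (C i) + var_open (\<Union>i\<in>F. C i)"
      by (intro var_open_Un C openin_Union) (use C in auto)
    also have "\<dots> \<le> var_open (C i) + (\<Sum>i\<in>F. var_open (C i))" using insert by (intro add_left_mono) auto
    finally show ?case using insert by simp
  qed
  have "f \<in> tests (\<Union>i\<in>F. C i)" using f F T Cc_inftyD(4)[OF f(1)] by (auto simp: tests_def)
  then have "ennreal (S f) \<le> var_open (\<Union>i\<in>F. C i)" unfolding var_open_def by (rule SUP_upper)
  also have "\<dots> \<le> (\<Sum>i. var_open (C i))"
    using fin sum_le_suminf[OF summableI F(1), of "\<lambda>i. var_open (C i)"] by (meson order_trans zero_le)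
  finally show "ennreal (S f) \<le> (\<Sum>i. var_open (C i))" .
qed

lemma var_outer_open: "openin (top_of_set U) C \<Longrightarrow> var_outer C = var_open C"
  unfolding var_outer_def by (intro antisym INF_lower INF_greatest) (auto intro: var_open_mono)

lemma var_outer_mono: "A \<subseteq> A' \<Longrightarrow> var_outer A \<le> var_outer A'"
  unfolding var_outer_def by (rule INF_superset_mono) auto

lemma var_outer_le: "openin (top_of_set U) C \<Longrightarrow> A \<subseteq> C \<Longrightarrow> var_outer A \<le> var_open C"
  unfolding var_outer_def by (rule INF_lower) auto

lemma outer_measure_space_var_outer: "outer_measure_space (Pow U) var_outer"
  unfolding outer_measure_space_def
proof (intro conjI)
  show "positive (Pow U) var_outer"
    unfolding positive_def using var_outer_open[of "{}"] var_open_empty by simp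
  show "increasing (Pow U) var_outer" by (auto simp: increasing_def intro: var_outer_mono)
  show "countably_subadditive (Pow U) var_outer"
    unfolding countably_subadditive_def
  proof (intro allI impI)
    fix A :: "nat \<Rightarrow> fseq set" assume A: "range A \<subseteq> Pow U"
    show "var_outer (\<Union>i. A i) \<le> (\<Sum>i. var_outer (A i))"
    proof (rule ennreal_le_epsilon)
      fix e :: real assume "0 < e" and fin: "(\<Sum>i. var_outer (A i)) < top"
      have "\<exists>C. openin (top_of_set U) C \<and> A i \<subseteq> C \<and> var_open C \<le> var_outer (A i) + ennreal (e * (1 / 2) ^ Suc i)" for i
      proof -
        have "var_outer (A i) \<noteq> top" using fin ennreal_suminf_lessD[of "\<lambda>i. var_outer (A i)" top i] by auto
        then have "var_outer (A i) < var_outer (A i) + ennreal (e * (1 / 2) ^ Suc i)"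
          using \<open>0 < e\<close> by (intro ennreal_less_add_pos) auto
        then show ?thesis unfolding var_outer_def INF_less_iff
          by (metis (mono_tags, lifting) less_imp_le mem_Collect_eq)
      qed
      then obtain C where C: "\<And>i. openin (top_of_set U) (C i)" "\<And>i. A i \<subseteq> C i"
        "\<And>i. var_open (C i) \<le> var_outer (A i) + ennreal (e * (1 / 2) ^ Suc i)" by metis
      have "var_outer (\<Union>i. A i) \<le> var_open (\<Union>i. C i)"
        by (rule var_outer_le) (use C in \<open>auto intro!: openin_Union\<close>)
      also have "\<dots> \<le> (\<Sum>i. var_open (C i))" by (rule var_open_UN[OF C(1)])
      also have "\<dots> \<le> (\<Sum>i. var_outer (A i) + ennreal (e * (1 / 2) ^ Suc i))"
        by (intro suminf_le C summableI)
      also have "\<dots> = (\<Sum>i. var_outer (A i)) + (\<Sum>i. ennreal (e * (1 / 2) ^ Suc i))"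
        by (rule suminf_add[symmetric]) (auto intro: summableI)
      also have "(\<Sum>i. ennreal (e * (1 / 2) ^ Suc i)) = ennreal e"
      proof (rule suminf_ennreal_eq)
        show "(\<lambda>i. e * (1 / 2) ^ Suc i) sums e" using sums_mult[OF power_half_series, of e] by simp
      qed (use \<open>0 < e\<close> in auto)
      finally show "var_outer (\<Union>i. A i) \<le> (\<Sum>i. var_outer (A i)) + ennreal e" .
    qed
  qed
qed

text \<open>Caratheodory's criterion reduces to additivity over disjoint supports: if
  \<open>f\<close> is a test field for \<open>C \<inter> D\<close> and \<open>g\<close> one for
  \<open>D - spt f\<close>, then their sum is a test field for \<open>D\<close>. The two suprema are
  taken one after the other, which is why \<open>g\<close> may depend on the support of
  \<open>f\<close>.\<close>

lemma open_in_lambda_system: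
  assumes C: "openin (top_of_set U) C"
  shows "C \<in> lambda_system U (Pow U) var_outer"
  unfolding lambda_system_def
proof (intro CollectI conjI ballI)
  show "C \<in> Pow U" using C openin_imp_subset by blast
  fix A assume A: "A \<in> Pow U"
  have sub: "subadditive (Pow U) var_outer" and emp: "var_outer {} = 0"
    using outer_measure_space_var_outer ring_of_sets.countably_subadditive_subadditive[OF _ _, of U "Pow U" var_outer]
    by (auto simp: outer_measure_space_def positive_def ring_of_sets_Pow)
  have "C \<inter> A \<union> (U - C) \<inter> A = A" using A by auto
  then have le: "var_outer A \<le> var_outer (C \<inter> A) + var_outer ((U - C) \<inter> A)"
    using subadditiveD[OF sub, of "C \<inter> A" "(U - C) \<inter> A"] A C openin_imp_subset[OF C] by auto
  have ge: "var_outer (C \<inter> A) + var_outer ((U - C) \<inter> A) \<le> var_outer A"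
    unfolding var_outer_def[of A]
  proof (rule INF_greatest)
    fix D assume "D \<in> {D. openin (top_of_set U) D \<and> A \<subseteq> D}"
    then have D: "openin (top_of_set U) D" "A \<subseteq> D" by auto
    have "var_outer (C \<inter> A) \<le> var_open (C \<inter> D)" using C D by (intro var_outer_le) auto
    also have "\<dots> + var_outer ((U - C) \<inter> A) \<le> var_open D"
      unfolding var_open_def[of "C \<inter> D"]
    proof (subst ennreal_SUP_add_left[symmetric])
      show "tests (C \<inter> D) \<noteq> {}"
        using Cc_infty_0 by (auto simp: tests_def spt_0 intro!: exI[of _ "\<lambda>x. 0"])
      show "(SUP f\<in>tests (C \<inter> D). ennreal (S f) + var_outer ((U - C) \<inter> A)) \<le> var_open D"
      proof (rule SUP_least)
        fix f assume "f \<in> tests (C \<inter> D)"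
        then have f: "f \<in> Cc_infty n U" "spt f \<subseteq> C \<inter> D" "\<And>x. norm (f x) \<le> 1" by (auto simp: tests_def)
        have "closed (spt f)" by (simp add: spt_def)
        then have D': "openin (top_of_set U) (D - spt f)"
          using D(1) by (metis closed_def openin_Int_open Diff_eq)
        have "(U - C) \<inter> A \<subseteq> D - spt f" using D f by auto
        then have "ennreal (S f) + var_outer ((U - C) \<inter> A) \<le> ennreal (S f) + var_open (D - spt f)"
          using D' by (intro add_left_mono var_outer_le)
        also have "\<dots> \<le> var_open D"
          unfolding var_open_def[of "D - spt f"]
        proof (subst ennreal_SUP_add_right)
          show "tests (D - spt f) \<noteq> {}"
            using Cc_infty_0 by (auto simp: tests_def spt_0 intro!: exI[of _ "\<lambda>x. 0"])
          show "(SUP g\<in>tests (D - spt f). ennreal (S f) + ennreal (S g)) \<le> var_open D"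
          proof (rule SUP_least)
            fix g assume "g \<in> tests (D - spt f)"
            then have g: "g \<in> Cc_infty n U" "spt g \<subseteq> D - spt f" "\<And>x. norm (g x) \<le> 1" by (auto simp: tests_def)
            \<comment> \<open>\<open>ennreal\<close> truncates negative values to 0, so a field with
              negative value is traded for the zero field before adding.\<close>
            define f' g' where "f' = (if 0 \<le> S f then f else (\<lambda>x. 0))" and "g' = (if 0 \<le> S g then g else (\<lambda>x. 0))"
            have f': "f' \<in> Cc_infty n U" "spt f' \<subseteq> spt f" "\<And>x. norm (f' x) \<le> 1" "ennreal (S f) = ennreal (S f')" "0 \<le> S f'"
              using f Cc_infty_0 by (auto simp: f'_def spt_0 S_0 ennreal_neg)
            have g': "g' \<in> Cc_infty n U" "spt g' \<subseteq> spt g" "\<And>x. norm (g' x) \<le> 1" "ennreal (S g) = ennreal (S g')" "0 \<le> S g'"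
              using g Cc_infty_0 by (auto simp: g'_def spt_0 S_0 ennreal_neg)
            have "(\<lambda>x. f' x + g' x) \<in> tests D"
              unfolding tests_def
            proof (intro CollectI conjI allI)
              show "(\<lambda>x. f' x + g' x) \<in> Cc_infty n U" by (rule Cc_infty_add[OF f'(1) g'(1)])
              have "spt (\<lambda>x. f' x + g' x) \<subseteq> spt f' \<union> spt g'"
                unfolding spt_def closure_Un[symmetric] by (rule closure_mono) auto
              then show "spt (\<lambda>x. f' x + g' x) \<subseteq> D" using f'(2) g'(2) f(2) g(2) by blast
              fix x
              have "f' x = 0 \<or> g' x = 0" using not_in_spt[of x f'] not_in_spt[of x g'] f'(2) g'(2) g(2) by auto
              then show "norm (f' x + g' x) \<le> 1" using f'(3)[of x] g'(3)[of x] by auto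
            qed
            then have "ennreal (S (\<lambda>x. f' x + g' x)) \<le> var_open D" unfolding var_open_def by (rule SUP_upper)
            then show "ennreal (S f) + ennreal (S g) \<le> var_open D"
              using f' g' S_add[OF f'(1) g'(1)] by simp
          qed
        qed
        finally show "ennreal (S f) + var_outer ((U - C) \<inter> A) \<le> var_open D" .
      qed
    qed
    finally show "var_outer (C \<inter> A) + var_outer ((U - C) \<inter> A) \<le> var_open D"
      by (simp add: add_right_mono)
  qed
  show "var_outer (C \<inter> A) + var_outer ((U - C) \<inter> A) = var_outer A"
    using le ge by (rule antisym[rotated])
qed

definition var_measure :: "fseq measure" where
  "var_measure = measure_of U {C. openin (top_of_set U) C} var_outer"

lemma sets_var_measure_borel_of: "sets var_measure = sets (borel_of (top_of_set U))"
  unfolding var_measure_def borel_of_def by (subst (1 2) sets_measure_of) (auto dest: openin_imp_subset)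

lemma emeasure_var_measure:
  assumes "A \<in> sets var_measure"
  shows "emeasure var_measure A = var_outer A"
proof -
  let ?G = "{C. openin (top_of_set U) C}"
  have G: "?G \<subseteq> Pow U" by (auto dest: openin_imp_subset)
  have ms: "measure_space U (lambda_system U (Pow U) var_outer) var_outer"
    by (rule sigma_algebra.caratheodory_lemma[OF sigma_algebra_Pow outer_measure_space_var_outer])
  then have sa: "sigma_algebra U (lambda_system U (Pow U) var_outer)" by (simp add: measure_space_def)
  have sub: "sigma_sets U ?G \<subseteq> lambda_system U (Pow U) var_outer"
    by (rule sigma_algebra.sigma_sets_subset[OF sa]) (auto intro: open_in_lambda_system)
  have "measure_space U (sigma_sets U ?G) var_outer"
    by (rule measure_down[OF ms sigma_algebra_sigma_sets[OF G] sub])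
  then have "positive (sigma_sets U ?G) var_outer" "countably_additive (sigma_sets U ?G) var_outer"
    by (auto simp: measure_space_def)
  moreover have "sets var_measure = sigma_sets U ?G"
    unfolding var_measure_def by (rule sets_measure_of[OF G])
  ultimately show ?thesis
    using emeasure_measure_of[OF var_measure_def G _ _ assms] by simp
qed

text \<open>A competitor has prescribed values on open sets, so by monotonicity it is at most the
  infimum of these over open supersets, and that infimum is \<open>var_measure\<close>.\<close>

lemma variation_eq: "variation n U S = var_measure"
  unfolding variation_def
proof (rule Greatest_equality)
  have op: "C \<in> sets var_measure" if "openin (top_of_set U) C" for C
    unfolding sets_var_measure_borel_of borel_of_def using that
    by (subst sets_measure_of) (auto dest: openin_imp_subset)
  show "sets var_measure = sets (borel_of (top_of_set U)) \<and> (\<forall>C. openin (top_of_set U) C \<longrightarrow>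
      emeasure var_measure C = (SUP \<theta>\<in>{\<theta> \<in> Cc_infty n U. spt \<theta> \<subseteq> C \<and> (\<forall>x. norm (\<theta> x) \<le> 1)}. ennreal (S \<theta>)))"
    using emeasure_var_measure[OF op] var_outer_open sets_var_measure_borel_of
    by (auto simp: var_open_def tests_def)
  fix N :: "fseq measure" assume N: "sets N = sets (borel_of (top_of_set U)) \<and> (\<forall>C. openin (top_of_set U) C \<longrightarrow>
      emeasure N C = (SUP \<theta>\<in>{\<theta> \<in> Cc_infty n U. spt \<theta> \<subseteq> C \<and> (\<forall>x. norm (\<theta> x) \<le> 1)}. ennreal (S \<theta>)))"
  have s: "sets N = sets var_measure" using N sets_var_measure_borel_of by simp
  have "emeasure N A \<le> emeasure var_measure A" if A: "A \<in> sets N" for A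
  proof -
    have "emeasure N A \<le> var_outer A"
      unfolding var_outer_def
    proof (rule INF_greatest)
      fix C assume C: "C \<in> {C. openin (top_of_set U) C \<and> A \<subseteq> C}"
      then have "emeasure N A \<le> emeasure N C" using op s by (intro emeasure_mono) auto
      also have "\<dots> = var_open C" using N C by (auto simp: var_open_def tests_def)
      finally show "emeasure N A \<le> var_open C" .
    qed
    then show ?thesis using emeasure_var_measure A s by simp
  qed
  then show "N \<le> var_measure" using le_measure[OF s] by simp
qed

lemma space_var_measure [simp]: "space var_measure = U"
  unfolding var_measure_def by (rule space_measure_of) (auto dest: openin_imp_subset)

lemma sets_var_measure: "sets var_measure = {A \<in> sets borel. A \<subseteq> U}"
  by (simp add: sets_var_measure_borel_of sets_borel_of_top_of_set)

lemma open_sets_var_measure: "openin (top_of_set U) C \<Longrightarrow> C \<in> sets var_measure"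
  by (auto simp: sets_var_measure openin_U_iff intro: openin_Rn_borel)

lemma emeasure_var_open: "openin (top_of_set U) C \<Longrightarrow> emeasure var_measure C = var_open C"
  by (simp add: emeasure_var_measure open_sets_var_measure var_outer_open)

lemma compact_sets_var_measure: "compact K \<Longrightarrow> K \<subseteq> U \<Longrightarrow> K \<in> sets var_measure"
  by (auto simp: sets_var_measure intro: borel_compact)

lemma outer_regular:
  assumes A: "A \<in> sets var_measure" "emeasure var_measure A \<noteq> top" and "0 < (e::real)"
  obtains C where "openin (top_of_set U) C" "A \<subseteq> C" "emeasure var_measure C \<le> emeasure var_measure A + ennreal e"
proof -
  have A': "var_outer A = emeasure var_measure A" using emeasure_var_measure[OF A(1)] by simp
  then have "var_outer A < var_outer A + ennreal e"
    using assms by (intro ennreal_less_add_pos) auto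
  then have "\<exists>C\<in>{C. openin (top_of_set U) C \<and> A \<subseteq> C}. var_open C < var_outer A + ennreal e"
    unfolding INF_less_iff[symmetric] var_outer_def[symmetric] .
  then obtain C where C: "openin (top_of_set U) C" "A \<subseteq> C" "var_open C < var_outer A + ennreal e" by auto
  show thesis
    by (rule that[OF C(1,2)]) (use C(3) A' emeasure_var_open[OF C(1)] in \<open>simp add: less_imp_le\<close>)
qed

end

section \<open>The continuous extension to integrable fields\<close>

locale radon_distribution = vector_distribution +
  assumes finite_compact: "\<And>K. compact K \<Longrightarrow> K \<subseteq> U \<Longrightarrow> emeasure var_measure K < \<infinity>"
begin

lemma finite_open_nbhd:
  assumes "compact K" "K \<subseteq> U"
  obtains N where "openin (top_of_set U) N" "K \<subseteq> N" "emeasure var_measure N < \<infinity>"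
proof -
  obtain \<zeta> :: "fseq \<Rightarrow> real" and L N where z: "\<And>k. Ck (Rn n) (Rn n) k \<zeta>" "\<And>x. 0 \<le> \<zeta> x" "\<And>x. \<zeta> x \<le> 1"
    "openin (Rn_top n) N" "K \<subseteq> N" "\<And>x. x \<in> N \<Longrightarrow> \<zeta> x = 1"
    "compact L" "L \<subseteq> U" "\<And>x. x \<notin> L \<Longrightarrow> \<zeta> x = 0"
    by (rule smooth_urysohn[OF open_U assms]) blast
  have "x \<in> L" if "x \<in> N" for x using z(6)[OF that] z(9)[of x] by auto
  then have NL: "N \<subseteq> L" by auto
  have "emeasure var_measure N \<le> emeasure var_measure L"
    by (rule emeasure_mono[OF NL]) (rule compact_sets_var_measure[OF z(7,8)])
  also have "\<dots> < \<infinity>" using finite_compact z(7,8) by auto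
  finally have "emeasure var_measure N < \<infinity>" .
  moreover have "openin (top_of_set U) N" unfolding openin_U_iff using z(4,8) NL by auto
  ultimately show thesis using that z(5) by blast
qed

text \<open>For the open set \<open>C\<close>, inner regularity is built into the variation: the
  support of a nearly optimal test field is compact and carries nearly all of the mass. Removing
  from it an open neighbourhood of \<open>C - A\<close> of hardly larger measure leaves a compact
  subset of \<open>A\<close>.\<close>

lemma inner_regular:
  assumes A: "A \<in> sets var_measure" "A \<subseteq> C" and C: "openin (top_of_set U) C" "emeasure var_measure C < \<infinity>"
    and e: "0 < (e::real)"
  obtains K where "compact K" "K \<subseteq> A" "emeasure var_measure (A - K) \<le> ennreal e"
proof -
  have Cs: "C \<in> sets var_measure" by (rule open_sets_var_measure[OF C(1)])
  have vC: "emeasure var_measure C = var_open C" by (rule emeasure_var_open[OF C(1)])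
  have "\<exists>f\<in>tests C. var_open C \<le> ennreal (S f) + ennreal (e / 2)"
  proof (rule ccontr)
    assume neg: "\<not> ?thesis"
    have "(SUP f\<in>tests C. ennreal (S f) + ennreal (e / 2)) \<le> var_open C"
      by (rule SUP_least) (use neg in \<open>auto simp: not_le intro: less_imp_le\<close>)
    moreover have "(SUP f\<in>tests C. ennreal (S f) + ennreal (e / 2)) = var_open C + ennreal (e / 2)"
      unfolding var_open_def
      by (rule ennreal_SUP_add_left) (auto simp: tests_def spt_0 Cc_infty_0 intro!: exI[of _ "\<lambda>x. 0"])
    moreover have "var_open C < var_open C + ennreal (e / 2)"
      using C(2) vC e by (intro ennreal_less_add_pos) auto
    ultimately show False by simp
  qed
  then obtain f where f: "f \<in> tests C" "var_open C \<le> ennreal (S f) + ennreal (e / 2)" by auto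
  define D where "D = spt f"
  have fC: "f \<in> Cc_infty n U" "D \<subseteq> C" using f by (auto simp: tests_def D_def)
  have D: "compact D" "D \<subseteq> U" using Cc_inftyD[OF fC(1)] by (auto simp: D_def)
  have Ds: "D \<in> sets var_measure" by (rule compact_sets_var_measure[OF D])
  \<comment> \<open>The measure of the compact set \<open>D\<close> is an infimum over its open
    supersets, and \<open>f\<close> is a test field for each of them.\<close>
  have "ennreal (S f) \<le> emeasure var_measure D"
    unfolding emeasure_var_measure[OF Ds] var_outer_def
  proof (rule INF_greatest)
    fix W assume "W \<in> {W. openin (top_of_set U) W \<and> D \<subseteq> W}"
    then have "f \<in> tests W" using f by (auto simp: tests_def D_def)
    then show "ennreal (S f) \<le> var_open W" unfolding var_open_def by (rule SUP_upper)
  qed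
  then have "emeasure var_measure C \<le> emeasure var_measure D + ennreal (e / 2)"
    using f(2) vC by (metis add_right_mono order_trans)
  moreover have "emeasure var_measure C = emeasure var_measure D + emeasure var_measure (C - D)"
    using plus_emeasure[OF Ds sets.Diff[OF Cs Ds]] fC(2) by (simp add: Un_absorb1)
  moreover have "emeasure var_measure D < \<infinity>" by (rule finite_compact[OF D])
  ultimately have CD: "emeasure var_measure (C - D) \<le> ennreal (e / 2)"
    by (auto simp: ennreal_add_left_cancel_le)
  have CA: "C - A \<in> sets var_measure" using Cs A by auto
  have CAfin: "emeasure var_measure (C - A) < \<infinity>"
    using emeasure_mono[of "C - A" C var_measure] Cs C(2) by (auto intro: le_less_trans)
  have CAtop: "emeasure var_measure (C - A) \<noteq> top" and e2: "0 < e / 2" using CAfin e by auto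
  obtain W where W: "openin (top_of_set U) W" "C - A \<subseteq> W"
    "emeasure var_measure W \<le> emeasure var_measure (C - A) + ennreal (e / 2)"
    by (rule outer_regular[OF CA CAtop e2]) blast
  have Ws: "W \<in> sets var_measure" by (rule open_sets_var_measure[OF W(1)])
  have "emeasure var_measure (C - A) + emeasure var_measure (W \<inter> A) = emeasure var_measure ((C - A) \<union> (W \<inter> A))"
    using CA Ws A by (intro plus_emeasure) auto
  also have "\<dots> \<le> emeasure var_measure W" using W Ws by (intro emeasure_mono) auto
  also have "\<dots> \<le> emeasure var_measure (C - A) + ennreal (e / 2)" by (rule W(3))
  finally have WA: "emeasure var_measure (W \<inter> A) \<le> ennreal (e / 2)"
    using CAfin by (auto simp: ennreal_add_left_cancel_le)
  obtain T where T: "open T" "W = U \<inter> T" using W(1) by (auto simp: openin_open)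
  show thesis
  proof (rule that[of "D - T"])
    show "compact (D - T)" using D(1) T(1) by (rule compact_diff)
    show "D - T \<subseteq> A" using fC(2) W(2) T(2) D(2) by auto
    have "A - (D - T) \<subseteq> (C - D) \<union> (W \<inter> A)" using A T D openin_imp_subset[OF C(1)] by auto
    then have "emeasure var_measure (A - (D - T)) \<le> emeasure var_measure ((C - D) \<union> (W \<inter> A))"
      using Cs Ds Ws A by (intro emeasure_mono) auto
    also have "\<dots> \<le> emeasure var_measure (C - D) + emeasure var_measure (W \<inter> A)"
      using Cs Ds Ws A by (intro emeasure_subadditive) auto
    also have "\<dots> \<le> ennreal (e / 2) + ennreal (e / 2)" by (intro add_mono CD WA)
    also have "\<dots> = ennreal e" using e by (simp flip: ennreal_plus)
    finally show "emeasure var_measure (A - (D - T)) \<le> ennreal e" .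
  qed
qed

text \<open>Splitting \<open>f\<close> repeatedly by cutoff functions, one level set of \<open>|f|\<close> at a time, gives a discrete
  version of \<open>S(f) \<le> \<integral>|f| d\<parallel>S\<parallel>\<close>.\<close>

lemma abs_S_le_peel:
  assumes "finite J" and "\<And>j. j \<in> J \<Longrightarrow> compact (K j) \<and> K j \<subseteq> W j \<and> openin (top_of_set U) (W j) \<and> 0 \<le> c j"
  shows "f \<in> Cc_infty n U \<Longrightarrow> openin (top_of_set U) C \<Longrightarrow> spt f \<subseteq> C \<Longrightarrow> (\<And>x. norm (f x) \<le> b) \<Longrightarrow>
    (\<And>j x. j \<in> J \<Longrightarrow> x \<in> W j \<Longrightarrow> norm (f x) \<le> c j) \<Longrightarrow>
    ennreal \<bar>S f\<bar> \<le> (\<Sum>j\<in>J. ennreal (c j) * var_open (W j)) + ennreal b * var_open (C - (\<Union>j\<in>J. K j))"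
  using assms
proof (induction J arbitrary: f C)
  case empty
  then show ?case using abs_S_le[of f C b] by simp
next
  case (insert j J)
  have W: "openin (Rn_top n) (W j)" "compact (K j)" "K j \<subseteq> W j" "0 \<le> c j" 
    using insert.prems(6)[of j] openin_U_iff by auto
  obtain g h where gh: "g \<in> Cc_infty n U" "h \<in> Cc_infty n U" "\<And>x. f x = g x + h x"
    "spt g \<subseteq> spt f \<inter> W j" "spt h \<subseteq> spt f - K j" "\<And>x. norm (g x) \<le> norm (f x)" "\<And>x. norm (h x) \<le> norm (f x)"
    by (rule Cc_infty_split[OF insert.prems(1) open_U W(1,2,3)]) blast
  have CK: "openin (top_of_set U) (C - K j)"
    using insert.prems(2) compact_imp_closed[OF W(2)] by (metis closed_def openin_Int_open Diff_eq)
  have "ennreal \<bar>S h\<bar> \<le> (\<Sum>j\<in>J. ennreal (c j) * var_open (W j)) + ennreal b * var_open (C - K j - (\<Union>j\<in>J. K j))"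
  proof (rule insert.IH[OF gh(2) CK])
    show "spt h \<subseteq> C - K j" using gh(5) insert.prems(3) by auto
    show "norm (h x) \<le> b" for x by (rule order_trans[OF gh(7) insert.prems(4)])
    show "norm (h x) \<le> c i" if "i \<in> J" "x \<in> W i" for i x
      using order_trans[OF gh(7) insert.prems(5)] that by auto
    show "compact (K i) \<and> K i \<subseteq> W i \<and> openin (top_of_set U) (W i) \<and> 0 \<le> c i" if "i \<in> J" for i
      using insert.prems(6) that by auto
  qed
  note Sh = this
  have Sg: "ennreal \<bar>S g\<bar> \<le> ennreal (c j) * var_open (W j)"
  proof (rule abs_S_le[OF gh(1)])
    show "spt g \<subseteq> W j" using gh(4) by auto
    fix x
    show "norm (g x) \<le> c j"
    proof (cases "x \<in> W j")
      case True
      then show ?thesis using order_trans[OF gh(6) insert.prems(5)] by auto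
    next
      case False
      then have "g x = 0" using gh(4) by (intro not_in_spt) auto
      then show ?thesis using W(4) by simp
    qed
  qed
  have "ennreal \<bar>S f\<bar> \<le> ennreal \<bar>S g\<bar> + ennreal \<bar>S h\<bar>"
  proof -
    have "f = (\<lambda>x. g x + h x)" using gh(3) by auto
    then have "S f = S g + S h" using S_add[OF gh(1,2)] by simp
    then show ?thesis by (simp add: abs_triangle_ineq ennreal_leI flip: ennreal_plus)
  qed
  also have "\<dots> \<le> ennreal (c j) * var_open (W j) +
     ((\<Sum>j\<in>J. ennreal (c j) * var_open (W j)) + ennreal b * var_open (C - K j - (\<Union>j\<in>J. K j)))"
    by (rule add_mono[OF Sg Sh])
  also have "C - K j - (\<Union>j\<in>J. K j) = C - (\<Union>j\<in>insert j J. K j)" by auto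
  finally show ?case using insert.hyps by (simp add: add.assoc)
qed

lemma measurable_var_measure:
  fixes f :: "fseq \<Rightarrow> 'b::topological_space"
  assumes "continuous_on U f" shows "f \<in> borel_measurable var_measure"
proof -
  have "sets (restrict_space borel U) = sets var_measure"
    unfolding sets_restrict_space sets_var_measure by (auto intro!: image_eqI[of _ "(\<inter>) U"])
  then show ?thesis
    using borel_measurable_continuous_on_restrict[OF assms] measurable_cong_sets by blast
qed

lemma Cc_infty_continuous: "f \<in> Cc_infty n U \<Longrightarrow> continuous_on U f"
  using Cc_inftyD(1)[of f n U 0] by simp

lemma Cc_infty_measurable: "f \<in> Cc_infty n U \<Longrightarrow> f \<in> borel_measurable var_measure"
  by (intro measurable_var_measure Cc_infty_continuous)

lemma Cc_infty_bounded:
  assumes f: "f \<in> Cc_infty n U"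
  obtains b where "0 < b" "\<And>x. norm (f x) \<le> b"
proof -
  have "compact (f ` spt f)"
    by (rule compact_continuous_image[OF continuous_on_subset[OF Cc_infty_continuous[OF f]]])
       (use Cc_inftyD[OF f] in auto)
  then obtain b where b: "0 < b" "\<And>y. y \<in> f ` spt f \<Longrightarrow> norm y \<le> b"
    using compact_imp_bounded bounded_pos by metis
  have "norm (f x) \<le> b" for x
    using b not_in_spt[of x f] by (cases "x \<in> spt f") auto
  then show thesis using that b(1) by blast
qed

lemma abs_S_le_nn_integral:
  assumes f: "f \<in> Cc_infty n U"
  shows "ennreal \<bar>S f\<bar> \<le> (\<integral>\<^sup>+x. ennreal (norm (f x)) \<partial>var_measure)"
proof -
  obtain b where b: "0 < b" "\<And>x. norm (f x) \<le> b" using Cc_infty_bounded[OF f] by blast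
  obtain C where C: "openin (top_of_set U) C" "spt f \<subseteq> C" "emeasure var_measure C < \<infinity>"
    using finite_open_nbhd[OF Cc_inftyD(3,4)[OF f]] by blast
  have Cs [measurable]: "C \<in> sets var_measure" by (rule open_sets_var_measure[OF C(1)])
  have [measurable]: "f \<in> borel_measurable var_measure" by (rule Cc_infty_measurable[OF f])
  have CU: "C \<subseteq> U" using C(1) openin_imp_subset by blast
  define q where "q = measure var_measure C"
  have q: "emeasure var_measure C = ennreal q" "0 \<le> q"
    using C(3) by (auto simp: q_def emeasure_eq_ennreal_measure)
  show ?thesis
  proof (rule ennreal_le_epsilon)
    fix e0 :: real assume e0: "0 < e0"
    \<comment> \<open>The final error is \<open>2 * e * q + e\<close>, with \<open>q\<close> the
      mass of the neighbourhood \<open>C\<close>; this choice makes it equal to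
      \<open>e0\<close>.\<close>
    define e where "e = e0 / (2 * q + 1)"
    have e: "0 < e" using e0 q(2) by (simp add: e_def)
    obtain k :: nat where k: "b < real k * e" using reals_Archimedean3[OF e] by blast
    have k0: "0 < k" using k b(1) by (cases k) auto
    \<comment> \<open>\<open>d\<close> is the mass lost per level. The \<open>k\<close> terms
      \<open>(k + 2) * e * d\<close> and the \<open>k\<close> terms \<open>b * d\<close> then add up
      to \<open>e\<close>.\<close>
    define d where "d = e / (real k * (real (k + 2) * e + b))"
    have d: "0 < d" using e k0 b by (auto simp: d_def intro!: divide_pos_pos mult_pos_pos add_pos_pos)
    define A where "A j = {x \<in> C. real j * e \<le> norm (f x) \<and> norm (f x) < real (j + 1) * e}" for j
    have As [measurable]: "A j \<in> sets var_measure" for j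
    proof -
      have "A j = C \<inter> {x \<in> space var_measure. real j * e \<le> norm (f x) \<and> norm (f x) < real (j + 1) * e}"
        using CU by (auto simp: A_def)
      moreover have "{x \<in> space var_measure. real j * e \<le> norm (f x) \<and> norm (f x) < real (j + 1) * e} \<in> sets var_measure"
        by measurable
      ultimately show ?thesis by auto
    qed
    have AC: "A j \<subseteq> C" for j by (auto simp: A_def)
    have Afin: "emeasure var_measure (A j) < \<infinity>" for j
      by (rule le_less_trans[OF emeasure_mono[OF AC Cs] C(3)])
    have A_unique: "i = j" if "x \<in> A i" "x \<in> A j" for x i j
    proof -
      have "real i * e < real (j + 1) * e" "real j * e < real (i + 1) * e"
        using that by (auto simp: A_def)
      from this[THEN mult_less_cancel_right_pos[OF e, THEN iffD1]]
      show ?thesis by linarith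
    qed
    have disj: "disjoint_family_on A {..<k}" using A_unique by (auto simp: disjoint_family_on_def)
    have cover: "C = (\<Union>j<k. A j)"
    proof (intro equalityI subsetI)
      fix x assume x: "x \<in> C"
      define j where "j = nat \<lfloor>norm (f x) / e\<rfloor>"
      have "real j \<le> norm (f x) / e" "norm (f x) / e < real j + 1"
      proof -
        have "real j = real_of_int \<lfloor>norm (f x) / e\<rfloor>" using e by (simp add: j_def)
        then show "real j \<le> norm (f x) / e" "norm (f x) / e < real j + 1" by linarith+
      qed
      then have *: "real j * e \<le> norm (f x)" "norm (f x) < real (j + 1) * e"
        using e by (auto simp: field_simps)
      have "real j * e < real k * e" using *(1) b(2)[of x] k by linarith
      then have "j < k" using e by simp
      then show "x \<in> (\<Union>j<k. A j)" using x * by (auto simp: A_def)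
    qed (use AC in auto)
    have "\<exists>K. compact K \<and> K \<subseteq> A j \<and> emeasure var_measure (A j - K) \<le> ennreal d" for j
      using inner_regular[OF As AC C(1,3) d] by metis
    then obtain K where K: "\<And>j. compact (K j)" "\<And>j. K j \<subseteq> A j" "\<And>j. emeasure var_measure (A j - K j) \<le> ennreal d"
      by metis
    have Ks [measurable]: "K j \<in> sets var_measure" for j
      using K AC CU by (intro compact_sets_var_measure) blast+
    \<comment> \<open>On \<open>A j\<close> the norm is below \<open>(j + 1) * e\<close>; one level
      more is still an open condition and holds around \<open>K j\<close>. The excess
      \<open>2 * e\<close> over the lower end of the level is the origin of the error
      \<open>2 * e * q\<close>.\<close>
    have "\<exists>W. openin (top_of_set U) W \<and> K j \<subseteq> W \<and> var_open W \<le> emeasure var_measure (A j) + ennreal d \<and>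
       (\<forall>x\<in>W. norm (f x) \<le> real (j + 2) * e)" for j
    proof -
      have "emeasure var_measure (K j) \<le> emeasure var_measure (A j)" using K As by (intro emeasure_mono) auto
      then have "emeasure var_measure (K j) \<noteq> top" using Afin[of j] by (auto simp: top_unique)
      then obtain W' where W': "openin (top_of_set U) W'" "K j \<subseteq> W'"
        "emeasure var_measure W' \<le> emeasure var_measure (K j) + ennreal d"
        by (rule outer_regular[OF Ks _ d]) blast+
      define W where "W = W' \<inter> (U \<inter> (\<lambda>x. norm (f x)) -` {..<real (j + 2) * e})"
      have oW: "openin (top_of_set U) W"
        unfolding W_def by (intro openin_Int W' continuous_openin_preimage_gen continuous_on_norm Cc_infty_continuous[OF f]) auto
      have "var_open W \<le> var_open W'" by (rule var_open_mono) (auto simp: W_def)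
      also have "\<dots> = emeasure var_measure W'" by (rule emeasure_var_open[OF W'(1), symmetric])
      also have "\<dots> \<le> emeasure var_measure (K j) + ennreal d" by (rule W'(3))
      also have "\<dots> \<le> emeasure var_measure (A j) + ennreal d"
        using K(2) As by (intro add_right_mono emeasure_mono) auto
      finally have "var_open W \<le> emeasure var_measure (A j) + ennreal d" .
      moreover have "K j \<subseteq> W"
      proof
        fix x assume x: "x \<in> K j"
        then have xA: "x \<in> A j" using K(2) by auto
        then have "norm (f x) < real (j + 1) * e" by (simp add: A_def)
        also have "\<dots> \<le> real (j + 2) * e" using e by (intro mult_right_mono) auto
        finally show "x \<in> W" using x W'(2) xA AC CU by (auto simp: W_def)
      qed
      ultimately show ?thesis using oW by (intro exI[of _ W]) (auto simp: W_def)
    qed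
    then obtain W where W: "\<And>j. openin (top_of_set U) (W j)" "\<And>j. K j \<subseteq> W j"
      "\<And>j. var_open (W j) \<le> emeasure var_measure (A j) + ennreal d"
      "\<And>j x. x \<in> W j \<Longrightarrow> norm (f x) \<le> real (j + 2) * e" by metis
    have oCK: "openin (top_of_set U) (C - (\<Union>j<k. K j))"
    proof -
      have "closed (\<Union>j<k. K j)" using K(1) by (intro closed_UN) (auto intro: compact_imp_closed)
      then show ?thesis using C(1) by (metis closed_def openin_Int_open Diff_eq)
    qed
    have "ennreal \<bar>S f\<bar> \<le> (\<Sum>j<k. ennreal (real (j + 2) * e) * var_open (W j)) + ennreal b * var_open (C - (\<Union>j<k. K j))"
      by (rule abs_S_le_peel[OF _ _ f C(1,2) b(2)]) (use K W e in auto)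
    also have "\<dots> \<le> (\<Sum>j<k. ennreal (real j * e) * emeasure var_measure (A j) + ennreal (2 * e) * emeasure var_measure (A j)
        + ennreal (real (k + 2) * e * d)) + ennreal b * (\<Sum>j<k. ennreal d)"
    proof (intro add_mono sum_mono mult_left_mono)
      fix j assume "j \<in> {..<k}"
      have "ennreal (real (j + 2) * e) * var_open (W j) \<le> ennreal (real (j + 2) * e) * (emeasure var_measure (A j) + ennreal d)"
        by (intro mult_left_mono W) auto
      also have "\<dots> = ennreal (real (j + 2) * e) * emeasure var_measure (A j) + ennreal (real (j + 2) * e) * ennreal d"
        by (rule distrib_left)
      also have "\<dots> = (ennreal (real j * e) + ennreal (2 * e)) * emeasure var_measure (A j) + ennreal (real (j + 2) * e * d)"
      proof -
        have "ennreal (real (j + 2) * e) = ennreal (real j * e) + ennreal (2 * e)"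
          using e by (simp add: distrib_right flip: ennreal_plus)
        moreover have "ennreal (real (j + 2) * e) * ennreal d = ennreal (real (j + 2) * e * d)"
          by (rule ennreal_mult[symmetric]) (use e d in auto)
        ultimately show ?thesis by (simp only:)
      qed
      also have "\<dots> \<le> (ennreal (real j * e) + ennreal (2 * e)) * emeasure var_measure (A j) + ennreal (real (k + 2) * e * d)"
        using \<open>j \<in> {..<k}\<close> e d by (intro add_left_mono ennreal_leI mult_right_mono) auto
      finally show "ennreal (real (j + 2) * e) * var_open (W j) \<le> ennreal (real j * e) * emeasure var_measure (A j) +
          ennreal (2 * e) * emeasure var_measure (A j) + ennreal (real (k + 2) * e * d)"
        by (simp only: distrib_right)
    next
      have "var_open (C - (\<Union>j<k. K j)) = emeasure var_measure (C - (\<Union>j<k. K j))"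
        by (rule emeasure_var_open[OF oCK, symmetric])
      also have "\<dots> \<le> emeasure var_measure (\<Union>j<k. A j - K j)"
        using cover by (intro emeasure_mono) auto
      also have "\<dots> \<le> (\<Sum>j<k. emeasure var_measure (A j - K j))"
        by (rule emeasure_subadditive_finite) auto
      also have "\<dots> \<le> (\<Sum>j<k. ennreal d)" by (intro sum_mono K)
      finally show "var_open (C - (\<Union>j<k. K j)) \<le> (\<Sum>j<k. ennreal d)" .
    qed auto
    also have "\<dots> = (\<Sum>j<k. ennreal (real j * e) * emeasure var_measure (A j)) + ennreal (2 * e) * emeasure var_measure C
       + (ennreal (real k * (real (k + 2) * e * d)) + ennreal (b * (real k * d)))"
    proof -
      have "(\<Sum>j<k. emeasure var_measure (A j)) = emeasure var_measure C"
        unfolding cover by (rule sum_emeasure) (use disj in auto)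
      moreover have "(\<Sum>j<k. ennreal x) = ennreal (real k * x)" if "0 \<le> x" for x
        using that by (subst sum_ennreal) auto
      moreover have "0 \<le> real (k + 2) * e * d" "0 \<le> d" using e d by auto
      ultimately have "(\<Sum>j<k. ennreal (real (k + 2) * e * d)) = ennreal (real k * (real (k + 2) * e * d))"
        "ennreal b * (\<Sum>j<k. ennreal d) = ennreal (b * (real k * d))"
        "(\<Sum>j<k. ennreal (2 * e) * emeasure var_measure (A j)) = ennreal (2 * e) * emeasure var_measure C"
        using b(1) by (simp_all add: ennreal_mult sum_distrib_left[symmetric])
      then show ?thesis by (simp only: sum.distrib add.assoc)
    qed
    also have "ennreal (real k * (real (k + 2) * e * d)) + ennreal (b * (real k * d)) = ennreal e"
    proof -
      have "real k * (real (k + 2) * e * d) + b * (real k * d) = d * (real k * (real (k + 2) * e + b))"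
        by (simp add: algebra_simps)
      also have "\<dots> = e"
      proof -
        have "0 < real k * (real (k + 2) * e + b)" using e k0 b by (auto intro!: mult_pos_pos add_pos_pos)
        then have "real k * (real (k + 2) * e + b) \<noteq> 0" by (rule less_imp_neq[symmetric])
        then show ?thesis unfolding d_def times_divide_eq_left by (rule nonzero_mult_div_cancel_right)
      qed
      finally show ?thesis using e d b by (simp flip: ennreal_plus)
    qed
    also have "(\<Sum>j<k. ennreal (real j * e) * emeasure var_measure (A j)) \<le> (\<integral>\<^sup>+x. ennreal (norm (f x)) \<partial>var_measure)"
    proof -
      have "(\<Sum>j<k. ennreal (real j * e) * emeasure var_measure (A j))
        = (\<integral>\<^sup>+x. (\<Sum>j<k. ennreal (real j * e) * indicator (A j) x) \<partial>var_measure)"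
        by (subst nn_integral_sum) (auto simp: nn_integral_cmult)
      also have "\<dots> \<le> (\<integral>\<^sup>+x. ennreal (norm (f x)) \<partial>var_measure)"
      proof (rule nn_integral_mono)
        fix x
        show "(\<Sum>j<k. ennreal (real j * e) * indicator (A j) x) \<le> ennreal (norm (f x))"
        proof (cases "\<exists>i<k. x \<in> A i")
          case True
          then obtain i where i: "i < k" "x \<in> A i" by auto
          have "(\<Sum>j<k. ennreal (real j * e) * indicator (A j) x) = (\<Sum>j<k. if j = i then ennreal (real i * e) else 0)"
            by (rule sum.cong) (use i A_unique in \<open>auto simp: indicator_def\<close>)
          also have "\<dots> = ennreal (real i * e)" using i by simp
          also have "\<dots> \<le> ennreal (norm (f x))" using i by (intro ennreal_leI) (auto simp: A_def)
          finally show ?thesis .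
        next
          case False
          then have "(\<Sum>j<k. ennreal (real j * e) * indicator (A j) x) = 0"
            by (intro sum.neutral) auto
          then show ?thesis by simp
        qed
      qed
      finally show ?thesis .
    qed
    finally have "ennreal \<bar>S f\<bar> \<le> (\<integral>\<^sup>+x. ennreal (norm (f x)) \<partial>var_measure) + ennreal (2 * e) * ennreal q + ennreal e"
      by (simp add: q add_right_mono)
    also have "\<dots> = (\<integral>\<^sup>+x. ennreal (norm (f x)) \<partial>var_measure) + ennreal (2 * e * q + e)"
      using e q(2) by (simp add: ennreal_mult add.assoc)
    also have "2 * e * q + e = e0"
    proof -
      have "2 * q + 1 \<noteq> 0" using q(2) by simp
      moreover have "2 * e * q + e = (2 * q + 1) * e" by (simp add: algebra_simps)
      ultimately show ?thesis by (simp add: e_def)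
    qed
    finally show "ennreal \<bar>S f\<bar> \<le> (\<integral>\<^sup>+x. ennreal (norm (f x)) \<partial>var_measure) + ennreal e0" .
  qed
qed

section \<open>Integrable fields and their approximation by test fields\<close>

abbreviation cvar :: "fseq measure" where "cvar \<equiv> completion var_measure"

definition L1_dist :: "(fseq \<Rightarrow> fseq) \<Rightarrow> (fseq \<Rightarrow> fseq) \<Rightarrow> ennreal" where
  "L1_dist f g = (\<integral>\<^sup>+z. ennreal (norm (f z - g z)) \<partial>cvar)"

lemma L1_iff: "f \<in> L1 n var_measure \<longleftrightarrow>
    f \<in> borel_measurable cvar \<and> f ` U \<subseteq> Rn n \<and> (\<integral>\<^sup>+z. ennreal (norm (f z)) \<partial>cvar) < \<infinity>"
  by (simp add: L1_def)

lemma L1_measurable: "f \<in> L1 n var_measure \<Longrightarrow> f \<in> borel_measurable cvar"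
  by (simp add: L1_iff)

lemma Cc_infty_L1: "f \<in> Cc_infty n U \<Longrightarrow> f \<in> L1 n var_measure"
proof -
  assume f: "f \<in> Cc_infty n U"
  obtain b where b: "0 < b" "\<And>x. norm (f x) \<le> b" using Cc_infty_bounded[OF f] by blast
  have s: "spt f \<in> sets var_measure" using Cc_inftyD[OF f] by (intro compact_sets_var_measure)
  have "(\<integral>\<^sup>+z. ennreal (norm (f z)) \<partial>var_measure) \<le> (\<integral>\<^sup>+z. ennreal b * indicator (spt f) z \<partial>var_measure)"
    by (rule nn_integral_mono) (use b not_in_spt[of _ f] in \<open>auto simp: indicator_def intro: ennreal_leI\<close>)
  also have "\<dots> = ennreal b * emeasure var_measure (spt f)" by (rule nn_integral_cmult_indicator[OF s])
  also have "\<dots> < \<infinity>"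
    using finite_compact[OF Cc_inftyD(3,4)[OF f]] by (simp add: ennreal_mult_less_top)
  finally show ?thesis
    using Cc_infty_measurable[OF f] Cc_inftyD(2)[OF f] by (auto simp: L1_iff nn_integral_completion measurable_completion)
qed

lemma L1_dist_triangle:
  assumes "f \<in> L1 n var_measure" "g \<in> L1 n var_measure" "h \<in> L1 n var_measure"
  shows "L1_dist f h \<le> L1_dist f g + L1_dist g h"
proof -
  note [measurable] = assms[THEN L1_measurable]
  have "L1_dist f h \<le> (\<integral>\<^sup>+z. ennreal (norm (f z - g z)) + ennreal (norm (g z - h z)) \<partial>cvar)"
    unfolding L1_dist_def
  proof (rule nn_integral_mono)
    fix z
    have "norm (f z - h z) \<le> norm (f z - g z) + norm (g z - h z)"
      using norm_triangle_ineq[of "f z - g z" "g z - h z"] by simp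
    then show "ennreal (norm (f z - h z)) \<le> ennreal (norm (f z - g z)) + ennreal (norm (g z - h z))"
      by (simp flip: ennreal_plus)
  qed
  also have "\<dots> = L1_dist f g + L1_dist g h"
    unfolding L1_dist_def by (rule nn_integral_add) measurable
  finally show ?thesis .
qed

lemma L1_dist_commute: "L1_dist f g = L1_dist g f"
  by (simp add: L1_dist_def norm_minus_commute)

lemma L1_add:
  assumes "f \<in> L1 n var_measure" "g \<in> L1 n var_measure"
  shows "(\<lambda>z. f z + g z) \<in> L1 n var_measure"
proof -
  note [measurable] = assms[THEN L1_measurable]
  have "(\<integral>\<^sup>+z. ennreal (norm (f z + g z)) \<partial>cvar) \<le> (\<integral>\<^sup>+z. ennreal (norm (f z)) + ennreal (norm (g z)) \<partial>cvar)"
    by (rule nn_integral_mono) (simp add: norm_triangle_ineq ennreal_leI flip: ennreal_plus)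
  also have "\<dots> = (\<integral>\<^sup>+z. ennreal (norm (f z)) \<partial>cvar) + (\<integral>\<^sup>+z. ennreal (norm (g z)) \<partial>cvar)"
    by (rule nn_integral_add) measurable
  also have "\<dots> < \<infinity>" using assms by (simp add: L1_iff)
  finally show ?thesis using assms by (auto simp: L1_iff intro: Rn_add)
qed

lemma L1_scaleR:
  assumes "f \<in> L1 n var_measure"
  shows "(\<lambda>z. c *\<^sub>R f z) \<in> L1 n var_measure"
proof -
  note [measurable] = assms[THEN L1_measurable]
  have "(\<integral>\<^sup>+z. ennreal (norm (c *\<^sub>R f z)) \<partial>cvar) = (\<integral>\<^sup>+z. ennreal \<bar>c\<bar> * ennreal (norm (f z)) \<partial>cvar)"
    by (rule nn_integral_cong) (simp add: ennreal_mult)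
  also have "\<dots> = ennreal \<bar>c\<bar> * (\<integral>\<^sup>+z. ennreal (norm (f z)) \<partial>cvar)"
    by (rule nn_integral_cmult) measurable
  also have "\<dots> < \<infinity>" using assms by (simp add: L1_iff ennreal_mult_less_top)
  finally show ?thesis using assms by (auto simp: L1_iff intro: Rn_scaleR)
qed

lemma S_diff_le:
  assumes "f \<in> Cc_infty n U" "g \<in> Cc_infty n U"
  shows "ennreal \<bar>S f - S g\<bar> \<le> L1_dist f g"
proof -
  have "(\<lambda>x. f x + (- 1) *\<^sub>R g x) \<in> Cc_infty n U"
    by (intro Cc_infty_add Cc_infty_scaleR assms U_Rn)
  from abs_S_le_nn_integral[OF this]
  have "ennreal \<bar>S (\<lambda>x. f x + (- 1) *\<^sub>R g x)\<bar> \<le> (\<integral>\<^sup>+x. ennreal (norm (f x - g x)) \<partial>var_measure)" by simp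
  moreover have "S (\<lambda>x. f x + (- 1) *\<^sub>R g x) = S f - S g"
    using S_add[OF assms(1) Cc_infty_scaleR[OF assms(2) U_Rn, of "- 1"]] S_scaleR[OF assms(2), of "- 1"] by simp
  ultimately show ?thesis by (simp add: L1_dist_def nn_integral_completion)
qed

text \<open>Approximability in L1 by smooth functions with compact support in \<open>U\<close>,
  stated for a single real function as the induction over integrable functions demands.\<close>

definition smooth_approx :: "(fseq \<Rightarrow> real) \<Rightarrow> bool" where
  "smooth_approx h \<longleftrightarrow> (\<forall>e>0. \<exists>\<phi> L. (\<forall>k. Ck (Rn n) (Rn n) k \<phi>) \<and> compact L \<and> L \<subseteq> U \<and> (\<forall>x. x \<notin> L \<longrightarrow> \<phi> x = 0) \<and>
     \<phi> \<in> borel_measurable cvar \<and> (\<integral>\<^sup>+z. ennreal \<bar>h z - \<phi> z\<bar> \<partial>cvar) \<le> ennreal e)"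

lemma smooth_measurable:
  fixes \<phi> :: "fseq \<Rightarrow> real"
  assumes "Ck (Rn n) (Rn n) 0 \<phi>" shows "\<phi> \<in> borel_measurable cvar"
  using assms U_Rn by (intro measurable_completion measurable_var_measure) (auto intro: continuous_on_subset)

text \<open>A smooth cutoff between a compact set \<open>K\<close> inside and an open set
  \<open>C\<close> outside differs from the indicator only on \<open>C - K\<close>. The regularity
  lemmas concern Borel sets, hence the passage to the main part of \<open>A\<close>.\<close>

lemma smooth_approx_indicator:
  assumes A: "A \<in> sets cvar" "emeasure cvar A < \<infinity>"
  shows "smooth_approx (\<lambda>x. indicator A x *\<^sub>R c)"
  unfolding smooth_approx_def
proof (intro allI impI)
  fix e :: real assume e: "0 < e"
  define d where "d = e / (2 * (\<bar>c\<bar> + 1))"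
  have d: "0 < d" using e by (simp add: d_def)
  define A' where "A' = main_part var_measure A"
  have A': "A' \<in> sets var_measure" using main_part_sets[of A var_measure] A by (simp add: A'_def)
  have A'fin: "emeasure var_measure A' \<noteq> top" using A by (simp add: A'_def emeasure_completion)
  obtain C where C: "openin (top_of_set U) C" "A' \<subseteq> C" "emeasure var_measure C \<le> emeasure var_measure A' + ennreal d"
    by (rule outer_regular[OF A' A'fin d]) blast
  have Cs [measurable]: "C \<in> sets var_measure" by (rule open_sets_var_measure[OF C(1)])
  have Cfin: "emeasure var_measure C < \<infinity>" using C(3) A'fin by (auto simp: top_unique less_top[symmetric])
  obtain K where K: "compact K" "K \<subseteq> A'" "emeasure var_measure (A' - K) \<le> ennreal d"
    by (rule inner_regular[OF A' C(2,1) Cfin d]) blast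
  have CU: "C \<subseteq> U" using C(1) openin_imp_subset by blast
  have Ks: "K \<in> sets var_measure" using K C CU by (intro compact_sets_var_measure) auto
  have oC: "openin (Rn_top n) C" using C(1) openin_U_iff by simp
  have KC: "K \<subseteq> C" using K C by auto
  obtain \<zeta> :: "fseq \<Rightarrow> real" and L N where z: "\<And>k. Ck (Rn n) (Rn n) k \<zeta>" "\<And>x. 0 \<le> \<zeta> x" "\<And>x. \<zeta> x \<le> 1"
    "openin (Rn_top n) N" "K \<subseteq> N" "\<And>x. x \<in> N \<Longrightarrow> \<zeta> x = 1"
    "compact L" "L \<subseteq> C" "\<And>x. x \<notin> L \<Longrightarrow> \<zeta> x = 0"
    by (rule smooth_urysohn[OF oC K(1) KC]) blast
  have CK: "emeasure var_measure (C - K) \<le> ennreal (2 * d)"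
  proof -
    have "emeasure var_measure A' + emeasure var_measure (C - A') = emeasure var_measure (A' \<union> (C - A'))"
      using A' Cs by (intro plus_emeasure) auto
    also have "A' \<union> (C - A') = C" using C(2) by auto
    also have "emeasure var_measure C \<le> emeasure var_measure A' + ennreal d" by (rule C(3))
    finally have CA: "emeasure var_measure (C - A') \<le> ennreal d"
      using A'fin by (auto simp: ennreal_add_left_cancel_le)
    have "C - K = (C - A') \<union> (A' - K)" using C K by auto
    then have "emeasure var_measure (C - K) \<le> emeasure var_measure (C - A') + emeasure var_measure (A' - K)"
      using emeasure_subadditive[of "C - A'" var_measure "A' - K"] Cs A' Ks by auto
    also have "\<dots> \<le> ennreal d + ennreal d" by (rule add_mono[OF CA K(3)])
    finally show ?thesis using d by (simp flip: ennreal_plus)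
  qed
  have "AE x in cvar. (x \<in> A) = (x \<in> A')"
    using AE_completion[OF AE_notin_null_part[OF A(1)]]
  proof (rule eventually_mono)
    fix x assume "x \<notin> null_part var_measure A"
    then show "(x \<in> A) = (x \<in> A')" using main_part_null_part_Un[OF A(1)] by (auto simp: A'_def)
  qed
  then have "AE x in cvar. ennreal \<bar>indicator A x *\<^sub>R c - \<zeta> x * c\<bar> \<le> ennreal \<bar>c\<bar> * indicator (C - K) x"
  proof (rule eventually_mono)
    fix x assume x: "(x \<in> A) = (x \<in> A')"
    show "ennreal \<bar>indicator A x *\<^sub>R c - \<zeta> x * c\<bar> \<le> ennreal \<bar>c\<bar> * indicator (C - K) x"
    proof (cases "x \<in> C - K")
      case True
      have "\<bar>indicator A x - \<zeta> x\<bar> \<le> 1" using z(2,3)[of x] by (auto simp: indicator_def)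
      then have "\<bar>(indicator A x - \<zeta> x) * c\<bar> \<le> \<bar>c\<bar>" unfolding abs_mult by (rule mult_left_le_one_le[rotated 2]) auto
      then show ?thesis using True by (simp add: left_diff_distrib ennreal_leI)
    next
      case False
      have "indicator A x = \<zeta> x"
      proof (cases "x \<in> K")
        case True
        then show ?thesis using x K(2) z(5,6) by (auto simp: indicator_def)
      next
        case nK: False
        then have "x \<notin> C" using False by auto
        then have "\<zeta> x = 0" "x \<notin> A" using z(8,9) x C(2) by auto
        then show ?thesis by simp
      qed
      then show ?thesis by simp
    qed
  qed
  then have "(\<integral>\<^sup>+x. ennreal \<bar>indicator A x *\<^sub>R c - \<zeta> x * c\<bar> \<partial>cvar) \<le> (\<integral>\<^sup>+x. ennreal \<bar>c\<bar> * indicator (C - K) x \<partial>cvar)"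
    by (rule nn_integral_mono_AE)
  also have "\<dots> = ennreal \<bar>c\<bar> * emeasure cvar (C - K)"
    using Cs Ks by (intro nn_integral_cmult_indicator) auto
  also have "\<dots> \<le> ennreal \<bar>c\<bar> * ennreal (2 * d)"
    using CK Cs Ks by (intro mult_left_mono) (auto simp: emeasure_completion)
  also have "\<dots> \<le> ennreal e"
  proof -
    have "\<bar>c\<bar> * (2 * d) \<le> (\<bar>c\<bar> + 1) * (2 * d)" using d by (intro mult_right_mono) auto
    also have "\<dots> = d * (2 * (\<bar>c\<bar> + 1))" by (simp add: algebra_simps)
    also have "\<dots> = e"
      unfolding d_def times_divide_eq_left by (rule nonzero_mult_div_cancel_right) simp
    finally show ?thesis using d by (simp add: ennreal_leI flip: ennreal_mult)
  qed
  finally have "(\<integral>\<^sup>+x. ennreal \<bar>indicator A x *\<^sub>R c - \<zeta> x * c\<bar> \<partial>cvar) \<le> ennreal e" .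
  moreover have "Ck (Rn n) (Rn n) k (\<lambda>x. \<zeta> x * c)" for k by (rule Ck_mult[OF subset_refl z(1) Ck_const])
  ultimately show "\<exists>\<phi> L. (\<forall>k. Ck (Rn n) (Rn n) k \<phi>) \<and> compact L \<and> L \<subseteq> U \<and> (\<forall>x. x \<notin> L \<longrightarrow> \<phi> x = 0) \<and>
     \<phi> \<in> borel_measurable cvar \<and> (\<integral>\<^sup>+z. ennreal \<bar>indicator A z *\<^sub>R c - \<phi> z\<bar> \<partial>cvar) \<le> ennreal e"
    using z(7,8,9) CU smooth_measurable[OF Ck_mult[OF subset_refl z(1) Ck_const]]
    by (intro exI[of _ "\<lambda>x. \<zeta> x * c"] exI[of _ L]) auto
qed

lemma smooth_approx_trans:
  assumes "h \<in> borel_measurable cvar"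
    and "\<And>e. 0 < e \<Longrightarrow> \<exists>g\<in>borel_measurable cvar. smooth_approx g \<and> (\<integral>\<^sup>+z. ennreal \<bar>h z - g z\<bar> \<partial>cvar) \<le> ennreal e"
  shows "smooth_approx h"
  unfolding smooth_approx_def
proof (intro allI impI)
  fix e :: real assume e: "0 < e"
  have "0 < e / 2" using e by simp
  then obtain g where g: "g \<in> borel_measurable cvar" "smooth_approx g"
    "(\<integral>\<^sup>+z. ennreal \<bar>h z - g z\<bar> \<partial>cvar) \<le> ennreal (e / 2)" using assms(2) by blast
  obtain \<phi> L where p: "\<forall>k. Ck (Rn n) (Rn n) k \<phi>" "compact L" "L \<subseteq> U" "\<forall>x. x \<notin> L \<longrightarrow> \<phi> x = 0"
     "\<phi> \<in> borel_measurable cvar" "(\<integral>\<^sup>+z. ennreal \<bar>g z - \<phi> z\<bar> \<partial>cvar) \<le> ennreal (e / 2)"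
    using g(2) \<open>0 < e / 2\<close> unfolding smooth_approx_def by blast
  note [measurable] = assms(1) g(1) p(5)
  have "(\<integral>\<^sup>+z. ennreal \<bar>h z - \<phi> z\<bar> \<partial>cvar) \<le> (\<integral>\<^sup>+z. ennreal \<bar>h z - g z\<bar> + ennreal \<bar>g z - \<phi> z\<bar> \<partial>cvar)"
    by (rule nn_integral_mono) (simp flip: ennreal_plus)
  also have "\<dots> = (\<integral>\<^sup>+z. ennreal \<bar>h z - g z\<bar> \<partial>cvar) + (\<integral>\<^sup>+z. ennreal \<bar>g z - \<phi> z\<bar> \<partial>cvar)"
    by (rule nn_integral_add) measurable
  also have "\<dots> \<le> ennreal (e / 2) + ennreal (e / 2)" by (rule add_mono[OF g(3) p(6)])
  also have "\<dots> = ennreal e" using e by (simp flip: ennreal_plus)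
  finally show "\<exists>\<phi> L. (\<forall>k. Ck (Rn n) (Rn n) k \<phi>) \<and> compact L \<and> L \<subseteq> U \<and> (\<forall>x. x \<notin> L \<longrightarrow> \<phi> x = 0) \<and>
     \<phi> \<in> borel_measurable cvar \<and> (\<integral>\<^sup>+z. ennreal \<bar>h z - \<phi> z\<bar> \<partial>cvar) \<le> ennreal e"
    using p by blast
qed

lemma smooth_approx_add:
  assumes [measurable]: "f \<in> borel_measurable cvar" "g \<in> borel_measurable cvar"
    and f: "smooth_approx f" and g: "smooth_approx g"
  shows "smooth_approx (\<lambda>x. f x + g x)"
  unfolding smooth_approx_def
proof (intro allI impI)
  fix e :: real assume e: "0 < e"
  then have "0 < e / 2" by simp
  obtain \<phi> L where p: "\<forall>k. Ck (Rn n) (Rn n) k \<phi>" "compact L" "L \<subseteq> U" "\<forall>x. x \<notin> L \<longrightarrow> \<phi> x = 0"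
     "\<phi> \<in> borel_measurable cvar" "(\<integral>\<^sup>+z. ennreal \<bar>f z - \<phi> z\<bar> \<partial>cvar) \<le> ennreal (e / 2)"
    using f \<open>0 < e / 2\<close> unfolding smooth_approx_def by blast
  obtain \<psi> L' where q: "\<forall>k. Ck (Rn n) (Rn n) k \<psi>" "compact L'" "L' \<subseteq> U" "\<forall>x. x \<notin> L' \<longrightarrow> \<psi> x = 0"
     "\<psi> \<in> borel_measurable cvar" "(\<integral>\<^sup>+z. ennreal \<bar>g z - \<psi> z\<bar> \<partial>cvar) \<le> ennreal (e / 2)"
    using g \<open>0 < e / 2\<close> unfolding smooth_approx_def by blast
  note [measurable] = p(5) q(5)
  have "(\<integral>\<^sup>+z. ennreal \<bar>f z + g z - (\<phi> z + \<psi> z)\<bar> \<partial>cvar) \<le> (\<integral>\<^sup>+z. ennreal \<bar>f z - \<phi> z\<bar> + ennreal \<bar>g z - \<psi> z\<bar> \<partial>cvar)"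
    by (rule nn_integral_mono) (simp flip: ennreal_plus)
  also have "\<dots> = (\<integral>\<^sup>+z. ennreal \<bar>f z - \<phi> z\<bar> \<partial>cvar) + (\<integral>\<^sup>+z. ennreal \<bar>g z - \<psi> z\<bar> \<partial>cvar)"
    by (rule nn_integral_add) measurable
  also have "\<dots> \<le> ennreal (e / 2) + ennreal (e / 2)" by (rule add_mono[OF p(6) q(6)])
  also have "\<dots> = ennreal e" using e by (simp flip: ennreal_plus)
  finally have le: "(\<integral>\<^sup>+z. ennreal \<bar>f z + g z - (\<phi> z + \<psi> z)\<bar> \<partial>cvar) \<le> ennreal e" .
  show "\<exists>\<phi> L. (\<forall>k. Ck (Rn n) (Rn n) k \<phi>) \<and> compact L \<and> L \<subseteq> U \<and> (\<forall>x. x \<notin> L \<longrightarrow> \<phi> x = 0) \<and>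
     \<phi> \<in> borel_measurable cvar \<and> (\<integral>\<^sup>+z. ennreal \<bar>f z + g z - \<phi> z\<bar> \<partial>cvar) \<le> ennreal e"
    using p(1-4) q(1-4) le by (intro exI[of _ "\<lambda>x. \<phi> x + \<psi> x"] exI[of _ "L \<union> L'"]) (auto intro!: Ck_add)
qed

lemma integrable_smooth_approx:
  fixes h :: "fseq \<Rightarrow> real"
  assumes "integrable cvar h"
  shows "smooth_approx h"
  using assms
proof (induction rule: integrable_induct)
  case (base A c)
  then show ?case by (intro smooth_approx_indicator) auto
next
  case (add f g)
  then show ?case by (intro smooth_approx_add) auto
next
  case (lim f s)
  have "(\<lambda>i. \<integral>\<^sup>+z. ennreal (norm (f z - s i z)) \<partial>cvar) \<longlonglongrightarrow> 0"
  proof (rule nn_integral_dominated_convergence_norm[where w = "\<lambda>x. 2 * norm (f x)"])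
    show "AE x in cvar. norm (s i x) \<le> 2 * norm (f x)" for i by (rule AE_I2) (rule lim.hyps(3))
    show "(\<integral>\<^sup>+x. ennreal (2 * norm (f x)) \<partial>cvar) < \<infinity>"
    proof -
      have "integrable cvar (\<lambda>x. 2 * norm (f x))" using lim.hyps(4) by simp
      then have "(\<integral>\<^sup>+x. ennreal (norm (2 * norm (f x))) \<partial>cvar) < \<infinity>" unfolding integrable_iff_bounded by (rule conjunct2)
      moreover have "norm (2 * norm (f x)) = 2 * norm (f x)" for x by simp
      ultimately show ?thesis by (simp only:)
    qed
    show "AE x in cvar. (\<lambda>i. s i x) \<longlonglongrightarrow> f x" by (rule AE_I2) (rule lim.hyps(2))
  qed (use lim.hyps in auto)
  show ?case
  proof (rule smooth_approx_trans)
    fix e :: real assume "0 < e"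
    then have "\<forall>\<^sub>F i in sequentially. (\<integral>\<^sup>+z. ennreal (norm (f z - s i z)) \<partial>cvar) < ennreal e"
      using \<open>(\<lambda>i. \<integral>\<^sup>+z. ennreal (norm (f z - s i z)) \<partial>cvar) \<longlonglongrightarrow> 0\<close> by (intro order_tendstoD(2)) auto
    then obtain i where "(\<integral>\<^sup>+z. ennreal (norm (f z - s i z)) \<partial>cvar) < ennreal e"
      using eventually_happens'[OF sequentially_bot] by blast
    then show "\<exists>g\<in>borel_measurable cvar. smooth_approx g \<and> (\<integral>\<^sup>+z. ennreal \<bar>f z - g z\<bar> \<partial>cvar) \<le> ennreal e"
      using lim.hyps(1)[of i] lim.IH[of i] by (intro bexI[of _ "s i"]) auto
  qed (use lim.hyps in auto)
qed

lemma L1_approx: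
  assumes f: "f \<in> L1 n var_measure" and e: "0 < (e::real)"
  obtains g where "g \<in> Cc_infty n U" "L1_dist g f \<le> ennreal e"
proof -
  note [measurable] = L1_measurable[OF f]
  \<comment> \<open>Each of the \<open>n\<close> coordinates may contribute the error
    \<open>d\<close>; the 1 avoids division by 0.\<close>
  define d where "d = e / (real n + 1)"
  have d: "0 < d" using e by (simp add: d_def)
  have "integrable cvar (\<lambda>x. inner (f x) (unit_vec i))" for i
  proof (rule integrableI_bounded)
    have "(\<integral>\<^sup>+x. ennreal (norm (inner (f x) (unit_vec i))) \<partial>cvar) \<le> (\<integral>\<^sup>+x. ennreal (norm (f x)) \<partial>cvar)"
      by (rule nn_integral_mono) (simp add: abs_coord_le ennreal_leI)
    also have "\<dots> < \<infinity>" using f by (simp add: L1_iff)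
    finally show "(\<integral>\<^sup>+x. ennreal (norm (inner (f x) (unit_vec i))) \<partial>cvar) < \<infinity>" .
  qed measurable
  then have int: "integrable cvar (\<lambda>x. coord (f x) i)" for i by simp
  then have cm [measurable]: "(\<lambda>x. coord (f x) i) \<in> borel_measurable cvar" for i by (rule borel_measurable_integrable)
  define P where "P i \<phi> L \<longleftrightarrow> (\<forall>k. Ck (Rn n) (Rn n) k \<phi>) \<and> compact L \<and> L \<subseteq> U \<and> (\<forall>x. x \<notin> L \<longrightarrow> \<phi> x = 0) \<and>
     \<phi> \<in> borel_measurable cvar \<and> (\<integral>\<^sup>+z. ennreal \<bar>coord (f z) i - \<phi> z\<bar> \<partial>cvar) \<le> ennreal d" for i \<phi> L
  have "\<exists>\<phi> L. P i \<phi> L" for i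
    using integrable_smooth_approx[OF int[of i]] d unfolding smooth_approx_def P_def by blast
  then obtain \<phi> L where "\<And>i. P i (\<phi> i) (L i)" by metis
  then have p: "\<And>i k. Ck (Rn n) (Rn n) k (\<phi> i)" "\<And>i. compact (L i)" "\<And>i. L i \<subseteq> U"
    "\<And>i x. x \<notin> L i \<Longrightarrow> \<phi> i x = 0" "\<And>i. \<phi> i \<in> borel_measurable cvar"
    "\<And>i. (\<integral>\<^sup>+z. ennreal \<bar>coord (f z) i - \<phi> i z\<bar> \<partial>cvar) \<le> ennreal d"
    unfolding P_def by blast+
  note [measurable] = p(5)
  define g where "g x = (\<Sum>i<n. \<phi> i x *\<^sub>R unit_vec i)" for x
  have "Ck (Rn n) U k (\<lambda>x. \<Sum>i<j. \<phi> i x *\<^sub>R unit_vec i)" for k j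
  proof (induction j)
    case (Suc j)
    then show ?case
      by (auto intro!: Ck_add Ck_scaleR[OF U_Rn Ck_subset[OF U_Rn p(1)] Ck_const])
  qed simp
  then have ck: "Ck (Rn n) U k g" for k by (simp add: g_def[abs_def])
  have gCc: "g \<in> Cc_infty n U"
  proof (rule Cc_inftyI(1)[OF ck, of "\<Union>i<n. L i"])
    show "g x \<in> Rn n" for x unfolding g_def by (intro Rn_sum Rn_scaleR unit_vec_Rn) auto
    show "compact (\<Union>i<n. L i)" by (intro compact_UN p) auto
    show "(\<Union>i<n. L i) \<subseteq> U" using p(3) by auto
    show "g x = 0" if "x \<notin> (\<Union>i<n. L i)" for x
      using that p(4) by (auto simp: g_def intro!: sum.neutral)
  qed
  have "L1_dist g f \<le> (\<integral>\<^sup>+z. (\<Sum>i<n. ennreal \<bar>coord (f z) i - \<phi> i z\<bar>) \<partial>cvar)"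
    unfolding L1_dist_def
  proof (rule nn_integral_mono)
    fix z assume "z \<in> space cvar"
    then have fz: "f z \<in> Rn n" using f by (auto simp: L1_iff)
    have "g z - f z = (\<Sum>i<n. \<phi> i z *\<^sub>R unit_vec i) - (\<Sum>i<n. coord (f z) i *\<^sub>R unit_vec i)"
      unfolding g_def using Rn_expand[OF fz] by (rule arg_cong)
    also have "\<dots> = (\<Sum>i<n. (\<phi> i z - coord (f z) i) *\<^sub>R unit_vec i)"
      by (simp add: sum_subtractf scaleR_diff_left)
    finally have "norm (g z - f z) \<le> (\<Sum>i<n. norm ((\<phi> i z - coord (f z) i) *\<^sub>R unit_vec i))"
      by (simp only: norm_sum)
    also have "\<dots> = (\<Sum>i<n. \<bar>coord (f z) i - \<phi> i z\<bar>)" by (simp add: abs_minus_commute)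
    finally show "ennreal (norm (g z - f z)) \<le> (\<Sum>i<n. ennreal \<bar>coord (f z) i - \<phi> i z\<bar>)"
      by (simp add: ennreal_leI)
  qed
  also have "\<dots> = (\<Sum>i<n. \<integral>\<^sup>+z. ennreal \<bar>coord (f z) i - \<phi> i z\<bar> \<partial>cvar)"
    by (rule nn_integral_sum) measurable
  also have "\<dots> \<le> (\<Sum>i<n. ennreal d)" by (intro sum_mono p)
  also have "\<dots> = ennreal (real n * d)" using d by (subst sum_ennreal) auto
  also have "\<dots> \<le> ennreal e" using e by (intro ennreal_leI) (simp add: d_def field_simps)
  finally show thesis using that gCc by blast
qed

text \<open>The value of the extension at \<open>f\<close> is characterised without choosing a
  sequence, as the only number whose distance from each test value is bounded by the L1 distance of
  the fields. It is the limit along any approximating sequence, which is Cauchy by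
  \<open>S_diff_le\<close>.\<close>

lemma extension_value_exists:
  assumes f: "f \<in> L1 n var_measure"
  shows "\<exists>!l. \<forall>g\<in>Cc_infty n U. ennreal \<bar>S g - l\<bar> \<le> L1_dist g f"
proof (rule ex_ex1I)
  have "\<exists>g. g \<in> Cc_infty n U \<and> L1_dist g f \<le> ennreal (1 / real (Suc k))" for k
    using L1_approx[OF f, of "1 / real (Suc k)"] by auto
  then obtain g where g: "\<And>k. g k \<in> Cc_infty n U" "\<And>k. L1_dist (g k) f \<le> ennreal (1 / real (Suc k))" by metis
  have dist: "\<bar>S h - S (g k)\<bar> \<le> t + 1 / real (Suc k)" if h: "h \<in> Cc_infty n U" "L1_dist h f \<le> ennreal t" "0 \<le> t" for h k t
  proof -
    have "ennreal \<bar>S h - S (g k)\<bar> \<le> L1_dist h (g k)" by (rule S_diff_le[OF h(1) g(1)])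
    also have "\<dots> \<le> L1_dist h f + L1_dist f (g k)" by (intro L1_dist_triangle Cc_infty_L1 h g f)
    also have "\<dots> \<le> ennreal t + ennreal (1 / real (Suc k))"
      using h(2) g(2)[of k] by (intro add_mono) (auto simp: L1_dist_commute)
    also have "\<dots> = ennreal (t + 1 / real (Suc k))" using h(3) by simp
    finally show ?thesis using h(3) by (subst (asm) ennreal_le_iff) auto
  qed
  have "Cauchy (\<lambda>k. S (g k))"
  proof (rule metric_CauchyI)
    fix e :: real assume "0 < e"
    then obtain N where N: "1 / real (Suc N) < e / 2" using nat_approx_posE[of "e / 2"] by auto
    have "dist (S (g i)) (S (g j)) < e" if "N \<le> i" "N \<le> j" for i j
    proof -
      have "\<bar>S (g i) - S (g j)\<bar> \<le> 1 / real (Suc i) + 1 / real (Suc j)" using dist[OF g(1) g(2)] by simp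
      also have "\<dots> \<le> 1 / real (Suc N) + 1 / real (Suc N)" using that by (intro add_mono divide_left_mono) auto
      finally show ?thesis using N by (simp add: dist_real_def)
    qed
    then show "\<exists>N. \<forall>i\<ge>N. \<forall>j\<ge>N. dist (S (g i)) (S (g j)) < e" by blast
  qed
  then obtain l where l: "(\<lambda>k. S (g k)) \<longlonglongrightarrow> l" using Cauchy_convergent convergent_def by blast
  have lim: "(\<lambda>k. 1 / real (Suc k)) \<longlonglongrightarrow> 0" using lim_inverse_n' LIMSEQ_Suc by blast
  show "\<exists>l. \<forall>g\<in>Cc_infty n U. ennreal \<bar>S g - l\<bar> \<le> L1_dist g f"
  proof (intro exI ballI)
    fix h assume h: "h \<in> Cc_infty n U"
    show "ennreal \<bar>S h - l\<bar> \<le> L1_dist h f"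
    proof (cases "L1_dist h f")
      case (real t)
      have "(\<lambda>k. \<bar>S h - S (g k)\<bar>) \<longlonglongrightarrow> \<bar>S h - l\<bar>" by (intro tendsto_intros l)
      moreover have "(\<lambda>k. t + 1 / real (Suc k)) \<longlonglongrightarrow> t + 0" by (intro tendsto_intros lim)
      ultimately have "\<bar>S h - l\<bar> \<le> t + 0"
        by (rule LIMSEQ_le) (use dist[OF h] real in auto)
      then show ?thesis using real by (simp add: ennreal_leI)
    qed simp
  qed
  fix l l' assume ll: "\<forall>g\<in>Cc_infty n U. ennreal \<bar>S g - l\<bar> \<le> L1_dist g f" "\<forall>g\<in>Cc_infty n U. ennreal \<bar>S g - l'\<bar> \<le> L1_dist g f"
  have *: "(\<lambda>k. S (g k)) \<longlonglongrightarrow> x" if "\<forall>g\<in>Cc_infty n U. ennreal \<bar>S g - x\<bar> \<le> L1_dist g f" for x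
  proof (rule LIM_zero_cancel, rule Lim_null_comparison[OF _ lim])
    have "\<bar>S (g k) - x\<bar> \<le> 1 / real (Suc k)" for k
    proof -
      have "ennreal \<bar>S (g k) - x\<bar> \<le> ennreal (1 / real (Suc k))" using that g order_trans by blast
      then show ?thesis by (simp add: ennreal_le_iff)
    qed
    then show "\<forall>\<^sub>F k in sequentially. norm (S (g k) - x) \<le> 1 / real (Suc k)" by simp
  qed
  show "l = l'" by (rule LIMSEQ_unique[OF *[OF ll(1)] *[OF ll(2)]])
qed

definition ext :: distrib where
  "ext f = (if f \<in> L1 n var_measure then (THE l. \<forall>g\<in>Cc_infty n U. ennreal \<bar>S g - l\<bar> \<le> L1_dist g f) else 0)"

lemma ext_approx:
  assumes "f \<in> L1 n var_measure" "g \<in> Cc_infty n U"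
  shows "ennreal \<bar>S g - ext f\<bar> \<le> L1_dist g f"
  using theI'[OF extension_value_exists[OF assms(1)]] assms by (simp add: ext_def)

lemma ext_eq: "g \<in> Cc_infty n U \<Longrightarrow> ext g = S g"
  using ext_approx[OF Cc_infty_L1, of g g] by (simp add: L1_dist_def)

lemma ext_notin: "f \<notin> L1 n var_measure \<Longrightarrow> ext f = 0"
  by (simp add: ext_def)

lemma abs_ext_le:
  assumes "f \<in> L1 n var_measure"
  shows "ennreal \<bar>ext f\<bar> \<le> (\<integral>\<^sup>+z. ennreal (norm (f z)) \<partial>cvar)"
  using ext_approx[OF assms Cc_infty_0] by (simp add: S_0 L1_dist_def)

lemma ext_eqI:
  assumes f: "f \<in> L1 n var_measure" and g: "\<And>e. 0 < e \<Longrightarrow> \<exists>g\<in>Cc_infty n U. L1_dist g f \<le> ennreal e \<and> \<bar>S g - l\<bar> \<le> e"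
  shows "ext f = l"
proof (rule ccontr)
  assume "ext f \<noteq> l"
  then have e: "0 < \<bar>ext f - l\<bar> / 3" by simp
  obtain g where g: "g \<in> Cc_infty n U" "L1_dist g f \<le> ennreal (\<bar>ext f - l\<bar> / 3)" "\<bar>S g - l\<bar> \<le> \<bar>ext f - l\<bar> / 3"
    using assms(2)[OF e] by blast
  have "ennreal \<bar>S g - ext f\<bar> \<le> ennreal (\<bar>ext f - l\<bar> / 3)" using ext_approx[OF f g(1)] g(2) by (rule order_trans)
  then have "\<bar>S g - ext f\<bar> \<le> \<bar>ext f - l\<bar> / 3" by (simp add: ennreal_le_iff)
  moreover have "\<bar>ext f - l\<bar> \<le> \<bar>S g - ext f\<bar> + \<bar>S g - l\<bar>" by linarith
  moreover have False if "c \<le> x + y" "x \<le> c / 3" "y \<le> c / 3" "0 < c / 3" for c x y :: real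
    using that by linarith
  ultimately show False using g(3) e by blast
qed

lemma ext_add:
  assumes f: "f \<in> L1 n var_measure" and h: "h \<in> L1 n var_measure"
  shows "ext (\<lambda>z. f z + h z) = ext f + ext h"
proof (rule ext_eqI[OF L1_add[OF f h]])
  fix e :: real assume "0 < e"
  then have e: "0 < e / 2" by simp
  obtain g where g: "g \<in> Cc_infty n U" "L1_dist g f \<le> ennreal (e / 2)" by (rule L1_approx[OF f e]) blast
  obtain k where k: "k \<in> Cc_infty n U" "L1_dist k h \<le> ennreal (e / 2)" by (rule L1_approx[OF h e]) blast
  note [measurable] = L1_measurable[OF f] L1_measurable[OF h] L1_measurable[OF Cc_infty_L1[OF g(1)]] L1_measurable[OF Cc_infty_L1[OF k(1)]]
  have "L1_dist (\<lambda>z. g z + k z) (\<lambda>z. f z + h z) \<le> (\<integral>\<^sup>+z. ennreal (norm (g z - f z)) + ennreal (norm (k z - h z)) \<partial>cvar)"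
    unfolding L1_dist_def
  proof (rule nn_integral_mono)
    fix z
    have "norm (g z + k z - (f z + h z)) \<le> norm (g z - f z) + norm (k z - h z)"
      using norm_triangle_ineq[of "g z - f z" "k z - h z"] by (simp add: algebra_simps)
    then show "ennreal (norm (g z + k z - (f z + h z))) \<le> ennreal (norm (g z - f z)) + ennreal (norm (k z - h z))"
      by (simp flip: ennreal_plus)
  qed
  also have "\<dots> = L1_dist g f + L1_dist k h" unfolding L1_dist_def by (rule nn_integral_add) measurable
  also have "\<dots> \<le> ennreal (e / 2) + ennreal (e / 2)" by (rule add_mono[OF g(2) k(2)])
  also have "\<dots> = ennreal e" using e by (simp flip: ennreal_plus)
  finally have d: "L1_dist (\<lambda>z. g z + k z) (\<lambda>z. f z + h z) \<le> ennreal e" .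
  have "\<bar>S g - ext f\<bar> \<le> e / 2" using order_trans[OF ext_approx[OF f g(1)] g(2)] e by (simp add: ennreal_le_iff)
  moreover have "\<bar>S k - ext h\<bar> \<le> e / 2" using order_trans[OF ext_approx[OF h k(1)] k(2)] e by (simp add: ennreal_le_iff)
  moreover have "S (\<lambda>z. g z + k z) = S g + S k" by (rule S_add[OF g(1) k(1)])
  ultimately have "\<bar>S (\<lambda>z. g z + k z) - (ext f + ext h)\<bar> \<le> e" by linarith
  then show "\<exists>u\<in>Cc_infty n U. L1_dist u (\<lambda>z. f z + h z) \<le> ennreal e \<and> \<bar>S u - (ext f + ext h)\<bar> \<le> e"
    using d Cc_infty_add[OF g(1) k(1)] by blast
qed

lemma ext_scaleR:
  assumes f: "f \<in> L1 n var_measure"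
  shows "ext (\<lambda>z. c *\<^sub>R f z) = c * ext f"
proof (rule ext_eqI[OF L1_scaleR[OF f]])
  fix e :: real assume "0 < e"
  then have e: "0 < e / (\<bar>c\<bar> + 1)" by simp
  have ce: "\<bar>c\<bar> * (e / (\<bar>c\<bar> + 1)) \<le> e"
    using mult_right_mono[of "\<bar>c\<bar>" "\<bar>c\<bar> + 1" "e / (\<bar>c\<bar> + 1)"] e by simp
  obtain g where g: "g \<in> Cc_infty n U" "L1_dist g f \<le> ennreal (e / (\<bar>c\<bar> + 1))" by (rule L1_approx[OF f e]) blast
  note [measurable] = L1_measurable[OF f] L1_measurable[OF Cc_infty_L1[OF g(1)]]
  have "L1_dist (\<lambda>z. c *\<^sub>R g z) (\<lambda>z. c *\<^sub>R f z) = (\<integral>\<^sup>+z. ennreal \<bar>c\<bar> * ennreal (norm (g z - f z)) \<partial>cvar)"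
    unfolding L1_dist_def by (rule nn_integral_cong) (simp add: ennreal_mult flip: scaleR_diff_right)
  also have "\<dots> = ennreal \<bar>c\<bar> * L1_dist g f" unfolding L1_dist_def by (rule nn_integral_cmult) measurable
  also have "\<dots> \<le> ennreal \<bar>c\<bar> * ennreal (e / (\<bar>c\<bar> + 1))" by (intro mult_left_mono g) auto
  also have "\<dots> \<le> ennreal e" using ce e by (simp add: ennreal_leI flip: ennreal_mult)
  finally have d: "L1_dist (\<lambda>z. c *\<^sub>R g z) (\<lambda>z. c *\<^sub>R f z) \<le> ennreal e" .
  have "\<bar>S g - ext f\<bar> \<le> e / (\<bar>c\<bar> + 1)" using order_trans[OF ext_approx[OF f g(1)] g(2)] e by (simp add: ennreal_le_iff)
  then have "\<bar>c\<bar> * \<bar>S g - ext f\<bar> \<le> \<bar>c\<bar> * (e / (\<bar>c\<bar> + 1))" by (rule mult_left_mono) simp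
  then have "\<bar>S (\<lambda>z. c *\<^sub>R g z) - c * ext f\<bar> \<le> e"
    using ce S_scaleR[OF g(1), of c] by (simp add: abs_mult flip: right_diff_distrib)
  then show "\<exists>u\<in>Cc_infty n U. L1_dist u (\<lambda>z. c *\<^sub>R f z) \<le> ennreal e \<and> \<bar>S u - c * ext f\<bar> \<le> e"
    using d Cc_infty_scaleR[OF g(1) U_Rn] by blast
qed

lemma ext_continuous:
  assumes f: "\<And>k. f k \<in> L1 n var_measure" and h: "h \<in> L1 n var_measure"
    and lim: "(\<lambda>k::nat. L1_dist (f k) h) \<longlonglongrightarrow> 0"
  shows "(\<lambda>k. ext (f k)) \<longlonglongrightarrow> ext h"
proof (rule LIMSEQ_I)
  fix e :: real assume e: "0 < e"
  have "\<forall>\<^sub>F k in sequentially. L1_dist (f k) h < ennreal (e / 2)"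
    using lim e by (intro order_tendstoD(2)) auto
  then obtain N where N: "\<And>k. N \<le> k \<Longrightarrow> L1_dist (f k) h < ennreal (e / 2)"
    by (auto simp: eventually_sequentially)
  have "norm (ext (f k) - ext h) < e" if k: "N \<le> k" for k
  proof -
    have fh: "(\<lambda>z. f k z + (-1) *\<^sub>R h z) \<in> L1 n var_measure" by (intro L1_add L1_scaleR f h)
    have "ext (\<lambda>z. f k z + (-1) *\<^sub>R h z) = ext (f k) - ext h"
      using ext_add[OF f[of k] L1_scaleR[OF h, of "-1"]] ext_scaleR[OF h, of "-1"] by simp
    then have "ennreal \<bar>ext (f k) - ext h\<bar> \<le> L1_dist (f k) h"
      using abs_ext_le[OF fh] by (simp add: L1_dist_def)
    also have "\<dots> \<le> ennreal (e / 2)" using N[OF k] by simp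
    finally have "\<bar>ext (f k) - ext h\<bar> \<le> e / 2" using e by (simp add: ennreal_le_iff)
    then show ?thesis using e by simp
  qed
  then show "\<exists>N. \<forall>k\<ge>N. norm (ext (f k) - ext h) < e" by blast
qed

lemma L1_extension_eq: "L1_extension n U S = ext"
  unfolding L1_extension_def variation_eq
proof (rule the_equality)
  show "(\<forall>\<theta>\<in>Cc_infty n U. ext \<theta> = S \<theta>) \<and> (\<forall>\<theta>. \<theta> \<notin> L1 n var_measure \<longrightarrow> ext \<theta> = 0) \<and>
    (\<forall>f \<theta>. (\<forall>k::nat. f k \<in> L1 n var_measure) \<and> \<theta> \<in> L1 n var_measure \<and>
        (\<lambda>k. \<integral>\<^sup>+z. ennreal (norm (f k z - \<theta> z)) \<partial>cvar) \<longlonglongrightarrow> 0 \<longrightarrow> (\<lambda>k. ext (f k)) \<longlonglongrightarrow> ext \<theta>)"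
    using ext_eq ext_notin ext_continuous unfolding L1_dist_def by blast
  fix T assume T: "(\<forall>\<theta>\<in>Cc_infty n U. T \<theta> = S \<theta>) \<and> (\<forall>\<theta>. \<theta> \<notin> L1 n var_measure \<longrightarrow> T \<theta> = 0) \<and>
    (\<forall>f \<theta>. (\<forall>k::nat. f k \<in> L1 n var_measure) \<and> \<theta> \<in> L1 n var_measure \<and>
        (\<lambda>k. \<integral>\<^sup>+z. ennreal (norm (f k z - \<theta> z)) \<partial>cvar) \<longlonglongrightarrow> 0 \<longrightarrow> (\<lambda>k. T (f k)) \<longlonglongrightarrow> T \<theta>)"
  show "T = ext"
  \<comment> \<open>As a rule, \<open>ext\<close> is function extensionality; the constant
    \<open>ext\<close> of this locale occurs in the goal.\<close>
  proof (rule ext)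
    fix f
    show "T f = ext f"
    proof (cases "f \<in> L1 n var_measure")
      case True
      have "\<exists>g. g \<in> Cc_infty n U \<and> L1_dist g f \<le> ennreal (1 / real (Suc k))" for k
        using L1_approx[OF True, of "1 / real (Suc k)"] by auto
      then obtain g where g: "\<And>k. g k \<in> Cc_infty n U" "\<And>k. L1_dist (g k) f \<le> ennreal (1 / real (Suc k))" by metis
      have "(\<lambda>k. 1 / real (Suc k)) \<longlonglongrightarrow> 0" using lim_inverse_n' LIMSEQ_Suc by blast
      then have "(\<lambda>k. ennreal (1 / real (Suc k))) \<longlonglongrightarrow> ennreal 0" by (rule tendsto_ennrealI)
      then have "(\<lambda>k. L1_dist (g k) f) \<longlonglongrightarrow> 0"
        using g(2) by (intro tendsto_sandwich[where f = "\<lambda>_. 0" and g = "\<lambda>k. L1_dist (g k) f"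
          and h = "\<lambda>k. ennreal (1 / real (Suc k))"]) auto
      then have lim: "(\<lambda>k. T (g k)) \<longlonglongrightarrow> T f" "(\<lambda>k. ext (g k)) \<longlonglongrightarrow> ext f"
        using T True Cc_infty_L1[OF g(1)] ext_continuous[of g f] unfolding L1_dist_def by blast+
      have "T (g k) = ext (g k)" for k using T g(1) ext_eq by simp
      then show ?thesis using lim LIMSEQ_unique by simp
    next
      case False then show ?thesis using T ext_notin by simp
    qed
  qed
qed

lemma cutoff_measurable:
  assumes E: "E \<in> sets cvar" and f: "f \<in> L1 n var_measure"
  shows "cutoff E f \<in> L1 n var_measure"
    "(\<integral>\<^sup>+z. ennreal (norm (cutoff E f z)) \<partial>cvar) = (\<integral>\<^sup>+z. ennreal (norm (f z)) * indicator E z \<partial>cvar)"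
proof -
  note [measurable] = E L1_measurable[OF f]
  show *: "(\<integral>\<^sup>+z. ennreal (norm (cutoff E f z)) \<partial>cvar) = (\<integral>\<^sup>+z. ennreal (norm (f z)) * indicator E z \<partial>cvar)"
    by (rule nn_integral_cong) (auto simp: cutoff_def indicator_def)
  have "\<dots> \<le> (\<integral>\<^sup>+z. ennreal (norm (f z)) \<partial>cvar)"
    by (rule nn_integral_mono) (auto simp: indicator_def)
  also have "\<dots> < \<infinity>" using f by (simp add: L1_iff)
  finally have "(\<integral>\<^sup>+z. ennreal (norm (cutoff E f z)) \<partial>cvar) < \<infinity>" using * by simp
  moreover have "cutoff E f \<in> borel_measurable cvar" unfolding cutoff_def by measurable
  ultimately show "cutoff E f \<in> L1 n var_measure"
    using f by (auto simp: L1_iff cutoff_def intro!: Rn_scaleR)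
qed

lemma restrict_distrib_eq: "restrict_distrib n U S E = (\<lambda>\<theta>. ext (cutoff E \<theta>))"
  by (simp add: restrict_distrib_def L1_extension_eq)

text \<open>The integral identity evaluates the restricted distribution at
  \<open>cutoff U \<theta>\<close>, whose support need not be a compact subset of \<open>U\<close>.
  A second extension is therefore involved, and the restriction has to be a Radon distribution in
  its own right. The bound on open sets later leads back to \<parallel>\<delta>V\<parallel> on
  \<open>E\<close>.\<close>

lemma restriction_radon:
  assumes E: "E \<in> sets cvar"
  shows "radon_distribution n U (restrict_distrib n U S E)"
    and "\<And>C. openin (top_of_set U) C \<Longrightarrow>
      emeasure (variation n U (restrict_distrib n U S E)) C \<le> emeasure cvar (E \<inter> C)"
proof -
  interpret R: vector_distribution n U "restrict_distrib n U S E"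
  proof
    show "openin (Rn_top n) U" by (rule open_U)
    fix f g :: "fseq \<Rightarrow> fseq" and c :: real assume f: "f \<in> Cc_infty n U"
    have "cutoff E (\<lambda>x. c *\<^sub>R f x) = (\<lambda>x. c *\<^sub>R cutoff E f x)" by (auto simp: cutoff_def)
    then show "restrict_distrib n U S E (\<lambda>x. c *\<^sub>R f x) = c * restrict_distrib n U S E f"
      using ext_scaleR[OF cutoff_measurable(1)[OF E Cc_infty_L1[OF f]]] by (simp add: restrict_distrib_eq)
    assume g: "g \<in> Cc_infty n U"
    have "cutoff E (\<lambda>x. f x + g x) = (\<lambda>x. cutoff E f x + cutoff E g x)" by (auto simp: cutoff_def scaleR_add_right)
    then show "restrict_distrib n U S E (\<lambda>x. f x + g x) = restrict_distrib n U S E f + restrict_distrib n U S E g"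
      using ext_add[OF cutoff_measurable(1)[OF E Cc_infty_L1[OF f]] cutoff_measurable(1)[OF E Cc_infty_L1[OF g]]]
      by (simp add: restrict_distrib_eq)
  qed
  have le: "emeasure R.var_measure C \<le> emeasure cvar (E \<inter> C)" if C: "openin (top_of_set U) C" for C
    unfolding R.emeasure_var_open[OF C] R.var_open_def
  proof (rule SUP_least)
    fix f assume "f \<in> R.tests C"
    then have f: "f \<in> Cc_infty n U" "spt f \<subseteq> C" "\<And>x. norm (f x) \<le> 1" by (auto simp: R.tests_def)
    have Cs: "C \<in> sets cvar" using open_sets_var_measure[OF C] by simp
    note L = cutoff_measurable[OF E Cc_infty_L1[OF f(1)]]
    have "ennreal (restrict_distrib n U S E f) \<le> ennreal \<bar>ext (cutoff E f)\<bar>"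
      by (simp add: restrict_distrib_eq ennreal_leI)
    also have "\<dots> \<le> (\<integral>\<^sup>+z. ennreal (norm (f z)) * indicator E z \<partial>cvar)"
      using abs_ext_le[OF L(1)] L(2) by simp
    also have "\<dots> \<le> (\<integral>\<^sup>+z. indicator (E \<inter> C) z \<partial>cvar)"
    proof (rule nn_integral_mono)
      fix z
      have "ennreal (norm (f z)) \<le> ennreal 1" by (rule ennreal_leI[OF f(3)])
      then show "ennreal (norm (f z)) * indicator E z \<le> indicator (E \<inter> C) z"
        using not_in_spt[of z f] f(2) by (auto simp: indicator_def)
    qed
    also have "\<dots> = emeasure cvar (E \<inter> C)" by (rule nn_integral_indicator[OF sets.Int[OF E Cs]])
    finally show "ennreal (restrict_distrib n U S E f) \<le> emeasure cvar (E \<inter> C)" .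
  qed
  then show "\<And>C. openin (top_of_set U) C \<Longrightarrow>
      emeasure (variation n U (restrict_distrib n U S E)) C \<le> emeasure cvar (E \<inter> C)"
    by (simp add: R.variation_eq)
  show "radon_distribution n U (restrict_distrib n U S E)"
  proof (unfold_locales)
    fix K assume K: "compact K" "K \<subseteq> U"
    obtain N where N: "openin (top_of_set U) N" "K \<subseteq> N" "emeasure var_measure N < \<infinity>"
      by (rule finite_open_nbhd[OF K]) blast
    have Ns: "N \<in> sets var_measure" by (rule open_sets_var_measure[OF N(1)])
    have "emeasure R.var_measure K \<le> emeasure R.var_measure N"
      by (rule emeasure_mono[OF N(2) R.open_sets_var_measure[OF N(1)]])
    also have "\<dots> \<le> emeasure cvar (E \<inter> N)" by (rule le[OF N(1)])
    also have "\<dots> \<le> emeasure cvar N" using Ns by (intro emeasure_mono) auto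
    also have "\<dots> < \<infinity>" using N(3) Ns by (simp add: emeasure_completion)
    finally show "emeasure R.var_measure K < \<infinity>" .
  qed
qed

end

section \<open>The first variation\<close>

lemma borel_measurable_continuous_map:
  assumes "sets N = sets (borel_of X)" "continuous_map X euclideanreal f"
  shows "f \<in> borel_measurable N"
proof (rule borel_measurableI)
  fix T :: "real set" assume T: "open T"
  have sp: "space N = topspace X" using sets_eq_imp_space_eq[OF assms(1)] by simp
  have "openin X {x \<in> topspace X. f x \<in> T}"
    using assms(2) T by (simp add: continuous_map_def)
  moreover have "f -` T \<inter> space N = {x \<in> topspace X. f x \<in> T}" using sp by auto
  ultimately show "f -` T \<inter> space N \<in> sets N"
    unfolding assms(1) borel_of_def by (subst sets_measure_of) (auto dest: openin_subset)
qed

lemma emeasure_add_measure: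
  assumes s: "sets N = sets M" and A: "A \<in> sets M"
  shows "emeasure (add_measure M N) A = emeasure M A + emeasure N A"
proof (rule emeasure_measure_of[OF add_measure_def])
  show "sets M \<subseteq> Pow (space M)" using sets.space_closed by auto
  show "positive (sets (add_measure M N)) (\<lambda>B. emeasure M B + emeasure N B)" by (simp add: positive_def)
  show "countably_additive (sets (add_measure M N)) (\<lambda>B. emeasure M B + emeasure N B)"
  proof (rule countably_additiveI)
    fix B :: "nat \<Rightarrow> 'a set" assume B: "range B \<subseteq> sets (add_measure M N)" "disjoint_family B"
    have "sets (add_measure M N) = sets M" unfolding add_measure_def by simp
    then have "range B \<subseteq> sets M" "range B \<subseteq> sets N" using B s by auto
    then have "(\<Sum>i. emeasure M (B i)) = emeasure M (\<Union>i. B i)" "(\<Sum>i. emeasure N (B i)) = emeasure N (\<Union>i. B i)"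
      using B(2) by (auto intro: suminf_emeasure)
    then show "(\<Sum>i. emeasure M (B i) + emeasure N (B i)) = emeasure M (\<Union>i. B i) + emeasure N (\<Union>i. B i)"
      by (simp add: suminf_add[OF summableI summableI, symmetric])
  qed
  show "A \<in> sets (add_measure M N)" using A by (simp add: add_measure_def)
qed

lemma sets_add_measure [simp]: "sets (add_measure M N) = sets M"
  by (simp add: add_measure_def)

lemma outer_measure_of_null_modification:
  assumes "E = E' \<union> N" "N \<subseteq> N'" "N' \<in> null_sets M" "E' \<inter> A \<in> sets M"
  shows "outer_measure_of M (E \<inter> A) = emeasure M (E' \<inter> A)"
proof (rule antisym)
  have "outer_measure_of M (E \<inter> A) \<le> outer_measure_of M (E' \<inter> A \<union> N')"
    using assms by (intro outer_measure_of_mono) auto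
  also have "\<dots> = emeasure M (E' \<inter> A \<union> N')" using assms by (intro outer_measure_of_eq) auto
  also have "\<dots> = emeasure M (E' \<inter> A)" using assms by (intro emeasure_Un_null_set) auto
  finally show "outer_measure_of M (E \<inter> A) \<le> emeasure M (E' \<inter> A)" .
  have "outer_measure_of M (E' \<inter> A) \<le> outer_measure_of M (E \<inter> A)"
    using assms by (intro outer_measure_of_mono) auto
  then show "emeasure M (E' \<inter> A) \<le> outer_measure_of M (E \<inter> A)" using assms by simp
qed

text \<open>\<open>restrict_measure\<close> is formed with the outer measure, as the set may fail to
  be Borel; up to a null set it is an ordinary density.\<close>

lemma restrict_measure_null_modification:
  assumes "E = E' \<union> N" "N \<subseteq> N'" "N' \<in> null_sets M" and E': "E' \<in> sets M"
  shows "restrict_measure M E = density M (indicator E')"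
proof -
  have "restrict_measure M E = measure_of (space M) (sets M) (emeasure (density M (indicator E')))"
    unfolding restrict_measure_def
  proof (rule measure_of_eq)
    fix B assume "B \<in> sigma_sets (space M) (sets M)"
    then have B: "B \<in> sets M" by (simp add: sets.sigma_sets_eq)
    then have "outer_measure_of M (E \<inter> B) = emeasure M (E' \<inter> B)"
      using assms by (intro outer_measure_of_null_modification[OF assms(1-3)]) auto
    also have "\<dots> = emeasure (density M (indicator E')) B"
      by (rule emeasure_restricted[OF E' B, symmetric])
    finally show "outer_measure_of M (E \<inter> B) = emeasure (density M (indicator E')) B" .
  qed (use sets.space_closed in auto)
  also have "\<dots> = density M (indicator E')"
    using measure_of_of_measure[of "density M (indicator E')"] by simp
  finally show ?thesis .
qed

lemma trace_inner_commute: "trace_inner n \<sigma> \<tau> = trace_inner n \<tau> \<sigma>"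
  by (simp add: trace_inner_def inner_commute)

lemma Cc_infty_derivative:
  assumes "\<theta> \<in> Cc_infty n W" "W \<subseteq> Rn n"
  obtains D where "\<And>z. z \<in> W \<Longrightarrow> (\<theta> has_derivative D z) (at z within Rn n)"
    "\<And>v. v \<in> Rn n \<Longrightarrow> continuous_on W (\<lambda>z. D z v)"
    "\<And>z v. z \<in> W \<Longrightarrow> v \<in> Rn n \<Longrightarrow> Deriv n \<theta> z v = D z v"
proof -
  have "Ck (Rn n) W (Suc 0) \<theta>" by (rule Cc_inftyD(1)[OF assms(1)])
  then obtain D where D: "\<And>z. z \<in> W \<Longrightarrow> (\<theta> has_derivative D z) (at z within Rn n)"
    "\<And>v. v \<in> Rn n \<Longrightarrow> Ck (Rn n) W 0 (\<lambda>z. D z v)" by (rule Ck_SucE) blast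
  show thesis
  proof (rule that[OF D(1)])
    show "continuous_on W (\<lambda>z. D z v)" if "v \<in> Rn n" for v using D(2)[OF that] by simp
    show "Deriv n \<theta> z v = D z v" if "z \<in> W" "v \<in> Rn n" for z v
      using Deriv_eq[OF D(1)[OF that(1)]] that assms(2) by blast
  qed
qed

section \<open>The weight of a varifold, and its first variation as a distribution\<close>

locale varifold_data =
  fixes n m :: nat and U :: "fseq set" and V :: "(fseq \<times> fseq set) measure"
  assumes open_U: "openin (Rn_top n) U" and varifold: "varifold n m U V"
begin

abbreviation P where "P \<equiv> prod_topology (top_of_set U) (Gr_top n m)"

lemma U_Rn: "U \<subseteq> Rn n"
  using open_U openin_imp_subset by blast

lemma U_borel [measurable]: "U \<in> sets borel"
  using openin_Rn_borel[OF open_U] .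

lemma sets_V: "sets V = sets (borel_of P)"
  and V_compact: "compactin P K \<Longrightarrow> emeasure V K < \<infinity>"
  and V_outer: "A \<in> sets V \<Longrightarrow> emeasure V A = (INF C\<in>{C. openin P C \<and> A \<subseteq> C}. emeasure V C)"
  using varifold by (auto simp: varifold_def radon_measure_def)

lemma space_V: "space V = U \<times> Gr n m"
  using sets_eq_imp_space_eq[OF sets_V] by simp

lemma openin_sets_V: "openin P C \<Longrightarrow> C \<in> sets V"
  unfolding sets_V borel_of_def using openin_subset[of P]
  by (subst sets_measure_of) (blast intro: sigma_sets.Basic)+

abbreviation W where "W \<equiv> weight U V"

lemma sets_W: "sets W = {A \<in> sets borel. A \<subseteq> U}"
  by (simp add: weight_def sets_borel_of_top_of_set)

lemma space_W [simp]: "space W = U"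
  by (simp add: weight_def)

lemma cylinder_sets: "A \<in> sets W \<Longrightarrow> A \<times> Gr n m \<in> sets V"
  and emeasure_W: "A \<in> sets W \<Longrightarrow> emeasure W A = emeasure V (A \<times> Gr n m)"
proof -
  have meas: "fst \<in> measurable V (borel_of (top_of_set U))"
    unfolding borel_of_def
  proof (rule measurable_measure_of)
    show "{C. openin (top_of_set U) C} \<subseteq> Pow (topspace (top_of_set U))"
      using openin_subset[of "top_of_set U"] by blast
    show "fst \<in> space V \<rightarrow> topspace (top_of_set U)" by (auto simp: space_V)
    fix C assume "C \<in> {C. openin (top_of_set U) C}"
    then have C: "openin (top_of_set U) C" "C \<subseteq> U" using openin_imp_subset by auto
    have "fst -` C \<inter> space V = C \<times> Gr n m" using C(2) by (auto simp: space_V)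
    moreover have "openin P (C \<times> Gr n m)"
      using C(1) openin_topspace[of "Gr_top n m"] by (simp add: openin_prod_Times_iff)
    ultimately show "fst -` C \<inter> space V \<in> sets V" using openin_sets_V by simp
  qed
  assume A: "A \<in> sets W"
  then have A': "A \<in> sets (borel_of (top_of_set U))" "A \<subseteq> U" unfolding sets_W by (auto simp: sets_borel_of_top_of_set)
  have eq: "fst -` A \<inter> space V = A \<times> Gr n m" using A'(2) by (auto simp: space_V)
  show "A \<times> Gr n m \<in> sets V" using measurable_sets[OF meas A'(1)] eq by simp
  show "emeasure W A = emeasure V (A \<times> Gr n m)"
    unfolding weight_def using emeasure_distr[OF meas A'(1)] eq by simp
qed

lemma compactin_cylinder:
  assumes "compact K" "K \<subseteq> U" shows "compactin P (K \<times> Gr n m)"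
proof -
  have "compactin (Gr_top n m) (Gr n m)" using compact_space_Gr[of n m] by (simp add: compact_space_def)
  moreover have "compactin (top_of_set U) K" using assms by (simp add: compactin_subtopology)
  ultimately show ?thesis by (simp add: compactin_Times)
qed

text \<open>The tube lemma: for an open set of the product containing the cylinder over
  \<open>A\<close>, the base points whose whole fibre it contains form an open set, because
  projecting along a compact space is a closed map. So outer regularity descends from
  \<open>V\<close> to its weight.\<close>

lemma W_outer_regular:
  assumes A: "A \<in> sets W" "emeasure W A \<noteq> top" and e: "0 < (e::real)"
  obtains C where "openin (top_of_set U) C" "A \<subseteq> C" "emeasure W C \<le> emeasure W A + ennreal e"
proof -
  have AV: "A \<times> Gr n m \<in> sets V" by (rule cylinder_sets[OF A(1)])
  have "emeasure V (A \<times> Gr n m) < emeasure V (A \<times> Gr n m) + ennreal e"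
    using A e emeasure_W by (intro ennreal_less_add_pos) auto
  then have "\<exists>C\<in>{C. openin P C \<and> A \<times> Gr n m \<subseteq> C}. emeasure V C < emeasure V (A \<times> Gr n m) + ennreal e"
    unfolding INF_less_iff[symmetric] V_outer[OF AV, symmetric] .
  then obtain C where C: "openin P C" "A \<times> Gr n m \<subseteq> C" "emeasure V C < emeasure V (A \<times> Gr n m) + ennreal e" by auto
  define D where "D = U - fst ` (topspace P - C)"
  have "closedin (top_of_set U) (fst ` (topspace P - C))"
    using closed_map_fst[OF compact_space_Gr[of n m], of "top_of_set U"] C(1)
    unfolding closed_map_def by (metis closedin_diff closedin_topspace)
  then have D: "openin (top_of_set U) D" unfolding D_def by (metis openin_diff openin_topspace topspace_euclidean_subtopology)
  have DC: "D \<times> Gr n m \<subseteq> C"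
  proof (rule subsetI, rule ccontr)
    fix p assume p: "p \<in> D \<times> Gr n m" "p \<notin> C"
    then have "p \<in> topspace P - C" by (auto simp: D_def)
    then have "fst p \<in> fst ` (topspace P - C)" by (rule imageI)
    then have "fst p \<notin> D" unfolding D_def by blast
    then show False using p(1) by auto
  qed
  have AD: "A \<subseteq> D"
    using A(1) C(2) by (auto simp: D_def sets_W)
  have Ds: "D \<in> sets W"
  proof -
    have "openin (Rn_top n) D" using D open_U by (rule openin_trans)
    then show ?thesis using openin_Rn_borel by (auto simp: sets_W D_def)
  qed
  have "emeasure W D \<le> emeasure V C"
    unfolding emeasure_W[OF Ds] using DC openin_sets_V[OF C(1)] by (rule emeasure_mono)
  also have "\<dots> \<le> emeasure W A + ennreal e" using C(3) emeasure_W[OF A(1)] by simp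
  finally show thesis using that D AD by blast
qed

lemma continuous_trace:
  assumes \<theta>: "\<theta> \<in> Cc_infty n O'" "O' \<subseteq> Rn n" "U \<subseteq> O'"
  shows "continuous_map P euclideanreal (\<lambda>(z, S). trace_inner n (Deriv n \<theta> z) (orth_proj S))"
proof -
  obtain D where D: "\<And>z. z \<in> O' \<Longrightarrow> (\<theta> has_derivative D z) (at z within Rn n)"
    "\<And>v. v \<in> Rn n \<Longrightarrow> continuous_on O' (\<lambda>z. D z v)"
    "\<And>z v. z \<in> O' \<Longrightarrow> v \<in> Rn n \<Longrightarrow> Deriv n \<theta> z v = D z v"
    by (rule Cc_infty_derivative[OF \<theta>(1,2)]) blast
  have "continuous_map P euclideanreal (\<lambda>p. \<Sum>i<n. inner (D (fst p) (unit_vec i)) (orth_proj (snd p) (unit_vec i)))"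
  proof (rule continuous_map_sum)
    fix i assume "i \<in> {..<n}"
    then have i: "unit_vec i \<in> Rn n" by (auto intro: unit_vec_Rn)
    have "continuous_map (top_of_set U) euclidean (\<lambda>z. D z (unit_vec i))"
      using continuous_on_subset[OF D(2)[OF i] \<theta>(3)] by (simp add: continuous_map_iff_continuous)
    then have 1: "continuous_map P euclidean (\<lambda>p. D (fst p) (unit_vec i))"
      using continuous_map_compose[OF continuous_map_fst, of "top_of_set U" euclidean "\<lambda>z. D z (unit_vec i)" "Gr_top n m"]
      by (simp add: o_def)
    have 2: "continuous_map P euclidean (\<lambda>p. orth_proj (snd p) (unit_vec i))"
      using continuous_map_compose[OF continuous_map_snd continuous_map_orth_proj, of "top_of_set U"] by (simp add: o_def)
    have "continuous_map P euclidean (\<lambda>p. (D (fst p) (unit_vec i), orth_proj (snd p) (unit_vec i)))"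
      using continuous_map_pairedI[OF 1 2] by simp
    moreover have "continuous_map euclidean euclideanreal (\<lambda>q::fseq \<times> fseq. inner (fst q) (snd q))"
      by (auto intro!: continuous_intros)
    ultimately have "continuous_map P euclideanreal ((\<lambda>q. inner (fst q) (snd q)) \<circ> (\<lambda>p. (D (fst p) (unit_vec i), orth_proj (snd p) (unit_vec i))))"
      by (rule continuous_map_compose)
    then show "continuous_map P euclideanreal (\<lambda>p. inner (D (fst p) (unit_vec i)) (orth_proj (snd p) (unit_vec i)))"
      by (simp add: o_def)
  qed auto
  then show ?thesis
  proof (rule continuous_map_eq)
    fix p assume "p \<in> topspace P"
    then have "fst p \<in> O'" using \<theta>(3) by auto
    then show "(\<Sum>i<n. inner (D (fst p) (unit_vec i)) (orth_proj (snd p) (unit_vec i))) =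
        (case p of (z, S) \<Rightarrow> trace_inner n (Deriv n \<theta> z) (orth_proj S))"
      using D(3) by (auto simp: case_prod_beta trace_inner_def unit_vec_Rn intro!: sum.cong)
  qed
qed

lemma integrable_trace:
  assumes \<theta>: "\<theta> \<in> Cc_infty n U" and N: "sets N = sets V" and fin: "\<And>K. compact K \<Longrightarrow> K \<subseteq> U \<Longrightarrow> emeasure N (K \<times> Gr n m) < \<infinity>"
  shows "integrable N (\<lambda>(z, S). trace_inner n (Deriv n \<theta> z) (orth_proj S))"
proof -
  let ?F = "\<lambda>(z, S). trace_inner n (Deriv n \<theta> z) (orth_proj S)"
  define K where "K = spt \<theta>"
  have K: "compact K" "K \<subseteq> U" using Cc_inftyD[OF \<theta>] by (auto simp: K_def)
  have cont: "continuous_map P euclideanreal ?F" by (rule continuous_trace[OF \<theta> U_Rn subset_refl])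
  have meas: "?F \<in> borel_measurable N"
    by (rule borel_measurable_continuous_map[OF _ cont]) (simp add: N sets_V)
  have spN: "space N = U \<times> Gr n m" using sets_eq_imp_space_eq[OF N] space_V by simp
  have cK: "compactin P (K \<times> Gr n m)" by (rule compactin_cylinder[OF K])
  have "compact (?F ` (K \<times> Gr n m))" using image_compactin[OF cK cont] by simp
  then obtain b where b: "\<And>y. y \<in> ?F ` (K \<times> Gr n m) \<Longrightarrow> norm y \<le> b"
    using compact_imp_bounded bounded_iff by metis
  have zero: "?F p = 0" if p: "p \<in> space N - K \<times> Gr n m" for p
  proof -
    obtain z S where zS: "p = (z, S)" "z \<in> U" "z \<notin> K" using p spN by (cases p) auto
    have zR: "z \<in> Rn n" using zS U_Rn by auto
    have "open (- K)" using compact_imp_closed[OF K(1)] by auto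
    \<comment> \<open>Off its support the field vanishes on a neighbourhood in the whole space,
      hence its derivative within \<open>Rn n\<close> is 0. The integrand is thus bounded and lives
      on a cylinder of finite mass.\<close>
    have "(\<theta> has_derivative (\<lambda>_. 0)) (at z)"
      by (rule has_derivative_transform_within_open[OF has_derivative_const[of 0] \<open>open (- K)\<close>])
         (use zS not_in_spt in \<open>auto simp: K_def\<close>)
    then have "(\<theta> has_derivative (\<lambda>_. 0)) (at z within Rn n)" by (rule has_derivative_at_withinI)
    then have "Deriv n \<theta> z v = 0" if "v \<in> Rn n" for v using Deriv_eq zR that by blast
    then show ?thesis by (auto simp: zS trace_inner_def unit_vec_Rn intro!: sum.neutral)
  qed
  have Ks: "K \<times> Gr n m \<in> sets N"
    unfolding N using K borel_compact by (intro cylinder_sets) (auto simp: sets_W)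
  show ?thesis
  proof (rule integrableI_bounded[OF meas])
    have "(\<integral>\<^sup>+p. ennreal (norm (?F p)) \<partial>N) \<le> (\<integral>\<^sup>+p. ennreal b * indicator (K \<times> Gr n m) p \<partial>N)"
    proof (rule nn_integral_mono)
      fix p assume "p \<in> space N"
      then show "ennreal (norm (?F p)) \<le> ennreal b * indicator (K \<times> Gr n m) p"
        using zero[of p] b[of "?F p"] by (cases "p \<in> K \<times> Gr n m") (auto intro: ennreal_leI)
    qed
    also have "\<dots> = ennreal b * emeasure N (K \<times> Gr n m)" by (rule nn_integral_cmult_indicator[OF Ks])
    also have "\<dots> < \<infinity>" using fin[OF K] by (simp add: ennreal_mult_less_top)
    finally show "(\<integral>\<^sup>+p. ennreal (norm (?F p)) \<partial>N) < \<infinity>" .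
  qed
qed

lemma first_variation_distribution:
  assumes N: "sets N = sets V" and fin: "\<And>K. compact K \<Longrightarrow> K \<subseteq> U \<Longrightarrow> emeasure N (K \<times> Gr n m) < \<infinity>"
  shows "vector_distribution n U (first_variation n N)"
proof
  show "openin (Rn_top n) U" by (rule open_U)
  have spN: "space N = U \<times> Gr n m" using sets_eq_imp_space_eq[OF N] space_V by simp
  fix f g :: "fseq \<Rightarrow> fseq" and c :: real assume f: "f \<in> Cc_infty n U"
  obtain D where D: "\<And>z. z \<in> U \<Longrightarrow> (f has_derivative D z) (at z within Rn n)"
    "\<And>z v. z \<in> U \<Longrightarrow> v \<in> Rn n \<Longrightarrow> Deriv n f z v = D z v"
    by (rule Cc_infty_derivative[OF f U_Rn]) blast
  have zR: "z \<in> Rn n" if "z \<in> U" for z using that U_Rn by auto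
  have intf: "integrable N (\<lambda>(z, S). trace_inner n (Deriv n f z) (orth_proj S))" by (rule integrable_trace[OF f N fin])
  have "Deriv n (\<lambda>x. c *\<^sub>R f x) z v = c *\<^sub>R Deriv n f z v" if "z \<in> U" "v \<in> Rn n" for z v
    using Deriv_eq[OF has_derivative_scaleR_right[OF D(1)[OF that(1)], of c] zR[OF that(1)] that(2)] D(2)[OF that] by simp
  then have "trace_inner n (Deriv n (\<lambda>x. c *\<^sub>R f x) z) Q = c * trace_inner n (Deriv n f z) Q" if "z \<in> U" for z Q
    using that by (simp add: trace_inner_def unit_vec_Rn sum_distrib_left)
  then have "first_variation n N (\<lambda>x. c *\<^sub>R f x) = (\<integral>p. c * (case p of (z, S) \<Rightarrow> trace_inner n (Deriv n f z) (orth_proj S)) \<partial>N)"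
    unfolding first_variation_def by (intro Bochner_Integration.integral_cong) (auto simp: spN)
  then show "first_variation n N (\<lambda>x. c *\<^sub>R f x) = c * first_variation n N f"
    by (simp add: first_variation_def)
  assume g: "g \<in> Cc_infty n U"
  obtain E where E: "\<And>z. z \<in> U \<Longrightarrow> (g has_derivative E z) (at z within Rn n)"
    "\<And>z v. z \<in> U \<Longrightarrow> v \<in> Rn n \<Longrightarrow> Deriv n g z v = E z v"
    by (rule Cc_infty_derivative[OF g U_Rn]) blast
  have intg: "integrable N (\<lambda>(z, S). trace_inner n (Deriv n g z) (orth_proj S))" by (rule integrable_trace[OF g N fin])
  have "Deriv n (\<lambda>x. f x + g x) z v = Deriv n f z v + Deriv n g z v" if "z \<in> U" "v \<in> Rn n" for z v
    using Deriv_eq[OF has_derivative_add[OF D(1)[OF that(1)] E(1)[OF that(1)]] zR[OF that(1)] that(2)] D(2)[OF that] E(2)[OF that] by simp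
  then have "trace_inner n (Deriv n (\<lambda>x. f x + g x) z) Q = trace_inner n (Deriv n f z) Q + trace_inner n (Deriv n g z) Q" if "z \<in> U" for z Q
    using that by (simp add: trace_inner_def unit_vec_Rn sum.distrib inner_add_left)
  then have "first_variation n N (\<lambda>x. f x + g x) = (\<integral>p. (case p of (z, S) \<Rightarrow> trace_inner n (Deriv n f z) (orth_proj S)) +
      (case p of (z, S) \<Rightarrow> trace_inner n (Deriv n g z) (orth_proj S)) \<partial>N)"
    unfolding first_variation_def by (intro Bochner_Integration.integral_cong) (auto simp: spN)
  then show "first_variation n N (\<lambda>x. f x + g x) = first_variation n N f + first_variation n N g"
    using Bochner_Integration.integral_add[OF intf intg] by (simp add: first_variation_def)
qed

end

section \<open>Monotonicity\<close>

text \<open>With y = x - z, the derivative of the field is \<Psi> times the identity minus 2 w times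
  the tensor square of y, and a projection onto an m-plane has trace m. Setting the field to 0 off
  \<open>Rn n\<close> gives it compact support in the whole space.\<close>

lemma radial_field:
  assumes z: "z \<in> Rn n" and b: "0 < b" and sep: "\<forall>y\<in>B. b < dist z y"
    and \<Psi>: "\<And>k. Ck UNIV UNIV k \<Psi>" "\<And>t. (\<Psi> has_real_derivative - w t) (at t)" "\<forall>t\<ge>b\<^sup>2. \<Psi> t = 0"
  defines "\<theta> \<equiv> (\<lambda>x. if x \<in> Rn n then \<Psi> (inner (x - z) (x - z)) *\<^sub>R (x - z) else 0)"
  shows "\<theta> \<in> Cc_infty n (Rn n - B)" "spt \<theta> \<subseteq> cball z b"
    "\<And>S x. S \<in> Gr n m \<Longrightarrow> x \<in> Rn n \<Longrightarrow> trace_inner n (orth_proj S) (Deriv n \<theta> x) =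
      real m * \<Psi> (inner (x - z) (x - z)) - 2 * w (inner (x - z) (x - z)) * inner (x - z) (orth_proj S (x - z))"
proof -
  have \<theta>_Rn: "\<theta> x = \<Psi> (inner (x - z) (x - z)) *\<^sub>R (x - z)" if "x \<in> Rn n" for x
    using that by (simp add: \<theta>_def)
  have ck: "Ck (Rn n) (Rn n) k (\<lambda>x. \<Psi> (inner (x - z) (x - z)) *\<^sub>R (x - z))" for k
    by (intro Ck_scaleR Ck_compose_real[OF _ \<Psi>(1)] Ck_inner Ck_diff Ck_id Ck_const) auto
  have ck\<theta>: "Ck (Rn n) (Rn n - B) k \<theta>" for k
    by (rule Ck_subset[OF _ Ck_cong[OF _ _ ck]]) (auto simp: \<theta>_Rn)
  have zero: "\<theta> x = 0" if "x \<notin> cball z b \<inter> Rn n" for x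
  proof (cases "x \<in> Rn n")
    case True
    then have "b \<le> norm (x - z)" using that by (simp add: dist_norm norm_minus_commute)
    then have "b\<^sup>2 \<le> inner (x - z) (x - z)" using b by (simp only: dot_square_norm) (intro power_mono, auto)
    then show ?thesis using \<Psi>(3) by (simp add: \<theta>_def)
  qed (simp add: \<theta>_def)
  have val: "\<theta> x \<in> Rn n" for x using z by (auto simp: \<theta>_def intro: Rn_scaleR Rn_diff)
  have comp: "compact (cball z b \<inter> Rn n)" by (rule compact_Rn) (auto intro: closed_Int closed_Rn)
  have sub: "cball z b \<inter> Rn n \<subseteq> Rn n - B" using sep by fastforce
  note I = Cc_inftyI[OF ck\<theta> val comp sub zero]
  show "\<theta> \<in> Cc_infty n (Rn n - B)" by (rule I(1))
  show "spt \<theta> \<subseteq> cball z b" using I(2) by auto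
  fix S x assume S: "S \<in> Gr n m" and x: "x \<in> Rn n"
  define y where "y = x - z"
  define t where "t = inner y y"
  have y: "y \<in> Rn n" unfolding y_def by (rule Rn_diff[OF x z])
  have "((\<lambda>x. inner (x - z) (x - z)) has_derivative (\<lambda>v. 2 * inner y v)) (at x within Rn n)"
    by (auto intro!: derivative_eq_intros simp: y_def inner_commute)
  moreover have "(\<Psi> has_derivative (\<lambda>u. - w t * u)) (at (inner (x - z) (x - z)))"
    using \<Psi>(2)[of t] unfolding has_field_derivative_def t_def y_def .
  ultimately have d1: "((\<lambda>x. \<Psi> (inner (x - z) (x - z))) has_derivative (\<lambda>v. - w t * (2 * inner y v))) (at x within Rn n)"
    by (rule has_derivative_compose)
  have d2: "((\<lambda>x. x - z) has_derivative (\<lambda>v. v)) (at x within Rn n)" by (auto intro!: derivative_eq_intros)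
  have "((\<lambda>x. \<Psi> (inner (x - z) (x - z)) *\<^sub>R (x - z)) has_derivative
      (\<lambda>v. \<Psi> t *\<^sub>R v + (- w t * (2 * inner y v)) *\<^sub>R y)) (at x within Rn n)"
    using bounded_bilinear.FDERIV[OF bounded_bilinear_scaleR d1 d2] unfolding t_def y_def .
  then have der: "(\<theta> has_derivative (\<lambda>v. \<Psi> t *\<^sub>R v + (- w t * (2 * inner y v)) *\<^sub>R y)) (at x within Rn n)"
    by (rule has_derivative_transform[OF x, rotated]) (rule \<theta>_Rn)
  have D: "Deriv n \<theta> x v = \<Psi> t *\<^sub>R v + (- w t * (2 * inner y v)) *\<^sub>R y" if "v \<in> Rn n" for v
    by (rule Deriv_eq[OF der x that])
  interpret Q: bounded_linear "orth_proj S" by (rule bounded_linear_orth_proj[OF S])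
  have "trace_inner n (orth_proj S) (Deriv n \<theta> x) =
      (\<Sum>i<n. \<Psi> t * coord (orth_proj S (unit_vec i)) i - 2 * w t * (coord y i * inner (orth_proj S (unit_vec i)) y))"
    unfolding trace_inner_def by (rule sum.cong) (auto simp: D unit_vec_Rn inner_add_right inner_diff_right)
  also have "\<dots> = \<Psi> t * (\<Sum>i<n. coord (orth_proj S (unit_vec i)) i) - 2 * w t * (\<Sum>i<n. coord y i * inner (orth_proj S (unit_vec i)) y)"
    by (simp add: sum_subtractf sum_distrib_left)
  also have "(\<Sum>i<n. coord (orth_proj S (unit_vec i)) i) = real m" by (rule orth_proj_props(7)[OF S])
  also have "(\<Sum>i<n. coord y i * inner (orth_proj S (unit_vec i)) y) = inner (orth_proj S (\<Sum>i<n. coord y i *\<^sub>R unit_vec i)) y"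
    by (simp add: Q.sum Q.scaleR inner_sum_left)
  also have "(\<Sum>i<n. coord y i *\<^sub>R unit_vec i) = y" by (rule Rn_expand[OF y, symmetric])
  finally show "trace_inner n (orth_proj S) (Deriv n \<theta> x) =
      real m * \<Psi> (inner (x - z) (x - z)) - 2 * w (inner (x - z) (x - z)) * inner (x - z) (orth_proj S (x - z))"
    by (simp add: t_def y_def inner_commute mult.commute)
qed

context radon_distribution
begin

lemma abs_ext_le_ball:
  assumes c: "\<And>x. x \<in> U \<Longrightarrow> norm (f x) \<le> c" "\<And>x. x \<in> U \<Longrightarrow> x \<notin> ball z s \<Longrightarrow> f x = 0"
  shows "ennreal \<bar>ext f\<bar> \<le> ennreal c * emeasure var_measure (U \<inter> ball z s)"
proof (cases "f \<in> L1 n var_measure")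
  case True
  have s: "U \<inter> ball z s \<in> sets var_measure" by (auto simp: sets_var_measure)
  have "ennreal \<bar>ext f\<bar> \<le> (\<integral>\<^sup>+x. ennreal (norm (f x)) \<partial>cvar)" by (rule abs_ext_le[OF True])
  also have "\<dots> = (\<integral>\<^sup>+x. ennreal (norm (f x)) \<partial>var_measure)" by (rule nn_integral_completion)
  also have "\<dots> \<le> (\<integral>\<^sup>+x. ennreal c * indicator (U \<inter> ball z s) x \<partial>var_measure)"
    by (rule nn_integral_mono) (use c in \<open>auto simp: indicator_def intro: ennreal_leI\<close>)
  also have "\<dots> = ennreal c * emeasure var_measure (U \<inter> ball z s)" by (rule nn_integral_cmult_indicator[OF s])
  finally show ?thesis .
next
  case False
  \<comment> \<open>The extension has the default value 0 outside L1, so the bound holds for every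
    field.\<close>
  then show ?thesis by (simp add: ext_notin)
qed

end

text \<open>\<open>E\<close> is only measurable for the completion: \<open>E'\<close> is its Borel part and \<open>N\<close> the remaining
  null set.\<close>

locale relative_varifold = varifold_data +
  fixes E B E' N N' :: "fseq set"
  assumes fv_radon: "radon_measure (top_of_set U) (variation_fv n U V)"
    and E_eq: "E = E' \<union> N" "N \<subseteq> N'" "N' \<in> null_sets (weight U V)" "N' \<in> null_sets (variation_fv n U V)"
      "E' \<in> sets (weight U V)"
    and B: "closed B" "B \<subseteq> Rn n" "B \<inter> U = {}"
    and finite_K: "\<And>K. compact K \<Longrightarrow> K \<subseteq> Rn n - B \<Longrightarrow>
        outer_measure_of (weight U V) (E \<inter> K)
        + outer_measure_of (variation_fv n U V) (E \<inter> K)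
        + outer_measure_of (variation_boundary n m U V E) (U \<inter> K) < \<infinity>"
    and identity: "\<And>\<theta>. \<theta> \<in> Cc_infty n (Rn n - B) \<Longrightarrow>
        (LINT (z, S):E \<times> Gr n m|completion V. trace_inner n (orth_proj S) (Deriv n \<theta> z))
        = L1_extension n U (restrict_distrib n U (first_variation n V) E) (cutoff U \<theta>)
          - L1_extension n U (distrib_boundary n m U V E) (cutoff U \<theta>)"
    and finite_E: "emeasure (weight U V) E' < \<infinity>"
begin

lemma E'_sub: "E' \<subseteq> U" and E'_borel [measurable]: "E' \<in> sets borel"
  using E_eq(5) by (auto simp: sets_W)

sublocale dV: vector_distribution n U "first_variation n V"
  by (rule first_variation_distribution) (use V_compact compactin_cylinder in auto)

lemma fv_eq: "variation_fv n U V = dV.var_measure"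
  by (simp add: variation_fv_def dV.variation_eq)

sublocale dV: radon_distribution n U "first_variation n V"
proof
  fix K assume "compact K" "K \<subseteq> U"
  then have "compactin (top_of_set U) K" by (simp add: compactin_subtopology)
  then show "emeasure dV.var_measure K < \<infinity>" using fv_radon by (auto simp: radon_measure_def fv_eq)
qed

lemma sets_fv: "sets dV.var_measure = sets W"
  by (simp add: dV.sets_var_measure sets_W)

lemma E_cvar: "E \<in> sets dV.cvar"
  by (rule sets_completionI[OF E_eq(1,2)]) (use E_eq(4,5) sets_fv in \<open>auto simp: fv_eq\<close>)

abbreviation R where "R \<equiv> restrict_distrib n U (first_variation n V) E"

sublocale R: radon_distribution n U R
  by (rule dV.restriction_radon(1)[OF E_cvar])

lemma R_le:
  assumes C: "openin (top_of_set U) C"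
  shows "emeasure R.var_measure C \<le> emeasure dV.var_measure (E' \<inter> C)"
proof -
  have Cs: "C \<in> sets dV.var_measure" by (rule dV.open_sets_var_measure[OF C])
  have E's: "E' \<in> sets dV.var_measure" using E_eq(5) sets_fv by simp
  have N's: "N' \<in> null_sets dV.var_measure" using E_eq(4) by (simp add: fv_eq)
  have "emeasure R.var_measure C \<le> emeasure dV.cvar (E \<inter> C)"
    using dV.restriction_radon(2)[OF E_cvar C] by (simp add: R.variation_eq)
  also have "\<dots> \<le> emeasure dV.cvar (E' \<inter> C \<union> N')"
    using E_eq(1,2) Cs E's N's by (intro emeasure_mono) (auto intro: null_setsD2)
  also have "\<dots> = emeasure dV.var_measure (E' \<inter> C \<union> N')"
    using Cs E's null_setsD2[OF N's] by (simp add: emeasure_completion)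
  also have "\<dots> = emeasure dV.var_measure (E' \<inter> C)"
    using Cs E's N's by (intro emeasure_Un_null_set) auto
  finally show ?thesis .
qed

lemma cylinder_null: "N' \<times> Gr n m \<in> null_sets V"
  using E_eq(3) cylinder_sets[of N'] emeasure_W[of N'] by (auto simp: null_sets_def)

lemma cylinder_E': "E' \<times> Gr n m \<in> sets V"
  by (rule cylinder_sets[OF E_eq(5)])

lemma restrict_V: "restrict_measure V (E \<times> Gr n m) = density V (indicator (E' \<times> Gr n m))"
  by (rule restrict_measure_null_modification[OF _ _ cylinder_null cylinder_E', of _ "N \<times> Gr n m"])
     (use E_eq(1,2) in auto)

abbreviation T where "T \<equiv> distrib_boundary n m U V E"

sublocale T: vector_distribution n U T
proof -
  interpret VE: vector_distribution n U "first_variation n (restrict_measure V (E \<times> Gr n m))"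
  proof (rule first_variation_distribution)
    show "sets (restrict_measure V (E \<times> Gr n m)) = sets V" by (simp add: restrict_V)
    fix K assume K: "compact K" "K \<subseteq> U"
    have Ks: "K \<times> Gr n m \<in> sets V" using K borel_compact by (intro cylinder_sets) (auto simp: sets_W)
    have "emeasure (restrict_measure V (E \<times> Gr n m)) (K \<times> Gr n m) = emeasure V (E' \<times> Gr n m \<inter> K \<times> Gr n m)"
      unfolding restrict_V by (rule emeasure_restricted[OF cylinder_E' Ks])
    also have "\<dots> \<le> emeasure V (K \<times> Gr n m)" using Ks by (intro emeasure_mono) auto
    also have "\<dots> < \<infinity>" by (rule V_compact[OF compactin_cylinder[OF K]])
    finally show "emeasure (restrict_measure V (E \<times> Gr n m)) (K \<times> Gr n m) < \<infinity>" .
  qed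
  show "vector_distribution n U T"
    by unfold_locales
       (auto simp: distrib_boundary_def R.S_add R.S_scaleR VE.S_add VE.S_scaleR algebra_simps intro: open_U)
qed

lemma T_eq: "variation_boundary n m U V E = T.var_measure"
  by (simp add: variation_boundary_def T.variation_eq)

sublocale T: radon_distribution n U T
proof
  fix K assume K: "compact K" "K \<subseteq> U"
  \<comment> \<open>A compact subset of \<open>U\<close> avoids \<open>B\<close>, so the local
    finiteness assumed on the complement of \<open>B\<close> applies.\<close>
  then have "K \<subseteq> Rn n - B" using B U_Rn by auto
  then have "outer_measure_of T.var_measure (U \<inter> K) < \<infinity>"
    using finite_K[OF K(1)] by (simp add: T_eq)
  moreover have "U \<inter> K = K" using K by auto
  ultimately show "emeasure T.var_measure K < \<infinity>"
    using outer_measure_of_eq[OF T.compact_sets_var_measure[OF K]] by simp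
qed

text \<open>The \<nu> of the overview, with \<open>E\<close> replaced by its Borel part.\<close>

definition \<nu> :: "fseq set \<Rightarrow> ennreal" where
  "\<nu> A = emeasure dV.var_measure (E' \<inter> A) + emeasure T.var_measure (U \<inter> A)"

lemma set_integral_eq:
  assumes \<theta>: "\<theta> \<in> Cc_infty n (Rn n - B)"
  shows "(\<lambda>(z, S). trace_inner n (orth_proj S) (Deriv n \<theta> z)) \<in> borel_measurable V"
    and "(LINT (z, S):E \<times> Gr n m|completion V. trace_inner n (orth_proj S) (Deriv n \<theta> z))
      = (\<integral>p. indicat_real (E' \<times> Gr n m) p * (case p of (z, S) \<Rightarrow> trace_inner n (orth_proj S) (Deriv n \<theta> z)) \<partial>V)"
proof -
  let ?F = "\<lambda>(z, S). trace_inner n (orth_proj S) (Deriv n \<theta> z)"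
  have "continuous_map P euclideanreal ?F"
    using continuous_trace[OF \<theta>] B U_Rn by (subst trace_inner_commute) auto
  then show F: "?F \<in> borel_measurable V" by (rule borel_measurable_continuous_map[OF sets_V])
  have Es: "E \<times> Gr n m \<in> sets (completion V)"
    by (rule sets_completionI[OF _ _ cylinder_null cylinder_E', of _ "N \<times> Gr n m"]) (use E_eq(1,2) in auto)
  have E's: "E' \<times> Gr n m \<in> sets (completion V)" using cylinder_E' by simp
  have Fc: "?F \<in> borel_measurable (completion V)" using F by (rule measurable_completion)
  have "AE p in completion V. p \<notin> N' \<times> Gr n m"
    by (rule AE_completion[OF AE_not_in[OF cylinder_null]])
  then have ae: "AE p in completion V. indicat_real (E \<times> Gr n m) p *\<^sub>R ?F p = indicat_real (E' \<times> Gr n m) p * ?F p"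
    by (rule eventually_mono) (use E_eq(1,2) in \<open>auto simp: indicator_def\<close>)
  have "(LINT p:E \<times> Gr n m|completion V. ?F p) = (\<integral>p. indicat_real (E' \<times> Gr n m) p * ?F p \<partial>completion V)"
    unfolding set_lebesgue_integral_def
    by (rule integral_cong_AE[OF _ _ ae]) (use Es E's Fc in auto)
  also have "\<dots> = (\<integral>p. indicat_real (E' \<times> Gr n m) p * ?F p \<partial>V)"
    by (rule integral_completion) (use cylinder_E' F in auto)
  finally show "(LINT p:E \<times> Gr n m|completion V. ?F p) = (\<integral>p. indicat_real (E' \<times> Gr n m) p * ?F p \<partial>V)" .
qed

text \<open>Here the integral identity enters. Its right side is a difference of two extensions,
  each at most the sup norm of the field times the variation of the ball, and the variation of the
  restricted distribution is dominated by \<parallel>\<delta>V\<parallel> on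
  \<open>E'\<close>.\<close>

lemma test_field_bound:
  assumes \<theta>: "\<theta> \<in> Cc_infty n (Rn n - B)" "\<And>x. norm (\<theta> x) \<le> c" "spt \<theta> \<subseteq> ball z s"
  shows "ennreal \<bar>\<integral>p. indicat_real (E' \<times> Gr n m) p * (case p of (z, S) \<Rightarrow> trace_inner n (orth_proj S) (Deriv n \<theta> z)) \<partial>V\<bar>
    \<le> ennreal c * \<nu> (ball z s)"
proof -
  have zero: "\<theta> x = 0" if "x \<notin> ball z s" for x using that \<theta>(3) by (intro not_in_spt) auto
  have c: "norm (cutoff U \<theta> x) \<le> c" if "x \<in> U" for x using \<theta>(2)[of x] that by (simp add: cutoff_def)
  have cz: "cutoff U \<theta> x = 0" if "x \<notin> ball z s" for x using zero[OF that] by (simp add: cutoff_def)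
  have oB: "openin (top_of_set U) (U \<inter> ball z s)" by (simp add: openin_open_Int)
  have EU: "E' \<inter> (U \<inter> ball z s) = E' \<inter> ball z s" using E'_sub by auto
  have "ennreal \<bar>R.ext (cutoff U \<theta>) - T.ext (cutoff U \<theta>)\<bar> \<le> ennreal (\<bar>R.ext (cutoff U \<theta>)\<bar> + \<bar>T.ext (cutoff U \<theta>)\<bar>)"
    by (rule ennreal_leI) linarith
  also have "\<dots> = ennreal \<bar>R.ext (cutoff U \<theta>)\<bar> + ennreal \<bar>T.ext (cutoff U \<theta>)\<bar>" by simp
  also have "\<dots> \<le> ennreal c * emeasure R.var_measure (U \<inter> ball z s) + ennreal c * emeasure T.var_measure (U \<inter> ball z s)"
    by (intro add_mono R.abs_ext_le_ball T.abs_ext_le_ball c cz)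
  also have "\<dots> \<le> ennreal c * emeasure dV.var_measure (E' \<inter> (U \<inter> ball z s)) + ennreal c * emeasure T.var_measure (U \<inter> ball z s)"
    by (intro add_right_mono mult_left_mono R_le[OF oB]) auto
  also have "\<dots> = ennreal c * \<nu> (ball z s)" unfolding EU \<nu>_def by (rule distrib_left[symmetric])
  finally show ?thesis
    using identity[OF \<theta>(1)] set_integral_eq(2)[OF \<theta>(1)] by (simp add: R.L1_extension_eq T.L1_extension_eq)
qed

lemma monotonicity:
  assumes z: "z \<in> Rn n" and sep: "\<And>y. y \<in> B \<Longrightarrow> c \<le> dist z y" and ord: "0 < a" "a < b" "b < c" and m: "1 \<le> m"
    and fin: "\<nu> (ball z c) < \<infinity>"
  shows "measure W (E' \<inter> ball z a) / a ^ m \<le> measure W (E' \<inter> ball z b) / b ^ m + b / a ^ m * enn2real (\<nu> (ball z c))"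
proof -
  have main: "measure W (E' \<inter> ball z a) / a1 ^ m \<le> measure W (E' \<inter> ball z b) / b1 ^ m + b / a ^ m * enn2real (\<nu> (ball z c))"
    if ab: "a < a1" "a1 < b1" "b1 < b" for a1 b1
  proof -
    obtain \<Psi> w :: "real \<Rightarrow> real" where p: "\<And>k. Ck UNIV UNIV k \<Psi>"
      "\<And>t. (\<Psi> has_real_derivative - w t) (at t)" "\<And>t. 0 \<le> w t" "\<And>t. b\<^sup>2 \<le> t \<Longrightarrow> \<Psi> t = 0"
      "\<And>t. 0 \<le> \<Psi> t" "\<And>t. \<Psi> t \<le> 2 / a ^ m"
      "\<And>t. 0 \<le> t \<Longrightarrow> 2 / a1 ^ m * (if t < a\<^sup>2 then 1 else 0) - 2 / b1 ^ m * (if t < b\<^sup>2 then 1 else 0)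
        \<le> real m * \<Psi> t - 2 * t * w t"
      by (rule radial_profile[OF ord(1) ab m]) blast
    define \<theta> where "\<theta> = (\<lambda>x. if x \<in> Rn n then \<Psi> (inner (x - z) (x - z)) *\<^sub>R (x - z) else 0)"
    have b0: "0 < b" using ord by simp
    have sepb: "\<forall>y\<in>B. b < dist z y" using sep ord by force
    have p4: "\<forall>t\<ge>b\<^sup>2. \<Psi> t = 0" using p(4) by blast
    note rf = radial_field[OF z b0 sepb p(1,2) p4, folded \<theta>_def]
    let ?G = "\<lambda>p. indicat_real (E' \<times> Gr n m) p * (case p of (z, S) \<Rightarrow> trace_inner n (orth_proj S) (Deriv n \<theta> z))"
    define H where "H p = 2 / a1 ^ m * indicat_real ((E' \<inter> ball z a) \<times> Gr n m) p
      - 2 / b1 ^ m * indicat_real ((E' \<inter> ball z b) \<times> Gr n m) p" for p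
    have Es: "E' \<inter> ball z s \<in> sets W" for s using E'_sub by (auto simp: sets_W)
    have EV: "(E' \<inter> ball z s) \<times> Gr n m \<in> sets V" for s by (rule cylinder_sets[OF Es])
    have EV_le: "emeasure V ((E' \<inter> ball z s) \<times> Gr n m) < \<infinity>" for s
    proof -
      have "emeasure V ((E' \<inter> ball z s) \<times> Gr n m) \<le> emeasure V (E' \<times> Gr n m)"
        using cylinder_E' by (intro emeasure_mono) auto
      also have "\<dots> < \<infinity>" using finite_E emeasure_W[OF E_eq(5)] by simp
      finally show ?thesis .
    qed
    have mEV: "measure V ((E' \<inter> ball z s) \<times> Gr n m) = measure W (E' \<inter> ball z s)" for s
      using emeasure_W[OF Es] by (simp add: measure_def)
    \<comment> \<open>For y = x - z the number \<open>inner y (orth_proj S y)\<close> lies between 0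
      and |y|^2. As \<open>w\<close> is nonnegative, the upper bound reduces the integrand to the
      inequality in one variable from \<open>radial_profile\<close>, and the lower bound gives the
      constant majorant needed for integrability.\<close>
    have bounds: "H p \<le> ?G p" "?G p \<le> real m * (2 / a ^ m) * indicat_real (E' \<times> Gr n m) p" for p
    proof -
      have "H p \<le> ?G p \<and> ?G p \<le> real m * (2 / a ^ m) * indicat_real (E' \<times> Gr n m) p"
      proof (cases "p \<in> E' \<times> Gr n m")
        case True
        then obtain x S where xS: "p = (x, S)" "x \<in> E'" "S \<in> Gr n m" by auto
        have xR: "x \<in> Rn n" using xS E'_sub U_Rn by auto
        define t where "t = inner (x - z) (x - z)"
        have t0: "0 \<le> t" by (simp add: t_def)
        have ball: "x \<in> ball z s \<longleftrightarrow> t < s\<^sup>2" if "0 < s" for s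
        proof -
          have "x \<in> ball z s \<longleftrightarrow> norm (x - z) < s" by (simp add: dist_norm norm_minus_commute)
          also have "\<dots> \<longleftrightarrow> t < s\<^sup>2" unfolding t_def dot_square_norm
            using that power2_less_imp_less[of "norm (x - z)" s] power_strict_mono[of "norm (x - z)" s 2] by auto
          finally show ?thesis .
        qed
        have G: "?G p = real m * \<Psi> t - 2 * w t * inner (x - z) (orth_proj S (x - z))"
          using rf(3)[OF xS(3) xR] xS by (simp add: t_def)
        have o: "0 \<le> inner (x - z) (orth_proj S (x - z))" "inner (x - z) (orth_proj S (x - z)) \<le> t"
          using orth_proj_props(4,5)[OF xS(3)] by (auto simp: t_def)
        have "2 * w t * inner (x - z) (orth_proj S (x - z)) \<le> 2 * w t * t" using o(2) p(3)[of t] by (intro mult_left_mono) auto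
        then have 1: "real m * \<Psi> t - 2 * t * w t \<le> ?G p" using G by (simp add: mult_ac)
        have "0 \<le> 2 * w t * inner (x - z) (orth_proj S (x - z))" using o(1) p(3)[of t] by simp
        moreover have "real m * \<Psi> t \<le> real m * (2 / a ^ m)" using p(6) by (intro mult_left_mono) auto
        ultimately have 2: "?G p \<le> real m * (2 / a ^ m)" using G by linarith
        have H: "H p = 2 / a1 ^ m * (if t < a\<^sup>2 then 1 else 0) - 2 / b1 ^ m * (if t < b\<^sup>2 then 1 else 0)"
          using xS ball[of a] ball[of b] ord b0 by (simp add: H_def indicator_def)
        show ?thesis using p(7)[OF t0] 1 2 H True by (simp add: xS)
      next
        case False
        then show ?thesis by (auto simp: H_def indicator_def)
      qed
      then show "H p \<le> ?G p" "?G p \<le> real m * (2 / a ^ m) * indicat_real (E' \<times> Gr n m) p" by auto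
    qed
    have intH: "integrable V H"
      unfolding H_def using EV EV_le by (intro Bochner_Integration.integrable_diff integrable_mult_right integrable_real_indicator) auto
    have intU: "integrable V (\<lambda>p. real m * (2 / a ^ m) * indicat_real (E' \<times> Gr n m) p)"
      using cylinder_E' finite_E emeasure_W[OF E_eq(5)] by (intro integrable_mult_right integrable_real_indicator) auto
    have measG: "?G \<in> borel_measurable V"
      using cylinder_E' set_integral_eq(1)[OF rf(1)] by (intro borel_measurable_times borel_measurable_indicator)
    have intG: "integrable V ?G"
    proof (rule Bochner_Integration.integrable_bound[OF Bochner_Integration.integrable_add[OF integrable_norm[OF intH] integrable_norm[OF intU]] measG])
      show "AE p in V. norm (?G p) \<le> norm (norm (H p) + norm (real m * (2 / a ^ m) * indicat_real (E' \<times> Gr n m) p))"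
      proof (rule AE_I2)
        fix p
        have "\<bar>g\<bar> \<le> \<bar>\<bar>h\<bar> + \<bar>k\<bar>\<bar>" if "h \<le> g" "g \<le> k" for g h k :: real using that by linarith
        from this[OF bounds[of p]]
        show "norm (?G p) \<le> norm (norm (H p) + norm (real m * (2 / a ^ m) * indicat_real (E' \<times> Gr n m) p))"
          by (simp only: real_norm_def)
      qed
    qed
    have "2 / a1 ^ m * measure W (E' \<inter> ball z a) - 2 / b1 ^ m * measure W (E' \<inter> ball z b) = (\<integral>p. H p \<partial>V)"
      unfolding H_def using EV EV_le mEV
      by (subst Bochner_Integration.integral_diff) (auto intro!: integrable_mult_right integrable_real_indicator)
    also have "\<dots> \<le> (\<integral>p. ?G p \<partial>V)" by (rule integral_mono[OF intH intG bounds(1)])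
    also have "\<dots> \<le> \<bar>\<integral>p. ?G p \<partial>V\<bar>" by simp
    also have "\<dots> \<le> (2 / a ^ m * b) * enn2real (\<nu> (ball z c))"
    proof -
      have norm: "norm (\<theta> x) \<le> 2 / a ^ m * b" for x
      proof (cases "x \<in> Rn n \<and> norm (x - z) < b")
        case True
        then have "norm (\<theta> x) = \<Psi> (inner (x - z) (x - z)) * norm (x - z)" using p(5) by (simp add: \<theta>_def)
        also have "\<dots> \<le> 2 / a ^ m * b" using True p(5,6) ord by (intro mult_mono) auto
        finally show ?thesis .
      next
        case False
        have "\<theta> x = 0"
        proof (cases "x \<in> Rn n")
          case True
          then have "b \<le> norm (x - z)" using False by auto
          then have "b\<^sup>2 \<le> inner (x - z) (x - z)" using b0 by (simp only: dot_square_norm) (intro power_mono, auto)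
          then show ?thesis using p(4) by (simp add: \<theta>_def)
        qed (simp add: \<theta>_def)
        then show ?thesis using ord by simp
      qed
      \<comment> \<open>The support lies in the closed ball of radius \<open>b\<close>; the larger
        open ball is taken because the variations are compared on open sets.\<close>
      have "spt \<theta> \<subseteq> ball z c" using rf(2) ord(3) by fastforce
      then have "ennreal \<bar>\<integral>p. ?G p \<partial>V\<bar> \<le> ennreal (2 / a ^ m * b) * \<nu> (ball z c)"
        using test_field_bound[OF rf(1) norm] by blast
      also have "\<dots> = ennreal (2 / a ^ m * b) * ennreal (enn2real (\<nu> (ball z c)))" using fin by simp
      also have "\<dots> = ennreal (2 / a ^ m * b * enn2real (\<nu> (ball z c)))"
        by (rule ennreal_mult[symmetric]) (use ord in auto)
      finally show ?thesis using ord by (subst (asm) ennreal_le_iff) auto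
    qed
    finally have *: "2 / a1 ^ m * measure W (E' \<inter> ball z a) - 2 / b1 ^ m * measure W (E' \<inter> ball z b)
        \<le> 2 / a ^ m * b * enn2real (\<nu> (ball z c))" .
    have "2 / x * y = 2 * (y / x)" "2 / x * b * y = 2 * (b / x * y)" for x y :: real by simp_all
    with * show ?thesis by (simp only:)
  qed
  \<comment> \<open>Let \<open>a1 = a + t\<close> decrease to \<open>a\<close> and
    \<open>b1 = b - t\<close> increase to \<open>b\<close>; the remaining quantities do not depend
    on \<open>t\<close>.\<close>
  have lim1: "((\<lambda>t. measure W (E' \<inter> ball z a) / (a + t) ^ m) \<longlongrightarrow> measure W (E' \<inter> ball z a) / (a + 0) ^ m) (at_right 0)"
    using ord by (intro tendsto_intros) auto
  have lim2: "((\<lambda>t. measure W (E' \<inter> ball z b) / (b - t) ^ m + b / a ^ m * enn2real (\<nu> (ball z c)))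
     \<longlongrightarrow> measure W (E' \<inter> ball z b) / (b - 0) ^ m + b / a ^ m * enn2real (\<nu> (ball z c))) (at_right 0)"
    using ord by (intro tendsto_intros) auto
  have ev: "\<forall>\<^sub>F t in at_right 0. measure W (E' \<inter> ball z a) / (a + t) ^ m
     \<le> measure W (E' \<inter> ball z b) / (b - t) ^ m + b / a ^ m * enn2real (\<nu> (ball z c))"
  proof (rule eventually_at_rightI[of 0 "(b - a) / 2"])
    fix t assume "t \<in> {0<..<(b - a) / 2}"
    then show "measure W (E' \<inter> ball z a) / (a + t) ^ m
       \<le> measure W (E' \<inter> ball z b) / (b - t) ^ m + b / a ^ m * enn2real (\<nu> (ball z c))"
      by (intro main) auto
  qed (use ord in auto)
  show ?thesis using tendsto_le[OF trivial_limit_at_right_real lim2 lim1 ev] by simp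
qed

end

section \<open>Densities and conclusion\<close>

lemma measurable_inclusion:
  assumes "sets M = {A \<in> sets borel. A \<subseteq> U}" "space M = U" "U \<in> sets borel"
  shows "(\<lambda>x. x) \<in> measurable M borel"
  using assms by (intro measurableI) auto

lemma emeasure_distr_inclusion:
  assumes "sets M = {A \<in> sets borel. A \<subseteq> U}" "space M = U" "U \<in> sets borel" "A \<in> sets borel"
  shows "emeasure (distr M borel (\<lambda>x. x)) A = emeasure M (U \<inter> A)"
  using emeasure_distr[OF measurable_inclusion[OF assms(1-3)] assms(4)] assms by (simp add: Int_commute)

lemma emeasure_distr_restricted:
  assumes "sets M = {A \<in> sets borel. A \<subseteq> U}" "space M = U" "U \<in> sets borel" "A \<in> sets borel" "E \<in> sets M"
  shows "emeasure (distr (density M (indicator E)) borel (\<lambda>x. x)) A = emeasure M (E \<inter> A)"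
proof -
  have "emeasure (distr (density M (indicator E)) borel (\<lambda>x. x)) A = emeasure (density M (indicator E)) (U \<inter> A)"
    by (rule emeasure_distr_inclusion) (use assms in auto)
  also have "\<dots> = emeasure M (E \<inter> (U \<inter> A))"
    by (rule emeasure_restricted) (use assms in auto)
  also have "E \<inter> (U \<inter> A) = E \<inter> A" using assms(1,5) by auto
  finally show ?thesis .
qed

context relative_varifold
begin

text \<open>Pushed forward along the inclusion of \<open>U\<close>, since
  \<open>isoperimetric_pair\<close> is about Borel measures on the whole type.\<close>

definition \<mu>b :: "fseq measure" where
  "\<mu>b = distr (density W (indicator E')) borel (\<lambda>x. x)"

definition \<nu>b :: "fseq measure" where
  "\<nu>b = add_measure (distr (density dV.var_measure (indicator E')) borel (\<lambda>x. x)) (distr T.var_measure borel (\<lambda>x. x))"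

lemma sets_\<mu>b [simp, measurable_cong]: "sets \<mu>b = sets borel"
  by (simp add: \<mu>b_def)

lemma sets_\<nu>b [simp, measurable_cong]: "sets \<nu>b = sets borel"
  by (simp add: \<nu>b_def)

lemma emeasure_\<mu>b: "A \<in> sets borel \<Longrightarrow> emeasure \<mu>b A = emeasure W (E' \<inter> A)"
  unfolding \<mu>b_def by (rule emeasure_distr_restricted[OF sets_W space_W U_borel _ E_eq(5)])

lemma emeasure_\<nu>b:
  assumes A: "A \<in> sets borel" shows "emeasure \<nu>b A = \<nu> A"
proof -
  have E's: "E' \<in> sets dV.var_measure" using E_eq(5) sets_fv by simp
  have "emeasure \<nu>b A = emeasure (distr (density dV.var_measure (indicator E')) borel (\<lambda>x. x)) A +
      emeasure (distr T.var_measure borel (\<lambda>x. x)) A"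
    unfolding \<nu>b_def by (rule emeasure_add_measure) (use A in auto)
  also have "\<dots> = \<nu> A"
    unfolding \<nu>_def
    by (intro arg_cong2[of _ _ _ _ "(+)"] emeasure_distr_restricted[OF dV.sets_var_measure dV.space_var_measure U_borel A E's]
        emeasure_distr_inclusion[OF T.sets_var_measure T.space_var_measure U_borel A])
  finally show ?thesis .
qed

lemma finite_\<mu>b: "finite_measure \<mu>b"
  using emeasure_\<mu>b[of UNIV] finite_E sets_eq_imp_space_eq[OF sets_\<mu>b] by (intro finite_measureI) auto

lemma measure_\<mu>b: "A \<in> sets borel \<Longrightarrow> measure \<mu>b A = measure W (E' \<inter> A)"
  using emeasure_\<mu>b by (simp add: measure_def)

text \<open>\<open>has_density\<close> refers to closed balls, the covering arguments to open ones.
  The bound passes to the open ball of radius \<open>s\<close> by letting the radii of closed balls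
  increase to \<open>s\<close>.\<close>

lemma density_ball_lower:
  assumes d: "has_density m W z d" "ennreal q < d" and q: "0 \<le> q" and m: "0 < unit_ball_vol (real m)"
  obtains s1 where "0 < s1" "\<And>s. 0 < s \<Longrightarrow> s < s1 \<Longrightarrow> ennreal (q * unit_ball_vol (real m) * s ^ m) \<le> emeasure W (U \<inter> ball z s)"
proof -
  define \<alpha> where "\<alpha> = unit_ball_vol (real m)"
  have \<alpha>: "0 < \<alpha>" using m by (simp add: \<alpha>_def)
  have "\<forall>\<^sub>F r in at_right 0. ennreal q < emeasure W (cball z r \<inter> space W) / ennreal (\<alpha> * r ^ m)"
    using d unfolding has_density_def \<alpha>_def by (rule order_tendstoD(1))
  then obtain s1 where s1: "0 < s1" "\<And>r. 0 < r \<Longrightarrow> r < s1 \<Longrightarrow> ennreal q < emeasure W (cball z r \<inter> U) / ennreal (\<alpha> * r ^ m)"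
    by (auto simp: eventually_at_right_field)
  have cb: "ennreal (q * \<alpha> * t ^ m) \<le> emeasure W (cball z t \<inter> U)" if t: "0 < t" "t < s1" for t
  proof -
    have p: "0 < \<alpha> * t ^ m" using \<alpha> t by simp
    have "ennreal (q * \<alpha> * t ^ m) = ennreal q * ennreal (\<alpha> * t ^ m)" using q p by (simp add: mult.assoc ennreal_mult)
    also have "\<dots> \<le> emeasure W (cball z t \<inter> U) / ennreal (\<alpha> * t ^ m) * ennreal (\<alpha> * t ^ m)"
      using s1(2)[OF t] by (intro mult_right_mono) auto
    also have "\<dots> = emeasure W (cball z t \<inter> U)"
    proof -
      have "ennreal (\<alpha> * t ^ m) / ennreal (\<alpha> * t ^ m) = 1"
        using divide_ennreal[of "\<alpha> * t ^ m" "\<alpha> * t ^ m"] \<alpha> t by simp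
      then show ?thesis by (simp add: ennreal_divide_times)
    qed
    finally show ?thesis .
  qed
  show thesis
  proof (rule that[OF s1(1)])
    fix s assume s: "0 < s" "s < s1"
    have "((\<lambda>t. ennreal (q * \<alpha> * t ^ m)) \<longlongrightarrow> ennreal (q * \<alpha> * s ^ m)) (at_left s)"
      by (intro tendsto_intros)
    moreover have "\<forall>\<^sub>F t in at_left s. ennreal (q * \<alpha> * t ^ m) \<le> emeasure W (U \<inter> ball z s)"
    proof (rule eventually_at_leftI[of 0])
      fix t assume t: "t \<in> {0<..<s}"
      then have "ennreal (q * \<alpha> * t ^ m) \<le> emeasure W (cball z t \<inter> U)" using cb s by auto
      also have "\<dots> \<le> emeasure W (U \<inter> ball z s)"
        using t by (intro emeasure_mono) (auto simp: sets_W)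
      finally show "ennreal (q * \<alpha> * t ^ m) \<le> emeasure W (U \<inter> ball z s)" .
    qed (use s in auto)
    ultimately show "ennreal (q * unit_ball_vol (real m) * s ^ m) \<le> emeasure W (U \<inter> ball z s)"
      unfolding \<alpha>_def by (rule tendsto_upperbound) (use trivial_limit_at_left_real in auto)
  qed
qed

text \<open>The density of \<open>\<parallel>V\<parallel>\<close> may be infinite, so that no doubling condition is available for the
  differentiation of \<open>\<parallel>V\<parallel> \<llcorner> E\<close> with respect to \<open>\<parallel>V\<parallel>\<close>; however, on the exceptional set
  the measure \<open>\<parallel>V\<parallel> \<llcorner> E\<close> itself has bounded density ratios, which suffices for a Vitali argument.\<close>

lemma upper_density_exceptional:
  assumes q: "0 < \<eta>" "\<eta> < q" and m: "0 < unit_ball_vol (real m)" and \<rho>: "0 < \<rho>"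
    and A: "A \<subseteq> E'" "\<And>z. z \<in> A \<Longrightarrow> \<exists>d\<ge>ennreal q. has_density m W z d"
      "\<And>z a. z \<in> A \<Longrightarrow> 0 < a \<Longrightarrow> a < \<rho> \<Longrightarrow> measure \<mu>b (ball z a) \<le> (q - \<eta>) * unit_ball_vol (real m) * a ^ m"
  shows "\<exists>N\<in>null_sets \<mu>b. A \<subseteq> N"
proof -
  interpret mu: finite_measure \<mu>b by (rule finite_\<mu>b)
  define \<alpha> where "\<alpha> = unit_ball_vol (real m)"
  have \<alpha>: "0 < \<alpha>" using m by (simp add: \<alpha>_def)
  \<comment> \<open>The ratio of \<open>(q - \<eta>) * \<alpha> * (5 * s) ^ m\<close>, which bounds
    \<mu>b on the enlarged ball, to \<open>\<eta> / 2 * \<alpha> * s ^ m\<close>, the mass that has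
    to lie outside \<open>E'\<close>.\<close>
  define K where "K = (q - \<eta>) * 5 ^ m / (\<eta> / 2)"
  have K: "0 < K" using q by (simp add: K_def)
  have small: "\<exists>C\<in>sets borel. A \<subseteq> C \<and> emeasure \<mu>b C \<le> ennreal K * ennreal e" if e: "0 < e" for e
  proof -
    have fE: "emeasure W E' \<noteq> top" using finite_E by auto
    obtain D where D: "openin (top_of_set U) D" "E' \<subseteq> D" "emeasure W D \<le> emeasure W E' + ennreal e"
      by (rule W_outer_regular[OF E_eq(5) fE e]) blast
    have Ds: "D \<in> sets W"
    proof -
      have "openin (Rn_top n) D" using D(1) open_U by (rule openin_trans)
      then show ?thesis using openin_Rn_borel openin_imp_subset[OF D(1)] by (auto simp: sets_W)
    qed
    have DEs: "D - E' \<in> sets W" using Ds E_eq(5) by auto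
    \<comment> \<open>The part of the weight in an open neighbourhood \<open>D\<close> of
      \<open>E'\<close> but outside \<open>E'\<close>. Its total mass is at most \<open>e\<close>,
      yet around a point of \<open>A\<close> it must supply the density that \<mu>b fails to
      reach.\<close>
    define \<mu>' where "\<mu>' = distr (density W (indicator (D - E'))) borel (\<lambda>x. x)"
    have em': "emeasure \<mu>' B = emeasure W ((D - E') \<inter> B)" if "B \<in> sets borel" for B
      unfolding \<mu>'_def by (rule emeasure_distr_restricted[OF sets_W space_W U_borel that DEs])
    have "emeasure W E' + emeasure W (D - E') = emeasure W (E' \<union> (D - E'))"
      using E_eq(5) DEs by (intro plus_emeasure) auto
    also have "E' \<union> (D - E') = D" using D(2) by auto
    also note D(3)
    finally have DE: "emeasure W (D - E') \<le> ennreal e" using fE by (auto simp: ennreal_add_left_cancel_le)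
    have "\<exists>s. 0 < s \<and> s \<le> 1 \<and> s \<le> 1 \<and> emeasure \<mu>b (ball z (5 * s)) \<le> ennreal K * emeasure \<mu>' (ball z s)"
      if z: "z \<in> A" for z
    proof -
      obtain d where d: "ennreal q \<le> d" "has_density m W z d" using A(2)[OF z] by auto
      have "ennreal (q - \<eta> / 2) < ennreal q" using q by (intro ennreal_lessI) auto
      then have dq: "ennreal (q - \<eta> / 2) < d" using d(1) by (rule less_le_trans)
      have q2: "0 \<le> q - \<eta> / 2" using q by simp
      obtain s1 where s1: "0 < s1" "\<And>s. 0 < s \<Longrightarrow> s < s1 \<Longrightarrow> ennreal ((q - \<eta> / 2) * \<alpha> * s ^ m) \<le> emeasure W (U \<inter> ball z s)"
        unfolding \<alpha>_def by (rule density_ball_lower[OF d(2) dq q2 m]) blast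
      obtain G where G: "open G" "D = U \<inter> G" using D(1) by (auto simp: openin_open)
      have "z \<in> G" using z A(1) D(2) G(2) by auto
      then obtain r0 where r0: "0 < r0" "ball z r0 \<subseteq> G" using G(1) open_contains_ball by blast
      \<comment> \<open>Small enough for the ball to lie in \<open>D\<close>, for the lower density
        bound to hold, and for \<open>5 * s\<close> to stay below \<open>\<rho>\<close>.\<close>
      define s where "s = min (min 1 r0) (min s1 \<rho>) / 6"
      have s: "0 < s" "s \<le> 1" "s < r0" "s < s1" "5 * s < \<rho>" "s < \<rho>"
        using r0(1) s1(1) \<rho> by (auto simp: s_def min_def)
      have fin: "emeasure W (E' \<inter> ball z a) = ennreal (measure \<mu>b (ball z a))" for a
        using emeasure_\<mu>b[of "ball z a"] by (simp add: mu.emeasure_eq_measure)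
      have "ennreal ((q - \<eta>) * \<alpha> * s ^ m) + ennreal (\<eta> / 2 * \<alpha> * s ^ m) = ennreal ((q - \<eta> / 2) * \<alpha> * s ^ m)"
        using q \<alpha> s by (subst ennreal_plus[symmetric]) (auto simp: algebra_simps)
      also have "\<dots> \<le> emeasure W (U \<inter> ball z s)" by (rule s1(2)[OF s(1,4)])
      also have "\<dots> \<le> emeasure W ((E' \<inter> ball z s) \<union> ((D - E') \<inter> ball z s))"
        using s(3) r0(2) G(2) Ds E_eq(5) DEs by (intro emeasure_mono) (auto simp: sets_W)
      also have "\<dots> \<le> emeasure W (E' \<inter> ball z s) + emeasure W ((D - E') \<inter> ball z s)"
        using E_eq(5) DEs by (intro emeasure_subadditive) (auto simp: sets_W)
      also have "emeasure W (E' \<inter> ball z s) \<le> ennreal ((q - \<eta>) * \<alpha> * s ^ m)"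
        unfolding fin \<alpha>_def using A(3)[OF z s(1,6)] by (rule ennreal_leI)
      also have "emeasure W ((D - E') \<inter> ball z s) = emeasure \<mu>' (ball z s)" by (rule em'[symmetric]) simp
      finally have le: "ennreal (\<eta> / 2 * \<alpha> * s ^ m) \<le> emeasure \<mu>' (ball z s)"
        by (simp add: ennreal_add_left_cancel_le add_right_mono)
      have "emeasure \<mu>b (ball z (5 * s)) = ennreal (measure \<mu>b (ball z (5 * s)))" by (rule mu.emeasure_eq_measure)
      also have "\<dots> \<le> ennreal ((q - \<eta>) * \<alpha> * (5 * s) ^ m)"
        unfolding \<alpha>_def using s by (intro ennreal_leI A(3)[OF z]) auto
      also have "(q - \<eta>) * \<alpha> * (5 * s) ^ m = K * (\<eta> / 2 * \<alpha> * s ^ m)"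
        using q by (simp add: K_def power_mult_distrib)
      also have "ennreal (K * (\<eta> / 2 * \<alpha> * s ^ m)) = ennreal K * ennreal (\<eta> / 2 * \<alpha> * s ^ m)"
        using K q \<alpha> s by (intro ennreal_mult) auto
      also have "\<dots> \<le> ennreal K * emeasure \<mu>' (ball z s)" by (rule mult_left_mono[OF le]) simp
      finally show ?thesis using s by blast
    qed
    then obtain C where C: "C \<in> sets borel" "A \<subseteq> C" "emeasure \<mu>b C \<le> ennreal K * emeasure \<mu>' (\<Union>z\<in>A. ball z 1)"
      using emeasure_cover_le[of \<mu>b \<mu>' A 1 "\<lambda>_. 1" "ennreal K"] by (auto simp: \<mu>'_def)
    have "emeasure \<mu>' (\<Union>z\<in>A. ball z 1) \<le> ennreal e"
    proof -
      have "(\<Union>z\<in>A. ball z 1) \<in> sets borel" by (intro borel_open open_UN ballI open_ball)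
      then have "emeasure \<mu>' (\<Union>z\<in>A. ball z 1) \<le> emeasure W (D - E')"
        using DEs by (subst em') (auto intro!: emeasure_mono)
      then show ?thesis using DE by (rule order_trans)
    qed
    then have "emeasure \<mu>b C \<le> ennreal K * ennreal e"
      using C(3) mult_left_mono[of _ "ennreal e" "ennreal K"] by (meson order_trans zero_le)
    then show ?thesis using C(1,2) by blast
  qed
  have "\<exists>C. C \<in> sets borel \<and> A \<subseteq> C \<and> emeasure \<mu>b C \<le> ennreal K * ennreal (1 / real (Suc k))" for k
    using small[of "1 / real (Suc k)"] by auto
  then obtain C where C: "\<And>k. C k \<in> sets borel" "\<And>k. A \<subseteq> C k" "\<And>k. emeasure \<mu>b (C k) \<le> ennreal K * ennreal (1 / real (Suc k))"
    by metis
  define N where "N = (\<Inter>k. C k)"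
  have Ns: "N \<in> sets \<mu>b" unfolding N_def using C(1) by simp
  have "measure \<mu>b N \<le> K * (1 / real (Suc k))" for k
  proof -
    have "emeasure \<mu>b N \<le> emeasure \<mu>b (C k)" unfolding N_def using C(1) by (intro emeasure_mono) auto
    also have "\<dots> \<le> ennreal (K * (1 / real (Suc k)))" using C(3)[of k] ennreal_mult[of K "1 / real (Suc k)"] K by simp
    finally show ?thesis using K by (simp add: mu.emeasure_eq_measure)
  qed
  moreover have "(\<lambda>k. K * (1 / real (Suc k))) \<longlonglongrightarrow> K * 0"
    by (intro tendsto_intros) (use lim_inverse_n' LIMSEQ_Suc in blast)
  ultimately have "measure \<mu>b N \<le> K * 0" by (intro LIMSEQ_le_const) auto
  then have "measure \<mu>b N = 0" using measure_nonneg[of \<mu>b N] by simp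
  then have "N \<in> null_sets \<mu>b" using Ns by (simp add: null_sets_def mu.emeasure_eq_measure)
  moreover have "A \<subseteq> N" using C(2) by (auto simp: N_def)
  ultimately show ?thesis by blast
qed

text \<open>The abstract theorem asks for lower bounds at arbitrarily small radii only. This is
  applied with \<open>q = 1\<close>, \<open>\<eta> = 1 / 2\<close> for the covering and with
  \<open>q = Q\<close>, \<open>\<eta> = 1 / (4 * M)\<close> for the points of high density. A
  failing point fails at all radii below some \<open>1 / real (Suc j)\<close>, so countably many
  exceptional sets suffice.\<close>

lemma upper_density:
  assumes q: "0 < \<eta>" "\<eta> < q" and m: "0 < unit_ball_vol (real m)"
  obtains Z where "Z \<in> null_sets \<mu>b"
    "\<And>z d s. z \<in> E' - Z \<Longrightarrow> ennreal q \<le> d \<Longrightarrow> has_density m W z d \<Longrightarrow> 0 < s \<Longrightarrow>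
      \<exists>a. 0 < a \<and> a < s \<and> (q - \<eta>) * unit_ball_vol (real m) * a ^ m \<le> measure \<mu>b (ball z a)"
proof -
  define A where "A j = {z \<in> E'. (\<exists>d\<ge>ennreal q. has_density m W z d) \<and>
     (\<forall>a. 0 < a \<and> a < 1 / real (Suc j) \<longrightarrow> measure \<mu>b (ball z a) \<le> (q - \<eta>) * unit_ball_vol (real m) * a ^ m)}" for j
  have "\<forall>j. \<exists>N. N \<in> null_sets \<mu>b \<and> A j \<subseteq> N"
  proof (intro allI, unfold Bex_def[symmetric])
    fix j
    show "\<exists>N\<in>null_sets \<mu>b. A j \<subseteq> N"
    proof (rule upper_density_exceptional[OF q m])
      show "0 < 1 / real (Suc j)" by simp
    qed (simp_all add: A_def)
  qed
  from choice[OF this] obtain N where "\<forall>j. N j \<in> null_sets \<mu>b \<and> A j \<subseteq> N j" by (rule exE)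
  then have N: "\<And>j. N j \<in> null_sets \<mu>b" "\<And>j. A j \<subseteq> N j" by simp_all
  show thesis
  proof (rule that[of "\<Union>j. N j"])
    show "(\<Union>j. N j) \<in> null_sets \<mu>b" using N(1) by auto
    fix z d s assume z: "z \<in> E' - (\<Union>j. N j)" and d: "ennreal q \<le> d" "has_density m W z d" and s: "0 < (s::real)"
    obtain j where j: "1 / real (Suc j) < s" using nat_approx_posE[OF s] by auto
    have "z \<notin> A j" using z N(2) by auto
    then obtain a where "0 < a" "a < 1 / real (Suc j)" "\<not> measure \<mu>b (ball z a) \<le> (q - \<eta>) * unit_ball_vol (real m) * a ^ m"
      using z d by (auto simp: A_def)
    then show "\<exists>a. 0 < a \<and> a < s \<and> (q - \<eta>) * unit_ball_vol (real m) * a ^ m \<le> measure \<mu>b (ball z a)"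
      using j by (intro exI[of _ a]) auto
  qed
qed

lemma isoperimetric_pair_relative:
  assumes m: "1 \<le> m" and fin: "\<nu> UNIV < \<infinity>"
  shows "isoperimetric_pair \<mu>b \<nu>b (Rn n) B m (unit_ball_vol (real m))"
proof unfold_locales
  show "sets \<mu>b = sets borel" "sets \<nu>b = sets borel" by simp_all
  show "emeasure \<mu>b (space \<mu>b) \<noteq> top" using finite_\<mu>b by (simp add: finite_measure.finite_emeasure_space)
  show "emeasure \<nu>b (space \<nu>b) \<noteq> top"
    using fin emeasure_\<nu>b[of UNIV] sets_eq_imp_space_eq[OF sets_\<nu>b] by simp
  show "\<exists>A. countable A \<and> A \<subseteq> sets \<mu>b \<and> \<Union> A = space \<mu>b \<and> (\<forall>a\<in>A. emeasure \<mu>b a \<noteq> \<infinity>)"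
    using finite_\<mu>b finite_measure.axioms(1) sigma_finite_measure.sigma_finite_countable by blast
  show "\<exists>A. countable A \<and> A \<subseteq> sets \<nu>b \<and> \<Union> A = space \<nu>b \<and> (\<forall>a\<in>A. emeasure \<nu>b a \<noteq> \<infinity>)"
    using \<open>emeasure \<nu>b (space \<nu>b) \<noteq> top\<close> sets.top[of \<nu>b] by (intro exI[of _ "{space \<nu>b}"]) auto
  show "1 \<le> m" by (rule m)
  show "0 < unit_ball_vol (real m)" by simp
  show "closed (Rn n)" by (rule closed_Rn)
  show "emeasure \<mu>b (- Rn n) = 0"
  proof -
    have "E' \<inter> - Rn n = {}" using E'_sub U_Rn by auto
    then show ?thesis using emeasure_\<mu>b[of "- Rn n"] closed_Rn by simp
  qed
  fix z a b c assume z: "z \<in> Rn n" and sep: "\<And>y. y \<in> B \<Longrightarrow> c \<le> dist z y" and ord: "0 < a" "a < b" "b < (c::real)"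
  have "\<nu> (ball z c) \<le> \<nu> UNIV"
    using emeasure_mono[of "ball z c" UNIV \<nu>b] emeasure_\<nu>b[of UNIV] emeasure_\<nu>b[of "ball z c"] by simp
  then have "\<nu> (ball z c) < \<infinity>" using fin by (rule le_less_trans)
  from monotonicity[OF z sep ord m this]
  show "measure \<mu>b (ball z a) / a ^ m \<le> measure \<mu>b (ball z b) / b ^ m + b / a ^ m * measure \<nu>b (ball z c)"
    by (simp add: measure_\<mu>b measure_def[of \<nu>b] emeasure_\<nu>b)
qed

end

text \<open>The assertion for one \<open>m\<close> and one \<open>\<Gamma>\<close>, the rest being
  quantified. Isolating it allows the constants for different \<open>m\<close> to be merged.\<close>

definition relative_isoperimetric :: "real \<Rightarrow> nat \<Rightarrow> real \<Rightarrow> bool" where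
  "relative_isoperimetric M m \<Gamma> \<longleftrightarrow> (\<forall>(n::nat) (Q::real) (U::fseq set) (V::(fseq \<times> fseq set) measure)
       (E::fseq set) (B::fseq set) (r::real).
      1 \<le> m \<and> m \<le> n \<and> real n \<le> M \<and> 1 \<le> Q \<and> Q \<le> M \<and>
      openin (Rn_top n) U \<and>
      varifold n m U V \<and>
      radon_measure (top_of_set U) (variation_fv n U V) \<and>
      (AE z in weight U V. \<exists>d\<ge>1. has_density m (weight U V) z d) \<and>
      E \<in> sets (completion (add_measure (weight U V) (variation_fv n U V))) \<and>
      closedin (Rn_top n) B \<and> B \<subseteq> (Rn_top n) frontier_of U \<and>
      (\<forall>K. compact K \<and> K \<subseteq> Rn n - B \<longrightarrow>
        outer_measure_of (weight U V) (E \<inter> K)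
        + outer_measure_of (variation_fv n U V) (E \<inter> K)
        + outer_measure_of (variation_boundary n m U V E) (U \<inter> K) < \<infinity>) \<and>
      (\<forall>\<theta>\<in>Cc_infty n (Rn n - B).
        (LINT (z, S):E \<times> Gr n m|completion V. trace_inner n (orth_proj S) (Deriv n \<theta> z))
        = L1_extension n U (restrict_distrib n U (first_variation n V) E) (cutoff U \<theta>)
          - L1_extension n U (distrib_boundary n m U V E) (cutoff U \<theta>)) \<and>
      0 < r \<and>
      outer_measure_of (weight U V) E \<le> ennreal ((Q - 1 / M) * unit_ball_vol (real m) * r ^ m) \<and>
      outer_measure_of (weight U V)
        (E \<inter> {z. \<exists>d. has_density m (weight U V) z d \<and> d < ennreal Q}) \<le> ennreal (r ^ m / \<Gamma>)
      \<longrightarrow>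
      ennreal (enn2real (outer_measure_of (weight U V)
          (E \<inter> {z \<in> Rn n. ball z r \<inter> Rn n \<subseteq> Rn n - B})) powr (1 - 1 / real m))
      \<le> ennreal \<Gamma> * (outer_measure_of (variation_boundary n m U V E) U
                      + outer_measure_of (variation_fv n U V) E))"

lemma relative_isoperimetric_exists:
  assumes M: "1 \<le> M" and m: "1 \<le> m"
  shows "\<exists>\<Gamma>0>0. \<forall>\<Gamma>\<ge>\<Gamma>0. relative_isoperimetric M m \<Gamma>"
proof -
  define \<alpha> where "\<alpha> = unit_ball_vol (real m)"
  have \<alpha>: "0 < \<alpha>" by (simp add: \<alpha>_def)
  obtain \<Gamma>0 where \<Gamma>0: "0 < \<Gamma>0"
    "\<And>(\<mu> :: fseq measure) \<nu> R B \<Gamma> Q r N L.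
      isoperimetric_pair \<mu> \<nu> R B m \<alpha> \<Longrightarrow> \<Gamma>0 \<le> \<Gamma> \<Longrightarrow> 1 \<le> Q \<Longrightarrow> Q \<le> M \<Longrightarrow> 0 < r \<Longrightarrow>
      measure \<mu> UNIV \<le> (Q - 1 / M) * \<alpha> * r ^ m \<Longrightarrow>
      N \<in> null_sets \<mu> \<Longrightarrow>
      (\<And>z s. z \<in> R - N \<Longrightarrow> 0 < s \<Longrightarrow> \<exists>a. 0 < a \<and> a < s \<and> \<alpha> / 2 * a ^ m \<le> measure \<mu> (ball z a)) \<Longrightarrow>
      L \<in> sets borel \<Longrightarrow> measure \<mu> L \<le> r ^ m / \<Gamma> \<Longrightarrow>
      (\<And>z s. z \<in> R - L \<Longrightarrow> 0 < s \<Longrightarrow>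
        \<exists>a. 0 < a \<and> a < s \<and> (Q - 1 / (4 * M)) * \<alpha> * a ^ m \<le> measure \<mu> (ball z a)) \<Longrightarrow>
      measure \<mu> {z \<in> R. \<forall>y\<in>B. r \<le> dist z y} powr (1 - 1 / real m) \<le> \<Gamma> * measure \<nu> UNIV"
    by (rule isoperimetric_pair_constant[OF M m \<alpha>]) blast
  have "relative_isoperimetric M m \<Gamma>" if \<Gamma>: "\<Gamma>0 \<le> \<Gamma>" for \<Gamma>
    unfolding relative_isoperimetric_def
  proof (intro allI impI, elim conjE)
    fix n :: nat and Q r :: real and U E B :: "fseq set" and V :: "(fseq \<times> fseq set) measure"
    assume Q: "1 \<le> Q" "Q \<le> M" and U: "openin (Rn_top n) U" and V: "varifold n m U V"
      and fv: "radon_measure (top_of_set U) (variation_fv n U V)"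
      and dens: "AE z in weight U V. \<exists>d\<ge>1. has_density m (weight U V) z d"
      and E: "E \<in> sets (completion (add_measure (weight U V) (variation_fv n U V)))"
      and B: "closedin (Rn_top n) B" "B \<subseteq> (Rn_top n) frontier_of U"
      and fin: "\<forall>K. compact K \<and> K \<subseteq> Rn n - B \<longrightarrow>
        outer_measure_of (weight U V) (E \<inter> K)
        + outer_measure_of (variation_fv n U V) (E \<inter> K)
        + outer_measure_of (variation_boundary n m U V E) (U \<inter> K) < \<infinity>"
      and ident: "\<forall>\<theta>\<in>Cc_infty n (Rn n - B).
        (LINT (z, S):E \<times> Gr n m|completion V. trace_inner n (orth_proj S) (Deriv n \<theta> z))
        = L1_extension n U (restrict_distrib n U (first_variation n V) E) (cutoff U \<theta>)
          - L1_extension n U (distrib_boundary n m U V E) (cutoff U \<theta>)"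
      and r: "0 < r"
      and mass: "outer_measure_of (weight U V) E \<le> ennreal ((Q - 1 / M) * unit_ball_vol (real m) * r ^ m)"
      and low: "outer_measure_of (weight U V)
        (E \<inter> {z. \<exists>d. has_density m (weight U V) z d \<and> d < ennreal Q}) \<le> ennreal (r ^ m / \<Gamma>)"
    interpret vd: varifold_data n m U V by unfold_locales (fact U V)+
    have \<Gamma>pos: "0 < \<Gamma>" using \<Gamma>0(1) \<Gamma> by linarith
    have sfv: "sets (variation_fv n U V) = sets (weight U V)"
      using fv by (simp add: radon_measure_def weight_def)
    obtain E' N N' where EN: "E = E' \<union> N" "N \<subseteq> N'" "N' \<in> null_sets (add_measure (weight U V) (variation_fv n U V))"
      "E' \<in> sets (add_measure (weight U V) (variation_fv n U V))"
      using E by (rule sets_completionE) blast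
    have N's: "N' \<in> sets (weight U V)" using EN(3) by (auto simp: null_sets_def)
    \<comment> \<open>\<open>E\<close> is measurable for the completion of the sum, so one null set
      serves both measures.\<close>
    have "emeasure (weight U V) N' + emeasure (variation_fv n U V) N' = 0"
      using EN(3) emeasure_add_measure[OF sfv N's] by (simp add: null_sets_def)
    then have N'null: "N' \<in> null_sets (weight U V)" "N' \<in> null_sets (variation_fv n U V)"
      using N's sfv by (auto simp: null_sets_def)
    have E's: "E' \<in> sets (weight U V)" using EN(4) by simp
    have outW: "outer_measure_of (weight U V) (E \<inter> A) = emeasure (weight U V) (E' \<inter> A)" if "E' \<inter> A \<in> sets (weight U V)" for A
      by (rule outer_measure_of_null_modification[OF EN(1,2) N'null(1) that])
    have WE: "emeasure (weight U V) E' \<le> ennreal ((Q - 1 / M) * \<alpha> * r ^ m)"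
      using outW[of UNIV] E's mass by (simp add: \<alpha>_def)
    have closedB: "closed B" using B(1) closed_Rn closedin_closed_trans by blast
    have BR: "B \<subseteq> Rn n" using B(1) closedin_imp_subset by blast
    \<comment> \<open>An open set does not meet its own frontier.\<close>
    have BU: "B \<inter> U = {}"
    proof -
      have "(Rn_top n) interior_of U = U" using U by (simp add: interior_of_openin)
      then show ?thesis using B(2) by (auto simp: frontier_of_def)
    qed
    interpret rv: relative_varifold n m U V E B E' N N'
    proof (unfold_locales)
      show "emeasure (weight U V) E' < \<infinity>" using WE by (rule le_less_trans) simp
    qed (use fv EN N'null E's closedB BR BU fin ident in auto)
    have outFv: "outer_measure_of (variation_fv n U V) E = emeasure rv.dV.var_measure E'"
      using outer_measure_of_null_modification[OF EN(1,2) N'null(2), of UNIV] E's sfv by (simp add: rv.fv_eq)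
    have outT: "outer_measure_of (variation_boundary n m U V E) U = emeasure rv.T.var_measure U"
      using outer_measure_of_eq[of U rv.T.var_measure] vd.U_borel by (simp add: rv.T_eq rv.T.sets_var_measure)
    have \<nu>: "outer_measure_of (variation_boundary n m U V E) U + outer_measure_of (variation_fv n U V) E = rv.\<nu> UNIV"
      by (simp add: outFv outT rv.\<nu>_def add.commute)
    show "ennreal (enn2real (outer_measure_of (weight U V)
          (E \<inter> {z \<in> Rn n. ball z r \<inter> Rn n \<subseteq> Rn n - B})) powr (1 - 1 / real m))
      \<le> ennreal \<Gamma> * (outer_measure_of (variation_boundary n m U V E) U + outer_measure_of (variation_fv n U V) E)"
    proof (cases "rv.\<nu> UNIV < \<infinity>")
      \<comment> \<open>The abstract theorem is about finite measures; if \<nu> is infinite, so is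
        the right side, as \<open>\<Gamma>\<close> is positive.\<close>
      case False
      then have "rv.\<nu> UNIV = top" by (simp add: less_top[symmetric])
      then show ?thesis unfolding \<nu> using \<Gamma>pos by (simp add: ennreal_mult_top)
    next
      case True
      define X where "X = {z \<in> Rn n. \<forall>y\<in>B. r \<le> dist z y}"
      have pair: "isoperimetric_pair rv.\<mu>b rv.\<nu>b (Rn n) B m \<alpha>"
        unfolding \<alpha>_def by (rule rv.isoperimetric_pair_relative[OF m True])
      interpret mu: finite_measure rv.\<mu>b by (rule rv.finite_\<mu>b)
      have X: "{z \<in> Rn n. ball z r \<inter> Rn n \<subseteq> Rn n - B} = X"
        using BR by (auto simp: X_def not_less[symmetric])
      have Xb: "X \<in> sets borel"
        using isoperimetric_pair.X_borel[OF pair, of r] isoperimetric_pair.X_def[OF pair] by (simp add: X_def)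
      have lhs: "outer_measure_of (weight U V) (E \<inter> {z \<in> Rn n. ball z r \<inter> Rn n \<subseteq> Rn n - B}) = ennreal (measure rv.\<mu>b X)"
      proof -
        have "E' \<inter> X \<in> sets (weight U V)" using E's Xb by (auto simp: vd.sets_W)
        then show ?thesis unfolding X using outW rv.emeasure_\<mu>b[OF Xb] by (simp add: mu.emeasure_eq_measure)
      qed
      have mass': "measure rv.\<mu>b UNIV \<le> (Q - 1 / M) * \<alpha> * r ^ m"
      proof -
        have "1 / M \<le> 1" using M by simp
        then have "1 / M \<le> Q" using Q(1) by linarith
        then have "0 \<le> (Q - 1 / M) * \<alpha> * r ^ m" using Q \<alpha> r by (intro mult_nonneg_nonneg) auto
        moreover have "ennreal (measure rv.\<mu>b UNIV) \<le> ennreal ((Q - 1 / M) * \<alpha> * r ^ m)"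
          using WE rv.emeasure_\<mu>b[of UNIV] by (simp add: mu.emeasure_eq_measure)
        ultimately show ?thesis by (simp add: ennreal_le_iff)
      qed
      obtain Z where Z: "Z \<in> null_sets (weight U V)" "\<And>z. z \<in> U - Z \<Longrightarrow> \<exists>d\<ge>1. has_density m (weight U V) z d"
        using dens by (auto elim!: AE_E3)
      have Zb: "Z \<in> sets borel" using Z(1) by (auto simp: null_sets_def vd.sets_W)
      have Z\<mu>: "Z \<in> null_sets rv.\<mu>b"
      proof -
        have "emeasure (weight U V) (E' \<inter> Z) \<le> emeasure (weight U V) Z" using Z(1) by (intro emeasure_mono) auto
        then show ?thesis using Z(1) Zb rv.emeasure_\<mu>b[OF Zb] by (auto simp: null_sets_def)
      qed
      have cE: "- E' \<in> null_sets rv.\<mu>b"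
        using rv.emeasure_\<mu>b[of "- E'"] rv.E'_borel by (auto simp: null_sets_def)
      have a0: "0 < unit_ball_vol (real m)" by simp
      obtain N1 where N1: "N1 \<in> null_sets rv.\<mu>b"
        "\<And>z d s. z \<in> E' - N1 \<Longrightarrow> ennreal 1 \<le> d \<Longrightarrow> has_density m (weight U V) z d \<Longrightarrow> 0 < s \<Longrightarrow>
          \<exists>a. 0 < a \<and> a < s \<and> (1 - 1 / 2) * unit_ball_vol (real m) * a ^ m \<le> measure rv.\<mu>b (ball z a)"
        by (rule rv.upper_density[of "1 / 2" 1, OF _ _ a0]) auto
      have M4: "0 < 1 / (4 * M)" "1 / (4 * M) < Q"
      proof -
        have "1 / (4 * M) \<le> 1 / 4" using M by (simp add: field_simps)
        then show "1 / (4 * M) < Q" using Q by linarith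
      qed (use M in simp)
      obtain N2 where N2: "N2 \<in> null_sets rv.\<mu>b"
        "\<And>z d s. z \<in> E' - N2 \<Longrightarrow> ennreal Q \<le> d \<Longrightarrow> has_density m (weight U V) z d \<Longrightarrow> 0 < s \<Longrightarrow>
          \<exists>a. 0 < a \<and> a < s \<and> (Q - 1 / (4 * M)) * unit_ball_vol (real m) * a ^ m \<le> measure rv.\<mu>b (ball z a)"
        by (rule rv.upper_density[OF M4 a0]) blast
      \<comment> \<open>The set of points of low density is not known to be measurable, so it is
        replaced by a measurable hull \<open>LD\<close> of the same outer measure.\<close>
      define Low where "Low = E \<inter> {z. \<exists>d. has_density m (weight U V) z d \<and> d < ennreal Q}"
      have "N' \<subseteq> U" using N's by (auto simp: vd.sets_W)
      then have "Low \<subseteq> space (weight U V)" using EN(1,2) rv.E'_sub by (auto simp: Low_def)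
      from outer_measure_of_attain[OF this]
      obtain LD where LD: "LD \<in> sets (weight U V)" "Low \<subseteq> LD" "outer_measure_of (weight U V) Low = emeasure (weight U V) LD"
        by (elim bexE conjE)
      have LDb: "LD \<in> sets borel" using LD(1) by (auto simp: vd.sets_W)
      have mLD: "measure rv.\<mu>b LD \<le> r ^ m / \<Gamma>"
      proof -
        have "emeasure rv.\<mu>b LD \<le> emeasure (weight U V) LD"
          using rv.emeasure_\<mu>b[OF LDb] LD(1) by (auto intro!: emeasure_mono)
        also have "\<dots> \<le> ennreal (r ^ m / \<Gamma>)" using LD(3) low by (simp add: Low_def)
        finally show ?thesis using \<Gamma>pos r by (simp add: mu.emeasure_eq_measure ennreal_le_iff)
      qed
      \<comment> \<open>Points outside \<open>E'\<close>, points without a density of at least 1 and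
        the exceptional points of \<open>upper_density\<close> carry no mass of \<mu>b; they are
        joined to the sets on which nothing is claimed.\<close>
      have null: "- E' \<union> Z \<union> N1 \<in> null_sets rv.\<mu>b" "- E' \<union> Z \<union> N2 \<in> null_sets rv.\<mu>b"
        using cE Z\<mu> N1(1) N2(1) by auto
      have Lb: "LD \<union> (- E' \<union> Z \<union> N2) \<in> sets borel" using LDb null(2) by (metis null_setsD2 rv.sets_\<mu>b sets.Un)
      have mL: "measure rv.\<mu>b (LD \<union> (- E' \<union> Z \<union> N2)) \<le> r ^ m / \<Gamma>"
        using mLD measure_Un_null_set[OF _ null(2), of LD] LDb by simp
      have "measure rv.\<mu>b X powr (1 - 1 / real m) \<le> \<Gamma> * measure rv.\<nu>b UNIV"
        unfolding X_def
      proof (rule \<Gamma>0(2)[OF pair \<Gamma> Q r mass' null(1) _ Lb mL])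
        fix z' :: fseq and s :: real
        assume z: "z' \<in> Rn n - (- E' \<union> Z \<union> N1)" and s: "0 < s"
        then have "z' \<in> U - Z" "z' \<in> E' - N1" using rv.E'_sub by auto
        then obtain d where "1 \<le> d" "has_density m (weight U V) z' d" using Z(2) by blast
        then show "\<exists>a. 0 < a \<and> a < s \<and> \<alpha> / 2 * a ^ m \<le> measure rv.\<mu>b (ball z' a)"
          using N1(2)[OF \<open>z' \<in> E' - N1\<close> _ _ s, of d] by (simp add: \<alpha>_def)
      next
        fix z' :: fseq and s :: real
        assume z: "z' \<in> Rn n - (LD \<union> (- E' \<union> Z \<union> N2))" and s: "0 < s"
        then have z': "z' \<in> U - Z" "z' \<in> E' - N2" "z' \<notin> Low" "z' \<in> E" using rv.E'_sub LD(2) EN(1) by auto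
        then obtain d where d: "1 \<le> d" "has_density m (weight U V) z' d" using Z(2) by blast
        then have "ennreal Q \<le> d" using z'(3,4) by (auto simp: Low_def not_less)
        then show "\<exists>a. 0 < a \<and> a < s \<and> (Q - 1 / (4 * M)) * \<alpha> * a ^ m \<le> measure rv.\<mu>b (ball z' a)"
          using N2(2)[OF z'(2) _ d(2) s] by (simp add: \<alpha>_def)
      qed
      then have "ennreal (measure rv.\<mu>b X powr (1 - 1 / real m)) \<le> ennreal (\<Gamma> * measure rv.\<nu>b UNIV)" by (rule ennreal_leI)
      also have "\<dots> = ennreal \<Gamma> * rv.\<nu> UNIV"
        using \<Gamma>pos True rv.emeasure_\<nu>b[of UNIV] by (simp add: ennreal_mult measure_def)
      finally show ?thesis unfolding lhs \<nu> by simp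
    qed
  qed
  then show ?thesis using \<Gamma>0(1) by blast
qed

theorem corollary8p7:
  fixes M :: real
  assumes "1 \<le> M"
  shows "\<exists>\<Gamma>::real. 0 < \<Gamma> \<and>
    (\<forall>(m::nat) (n::nat) (Q::real) (U::fseq set) (V::(fseq \<times> fseq set) measure)
       (E::fseq set) (B::fseq set) (r::real).
      1 \<le> m \<and> m \<le> n \<and> real n \<le> M \<and> 1 \<le> Q \<and> Q \<le> M \<and>
      openin (Rn_top n) U \<and>
      varifold n m U V \<and>
      radon_measure (top_of_set U) (variation_fv n U V) \<and>
      (AE z in weight U V. \<exists>d\<ge>1. has_density m (weight U V) z d) \<and>
      E \<in> sets (completion (add_measure (weight U V) (variation_fv n U V))) \<and>
      closedin (Rn_top n) B \<and> B \<subseteq> (Rn_top n) frontier_of U \<and>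
      (\<forall>K. compact K \<and> K \<subseteq> Rn n - B \<longrightarrow>
        outer_measure_of (weight U V) (E \<inter> K)
        + outer_measure_of (variation_fv n U V) (E \<inter> K)
        + outer_measure_of (variation_boundary n m U V E) (U \<inter> K) < \<infinity>) \<and>
      (\<forall>\<theta>\<in>Cc_infty n (Rn n - B).
        (LINT (z, S):E \<times> Gr n m|completion V. trace_inner n (orth_proj S) (Deriv n \<theta> z))
        = L1_extension n U (restrict_distrib n U (first_variation n V) E) (cutoff U \<theta>)
          - L1_extension n U (distrib_boundary n m U V E) (cutoff U \<theta>)) \<and>
      0 < r \<and>
      outer_measure_of (weight U V) E \<le> ennreal ((Q - 1 / M) * unit_ball_vol (real m) * r ^ m) \<and>
      outer_measure_of (weight U V)
        (E \<inter> {z. \<exists>d. has_density m (weight U V) z d \<and> d < ennreal Q}) \<le> ennreal (r ^ m / \<Gamma>)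
      \<longrightarrow>
      ennreal (enn2real (outer_measure_of (weight U V)
          (E \<inter> {z \<in> Rn n. ball z r \<inter> Rn n \<subseteq> Rn n - B})) powr (1 - 1 / real m))
      \<le> ennreal \<Gamma> * (outer_measure_of (variation_boundary n m U V E) U
                      + outer_measure_of (variation_fv n U V) E))"
proof -
  obtain G where G: "\<And>m. 1 \<le> m \<Longrightarrow> 0 < G m \<and> (\<forall>\<Gamma>\<ge>G m. relative_isoperimetric M m \<Gamma>)"
    using relative_isoperimetric_exists[OF assms] by metis
  \<comment> \<open>Since \<open>m \<le> n \<le> M\<close>, only finitely many \<open>m\<close>
    occur, and the sum of their nonnegative thresholds dominates each of them.\<close>
  define k where "k = nat \<lfloor>M\<rfloor>"
  define \<Gamma> where "\<Gamma> = 1 + (\<Sum>m\<in>{1..k}. G m)"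
  have nn: "0 \<le> G m" if "m \<in> {1..k}" for m using G[of m] that by auto
  have \<Gamma>: "0 < \<Gamma>" unfolding \<Gamma>_def using sum_nonneg[of "{1..k}" G] nn by force
  have main: "relative_isoperimetric M m \<Gamma>" if "1 \<le> m" "m \<le> n" "real n \<le> M" for m n
  proof -
    have "m \<in> {1..k}" using that by (auto simp: k_def le_nat_floor)
    then have "G m \<le> (\<Sum>m\<in>{1..k}. G m)" by (rule member_le_sum) (use nn in auto)
    then show ?thesis using G[OF that(1)] by (simp add: \<Gamma>_def)
  qed
  show ?thesis
  proof (intro exI[of _ \<Gamma>] conjI allI impI, rule \<Gamma>, goal_cases)
    case (1 m n Q U V E B r)
    then have "relative_isoperimetric M m \<Gamma>" by (intro main[of m n]) simp_all
    then show ?case unfolding relative_isoperimetric_def by (elim allE impE) (rule 1)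
  qed
qed

end
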